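(* Let $\Omega\subset\mathbb{R}^N$ be a domain of class $C^2$ with boundary $\Gamma$. Let $x\in\Omega$ and assume that, for $R>0$, there exists a point $y_x\in\Gamma$ such that $\overline{B_R(x)}\cap(\mathbb{R}^N\setminus\Omega)=\{y_x\}$ and $\kappa_j(y_x)<1/R$ for $j=1,\dots,N-1$. Let $1<p\le\infty$, let $u$ be the bounded viscosity solution of $u_t=\Delta_p^Gu$ in $\Omega\times(0,\infty)$, $u=0$ on $\Omega\times\{0\}$, $u=1$ on $\Gamma\times(0,\infty)$, and, for $1<q\le\infty$, let $\mu_q^u(x,t)$ be the $q$-mean of $u(\cdot,t)$ on $B_R(x)$. Then, for $1<q<\infty$, $$\lim_{t\to0^+}\left(\frac{R^2}t\right)^{\frac{N+1}{4(q-1)}}\mu_q^u(x,t)=\left\{\frac{c_N\int_0^\infty\mathrm{Erfc}(\sigma)^{q-1}\sigma^{\frac{N-1}2}\,d\sigma}{(p')^{\frac{N+1}4}\sqrt{\Pi_\Gamma(y_x)}}\right\}^{\frac1{q-1}},\qquad c_N=N!\;\Gamma\!\left(\tfrac{N+1}2\right)^{-2}$$ (where $\Gamma(\cdot)$ in the formula for $c_N$ is Euler's gamma function), and $$\lim_{t\to0^+}\mu_\infty^u(x,t)=\frac12.$$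
   Context: $N\ge2$; $\Omega$ is not necessarily bounded. $p'=p/(p-1)$, with $p'=1$ if $p=\infty$. $B_R(x)$ is the open ball of radius $R$ centered at $x$. $\kappa_1(y),\dots,\kappa_{N-1}(y)$ are the principal curvatures of $\Gamma$ at $y\in\Gamma$ with respect to the interior normal direction to $\Gamma$, and $\Pi_\Gamma(y)=\prod_{j=1}^{N-1}[1-R\,\kappa_j(y)]$. $\mathrm{Erfc}(\sigma)=\frac2{\sqrt\pi}\int_\sigma^\infty e^{-\tau^2}d\tau$. $q$-mean: for $1<q\le\infty$, $\mu_q^u(x,t)$ is the unique real $\mu$ such that $\|u(\cdot,t)-\mu\|_{L^q(B_R(x))}\le\|u(\cdot,t)-\lambda\|_{L^q(B_R(x))}$ for all $\lambda\in\mathbb{R}$. The game-theoretic (normalized) $p$-Laplacian is $\Delta_p^Gu=\frac1p\Big\{\Delta u+(p-2)\frac{\langle\nabla^2u\,\nabla u,\nabla u\rangle}{|\nabla u|^2}\Big\}$, and $\Delta_\infty^G$ is its limit as $p\to\infty$, i.e. $\Delta_\infty^Gu=\frac{\langle\nabla^2u\,\nabla u,\nabla u\rangle}{|\nabla u|^2}$. Put $F(\xi,X)=\frac1p\mathrm{tr}X+(1-\frac2p)\frac{\langle X\xi,\xi\rangle}{|\xi|^2}$ for $\xi\in\mathbb{R}^N\setminus\{0\}$ and $X$ real symmetric $N\times N$ (with $1/p=0$ if $p=\infty$), $F_*(\xi,X)=\lim_{r\to0^+}\inf\{F(\eta,Y):\eta\ne0,|\eta-\xi|<r,|Y-X|<r\}$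 and $F^*=-(-F)_*$. A function $u\in C(\Omega\times(0,\infty))$ is a viscosity solution of $u_t=\Delta_p^Gu$ if at every $(x,t)\in\Omega\times(0,\infty)$: for every $\varphi\in C^2(\Omega\times(0,\infty))$ such that $u-\varphi$ attains its maximum at $(x,t)$, $\varphi_t-F^*(\nabla\varphi,\nabla^2\varphi)\le0$ at $(x,t)$; and for every $\varphi\in C^2(\Omega\times(0,\infty))$ such that $u-\varphi$ attains its minimum at $(x,t)$, $\varphi_t-F_*(\nabla\varphi,\nabla^2\varphi)\ge0$ at $(x,t)$. The initial and boundary conditions are meant classically: $u$ is continuous on $\overline\Omega\times[0,\infty)$ away from $\Gamma\times\{0\}$. *)

theory Defs
  imports "HOL-Analysis.Analysis" "HOL-Probability.Essential_Supremum"
begin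

text \<open>The set \<open>S\<close> is meant to be open.\<close>

definition C2_on :: "'a::real_normed_vector set \<Rightarrow> ('a \<Rightarrow> real) \<Rightarrow> bool" where
  "C2_on S f \<longleftrightarrow>
    (\<exists>(f' :: 'a \<Rightarrow> 'a \<Rightarrow>\<^sub>L real) (f'' :: 'a \<Rightarrow> 'a \<Rightarrow>\<^sub>L ('a \<Rightarrow>\<^sub>L real)).
      (\<forall>x\<in>S. (f has_derivative blinfun_apply (f' x)) (at x)) \<and>
      (\<forall>x\<in>S. (f' has_derivative blinfun_apply (f'' x)) (at x)) \<and>
      continuous_on S f'')"

definition grad :: "(real^'n \<Rightarrow> real) \<Rightarrow> real^'n \<Rightarrow> real^'n" where
  "grad f x = (\<chi> i. frechet_derivative f (at x) (axis i 1))"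

definition hessian :: "(real^'n \<Rightarrow> real) \<Rightarrow> real^'n \<Rightarrow> real^'n^'n" where
  "hessian f x = jacobian (grad f) (at x)"

text \<open>Near \<open>y\<close>, the set \<open>\<Omega>\<close> is the strict epigraph, in the unit direction \<open>\<nu>\<close>, of a \<open>C\<^sup>2\<close>
  function \<open>g\<close> of the \<open>N - 1\<close> coordinates orthogonal to \<open>\<nu>\<close>. Such a function is encoded as a
  function on the whole space which is constant along \<open>\<nu>\<close>; \<open>\<nu>\<close> points into \<open>\<Omega>\<close>.\<close>

definition local_C2_graph ::
    "(real^'n) set \<Rightarrow> real^'n \<Rightarrow> real^'n \<Rightarrow> (real^'n \<Rightarrow> real) \<Rightarrow> bool" where
  "local_C2_graph \<Omega> y \<nu> g \<longleftrightarrow>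
    norm \<nu> = 1 \<and> C2_on UNIV g \<and> (\<forall>z s. g (z + s *\<^sub>R \<nu>) = g z) \<and>
    (\<exists>r>0. \<forall>z\<in>ball y r. z \<in> \<Omega> \<longleftrightarrow> g z < z \<bullet> \<nu>)"

definition C2_domain :: "(real^'n) set \<Rightarrow> bool" where
  "C2_domain \<Omega> \<longleftrightarrow> open \<Omega> \<and> connected \<Omega> \<and> \<Omega> \<noteq> {} \<and>
    (\<forall>y\<in>frontier \<Omega>. \<exists>\<nu> g. local_C2_graph \<Omega> y \<nu> g)"

text \<open>The reals \<open>\<kappa> 1, \<dots>, \<kappa> (N - 1)\<close> are the principal curvatures of the boundary at \<open>y\<close> with
  respect to the interior normal: if the boundary is written near \<open>y\<close> as a graph over its
  tangent space, in the direction \<open>\<nu>\<close> of the interior normal (whence the vanishing gradient), they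
  are the eigenvalues, with multiplicity, of the Hessian at \<open>y\<close> of the graph function; the vectors
  \<open>e 1, \<dots>, e (N - 1)\<close> are principal directions, forming an orthonormal basis of the tangent
  space. The curvatures of a ball of radius \<open>R\<close> are thus \<open>1 / R\<close>.\<close>

definition principal_curvatures ::
    "(real^'n) set \<Rightarrow> real^'n \<Rightarrow> (nat \<Rightarrow> real) \<Rightarrow> bool" where
  "principal_curvatures \<Omega> y \<kappa> \<longleftrightarrow>
    (\<exists>\<nu> g e. local_C2_graph \<Omega> y \<nu> g \<and> grad g y = 0 \<and>
      (\<forall>j\<in>{1..CARD('n) - 1}. e j \<bullet> \<nu> = 0) \<and>
      (\<forall>i\<in>{1..CARD('n) - 1}. \<forall>j\<in>{1..CARD('n) - 1}. e i \<bullet> e j = (if i = j then 1 else 0)) \<and>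
      (\<forall>j\<in>{1..CARD('n) - 1}. hessian g y *v e j = \<kappa> j *\<^sub>R e j))"

text \<open>Exponents in \<open>(1, \<infinity>]\<close> are extended reals; note that \<open>1 / \<infinity> = 0\<close> in \<open>ereal\<close>.\<close>

definition conj_exp :: "ereal \<Rightarrow> real" where
  "conj_exp p = (if p = \<infinity> then 1 else real_of_ereal p / (real_of_ereal p - 1))"

text \<open>Thus \<open>\<Delta>\<^sub>p\<^sup>G u = game_F p (\<nabla>u) (\<nabla>\<^sup>2u)\<close> wherever \<open>\<nabla>u \<noteq> 0\<close>.\<close>

definition game_F :: "ereal \<Rightarrow> real^'n \<Rightarrow> real^'n^'n \<Rightarrow> real" where
  "game_F p \<xi> X = real_of_ereal (1 / p) * trace X
     + (1 - 2 * real_of_ereal (1 / p)) * (((X *v \<xi>) \<bullet> \<xi>) / (norm \<xi>)\<^sup>2)"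

definition lower_env ::
    "(real^'n \<Rightarrow> real^'n^'n \<Rightarrow> real) \<Rightarrow> real^'n \<Rightarrow> real^'n^'n \<Rightarrow> real" where
  "lower_env F \<xi> X = Lim (at_right 0)
     (\<lambda>r. Inf {F \<eta> Y | \<eta> Y. \<eta> \<noteq> 0 \<and> transpose Y = Y \<and> norm (\<eta> - \<xi>) < r \<and> norm (Y - X) < r})"

definition upper_env ::
    "(real^'n \<Rightarrow> real^'n^'n \<Rightarrow> real) \<Rightarrow> real^'n \<Rightarrow> real^'n^'n \<Rightarrow> real" where
  "upper_env F \<xi> X = - lower_env (\<lambda>\<eta> Y. - F \<eta> Y) \<xi> X"

definition viscosity_solution ::
    "ereal \<Rightarrow> (real^'n) set \<Rightarrow> ((real^'n) \<times> real \<Rightarrow> real) \<Rightarrow> bool" where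
  "viscosity_solution p \<Omega> u \<longleftrightarrow>
    continuous_on (\<Omega> \<times> {0<..}) u \<and>
    (\<forall>x\<in>\<Omega>. \<forall>t>0.
      (\<forall>\<phi>. C2_on (\<Omega> \<times> {0<..}) \<phi> \<and>
           (\<forall>z\<in>\<Omega> \<times> {0<..}. u z - \<phi> z \<le> u (x, t) - \<phi> (x, t)) \<longrightarrow>
         deriv (\<lambda>s. \<phi> (x, s)) t
           - upper_env (game_F p) (grad (\<lambda>z. \<phi> (z, t)) x) (hessian (\<lambda>z. \<phi> (z, t)) x) \<le> 0) \<and>
      (\<forall>\<phi>. C2_on (\<Omega> \<times> {0<..}) \<phi> \<and>
           (\<forall>z\<in>\<Omega> \<times> {0<..}. u z - \<phi> z \<ge> u (x, t) - \<phi> (x, t)) \<longrightarrow>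
         deriv (\<lambda>s. \<phi> (x, s)) t
           - lower_env (game_F p) (grad (\<lambda>z. \<phi> (z, t)) x) (hessian (\<lambda>z. \<phi> (z, t)) x) \<ge> 0))"

definition bounded_IBVP_solution ::
    "ereal \<Rightarrow> (real^'n) set \<Rightarrow> ((real^'n) \<times> real \<Rightarrow> real) \<Rightarrow> bool" where
  "bounded_IBVP_solution p \<Omega> u \<longleftrightarrow>
    viscosity_solution p \<Omega> u \<and>
    bounded (u ` (\<Omega> \<times> {0<..})) \<and>
    continuous_on (closure \<Omega> \<times> {0..} - frontier \<Omega> \<times> {0}) u \<and>
    (\<forall>x\<in>\<Omega>. u (x, 0) = 0) \<and>
    (\<forall>y\<in>frontier \<Omega>. \<forall>t>0. u (y, t) = 1)"

text \<open>The value of an infinite norm is immaterial here: only bounded functions on balls occur.\<close>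

definition Lq_norm :: "ereal \<Rightarrow> (real^'n) set \<Rightarrow> (real^'n \<Rightarrow> real) \<Rightarrow> real" where
  "Lq_norm q S f =
    (if q = \<infinity> then real_of_ereal (esssup (lebesgue_on S) (\<lambda>y. ereal \<bar>f y\<bar>))
     else (\<integral>y. \<bar>f y\<bar> powr real_of_ereal q \<partial>lebesgue_on S) powr (1 / real_of_ereal q))"

definition q_mean ::
    "ereal \<Rightarrow> real \<Rightarrow> ((real^'n) \<times> real \<Rightarrow> real) \<Rightarrow> real^'n \<Rightarrow> real \<Rightarrow> real" where
  "q_mean q R u x t =
    (THE \<mu>. \<forall>c. Lq_norm q (ball x R) (\<lambda>y. u (y, t) - \<mu>)
                 \<le> Lq_norm q (ball x R) (\<lambda>y. u (y, t) - c))"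

definition Erfc :: "real \<Rightarrow> real" where
  "Erfc \<sigma> = 2 / sqrt pi * (LBINT \<tau>:{\<sigma>..}. exp (- \<tau>\<^sup>2))"

end

theory Submission
  imports Defs "HOL-Probability.Distributions"
begin

text \<open>For small times the solution is a thin boundary layer. Let \<open>h\<close> be the height above the
  boundary, written near \<open>y\<close> as a graph in the direction of the interior normal \<open>\<nu>\<close>. A function
  \<open>\<phi>(h)\<close> has a gradient almost parallel to \<open>\<nu>\<close>, and up to lower order terms its second
  derivatives form \<open>\<phi>''(h) \<nu> \<otimes> \<nu>\<close>; there the operator equals
  \<open>(1 / p + 1 - 2 / p) \<phi>'' = \<phi>'' / p'\<close>. So across the layer the equation is the heat equation in
  one variable with diffusivity \<open>1 / p'\<close>, and the data 0 and 1 lead to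
  \<open>u \<approx> Erfc (sqrt p' h / (2 sqrt t))\<close>.

  This is made precise by a comparison principle for subsolutions and smooth strict
  supersolutions (\<open>comparison\<close>). The barriers in the layer have gradients in a narrow cone about
  the normal, which keeps them away from the singularity of the operator and makes the operator
  act almost linearly on them (\<open>two_profile_strict_supersolution\<close>). They are Erfc profiles whose
  diffusivity is slightly larger or smaller than \<open>1 / p'\<close>, with corrections
  (\<open>boundary_upper_barrier\<close>, \<open>boundary_lower_barrier\<close>); together they give the limit of \<open>u\<close>
  along points that approach the boundary at distances of order \<open>sqrt t\<close>
  (\<open>boundary_layer_limit\<close>). At distance \<open>d\<close> from the boundary \<open>u\<close> is of order
  \<open>exp (- c d\<^sup>2 / t)\<close> (\<open>interior_decay\<close>). Because the curvatures at \<open>y\<close> are less than \<open>1 / R\<close>,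
  points of the ball at depth \<open>s\<close> below the tangent plane at \<open>y\<close> have a distance of order \<open>s\<close>
  from the boundary (\<open>depth_in_touching_ball\<close>), so this decay is available on the whole ball.

  The mean for \<open>q < \<infinity>\<close> is the root \<open>\<mu>\<close> of \<open>\<integral>\<^sub>B spow (q - 1) (u - \<mu>) = 0\<close>, where \<open>spow\<close> is the
  signed power, and the integral decreases in \<open>\<mu>\<close>. Blow up \<open>y\<close> by the scale \<open>sqrt t\<close> in the
  normal and \<open>t powr (1/4)\<close> in the tangential directions. The ball becomes a paraboloid, and
  with the scales \<open>(1 - R \<kappa>\<^sub>j) powr (-1/2)\<close> along the principal directions its slices at
  constant height become round; the Jacobian is \<open>t powr ((N + 1) / 4) / sqrt \<Pi>\<^sub>\<Gamma>\<close>. By dominated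
  convergence (\<open>scaled_integral_limit\<close>) the layer contributes this Jacobian times an integral of
  \<open>Erfc powr (q - 1)\<close> over the paraboloid, which Fubini reduces to the integral in the theorem,
  and the rest of the ball contributes \<open>- |B| \<mu> powr (q - 1)\<close>. Balancing the two determines the
  order \<open>(t / R\<^sup>2) powr ((N + 1) / (4 (q - 1)))\<close> of the mean and its coefficient; the volumes of
  balls combine to \<open>c\<^sub>N\<close> by Legendre's duplication formula (\<open>constant_identity\<close>).

  For \<open>q = \<infinity>\<close> the mean is the midpoint of the range of \<open>u\<close> on the ball, and the range tends to
  the interval from 0 to 1.\<close>

section \<open>Functions of class \<open>C\<^sup>2\<close>\<close>

lemma C2_onI:
  fixes f :: "'a::real_normed_vector \<Rightarrow> real"
  assumes "\<And>x. x \<in> S \<Longrightarrow> (f has_derivative blinfun_apply (f' x)) (at x)"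
    and "\<And>x. x \<in> S \<Longrightarrow> (f' has_derivative blinfun_apply (f'' x)) (at x)"
    and "continuous_on S f''"
  shows "C2_on S f"
  using assms unfolding C2_on_def by blast

lemma C2_on_bounded_linear:
  assumes "bounded_linear (f :: 'a::real_normed_vector \<Rightarrow> real)"
  shows "C2_on S f"
proof (rule C2_onI)
  show "(f has_derivative blinfun_apply (Blinfun f)) (at x)" for x
    by (simp add: assms bounded_linear_Blinfun_apply bounded_linear_imp_has_derivative)
  show "((\<lambda>_. Blinfun f) has_derivative blinfun_apply 0) (at x)" for x
    by (auto intro!: derivative_eq_intros)
qed auto

lemma C2_on_const: "C2_on S (\<lambda>x::'a::real_normed_vector. c)"
  by (rule C2_onI[where f'="\<lambda>_. 0" and f''="\<lambda>_. 0"]) (auto intro!: derivative_eq_intros)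

lemma C2_on_add:
  assumes "C2_on S f" "C2_on S (g :: 'a::real_normed_vector \<Rightarrow> real)"
  shows "C2_on S (\<lambda>x. f x + g x)"
proof -
  from assms obtain f' f'' g' g'' where
    f: "\<And>x. x \<in> S \<Longrightarrow> (f has_derivative blinfun_apply (f' x)) (at x)"
    "\<And>x. x \<in> S \<Longrightarrow> (f' has_derivative blinfun_apply (f'' x)) (at x)" "continuous_on S f''"
    and g: "\<And>x. x \<in> S \<Longrightarrow> (g has_derivative blinfun_apply (g' x)) (at x)"
    "\<And>x. x \<in> S \<Longrightarrow> (g' has_derivative blinfun_apply (g'' x)) (at x)" "continuous_on S g''"
    unfolding C2_on_def by blast
  show ?thesis
    by (rule C2_onI[where f'="\<lambda>x. f' x + g' x" and f''="\<lambda>x. f'' x + g'' x"])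
      (auto intro!: derivative_eq_intros f g continuous_intros simp: blinfun.add_left)
qed

lemma C2_on_compose_real:
  assumes "C2_on S (f :: 'a::real_normed_vector \<Rightarrow> real)"
    and d1: "\<And>x. x \<in> S \<Longrightarrow> (\<phi> has_real_derivative \<phi>' (f x)) (at (f x))"
    and d2: "\<And>x. x \<in> S \<Longrightarrow> (\<phi>' has_real_derivative \<phi>'' (f x)) (at (f x))"
    and d3: "continuous_on (f ` S) \<phi>''"
  shows "C2_on S (\<lambda>x. \<phi> (f x))"
proof -
  from assms obtain f' f'' where
    f: "\<And>x. x \<in> S \<Longrightarrow> (f has_derivative blinfun_apply (f' x)) (at x)"
    "\<And>x. x \<in> S \<Longrightarrow> (f' has_derivative blinfun_apply (f'' x)) (at x)" "continuous_on S f''"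
    unfolding C2_on_def by blast
  have cf: "continuous_on S f" and cf': "continuous_on S f'"
    using f(1,2) by (meson continuous_at_imp_continuous_on has_derivative_continuous)+
  show ?thesis
  proof (rule C2_onI)
    fix x assume x: "x \<in> S"
    have "((\<lambda>x. \<phi> (f x)) has_derivative (\<lambda>v. \<phi>' (f x) * f' x v)) (at x)"
      using has_derivative_compose[OF f(1)[OF x]] d1[OF x] by (simp add: has_field_derivative_def)
    then show "((\<lambda>x. \<phi> (f x)) has_derivative blinfun_apply (\<phi>' (f x) *\<^sub>R f' x)) (at x)"
      by (simp add: scaleR_blinfun.rep_eq)
    have 1: "((\<lambda>x. \<phi>' (f x)) has_derivative (\<lambda>v. \<phi>'' (f x) * f' x v)) (at x)"
      using has_derivative_compose[OF f(1)[OF x]] d2[OF x] by (simp add: has_field_derivative_def)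
    show "((\<lambda>x. \<phi>' (f x) *\<^sub>R f' x) has_derivative blinfun_apply
       (\<phi>' (f x) *\<^sub>R f'' x + \<phi>'' (f x) *\<^sub>R (blinfun_scaleR_left (f' x) o\<^sub>L f' x))) (at x)"
      by (rule derivative_eq_intros has_derivative_eq_rhs[OF has_derivative_scaleR[OF 1 f(2)[OF x]]])+
        (auto simp: blinfun.add_left blinfun.scaleR_left)
  next
    have "continuous_on S (\<lambda>x. blinfun_scaleR_left (f' x))"
      by (rule bounded_linear.continuous_on[OF bounded_linear_blinfun_scaleR_left cf'])
    then have a: "continuous_on S (\<lambda>x. blinfun_scaleR_left (f' x) o\<^sub>L f' x)"
      by (rule bounded_bilinear.continuous_on[OF bounded_bilinear_blinfun_compose _ cf'])
    have b: "continuous_on S (\<lambda>x. \<phi>'' (f x))"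
      using continuous_on_compose[OF cf d3] by (simp add: o_def)
    have c: "continuous_on S (\<lambda>x. \<phi>' (f x))"
      by (rule continuous_at_imp_continuous_on)
        (metis f(1) d2 DERIV_continuous continuous_within_compose2 has_derivative_continuous isCont_o2)
    show "continuous_on S (\<lambda>x. \<phi>' (f x) *\<^sub>R f'' x + \<phi>'' (f x) *\<^sub>R (blinfun_scaleR_left (f' x) o\<^sub>L f' x))"
      by (intro continuous_intros a b c f)
  qed
qed

lemma C2_on_cmult:
  assumes "C2_on S (f :: 'a::real_normed_vector \<Rightarrow> real)"
  shows "C2_on S (\<lambda>x. c * f x)"
  by (rule C2_on_compose_real[OF assms, where \<phi>="\<lambda>r. c * r" and \<phi>'="\<lambda>_. c" and \<phi>''="\<lambda>_. 0"])
    (auto intro!: derivative_eq_intros)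

lemma C2_on_power2:
  assumes "C2_on S (f :: 'a::real_normed_vector \<Rightarrow> real)"
  shows "C2_on S (\<lambda>x. (f x)\<^sup>2)"
  by (rule C2_on_compose_real[OF assms, where \<phi>="\<lambda>r. r\<^sup>2" and \<phi>'="\<lambda>r. 2*r" and \<phi>''="\<lambda>_. 2"])
    (auto intro!: derivative_eq_intros)

lemma C2_on_minus:
  assumes "C2_on S (f :: 'a::real_normed_vector \<Rightarrow> real)"
  shows "C2_on S (\<lambda>x. - f x)"
  using C2_on_cmult[OF assms, of "-1"] by simp

lemma C2_on_diff:
  assumes "C2_on S f" "C2_on S (g :: 'a::real_normed_vector \<Rightarrow> real)"
  shows "C2_on S (\<lambda>x. f x - g x)"
  using C2_on_add[OF assms(1) C2_on_minus[OF assms(2)]] by simp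

text \<open>By polarisation, products reduce to squares and sums.\<close>

lemma C2_on_mult:
  assumes "C2_on S f" "C2_on S (g :: 'a::real_normed_vector \<Rightarrow> real)"
  shows "C2_on S (\<lambda>x. f x * g x)"
proof -
  have "(\<lambda>x. f x * g x) = (\<lambda>x. (1/2) * ((f x + g x)\<^sup>2 - ((f x)\<^sup>2 + (g x)\<^sup>2)))"
    by (auto simp: power2_eq_square field_simps)
  then show ?thesis
    using assms by (simp only:) (intro C2_on_cmult C2_on_diff C2_on_power2 C2_on_add)
qed

lemma C2_on_sum:
  assumes "\<And>i. i \<in> I \<Longrightarrow> C2_on S (f i :: 'a::real_normed_vector \<Rightarrow> real)"
  shows "C2_on S (\<lambda>x. \<Sum>i\<in>I. f i x)"
  using assms by (induction I rule: infinite_finite_induct) (auto intro!: C2_on_const C2_on_add)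

lemma C2_on_exp:
  assumes "C2_on S (f :: 'a::real_normed_vector \<Rightarrow> real)"
  shows "C2_on S (\<lambda>x. exp (f x))"
  by (rule C2_on_compose_real[OF assms, where \<phi>'=exp and \<phi>''=exp])
    (auto intro!: derivative_eq_intros continuous_intros)

lemma C2_on_powr:
  assumes "C2_on S (f :: 'a::real_normed_vector \<Rightarrow> real)" "\<And>x. x \<in> S \<Longrightarrow> f x > 0"
  shows "C2_on S (\<lambda>x. f x powr c)"
  using assms(2)
  by (intro C2_on_compose_real[OF assms(1), where \<phi>="\<lambda>r. r powr c" and \<phi>'="\<lambda>r. c * r powr (c - 1)"
        and \<phi>''="\<lambda>r. c * ((c - 1) * r powr (c - 1 - 1))"])
     (force intro!: derivative_eq_intros continuous_intros)+

text \<open>The second derivative takes values in a space of bounded linear maps, so precomposition with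
  the projection enters as the bounded linear map \<open>L\<close> on that space.\<close>

lemma C2_on_fst:
  assumes "C2_on UNIV (g :: 'a::real_normed_vector \<Rightarrow> real)"
  shows "C2_on S (\<lambda>z::'a \<times> 'b::real_normed_vector. g (fst z))"
proof -
  from assms obtain f' f'' where
    f: "\<And>x. (g has_derivative blinfun_apply (f' x)) (at x)"
    "\<And>x. (f' has_derivative blinfun_apply (f'' x)) (at x)" "continuous_on UNIV f''"
    unfolding C2_on_def by blast
  define L where "L = Blinfun (\<lambda>A::'a \<Rightarrow>\<^sub>L real. A o\<^sub>L (fst_blinfun :: ('a\<times>'b) \<Rightarrow>\<^sub>L 'a))"
  have L: "blinfun_apply L A = A o\<^sub>L fst_blinfun" for A
    unfolding L_def by (simp add: bounded_linear_Blinfun_apply bounded_bilinear.bounded_linear_left[OF bounded_bilinear_blinfun_compose])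
  show ?thesis
  proof (rule C2_onI)
    fix z :: "'a \<times> 'b"
    show "((\<lambda>z. g (fst z)) has_derivative blinfun_apply (f' (fst z) o\<^sub>L fst_blinfun)) (at z)"
      by (rule has_derivative_eq_rhs[OF has_derivative_compose[OF has_derivative_fst[OF has_derivative_ident] f(1)]]) auto
    have 1: "((\<lambda>z. f' (fst z)) has_derivative (\<lambda>h. f'' (fst z) (fst h))) (at z)"
      by (rule has_derivative_compose[OF has_derivative_fst[OF has_derivative_ident] f(2)])
    show "((\<lambda>z. f' (fst z) o\<^sub>L fst_blinfun) has_derivative blinfun_apply (L o\<^sub>L (f'' (fst z) o\<^sub>L fst_blinfun))) (at z)"
      by (rule has_derivative_eq_rhs[OF bounded_linear.has_derivative[OF blinfun.bounded_linear_right[of L] 1, unfolded L]])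
        (simp add: L fun_eq_iff)
  next
    have "continuous_on S (\<lambda>z. f'' (fst z))"
      using continuous_on_compose2[OF f(3) continuous_on_fst[OF continuous_on_id]] by simp
    then show "continuous_on S (\<lambda>z::'a\<times>'b. L o\<^sub>L (f'' (fst z) o\<^sub>L fst_blinfun))"
      by (intro bounded_bilinear.continuous_on[OF bounded_bilinear_blinfun_compose] continuous_on_const)
  qed
qed

lemma C2_on_snd: "C2_on S (snd :: 'a::real_normed_vector \<times> real \<Rightarrow> real)"
  by (rule C2_on_bounded_linear) (rule bounded_linear_snd)

lemma C2_on_norm2: "C2_on S (\<lambda>z::real^'n. (norm (z - a))\<^sup>2)"
proof -
  have "(\<lambda>z::real^'n. (norm (z - a))\<^sup>2) = (\<lambda>z. \<Sum>i\<in>UNIV. (z $ i - a $ i)\<^sup>2)"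
    by (simp add: norm_vec_def L2_set_def sum_nonneg fun_eq_iff)
  then show ?thesis
    by (simp only:) (intro C2_on_sum C2_on_power2 C2_on_diff C2_on_const C2_on_bounded_linear bounded_linear_vec_nth)
qed

lemma C2_on_inner: "C2_on S (\<lambda>z::'a::real_inner. z \<bullet> a)"
  by (rule C2_on_bounded_linear) (rule bounded_linear_inner_left)

text \<open>The second difference over the parallelogram spanned by \<open>s v\<close> and \<open>s w\<close> is symmetric in \<open>v\<close>
  and \<open>w\<close>; two applications of the mean value theorem show that, divided by \<open>s\<^sup>2\<close>, it tends to
  the second derivative at \<open>(v, w)\<close>. The symmetry of Hessians is needed because the envelopes of
  the operator see only symmetric matrices.\<close>

lemma C2_on_UNIV_second_derivative_symmetric:
  fixes g :: "'a::real_normed_vector \<Rightarrow> real"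
  assumes f: "\<And>x. (g has_derivative blinfun_apply (f' x)) (at x)"
    "\<And>x. (f' has_derivative blinfun_apply (f'' x)) (at x)" "continuous_on UNIV f''"
  shows "f'' x v w = f'' x w v"
proof -
  have mvt: "\<exists>a b. 0 < a \<and> a < s \<and> 0 < b \<and> b < s \<and>
      g (x + s *\<^sub>R v + s *\<^sub>R w) - g (x + s *\<^sub>R v) - g (x + s *\<^sub>R w) + g x = s * s * f'' (x + a *\<^sub>R v + b *\<^sub>R w) v w"
    if "s > 0" for s and v w :: 'a
  proof -
    define \<psi> where "\<psi> \<tau> = g (x + s *\<^sub>R v + \<tau> *\<^sub>R w) - g (x + \<tau> *\<^sub>R w)" for \<tau>
    have d: "(\<psi> has_real_derivative (f' (x + s *\<^sub>R v + \<tau> *\<^sub>R w) w - f' (x + \<tau> *\<^sub>R w) w)) (at \<tau>)" for \<tau>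
      unfolding \<psi>_def has_field_derivative_def
      by (rule derivative_eq_intros has_derivative_eq_rhs[OF has_derivative_compose[OF _ f(1)]] refl)+
        (auto simp: blinfun.scaleR_right algebra_simps)
    obtain b where b: "0 < b" "b < s" "\<psi> s - \<psi> 0 = (s - 0) * (f' (x + s *\<^sub>R v + b *\<^sub>R w) w - f' (x + b *\<^sub>R w) w)"
      using MVT2[OF \<open>0 < s\<close>, of \<psi> "\<lambda>\<tau>. f' (x + s *\<^sub>R v + \<tau> *\<^sub>R w) w - f' (x + \<tau> *\<^sub>R w) w"] d by blast
    have d2: "((\<lambda>\<sigma>. f' (x + \<sigma> *\<^sub>R v + b *\<^sub>R w) w) has_real_derivative f'' (x + \<sigma> *\<^sub>R v + b *\<^sub>R w) v w) (at \<sigma>)" for \<sigma>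
    proof -
      have "((\<lambda>\<sigma>. f' (x + \<sigma> *\<^sub>R v + b *\<^sub>R w)) has_derivative (\<lambda>h. f'' (x + \<sigma> *\<^sub>R v + b *\<^sub>R w) (h *\<^sub>R v))) (at \<sigma>)"
        by (rule has_derivative_compose[OF _ f(2), where f'="\<lambda>h. h *\<^sub>R v"]) (auto intro!: derivative_eq_intros)
      then have "((\<lambda>\<sigma>. f' (x + \<sigma> *\<^sub>R v + b *\<^sub>R w) w) has_derivative (\<lambda>h. f'' (x + \<sigma> *\<^sub>R v + b *\<^sub>R w) (h *\<^sub>R v) w)) (at \<sigma>)"
        by (rule bounded_linear.has_derivative[OF blinfun.bounded_linear_left])
      then show ?thesis
        unfolding has_field_derivative_def
        by (rule has_derivative_eq_rhs) (simp add: fun_eq_iff blinfun.scaleR_right blinfun.scaleR_left)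
    qed
    obtain a where "0 < a" "a < s"
      "f' (x + s *\<^sub>R v + b *\<^sub>R w) w - f' (x + 0 *\<^sub>R v + b *\<^sub>R w) w = (s - 0) * f'' (x + a *\<^sub>R v + b *\<^sub>R w) v w"
      using MVT2[OF \<open>0 < s\<close>, of "\<lambda>\<sigma>. f' (x + \<sigma> *\<^sub>R v + b *\<^sub>R w) w" "\<lambda>\<sigma>. f'' (x + \<sigma> *\<^sub>R v + b *\<^sub>R w) v w"] d2 by blast
    with b show ?thesis
      by (intro exI[of _ a] exI[of _ b]) (auto simp: \<psi>_def)
  qed
  have lim: "((\<lambda>s. (g (x + s *\<^sub>R v + s *\<^sub>R w) - g (x + s *\<^sub>R v) - g (x + s *\<^sub>R w) + g x) / (s * s)) \<longlongrightarrow> f'' x v w) (at_right 0)"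
    for v w
  proof -
    let ?P = "\<lambda>s a b. s > 0 \<longrightarrow> 0 < a \<and> a < s \<and> 0 < b \<and> b < s \<and>
      g (x + s *\<^sub>R v + s *\<^sub>R w) - g (x + s *\<^sub>R v) - g (x + s *\<^sub>R w) + g x = s * s * f'' (x + a *\<^sub>R v + b *\<^sub>R w) v w"
    have "\<forall>s. \<exists>a b. ?P s a b" using mvt by blast
    then obtain a b where "\<forall>s. ?P s (a s) (b s)"
      unfolding choice_iff by blast
    then have ab: "\<forall>\<^sub>F s in at_right 0. s > 0 \<and> ?P s (a s) (b s)"
      by (intro eventually_mono[OF eventually_at_right_less[of 0]]) blast
    have "\<forall>\<^sub>F s in at_right 0. 0 \<le> a s" "\<forall>\<^sub>F s in at_right 0. a s \<le> s"
      "\<forall>\<^sub>F s in at_right 0. 0 \<le> b s" "\<forall>\<^sub>F s in at_right 0. b s \<le> s"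
      using ab by (auto elim!: eventually_mono)
    then have a0: "(a \<longlongrightarrow> 0) (at_right 0)" and b0: "(b \<longlongrightarrow> 0) (at_right 0)"
      using tendsto_sandwich[OF _ _ tendsto_const tendsto_ident_at] by blast+
    have "((\<lambda>s. x + a s *\<^sub>R v + b s *\<^sub>R w) \<longlongrightarrow> x) (at_right 0)"
      by (rule tendsto_eq_intros a0 b0 refl | simp)+
    moreover have "isCont f'' x" using f(3) by (simp add: continuous_on_eq_continuous_at)
    ultimately have "((\<lambda>s. f'' (x + a s *\<^sub>R v + b s *\<^sub>R w)) \<longlongrightarrow> f'' x) (at_right 0)"
      by (rule isCont_tendsto_compose[rotated])
    then have "((\<lambda>s. f'' (x + a s *\<^sub>R v + b s *\<^sub>R w) v w) \<longlongrightarrow> f'' x v w) (at_right 0)"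
      by (intro blinfun.tendsto tendsto_const)
    then show ?thesis
      by (rule Lim_transform_eventually, intro eventually_mono[OF ab]) auto
  qed
  have "((\<lambda>s. (g (x + s *\<^sub>R v + s *\<^sub>R w) - g (x + s *\<^sub>R v) - g (x + s *\<^sub>R w) + g x) / (s * s)) \<longlongrightarrow> f'' x w v) (at_right 0)"
    using lim[of w v] by (simp add: algebra_simps)
  then show ?thesis
    using lim[of v w] tendsto_unique[OF trivial_limit_at_right_real] by blast
qed

section \<open>Gradients and Hessians\<close>

text \<open>A gradient field on a whole neighbourhood that is differentiable at the point is just what
  makes \<open>grad\<close> and \<open>hessian\<close>, which are total functions, take the intended values; unlike class
  \<open>C\<^sup>2\<close> it is a property at a single point and is computed by simple rules.\<close>

definition has_jet :: "(real^'n \<Rightarrow> real) \<Rightarrow> real^'n \<Rightarrow> real^'n \<Rightarrow> real^'n^'n \<Rightarrow> bool" where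
  "has_jet f x \<xi> X \<longleftrightarrow> (\<exists>G. (\<forall>\<^sub>F z in nhds x. (f has_derivative (\<lambda>v. G z \<bullet> v)) (at z)) \<and>
     G x = \<xi> \<and> (G has_derivative (\<lambda>v. X *v v)) (at x))"

lemma has_jetI:
  assumes "\<And>z. (f has_derivative (\<lambda>v. G z \<bullet> v)) (at z)" "G x = \<xi>" "(G has_derivative (\<lambda>v. X *v v)) (at x)"
  shows "has_jet f x \<xi> X"
  using assms unfolding has_jet_def by (auto intro!: exI[of _ G])

lemma has_jet_grad_hessian:
  assumes "has_jet f x \<xi> X"
  shows "grad f x = \<xi>" "hessian f x = X"
proof -
  obtain G where G: "\<forall>\<^sub>F z in nhds x. (f has_derivative (\<lambda>v. G z \<bullet> v)) (at z)" "G x = \<xi>"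
    "(G has_derivative (\<lambda>v. X *v v)) (at x)"
    using assms unfolding has_jet_def by blast
  have gr: "grad f z = G z" if "(f has_derivative (\<lambda>v. G z \<bullet> v)) (at z)" for z
    using frechet_derivative_at[OF that, symmetric]
    by (simp add: grad_def vec_eq_iff inner_axis)
  have ev: "\<forall>\<^sub>F z in nhds x. G z = grad f z"
    using G(1) by eventually_elim (simp add: gr)
  show "grad f x = \<xi>" using eventually_nhds_x_imp_x[OF ev] G(2) by simp
  have "(grad f has_derivative (\<lambda>v. X *v v)) (at x)"
    by (rule has_derivative_transform_eventually[OF G(3)])
      (use ev eventually_nhds_x_imp_x[OF ev] in \<open>auto simp: eventually_at_filter elim: eventually_mono\<close>)
  then have "frechet_derivative (grad f) (at x) = (\<lambda>v. X *v v)"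
    using frechet_derivative_at by metis
  then show "hessian f x = X" by (simp add: hessian_def jacobian_def)
qed

lemma has_jet_add:
  assumes "has_jet f x \<xi> X" "has_jet g x \<zeta> Y"
  shows "has_jet (\<lambda>z. f z + g z) x (\<xi> + \<zeta>) (X + Y)"
proof -
  obtain G H where G: "\<forall>\<^sub>F z in nhds x. (f has_derivative (\<lambda>v. G z \<bullet> v)) (at z)" "G x = \<xi>"
    "(G has_derivative (\<lambda>v. X *v v)) (at x)"
    and H: "\<forall>\<^sub>F z in nhds x. (g has_derivative (\<lambda>v. H z \<bullet> v)) (at z)" "H x = \<zeta>"
    "(H has_derivative (\<lambda>v. Y *v v)) (at x)"
    using assms unfolding has_jet_def by blast
  show ?thesis unfolding has_jet_def
  proof (intro exI[of _ "\<lambda>z. G z + H z"] conjI)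
    show "\<forall>\<^sub>F z in nhds x. ((\<lambda>z. f z + g z) has_derivative (\<lambda>v. (G z + H z) \<bullet> v)) (at z)"
      using G(1) H(1) by eventually_elim (auto simp: inner_add_left intro!: derivative_eq_intros)
    show "((\<lambda>z. G z + H z) has_derivative (\<lambda>v. (X + Y) *v v)) (at x)"
      using has_derivative_add[OF G(3) H(3)] by (simp add: matrix_vector_mult_add_rdistrib)
  qed (simp add: G H)
qed

lemma has_jet_const: "has_jet (\<lambda>_. c) x 0 0"
  by (rule has_jetI[where G="\<lambda>_. 0"]) auto

definition outer :: "real^'n \<Rightarrow> real^'n^'n" where
  "outer k = (\<chi> i j. k $ i * k $ j)"

lemma outer_mult: "outer k *v v = (k \<bullet> v) *\<^sub>R k"
  by (simp add: vec_eq_iff outer_def matrix_vector_mult_def inner_vec_def mult.assoc mult.commute[of "sum _ _"] flip: sum_distrib_left)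

lemma transpose_outer [simp]: "transpose (outer k) = outer k"
  by (simp add: transpose_def outer_def vec_eq_iff mult.commute)

lemma trace_outer: "trace (outer k) = (norm k)\<^sup>2"
  by (simp add: trace_def outer_def norm_vec_def L2_set_def sum_nonneg power2_eq_square)

lemma has_jet_compose:
  assumes "has_jet f x \<xi> X"
    and d1: "\<And>r. (\<phi> has_real_derivative \<phi>' r) (at r)"
    and d2: "(\<phi>' has_real_derivative c) (at (f x))"
  shows "has_jet (\<lambda>z. \<phi> (f z)) x (\<phi>' (f x) *\<^sub>R \<xi>) (c *\<^sub>R outer \<xi> + \<phi>' (f x) *\<^sub>R X)"
proof -
  obtain G where G: "\<forall>\<^sub>F z in nhds x. (f has_derivative (\<lambda>v. G z \<bullet> v)) (at z)" "G x = \<xi>"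
    "(G has_derivative (\<lambda>v. X *v v)) (at x)"
    using assms unfolding has_jet_def by blast
  show ?thesis unfolding has_jet_def
  proof (intro exI[of _ "\<lambda>z. \<phi>' (f z) *\<^sub>R G z"] conjI)
    show "\<forall>\<^sub>F z in nhds x. ((\<lambda>z. \<phi> (f z)) has_derivative (\<lambda>v. (\<phi>' (f z) *\<^sub>R G z) \<bullet> v)) (at z)"
      using G(1)
    proof eventually_elim
      case (elim z)
      from has_derivative_compose[OF elim d1[of "f z", unfolded has_field_derivative_def]]
      show ?case by simp
    qed
    have fx: "(f has_derivative (\<lambda>v. \<xi> \<bullet> v)) (at x)" using eventually_nhds_x_imp_x[OF G(1)] G(2) by simp
    have "((\<lambda>z. \<phi>' (f z)) has_derivative (\<lambda>v. c * (\<xi> \<bullet> v))) (at x)"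
      using has_derivative_compose[OF fx d2[unfolded has_field_derivative_def]] by simp
    from has_derivative_scaleR[OF this G(3)]
    show "((\<lambda>z. \<phi>' (f z) *\<^sub>R G z) has_derivative (\<lambda>v. (c *\<^sub>R outer \<xi> + \<phi>' (f x) *\<^sub>R X) *v v)) (at x)"
      by (rule has_derivative_eq_rhs)
        (auto simp: fun_eq_iff matrix_vector_mult_add_rdistrib outer_mult G(2) scaleR_matrix_vector_assoc[symmetric])
  qed (simp add: G)
qed

lemma has_jet_cmult:
  assumes "has_jet f x \<xi> X" shows "has_jet (\<lambda>z. c * f z) x (c *\<^sub>R \<xi>) (c *\<^sub>R X)"
  using has_jet_compose[OF assms, of "\<lambda>r. c * r" "\<lambda>_. c" 0]
  by (auto intro!: derivative_eq_intros)

lemma has_jet_minus: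
  assumes "has_jet f x \<xi> X" shows "has_jet (\<lambda>z. - f z) x (- \<xi>) (- X)"
  using has_jet_cmult[OF assms, of "-1"] by simp

lemma has_jet_inner: "has_jet (\<lambda>z. z \<bullet> a) x a 0"
  by (rule has_jetI[where G="\<lambda>_. a"]) (auto intro!: derivative_eq_intros simp: inner_commute)

lemma has_jet_norm2: "has_jet (\<lambda>z. (norm (z - a))\<^sup>2) x (2 *\<^sub>R (x - a)) (2 *\<^sub>R mat 1)"
proof (rule has_jetI[where G="\<lambda>z. 2 *\<^sub>R (z - a)"])
  show "((\<lambda>z. (norm (z - a))\<^sup>2) has_derivative (\<bullet>) (2 *\<^sub>R (z - a))) (at z)" for z
    unfolding power2_norm_eq_inner
    by (rule derivative_eq_intros refl)+ (auto simp: fun_eq_iff inner_commute)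
  show "((\<lambda>z. 2 *\<^sub>R (z - a)) has_derivative (\<lambda>v. (2 *\<^sub>R mat 1) *v v)) (at x)"
    by (rule derivative_eq_intros refl)+ (auto simp: fun_eq_iff scaleR_matrix_vector_assoc[symmetric])
qed simp

lemma has_derivative_vec:
  fixes f :: "'n::finite \<Rightarrow> 'a::real_normed_vector \<Rightarrow> real"
  assumes "\<And>i. (f i has_derivative f' i) (at x)"
  shows "((\<lambda>z. \<chi> i. f i z) has_derivative (\<lambda>v. \<chi> i. f' i v)) (at x)"
  unfolding has_derivative_componentwise_within[of "\<lambda>z. \<chi> i. f i z"]
  using assms by (auto simp: Basis_vec_def inner_axis)

text \<open>Test functions are differentiated in space with the time frozen and vice versa; both partial
  derivatives are restrictions of the total one.\<close>

lemma has_jet_slice: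
  fixes \<phi> :: "(real^'n) \<times> real \<Rightarrow> real"
  assumes "C2_on (\<Omega> \<times> {0<..}) \<phi>" "open \<Omega>" "x \<in> \<Omega>" "t > 0"
  obtains \<tau> \<xi> X where "has_jet (\<lambda>z. \<phi> (z, t)) x \<xi> X" "((\<lambda>s. \<phi> (x, s)) has_real_derivative \<tau>) (at t)"
proof -
  obtain f' f'' where
    f: "\<And>z. z \<in> \<Omega> \<times> {0<..} \<Longrightarrow> (\<phi> has_derivative blinfun_apply (f' z)) (at z)"
    "\<And>z. z \<in> \<Omega> \<times> {0<..} \<Longrightarrow> (f' has_derivative blinfun_apply (f'' z)) (at z)"
    using assms(1) unfolding C2_on_def by blast
  define G where "G z = (\<chi> i. f' (z, t) (axis i 1, 0))" for z
  define X where "X = (\<chi> i j. f'' (x, t) (axis j 1, 0) (axis i 1, 0))"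
  have 1: "((\<lambda>z. \<phi> (z, t)) has_derivative (\<lambda>v. G z \<bullet> v)) (at z)" if "z \<in> \<Omega>" for z
  proof -
    have 1: "((\<lambda>z. \<phi> (z, t)) has_derivative (\<lambda>v. f' (z, t) (v, 0))) (at z)"
      using f(1)[of "(z,t)"] that \<open>t > 0\<close>
      by (intro has_derivative_compose[of "\<lambda>z. (z, t)" "\<lambda>v. (v, 0)" z UNIV \<phi> "f' (z, t)"])
        (auto intro!: derivative_eq_intros)
    have "f' (z, t) (v, 0) = G z \<bullet> v" for v
    proof -
      have "(v, 0::real) = (\<Sum>i\<in>UNIV. (v $ i) *\<^sub>R (axis i 1, 0))"
        by (rule prod_eqI) (auto simp: fst_sum snd_sum basis_expansion scalar_mult_eq_scaleR[symmetric])
      then have "f' (z, t) (v, 0) = (\<Sum>i\<in>UNIV. (v $ i) * f' (z, t) (axis i 1, 0))"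
        by (simp only: blinfun.sum_right blinfun.scaleR_right real_scaleR_def)
      then show ?thesis by (simp add: G_def inner_vec_def mult.commute)
    qed
    with 1 show ?thesis by simp
  qed
  have 2: "(G has_derivative (\<lambda>v. X *v v)) (at x)"
  proof -
    have "((\<lambda>z. f' (z, t)) has_derivative (\<lambda>v. f'' (x, t) (v, 0))) (at x)"
      using f(2)[of "(x,t)"] assms
      by (intro has_derivative_compose[of "\<lambda>z. (z, t)" "\<lambda>v. (v, 0)" x UNIV f' "f'' (x, t)"])
        (auto intro!: derivative_eq_intros)
    then have c: "((\<lambda>z. f' (z, t) w) has_derivative (\<lambda>v. f'' (x, t) (v, 0) w)) (at x)" for w
      by (rule bounded_linear.has_derivative[OF blinfun.bounded_linear_left])
    have e: "f'' (x, t) (v, 0) w = (\<Sum>j\<in>UNIV. f'' (x, t) (axis j 1, 0) w * v $ j)" for v w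
    proof -
      have "(v, 0::real) = (\<Sum>i\<in>UNIV. (v $ i) *\<^sub>R (axis i 1, 0))"
        by (rule prod_eqI) (auto simp: fst_sum snd_sum basis_expansion scalar_mult_eq_scaleR[symmetric])
      then have "f'' (x, t) (v, 0) w = (\<Sum>i\<in>UNIV. (v $ i) * f'' (x, t) (axis i 1, 0) w)"
        by (simp only: blinfun.sum_right blinfun.scaleR_right blinfun.sum_left blinfun.scaleR_left real_scaleR_def)
      then show ?thesis by (simp add: mult.commute)
    qed
    have "(G has_derivative (\<lambda>v. \<chi> i. f'' (x, t) (v, 0) (axis i 1, 0))) (at x)"
      unfolding G_def by (rule has_derivative_vec) (rule c)
    moreover have "(\<chi> i. f'' (x, t) (v, 0) (axis i 1, 0)) = X *v v" for v
      by (simp only: X_def matrix_vector_mult_def vec_lambda_beta e[of v])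
    ultimately show ?thesis by simp
  qed
  have "has_jet (\<lambda>z. \<phi> (z, t)) x (G x) X"
    unfolding has_jet_def using 1 2 assms(2,3)
    by (intro exI[of _ G]) (auto simp: eventually_nhds)
  moreover have "((\<lambda>s. \<phi> (x, s)) has_real_derivative f' (x, t) (0, 1)) (at t)"
  proof -
    have "((\<lambda>s. \<phi> (x, s)) has_derivative (\<lambda>v. f' (x, t) (0, v))) (at t)"
      using f(1)[of "(x,t)"] assms
      by (intro has_derivative_compose[of "\<lambda>s. (x, s)" "\<lambda>v. (0, v)" t UNIV \<phi> "f' (x, t)"])
        (auto intro!: derivative_eq_intros)
    moreover have "(\<lambda>v. f' (x, t) (0, v)) = (\<lambda>v. f' (x, t) (0, 1) * v)"
    proof
      fix v
      have "f' (x, t) (0, v) = f' (x, t) (v *\<^sub>R (0, 1))" by simp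
      also have "\<dots> = v *\<^sub>R f' (x, t) (0, 1)" by (rule blinfun.scaleR_right)
      finally show "f' (x, t) (0, v) = f' (x, t) (0, 1) * v" by simp
    qed
    ultimately show ?thesis unfolding has_field_derivative_def by metis
  qed
  ultimately show ?thesis by (rule that)
qed

lemma C2_on_UNIV_jet:
  fixes g :: "real^'n \<Rightarrow> real"
  assumes "C2_on UNIV g"
  shows "has_jet g x (grad g x) (hessian g x)" "transpose (hessian g x) = hessian g x"
    "continuous_on UNIV (hessian g)" "(g has_derivative (\<lambda>v. grad g x \<bullet> v)) (at x)"
    "(grad g has_derivative (\<lambda>v. hessian g x *v v)) (at x)"
proof -
  obtain f' f'' where
    f: "\<And>x. (g has_derivative blinfun_apply (f' x)) (at x)"
    "\<And>x. (f' has_derivative blinfun_apply (f'' x)) (at x)" "continuous_on UNIV f''"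
    using assms unfolding C2_on_def by blast
  define G where "G z = (\<chi> i. f' z (axis i 1))" for z
  define X where "X x = (\<chi> i j. f'' x (axis j 1) (axis i 1))" for x
  have be: "v = (\<Sum>i\<in>UNIV. (v $ i) *\<^sub>R axis i 1)" for v :: "real^'n"
    by (simp add: basis_expansion scalar_mult_eq_scaleR[symmetric])
  have 1: "f' z v = G z \<bullet> v" for z v
    by (subst be) (simp add: blinfun.sum_right blinfun.scaleR_right G_def inner_vec_def mult.commute)
  have 2: "(G has_derivative (\<lambda>v. X x *v v)) (at x)" for x
  proof -
    have c: "((\<lambda>z. f' z w) has_derivative (\<lambda>v. f'' x v w)) (at x)" for w
      by (rule bounded_linear.has_derivative[OF blinfun.bounded_linear_left f(2)])
    have e: "f'' x v w = (\<Sum>j\<in>UNIV. f'' x (axis j 1) w * v $ j)" for v w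
      by (subst be) (simp add: blinfun.sum_right blinfun.scaleR_right blinfun.sum_left blinfun.scaleR_left mult.commute)
    have "(G has_derivative (\<lambda>v. \<chi> i. f'' x v (axis i 1))) (at x)"
      unfolding G_def by (rule has_derivative_vec) (rule c)
    moreover have "(\<chi> i. f'' x v (axis i 1)) = X x *v v" for v
      by (simp only: X_def matrix_vector_mult_def vec_lambda_beta e[of v])
    ultimately show ?thesis by simp
  qed
  have j: "has_jet g x (G x) (X x)" for x
    by (rule has_jetI[OF _ _ 2]) (use f(1) in \<open>simp_all add: 1[abs_def, symmetric]\<close>)
  have eq: "grad g = G" "hessian g = X"
    using has_jet_grad_hessian[OF j] by auto
  show "has_jet g x (grad g x) (hessian g x)" using j eq by simp
  show "transpose (hessian g x) = hessian g x"
    using C2_on_UNIV_second_derivative_symmetric[OF f]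
    by (simp add: eq X_def transpose_def vec_eq_iff)
  show "continuous_on UNIV (hessian g)"
    unfolding eq X_def by (intro continuous_on_vec_lambda blinfun.continuous_on f(3) continuous_on_const)
  show "(g has_derivative (\<lambda>v. grad g x \<bullet> v)) (at x)"
    using f(1)[of x] by (simp add: eq 1[abs_def, symmetric])
  show "(grad g has_derivative (\<lambda>v. hessian g x *v v)) (at x)" using 2 eq by simp
qed

section \<open>The operator and its semicontinuous envelopes\<close>

lemma norm_matrix_vector_mult_le:
  fixes Y :: "real^'n^'m" shows "norm (Y *v v) \<le> norm Y * norm v"
proof -
  have "(norm (Y *v v))\<^sup>2 = (\<Sum>i\<in>UNIV. (Y $ i \<bullet> v)\<^sup>2)"
    by (simp add: norm_vec_def L2_set_def sum_nonneg matrix_vector_mul_component)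
  also have "\<dots> \<le> (\<Sum>i\<in>UNIV. (norm (Y $ i))\<^sup>2 * (norm v)\<^sup>2)"
    unfolding power2_norm_eq_inner by (intro sum_mono Cauchy_Schwarz_ineq)
  also have "\<dots> = (norm Y * norm v)\<^sup>2"
    by (simp add: norm_vec_def[of Y] L2_set_def sum_nonneg power_mult_distrib sum_distrib_right)
  finally show ?thesis by (rule power2_le_imp_le) simp
qed

lemma abs_trace_le:
  fixes Y :: "real^'n^'n" shows "\<bar>trace Y\<bar> \<le> real CARD('n) * norm Y"
proof -
  have "\<bar>trace Y\<bar> \<le> (\<Sum>i\<in>UNIV. \<bar>Y $ i $ i\<bar>)" unfolding trace_def by (rule sum_abs)
  also have "\<dots> \<le> (\<Sum>i\<in>(UNIV::'n set). norm Y)"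
    by (intro sum_mono order_trans[OF component_le_norm_cart Finite_Cartesian_Product.norm_nth_le])
  finally show ?thesis by simp
qed

lemma trace_scaleR: "trace (c *\<^sub>R X) = c * trace (X :: real^'n^'n)"
  by (simp add: trace_def sum_distrib_left)

lemma game_F_linear:
  "game_F p \<xi> (X + Y) = game_F p \<xi> X + game_F p \<xi> Y"
  "game_F p \<xi> (c *\<^sub>R X) = c * game_F p \<xi> X"
proof -
  show "game_F p \<xi> (X + Y) = game_F p \<xi> X + game_F p \<xi> Y"
    unfolding game_F_def trace_add matrix_vector_mult_add_rdistrib inner_add_left add_divide_distrib
    by (simp add: distrib_left)
  have "(c *\<^sub>R X) *v \<xi> = c *\<^sub>R (X *v \<xi>)" by (simp add: scaleR_matrix_vector_assoc)
  then show "game_F p \<xi> (c *\<^sub>R X) = c * game_F p \<xi> X"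
    unfolding game_F_def by (simp add: trace_scaleR distrib_left mult.left_commute)
qed

lemma game_F_uminus: "game_F p (- \<xi>) (- X) = - game_F p \<xi> X"
proof -
  have "game_F p (- \<xi>) (- X) = game_F p \<xi> (- X)"
    unfolding game_F_def using matrix_vector_mult_diff_distrib[of X 0 \<xi>]
    by (simp add: linear_neg[OF matrix_vector_mul_linear])
  then show ?thesis using game_F_linear(2)[of p \<xi> "-1" X] by simp
qed

text \<open>In terms of \<open>1 / p\<close>, with value 0 for \<open>p = \<infinity>\<close>, all exponents are treated alike.\<close>

lemma inverse_exponent_bounds:
  assumes "1 < p" shows "0 \<le> real_of_ereal (1 / p)" "real_of_ereal (1 / p) < 1"
    "1 / conj_exp p = 1 - real_of_ereal (1 / p)" "conj_exp p > 0"
proof -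
  have *: "0 \<le> real_of_ereal (1 / p) \<and> real_of_ereal (1 / p) < 1 \<and>
    1 / conj_exp p = 1 - real_of_ereal (1 / p) \<and> conj_exp p > 0"
  proof (cases p)
    case (real r)
    then have "r > 1" using assms by simp
    then show ?thesis using real
      by (auto simp: conj_exp_def field_simps one_ereal_def)
  qed (use assms in \<open>auto simp: conj_exp_def\<close>)
  then show "0 \<le> real_of_ereal (1 / p)" "real_of_ereal (1 / p) < 1"
    "1 / conj_exp p = 1 - real_of_ereal (1 / p)" "conj_exp p > 0" by auto
qed

text \<open>The bound is uniform in the gradient, so it also controls the envelopes where the gradient
  vanishes.\<close>

lemma abs_game_F_le:
  fixes Y :: "real^'n^'n"
  assumes "1 < p" shows "\<bar>game_F p \<eta> Y\<bar> \<le> (real CARD('n) + 1) * norm Y"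
proof -
  note ip = inverse_exponent_bounds[OF assms]
  define c where "c = real_of_ereal (1 / p)"
  have "\<bar>(Y *v \<eta>) \<bullet> \<eta>\<bar> \<le> norm Y * (norm \<eta>)\<^sup>2"
    by (rule order_trans[OF Cauchy_Schwarz_ineq2])
      (use mult_right_mono[OF norm_matrix_vector_mult_le[of Y \<eta>], of "norm \<eta>"] in \<open>simp add: power2_eq_square mult.assoc\<close>)
  then have b: "\<bar>((Y *v \<eta>) \<bullet> \<eta>) / (norm \<eta>)\<^sup>2\<bar> \<le> norm Y"
    by (cases "\<eta> = 0") (simp_all add: field_simps)
  have "\<bar>game_F p \<eta> Y\<bar> \<le> \<bar>c * trace Y\<bar> + \<bar>(1 - 2 * c) * (((Y *v \<eta>) \<bullet> \<eta>) / (norm \<eta>)\<^sup>2)\<bar>"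
    unfolding game_F_def c_def by (rule abs_triangle_ineq)
  also have "\<dots> \<le> 1 * (real CARD('n) * norm Y) + 1 * norm Y"
    unfolding abs_mult by (intro add_mono mult_mono abs_trace_le b) (use ip(1,2) in \<open>auto simp: c_def[symmetric]\<close>)
  finally show ?thesis by (simp add: algebra_simps)
qed

text \<open>The infima over shrinking neighbourhoods increase, and the upper bound on \<open>F\<close> keeps them
  bounded. Hence the limit in the definition of the envelope exists and is their supremum, and
  it inherits every lower bound that holds near the point.\<close>

lemma lower_env_ge:
  fixes F :: "real^'n \<Rightarrow> real^'n^'n \<Rightarrow> real"
  assumes bd: "\<And>\<eta> Y. F \<eta> Y \<le> C * norm Y" and C: "C \<ge> 0" and X: "transpose X = X" and "r0 > 0"
    and b: "\<And>\<eta> Y. \<eta> \<noteq> 0 \<Longrightarrow> transpose Y = Y \<Longrightarrow> norm (\<eta> - \<xi>) < r0 \<Longrightarrow> norm (Y - X) < r0 \<Longrightarrow> b \<le> F \<eta> Y"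
  shows "b \<le> lower_env F \<xi> X"
proof -
  define A where "A r = {F \<eta> Y | \<eta> Y. \<eta> \<noteq> 0 \<and> transpose Y = Y \<and> norm (\<eta> - \<xi>) < r \<and> norm (Y - X) < r}" for r
  define m where "m r = Inf (A r)" for r
  have ex: "\<exists>\<eta>. \<eta> \<noteq> 0 \<and> norm (\<eta> - \<xi>) < r" if "r > 0" for r
  proof (cases "\<xi> = 0")
    case True
    then show ?thesis using that
      by (intro exI[of _ "(r/2) *\<^sub>R axis undefined 1"]) (auto simp: axis_eq_0_iff)
  qed (use that in auto)
  have ne: "A r \<noteq> {}" if "r > 0" for r
    using ex[OF that] X that unfolding A_def by force
  have bb: "bdd_below (A r)" if "r \<le> r0" for r
    unfolding A_def by (rule bdd_belowI[of _ b]) (use b that in force)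
  have ge: "b \<le> m r" if "0 < r" "r \<le> r0" for r
    unfolding m_def by (rule cInf_greatest[OF ne]) (use b that in \<open>force simp: A_def\<close>)+
  have anti: "m s \<le> m r" if "0 < r" "r \<le> s" "s \<le> r0" for r s
    unfolding m_def by (rule cInf_superset_mono[OF ne bb]) (use that in \<open>force simp: A_def\<close>)+
  have up: "m r \<le> C * norm X" if r: "0 < r" "r \<le> r0" for r
  proof -
    obtain \<eta> where "\<eta> \<noteq> 0" "norm (\<eta> - \<xi>) < r" using ex[OF r(1)] by blast
    then have "F \<eta> X \<in> A r" using X r unfolding A_def by force
    then have "m r \<le> F \<eta> X" unfolding m_def by (rule cInf_lower[OF _ bb[OF r(2)]])
    then show ?thesis using bd order_trans by blast
  qed
  define L where "L = Sup (m ` {0<..r0})"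
  have bda: "bdd_above (m ` {0<..r0})" by (rule bdd_aboveI[of _ "C * norm X"]) (use up in auto)
  have "(m \<longlongrightarrow> L) (at_right 0)"
  proof (rule order_tendstoI)
    fix a assume "a < L"
    then obtain r1 where r1: "0 < r1" "r1 \<le> r0" "a < m r1"
      unfolding L_def using less_cSup_iff[OF _ bda] \<open>r0 > 0\<close> by auto
    show "\<forall>\<^sub>F r in at_right 0. a < m r"
      unfolding eventually_at_right_field
      by (intro exI[of _ r1]) (use r1 anti in \<open>fastforce intro: less_le_trans\<close>)
  next
    fix a assume "L < a"
    have "m r \<le> L" if "0 < r" "r < r0" for r
      unfolding L_def by (rule cSup_upper[OF _ bda]) (use that in auto)
    then show "\<forall>\<^sub>F r in at_right 0. m r < a"
      unfolding eventually_at_right_field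
      by (intro exI[of _ r0]) (use \<open>L < a\<close> \<open>r0 > 0\<close> in \<open>fastforce intro: le_less_trans\<close>)
  qed
  then have "Lim (at_right 0) m = L" by (intro tendsto_Lim) auto
  then have "lower_env F \<xi> X = L"
    by (simp add: lower_env_def m_def[abs_def] A_def)
  moreover have "b \<le> L"
    using ge[of r0] \<open>r0 > 0\<close> cSup_upper[OF _ bda, of "m r0"] unfolding L_def by force
  ultimately show ?thesis by simp
qed

lemma upper_env_le:
  fixes X :: "real^'n^'n"
  assumes "1 < p" and X: "transpose X = X" and "r0 > 0"
    and b: "\<And>\<eta> Y. \<eta> \<noteq> 0 \<Longrightarrow> transpose Y = Y \<Longrightarrow> norm (\<eta> - \<xi>) < r0 \<Longrightarrow> norm (Y - X) < r0 \<Longrightarrow> game_F p \<eta> Y \<le> b"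
  shows "upper_env (game_F p) \<xi> X \<le> b"
proof -
  have "- b \<le> lower_env (\<lambda>\<eta> Y. - game_F p \<eta> Y) \<xi> X"
  proof (rule lower_env_ge[OF _ _ X \<open>r0 > 0\<close>])
    show "- game_F p \<eta> Y \<le> (real CARD('n) + 1) * norm Y" for \<eta> and Y :: "real^'n^'n"
      using abs_game_F_le[OF \<open>1 < p\<close>, of \<eta> Y] by linarith
  qed (use b in auto)
  then show ?thesis unfolding upper_env_def by simp
qed

text \<open>This estimate is for barriers whose gradient vanishes somewhere, such as a radial one.\<close>

lemma upper_env_le_norm:
  fixes X :: "real^'n^'n"
  assumes "1 < p" and X: "transpose X = X"
  shows "upper_env (game_F p) \<xi> X \<le> (real CARD('n) + 1) * norm X"
proof (rule field_le_epsilon)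
  fix e :: real assume "e > 0"
  define N where "N = real CARD('n) + 1"
  have "N > 0" by (simp add: N_def)
  show "upper_env (game_F p) \<xi> X \<le> (real CARD('n) + 1) * norm X + e"
  proof (rule upper_env_le[OF assms, of "e / N"])
    fix \<eta> :: "real^'n" and Y :: "real^'n^'n" assume "norm (Y - X) < e / N"
    then have "norm Y \<le> norm X + e / N" using norm_triangle_sub[of Y X] by simp
    then have "N * norm Y \<le> N * (norm X + e / N)" using \<open>N > 0\<close> by simp
    also have "\<dots> = N * norm X + e" using \<open>N > 0\<close> by (simp add: field_simps)
    finally show "game_F p \<eta> Y \<le> (real CARD('n) + 1) * norm X + e"
      using abs_game_F_le[OF \<open>1 < p\<close>, of \<eta> Y] by (simp add: N_def)
  qed (use \<open>e > 0\<close> \<open>N > 0\<close> in auto)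
qed

text \<open>Off the zero gradient \<open>F\<close> is continuous, so that passing to the envelope changes nothing.\<close>

lemma upper_env_le_game_F:
  fixes X :: "real^'n^'n"
  assumes "1 < p" and X: "transpose X = X" and "\<xi> \<noteq> 0"
  shows "upper_env (game_F p) \<xi> X \<le> game_F p \<xi> X"
proof (rule field_le_epsilon)
  fix e :: real assume "e > 0"
  have "((\<lambda>z. game_F p (fst z) (snd z)) \<longlongrightarrow> game_F p (fst (\<xi>, X)) (snd (\<xi>, X))) (at (\<xi>, X))"
    unfolding game_F_def trace_def matrix_vector_mult_def
    by (intro tendsto_intros) (use \<open>\<xi> \<noteq> 0\<close> in auto)
  then have "continuous (at (\<xi>, X)) (\<lambda>z. game_F p (fst z) (snd z))" by (simp add: continuous_at)
  then obtain d where d: "d > 0" "\<And>z. dist z (\<xi>, X) < d \<Longrightarrow> dist (game_F p (fst z) (snd z)) (game_F p \<xi> X) < e"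
    unfolding continuous_at_eps_delta using \<open>e > 0\<close> by fastforce
  show "upper_env (game_F p) \<xi> X \<le> game_F p \<xi> X + e"
  proof (rule upper_env_le[OF assms(1,2), of "d/2"])
    fix \<eta> :: "real^'n" and Y :: "real^'n^'n" assume *: "norm (\<eta> - \<xi>) < d/2" "norm (Y - X) < d/2"
    have "dist (\<eta>, Y) (\<xi>, X) \<le> dist \<eta> \<xi> + dist Y X"
      unfolding dist_Pair_Pair by (rule sqrt_sum_squares_le_sum) auto
    also have "\<dots> < d" using * by (simp add: dist_norm)
    finally show "game_F p \<eta> Y \<le> game_F p \<xi> X + e" using d(2)[of "(\<eta>, Y)"] by (simp add: dist_real_def)
  qed (use d in auto)
qed

text \<open>The operator is odd in the gradient and the matrix together.\<close>

lemma lower_env_game_F_uminus: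
  fixes \<xi> :: "real^'n"
  shows "lower_env (game_F p) (- \<xi>) (- X) = - upper_env (game_F p) \<xi> X"
proof -
  have "{game_F p \<eta> Y | \<eta> Y. \<eta> \<noteq> 0 \<and> transpose Y = Y \<and> norm (\<eta> - - \<xi>) < r \<and> norm (Y - - X) < r} =
    {- game_F p \<eta> Y | \<eta> Y. \<eta> \<noteq> 0 \<and> transpose Y = Y \<and> norm (\<eta> - \<xi>) < r \<and> norm (Y - X) < r}"
    (is "?A = ?B") for r
  proof -
    have tr: "transpose (- Y) = - transpose Y" for Y :: "real^'n^'n" by (simp add: transpose_def vec_eq_iff)
    have n: "norm (- a - b) = norm (a + b)" for a b :: "'c::real_normed_vector"
      by (metis norm_minus_cancel minus_add_distrib diff_conv_add_uminus)
    show ?thesis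
    proof safe
      fix \<eta> :: "real^'n" and Y :: "real^'n^'n"
      assume "\<eta> \<noteq> 0" "transpose Y = Y" "norm (\<eta> - - \<xi>) < r" "norm (Y - - X) < r"
      then show "\<exists>\<eta>' Y'. game_F p \<eta> Y = - game_F p \<eta>' Y' \<and> \<eta>' \<noteq> 0 \<and> transpose Y' = Y' \<and> norm (\<eta>' - \<xi>) < r \<and> norm (Y' - X) < r"
        by (intro exI[of _ "- \<eta>"] exI[of _ "- Y"]) (auto simp: game_F_uminus tr n)
    next
      fix \<eta> :: "real^'n" and Y :: "real^'n^'n"
      assume "\<eta> \<noteq> 0" "transpose Y = Y" "norm (\<eta> - \<xi>) < r" "norm (Y - X) < r"
      then show "\<exists>\<eta>' Y'. - game_F p \<eta> Y = game_F p \<eta>' Y' \<and> \<eta>' \<noteq> 0 \<and> transpose Y' = Y' \<and> norm (\<eta>' - - \<xi>) < r \<and> norm (Y' - - X) < r"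
        by (intro exI[of _ "- \<eta>"] exI[of _ "- Y"]) (auto simp: game_F_uminus tr norm_minus_commute)
    qed
  qed
  then show ?thesis unfolding upper_env_def lower_env_def by simp
qed

section \<open>Subsolutions and the comparison principle\<close>

definition viscosity_subsolution ::
    "ereal \<Rightarrow> (real^'n) set \<Rightarrow> ((real^'n) \<times> real \<Rightarrow> real) \<Rightarrow> bool" where
  "viscosity_subsolution p \<Omega> u \<longleftrightarrow>
    continuous_on (\<Omega> \<times> {0<..}) u \<and>
    (\<forall>x\<in>\<Omega>. \<forall>t>0. \<forall>\<phi>. C2_on (\<Omega> \<times> {0<..}) \<phi> \<and>
           (\<forall>z\<in>\<Omega> \<times> {0<..}. u z - \<phi> z \<le> u (x, t) - \<phi> (x, t)) \<longrightarrow>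
         deriv (\<lambda>s. \<phi> (x, s)) t
           \<le> upper_env (game_F p) (grad (\<lambda>z. \<phi> (z, t)) x) (hessian (\<lambda>z. \<phi> (z, t)) x))"

text \<open>Since the equation is odd, \<open>- u\<close> is a solution together with \<open>u\<close>. Thus lower bounds for \<open>u\<close>
  are upper bounds for the subsolution \<open>- u\<close>, and one comparison principle, for subsolutions and
  classical strict supersolutions, is enough.\<close>

lemma viscosity_solution_subsolutions:
  fixes \<Omega> :: "(real^'n) set"
  assumes "viscosity_solution p \<Omega> u" "open \<Omega>"
  shows "viscosity_subsolution p \<Omega> u" "viscosity_subsolution p \<Omega> (\<lambda>z. - u z)"
proof -
  show "viscosity_subsolution p \<Omega> u"
    using assms(1) unfolding viscosity_solution_def viscosity_subsolution_def by simp
  have "deriv (\<lambda>s. \<phi> (x, s)) t \<le> upper_env (game_F p) (grad (\<lambda>z. \<phi> (z, t)) x) (hessian (\<lambda>z. \<phi> (z, t)) x)"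
    if x: "x \<in> \<Omega>" "t > 0" and c: "C2_on (\<Omega> \<times> {0<..}) \<phi>"
      and m: "\<And>z. z \<in> \<Omega> \<times> {0<..} \<Longrightarrow> - u z - \<phi> z \<le> - u (x, t) - \<phi> (x, t)" for x t \<phi>
  proof -
    obtain \<tau> \<xi> X where j: "has_jet (\<lambda>z. \<phi> (z, t)) x \<xi> X" and d: "((\<lambda>s. \<phi> (x, s)) has_real_derivative \<tau>) (at t)"
      using has_jet_slice[OF c assms(2) x] by blast
    have "\<forall>z\<in>\<Omega> \<times> {0<..}. u z - (- \<phi> z) \<ge> u (x, t) - (- \<phi> (x, t))" using m by force
    with assms(1) x C2_on_minus[OF c]
    have "deriv (\<lambda>s. - \<phi> (x, s)) t - lower_env (game_F p) (grad (\<lambda>z. - \<phi> (z, t)) x) (hessian (\<lambda>z. - \<phi> (z, t)) x) \<ge> 0"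
      unfolding viscosity_solution_def by blast
    moreover have "deriv (\<lambda>s. - \<phi> (x, s)) t = - \<tau>"
      by (rule DERIV_imp_deriv[OF DERIV_minus[OF d]])
    ultimately show ?thesis
      using has_jet_grad_hessian[OF j] has_jet_grad_hessian[OF has_jet_minus[OF j]]
      by (simp add: lower_env_game_F_uminus DERIV_imp_deriv[OF d])
  qed
  then show "viscosity_subsolution p \<Omega> (\<lambda>z. - u z)"
    using assms(1) unfolding viscosity_solution_def viscosity_subsolution_def
    by (auto intro!: continuous_on_minus)
qed

text \<open>The superlevel set of \<open>\<Phi>\<close> through a point is closed if \<open>\<Phi>\<close> drops below that level near every
  boundary point that is missing from \<open>D\<close>. Being bounded it is then compact, and a maximum on it
  is one on \<open>D\<close>.\<close>

lemma max_attained_if_boundary_excluded: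
  fixes \<Phi> :: "'a::euclidean_space \<Rightarrow> real"
  assumes "bounded D" "continuous_on D \<Phi>" "z1 \<in> D"
    and bd: "\<And>z0. z0 \<in> closure D - D \<Longrightarrow> \<forall>\<^sub>F z in at z0 within D. \<Phi> z < \<Phi> z1"
  obtains z0 where "z0 \<in> D" "\<And>z. z \<in> D \<Longrightarrow> \<Phi> z \<le> \<Phi> z0"
proof -
  define S where "S = {z \<in> D. \<Phi> z1 \<le> \<Phi> z}"
  have "closed S"
    unfolding closed_sequential_limits
  proof (intro allI impI, elim conjE)
    fix f l assume f: "\<forall>n. f n \<in> S" and l: "f \<longlonglongrightarrow> l"
    have fD: "\<And>n. f n \<in> D" and fz: "\<And>n. \<Phi> z1 \<le> \<Phi> (f n)" using f by (auto simp: S_def)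
    have lc: "l \<in> closure D" using fD l closure_sequential by blast
    have "l \<in> D"
    proof (rule ccontr)
      assume "l \<notin> D"
      then have "\<forall>\<^sub>F z in at l within D. \<Phi> z < \<Phi> z1" using bd lc by blast
      moreover have "filterlim f (at l within D) sequentially"
        unfolding filterlim_at using l fD \<open>l \<notin> D\<close> by (auto intro!: always_eventually)
      ultimately have "\<forall>\<^sub>F n in sequentially. \<Phi> (f n) < \<Phi> z1" by (rule eventually_compose_filterlim)
      then obtain n where "\<Phi> (f n) < \<Phi> z1" by (auto simp: eventually_sequentially)
      then show False using fz[of n] by simp
    qed
    moreover have "(\<lambda>n. \<Phi> (f n)) \<longlonglongrightarrow> \<Phi> l"
      using continuous_on_tendsto_compose[OF assms(2) l \<open>l \<in> D\<close>] fD by simp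
    then have "\<Phi> z1 \<le> \<Phi> l" by (rule LIMSEQ_le_const) (use fz in auto)
    ultimately show "l \<in> S" by (simp add: S_def)
  qed
  moreover have "bounded S" using bounded_subset[OF \<open>bounded D\<close>] by (auto simp: S_def)
  ultimately have "compact S" by (simp add: compact_eq_bounded_closed)
  moreover have "continuous_on S \<Phi>" using continuous_on_subset[OF assms(2)] by (auto simp: S_def)
  moreover have "z1 \<in> S" using assms(3) by (simp add: S_def)
  ultimately obtain z0 where z0: "z0 \<in> S" "\<forall>z\<in>S. \<Phi> z \<le> \<Phi> z0"
    using continuous_attains_sup[of S \<Phi>] by blast
  show ?thesis
  proof (rule that)
    show "z0 \<in> D" using z0 by (simp add: S_def)
    fix z assume "z \<in> D"
    then show "\<Phi> z \<le> \<Phi> z0" using z0 \<open>z1 \<in> S\<close> by (cases "z \<in> S") (force simp: S_def)+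
  qed
qed

text \<open>A classical notion: the barriers below are smooth, and only their values and derivatives at
  one point matter. The upper envelope is the one against which subsolutions are tested.\<close>

definition strict_supersolution_at ::
  "ereal \<Rightarrow> ((real^'n) \<times> real \<Rightarrow> real) \<Rightarrow> real^'n \<Rightarrow> real \<Rightarrow> bool" where
  "strict_supersolution_at p w z t \<longleftrightarrow> (\<exists>\<tau> \<xi> X. ((\<lambda>s. w (z, s)) has_real_derivative \<tau>) (at t) \<and>
     has_jet (\<lambda>z. w (z, t)) z \<xi> X \<and> upper_env (game_F p) \<xi> X < \<tau>)"

text \<open>In the definition of a subsolution the test function touches from above on all of the domain.
  A large multiple of the fourth power of the distance to \<open>(x, t)\<close> turns a local maximum into
  such a global one, and it changes neither the time derivative nor the jet at \<open>(x, t)\<close>.\<close>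

lemma subsolution_no_local_touching:
  fixes \<Omega> :: "(real^'n) set"
  assumes sub: "viscosity_subsolution p \<Omega> U" and "open \<Omega>"
    and UM: "\<And>z. z \<in> \<Omega> \<times> {0<..} \<Longrightarrow> U z \<le> M"
    and C2: "C2_on (\<Omega> \<times> {0<..}) w" and wB: "\<And>z. z \<in> \<Omega> \<times> {0<..} \<Longrightarrow> - B \<le> w z"
    and x: "x \<in> \<Omega>" "t > 0" and "\<rho> > 0"
    and max: "\<And>z. z \<in> ball (x, t) \<rho> \<Longrightarrow> z \<in> \<Omega> \<times> {0<..} \<Longrightarrow> U z - w z \<le> U (x, t) - w (x, t)"
  shows "\<not> strict_supersolution_at p w x t"
proof
  assume "strict_supersolution_at p w x t"
  then obtain \<tau> \<xi> X where d: "((\<lambda>s. w (x, s)) has_real_derivative \<tau>) (at t)"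
    and j: "has_jet (\<lambda>z. w (z, t)) x \<xi> X" and lt: "upper_env (game_F p) \<xi> X < \<tau>"
    unfolding strict_supersolution_at_def by blast
  define m where "m = U (x, t) - w (x, t)"
  define K where "K = max 0 ((M + B - m) / \<rho>^4)"
  define Q where "Q z = ((norm (fst z - x))\<^sup>2 + (snd z - t)\<^sup>2)\<^sup>2" for z :: "(real^'n) \<times> real"
  define \<phi> where "\<phi> z = w z + K * Q z" for z
  have C2Q: "C2_on (\<Omega> \<times> {0<..}) Q"
    unfolding Q_def
    by (intro C2_on_power2 C2_on_add C2_on_diff C2_on_snd C2_on_const C2_on_fst C2_on_norm2)
  have "C2_on (\<Omega> \<times> {0<..}) \<phi>" unfolding \<phi>_def by (intro C2_on_add C2 C2_on_cmult C2Q)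
  moreover have "U z - \<phi> z \<le> U (x, t) - \<phi> (x, t)" if z: "z \<in> \<Omega> \<times> {0<..}" for z
  proof (cases "z \<in> ball (x, t) \<rho>")
    case True
    have "0 \<le> K * Q z" by (simp add: K_def Q_def)
    then show ?thesis using max[OF True z] by (simp add: \<phi>_def Q_def)
  next
    case False
    have "(norm (fst z - x))\<^sup>2 + (snd z - t)\<^sup>2 = (dist z (x, t))\<^sup>2"
      by (cases z) (simp only: dist_Pair_Pair fst_conv snd_conv, simp add: dist_norm)
    also have "\<dots> \<ge> \<rho>\<^sup>2" using False \<open>\<rho> > 0\<close> by (intro power_mono) (auto simp: dist_commute)
    finally have "(\<rho>\<^sup>2)\<^sup>2 \<le> Q z" unfolding Q_def by (intro power_mono) auto
    then have "\<rho>^4 \<le> Q z" by simp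
    then have "K * \<rho>^4 \<le> K * Q z" by (intro mult_left_mono) (auto simp: K_def)
    moreover have "M + B - m \<le> K * \<rho>^4"
    proof -
      have "((M + B - m) / \<rho>^4) * \<rho>^4 \<le> K * \<rho>^4" unfolding K_def by (intro mult_right_mono) auto
      then show ?thesis using \<open>\<rho> > 0\<close> by simp
    qed
    moreover have "Q (x, t) = 0" by (simp add: Q_def)
    ultimately show ?thesis using UM[OF z] wB[OF z] by (simp add: \<phi>_def m_def)
  qed
  ultimately have le: "deriv (\<lambda>s. \<phi> (x, s)) t \<le> upper_env (game_F p) (grad (\<lambda>z. \<phi> (z, t)) x) (hessian (\<lambda>z. \<phi> (z, t)) x)"
    using sub x unfolding viscosity_subsolution_def by blast
  have "((\<lambda>s. \<phi> (x, s)) has_real_derivative \<tau>) (at t)"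
    unfolding \<phi>_def Q_def by (rule derivative_eq_intros d refl | simp)+
  then have "deriv (\<lambda>s. \<phi> (x, s)) t = \<tau>" by (rule DERIV_imp_deriv)
  moreover have j2: "has_jet (\<lambda>z. \<phi> (z, t)) x \<xi> X"
  proof -
    have "has_jet (\<lambda>z. ((norm (z - x))\<^sup>2)\<^sup>2) x 0 0"
    proof -
      have d: "((\<lambda>r. r\<^sup>2) has_real_derivative 2 * r) (at r)" "((\<lambda>r. 2 * r) has_real_derivative 2) (at r)" for r :: real
        by (auto intro!: derivative_eq_intros)
      have "outer (0::real^'n) = 0" by (simp add: outer_def vec_eq_iff)
      then show ?thesis
        using has_jet_compose[OF has_jet_norm2[of x x] d] by simp
    qed
    then have "has_jet (\<lambda>z. w (z, t) + K * ((norm (z - x))\<^sup>2)\<^sup>2) x (\<xi> + K *\<^sub>R 0) (X + K *\<^sub>R 0)"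
      by (intro has_jet_add j has_jet_cmult)
    then show ?thesis by (simp add: \<phi>_def Q_def)
  qed
  ultimately show False using le lt has_jet_grad_hessian[OF j2] by simp
qed

text \<open>Suppose that \<open>U\<close> exceeds \<open>w\<close> at \<open>(z, t)\<close>. Subtract a penalty that is half of the excess at
  time \<open>t\<close> but larger than \<open>M + B\<close>, a bound for \<open>U - w\<close>, at time \<open>T\<close>. Then the difference
  attains a maximum inside the cylinder. The penalty increases in time and is constant in space,
  so that adding it to \<open>w\<close> preserves strict supersolutions; this contradicts the maximum. The
  boundary condition is a comparison near each point of the bottom and of the lateral boundary,
  because \<open>U\<close> need not extend there.\<close>

lemma comparison:
  fixes \<Omega> D :: "(real^'n) set"
  assumes sub: "viscosity_subsolution p \<Omega> U" and "open \<Omega>" "open D" "D \<subseteq> \<Omega>" "bounded D" "T > 0"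
    and UM: "\<And>z. z \<in> \<Omega> \<times> {0<..} \<Longrightarrow> U z \<le> M"
    and C2: "C2_on (\<Omega> \<times> {0<..}) w" and wB: "\<And>z. z \<in> \<Omega> \<times> {0<..} \<Longrightarrow> - B \<le> w z"
    and super: "\<And>z t. z \<in> D \<Longrightarrow> 0 < t \<Longrightarrow> t < T \<Longrightarrow> strict_supersolution_at p w z t"
    and bd: "\<And>z0 t0. z0 \<in> closure D \<Longrightarrow> 0 \<le> t0 \<Longrightarrow> t0 \<le> T \<Longrightarrow> z0 \<notin> D \<or> t0 = 0 \<Longrightarrow>
       \<forall>\<^sub>F z in at (z0, t0) within D \<times> {0<..<T}. U z \<le> w z"
    and z: "z \<in> D" "0 < t" "t < T"
  shows "U (z, t) \<le> w (z, t)"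
proof (rule ccontr)
  assume "\<not> ?thesis"
  then have gt: "w (z, t) < U (z, t)" by simp
  define lam where "lam = (U (z, t) - w (z, t)) / 2"
  have lam: "lam > 0" using gt by (simp add: lam_def)
  define k where "k = max 0 (ln ((\<bar>M\<bar> + \<bar>B\<bar> + 1) / lam) / (T - t))"
  \<comment> \<open>The rate makes the penalty at time \<open>T\<close> larger than the bound \<open>M + B\<close> for \<open>U - w\<close>.\<close>
  define pen where "pen s = lam * exp (k * (s - t))" for s
  have pen_pos: "pen s > 0" for s using lam by (simp add: pen_def)
  have k0: "k \<ge> 0" by (simp add: k_def)
  have penT: "pen T \<ge> \<bar>M\<bar> + \<bar>B\<bar> + 1"
  proof -
    have "ln ((\<bar>M\<bar> + \<bar>B\<bar> + 1) / lam) / (T - t) * (T - t) \<le> k * (T - t)"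
      unfolding k_def by (intro mult_right_mono) (use z in auto)
    then have "ln ((\<bar>M\<bar> + \<bar>B\<bar> + 1) / lam) \<le> k * (T - t)" using z by simp
    then have "exp (ln ((\<bar>M\<bar> + \<bar>B\<bar> + 1) / lam)) \<le> exp (k * (T - t))" by simp
    then have "(\<bar>M\<bar> + \<bar>B\<bar> + 1) / lam \<le> exp (k * (T - t))"
      using lam by (subst (asm) exp_ln) auto
    then show ?thesis using lam by (simp add: pen_def field_simps)
  qed
  define v where "v z = w z + pen (snd z)" for z :: "(real^'n) \<times> real"
  define \<Phi> where "\<Phi> z = U z - v z" for z
  let ?Q = "D \<times> {0<..<T}"
  have Qsub: "?Q \<subseteq> \<Omega> \<times> {0<..}" using \<open>D \<subseteq> \<Omega>\<close> by auto
  have C2v: "C2_on (\<Omega> \<times> {0<..}) v"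
    unfolding v_def pen_def
    by (intro C2_on_add C2 C2_on_cmult C2_on_exp C2_on_diff C2_on_snd C2_on_const)
  have cw: "continuous_on ?Q v"
    using C2v Qsub unfolding C2_on_def
    by (meson continuous_at_imp_continuous_on has_derivative_continuous subsetD)
  have cPhi: "continuous_on ?Q \<Phi>"
    unfolding \<Phi>_def using sub Qsub cw continuous_on_subset
    by (auto simp: viscosity_subsolution_def intro!: continuous_on_diff)
  have z1: "(z, t) \<in> ?Q" using z by simp
  have pos: "\<Phi> (z, t) > 0" using gt by (simp add: \<Phi>_def v_def pen_def lam_def field_simps)
  have "bounded ?Q" using \<open>bounded D\<close> by (intro bounded_Times) auto
  moreover have "\<forall>\<^sub>F z' in at z0 within ?Q. \<Phi> z' < \<Phi> (z, t)" if z0: "z0 \<in> closure ?Q - ?Q" for z0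
  proof -
    obtain x0 t0 where xt: "z0 = (x0, t0)" by fastforce
    have clo: "x0 \<in> closure D" "0 \<le> t0" "t0 \<le> T"
      using z0 \<open>T > 0\<close> by (auto simp: closure_Times xt)
    show "\<forall>\<^sub>F z' in at z0 within ?Q. \<Phi> z' < \<Phi> (z, t)"
    proof (cases "x0 \<notin> D \<or> t0 = 0")
      case True
      from bd[OF clo True] show ?thesis
        unfolding xt
      proof eventually_elim
        case (elim z')
        then show ?case using pos pen_pos[of "snd z'"] unfolding \<Phi>_def v_def by linarith
      qed
    next
      case False
      then have "t0 = T" using z0 clo by (auto simp: xt)
      have "((\<lambda>z. pen (snd z)) \<longlongrightarrow> pen t0) (at z0 within ?Q)"
        unfolding pen_def xt by (intro tendsto_eq_intros refl | simp)+
      then have "\<forall>\<^sub>F z in at z0 within ?Q. pen (snd z) > \<bar>M\<bar> + \<bar>B\<bar>"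
        by (rule order_tendstoD) (use penT in \<open>simp add: \<open>t0 = T\<close>\<close>)
      moreover have "\<forall>\<^sub>F z in at z0 within ?Q. z \<in> ?Q" by (auto simp: eventually_at_filter)
      ultimately show ?thesis
      proof eventually_elim
        case (elim z')
        then have "U z' \<le> M" "- B \<le> w z'" using UM wB Qsub by auto
        with elim pos show ?case unfolding \<Phi>_def v_def by linarith
      qed
    qed
  qed
  ultimately obtain z0 where z0: "z0 \<in> ?Q" "\<And>z. z \<in> ?Q \<Longrightarrow> \<Phi> z \<le> \<Phi> z0"
    using max_attained_if_boundary_excluded[OF _ cPhi z1] by blast
  obtain x0 t0 where xt: "z0 = (x0, t0)" by fastforce
  have "open ?Q" using \<open>open D\<close> by (intro open_Times) auto
  then obtain \<rho> where \<rho>: "\<rho> > 0" "ball z0 \<rho> \<subseteq> ?Q" using z0(1) open_contains_ball by blast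
  have x0: "x0 \<in> D" "0 < t0" "t0 < T" using z0(1) xt by auto
  have "\<not> strict_supersolution_at p v x0 t0"
  proof (rule subsolution_no_local_touching[OF sub \<open>open \<Omega>\<close> UM C2v _ _ _ \<rho>(1)])
    show "- B \<le> v z" if "z \<in> \<Omega> \<times> {0<..}" for z
      using wB[OF that] pen_pos[of "snd z"] by (simp add: v_def)
    show "U z - v z \<le> U (x0, t0) - v (x0, t0)" if "z \<in> ball (x0, t0) \<rho>" for z
      using z0(2)[of z] \<rho> that xt by (auto simp: \<Phi>_def)
  qed (use x0 \<open>D \<subseteq> \<Omega>\<close> in auto)
  moreover have "strict_supersolution_at p v x0 t0"
  proof -
    obtain \<tau> \<xi> X where d: "((\<lambda>s. w (x0, s)) has_real_derivative \<tau>) (at t0)"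
      and j: "has_jet (\<lambda>z. w (z, t0)) x0 \<xi> X" and lt: "upper_env (game_F p) \<xi> X < \<tau>"
      using super[OF x0] unfolding strict_supersolution_at_def by blast
    have "((\<lambda>s. v (x0, s)) has_real_derivative (\<tau> + k * pen t0)) (at t0)"
      unfolding v_def pen_def by (rule derivative_eq_intros d refl | simp)+
    moreover have "has_jet (\<lambda>z. v (z, t0)) x0 \<xi> X"
      using has_jet_add[OF j has_jet_const[of "pen t0"]] by (simp add: v_def)
    moreover have "k * pen t0 \<ge> 0" using k0 pen_pos[of t0] by simp
    ultimately show ?thesis unfolding strict_supersolution_at_def using lt
      by (intro exI[of _ "\<tau> + k * pen t0"] exI[of _ \<xi>] exI[of _ X]) auto
  qed
  ultimately show False by simp
qed

section \<open>Exponential decay in the interior\<close>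

lemma norm_outer: "norm (outer k) = (norm k)\<^sup>2"
proof -
  have "outer k $ i = k $ i *\<^sub>R k" for i by (simp add: outer_def vec_eq_iff)
  then have "norm (outer k) = L2_set (\<lambda>i. \<bar>k $ i\<bar> * norm k) UNIV"
    by (simp add: norm_vec_def[of "outer k"])
  also have "\<dots> = L2_set (\<lambda>i. norm (k $ i)) UNIV * norm k"
    by (subst L2_set_left_distrib) auto
  finally show ?thesis by (simp add: norm_vec_def[of k] power2_eq_square)
qed

text \<open>On the ball of radius \<open>d\<close> about \<open>z\<close> the solution lies below the barrier
  \<open>M exp (\<theta> (|y - z|\<^sup>2 - d\<^sup>2) + b s)\<close>, which is at least \<open>M\<close> on the sphere and positive
  initially. Its gradient vanishes at the centre, but the crude bound for the envelope is good
  enough: with \<open>\<theta>\<close> of order \<open>1 / T\<close> the growth rate \<open>b\<close> consumes, up to a constant, only half of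
  the gain \<open>\<theta> d\<^sup>2\<close> at the centre. The constants must not depend on the point, so domain,
  subsolution and ball are quantified after them.\<close>

lemma interior_decay:
  fixes p :: ereal
  assumes "1 < p"
  obtains C c where "C > 0" "c > 0"
    "\<And>(\<Omega>::(real^'n) set) U M z d T. open \<Omega> \<Longrightarrow> viscosity_subsolution p \<Omega> U \<Longrightarrow> M > 0 \<Longrightarrow>
      (\<And>z. z \<in> \<Omega> \<times> {0<..} \<Longrightarrow> U z \<le> M) \<Longrightarrow>
      (\<And>z0. z0 \<in> \<Omega> \<Longrightarrow> (U \<longlongrightarrow> 0) (at (z0, 0) within \<Omega> \<times> {0<..})) \<Longrightarrow>
      cball z d \<subseteq> \<Omega> \<Longrightarrow> d > 0 \<Longrightarrow> T > 0 \<Longrightarrow> U (z, T) \<le> C * M * exp (- c * d\<^sup>2 / T)"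
proof -
  define N where "N = real CARD('n) + 1"
  define S where "S = norm (mat 1 :: real^'n^'n)"
  have N: "N > 0" by (simp add: N_def)
  have "U (z, T) \<le> exp (S / 4 + 1) * M * exp (- (1 / (16 * N)) * d\<^sup>2 / T)"
    if "open \<Omega>" and sub: "viscosity_subsolution p \<Omega> U" and M: "M > 0"
      and UM: "\<And>z. z \<in> \<Omega> \<times> {0<..} \<Longrightarrow> U z \<le> M"
      and U0: "\<And>z0. z0 \<in> \<Omega> \<Longrightarrow> (U \<longlongrightarrow> 0) (at (z0, 0) within \<Omega> \<times> {0<..})"
      and cb: "cball z d \<subseteq> \<Omega>" and d: "d > 0" and T: "T > 0"
    for \<Omega> :: "(real^'n) set" and U M z d T
  proof -
    \<comment> \<open>With this choice \<open>N * 4 \<theta>\<^sup>2 d\<^sup>2 * T\<close>, the main part of \<open>b T\<close>, is \<open>\<theta> d\<^sup>2 / 2\<close>.\<close>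
    define \<theta> where "\<theta> = 1 / (8 * N * T)"
    define b where "b = N * (4 * \<theta>\<^sup>2 * d\<^sup>2 + 2 * \<theta> * S) + 1 / T"
    define w where "w y = M * exp (\<theta> * ((norm (fst y - z))\<^sup>2 - d\<^sup>2) + b * snd y)" for y :: "(real^'n) \<times> real"
    have th: "\<theta> > 0" using N T by (simp add: \<theta>_def)
    have S: "S \<ge> 0" by (simp add: S_def)
    have b: "b > 0" using N th S T by (auto simp: b_def intro!: add_nonneg_pos mult_nonneg_nonneg add_nonneg_nonneg)
    have wpos: "w y > 0" for y using M by (simp add: w_def)
    have cw: "(w \<longlongrightarrow> w y) (at y within A)" for y A
      unfolding w_def by (intro tendsto_intros)
    have "U (z, T) \<le> w (z, T)"
    \<comment> \<open>A time horizon beyond \<open>T\<close>, since comparison holds strictly before the final time.\<close>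
    proof (rule comparison[OF sub \<open>open \<Omega>\<close>, of "ball z d" "2 * T" M w 0])
      show "C2_on (\<Omega> \<times> {0<..}) w"
        unfolding w_def by (intro C2_on_cmult C2_on_exp C2_on_add C2_on_diff C2_on_fst C2_on_norm2 C2_on_const C2_on_snd)
      show "- 0 \<le> w y" for y using wpos[of y] by simp
      show "strict_supersolution_at p w y t" if y: "y \<in> ball z d" and t: "0 < t" for y t
      proof -
        let ?W = "w (y, t)"
        have 1: "((\<lambda>s. w (y, s)) has_real_derivative b * ?W) (at t)"
          unfolding w_def by (rule derivative_eq_intros refl | simp)+
        have 2: "has_jet (\<lambda>x. w (x, t)) y ((\<theta> * ?W) *\<^sub>R (2 *\<^sub>R (y - z)))
             ((\<theta>\<^sup>2 * ?W) *\<^sub>R outer (2 *\<^sub>R (y - z)) + (\<theta> * ?W) *\<^sub>R (2 *\<^sub>R mat 1))"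
        proof -
          have d: "((\<lambda>r. M * exp (\<theta> * (r - d\<^sup>2) + b * t)) has_real_derivative
              \<theta> * (M * exp (\<theta> * (r - d\<^sup>2) + b * t))) (at r)"
            "((\<lambda>r. \<theta> * (M * exp (\<theta> * (r - d\<^sup>2) + b * t))) has_real_derivative
              \<theta>\<^sup>2 * (M * exp (\<theta> * (r - d\<^sup>2) + b * t))) (at r)" for r
            by (rule derivative_eq_intros refl | simp add: power2_eq_square)+
          show ?thesis using has_jet_compose[OF has_jet_norm2[of z y] d] by (simp add: w_def)
        qed
        let ?X = "(\<theta>\<^sup>2 * ?W) *\<^sub>R outer (2 *\<^sub>R (y - z)) + (\<theta> * ?W) *\<^sub>R (2 *\<^sub>R (mat 1 :: real^'n^'n))"
        have tr: "transpose ?X = ?X"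
          by (auto simp: transpose_def vec_eq_iff outer_def mat_def)
        have "norm ?X \<le> (\<theta>\<^sup>2 * ?W) * (2 * norm (y - z))\<^sup>2 + (\<theta> * ?W) * (2 * S)"
          by (rule order_trans[OF norm_triangle_ineq]) (use th wpos[of "(y,t)"] in \<open>simp add: norm_outer S_def\<close>)
        also have "\<dots> \<le> (\<theta>\<^sup>2 * ?W) * (2 * d)\<^sup>2 + (\<theta> * ?W) * (2 * S)"
          using y th wpos[of "(y,t)"] by (intro add_right_mono mult_left_mono power_mono) (auto simp: dist_norm norm_minus_commute)
        also have "\<dots> = (4 * \<theta>\<^sup>2 * d\<^sup>2 + 2 * \<theta> * S) * ?W" by (simp add: power2_eq_square algebra_simps)
        finally have "N * norm ?X \<le> N * ((4 * \<theta>\<^sup>2 * d\<^sup>2 + 2 * \<theta> * S) * ?W)" using N by simp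
        also have "\<dots> = (b - 1 / T) * ?W" by (simp add: b_def)
        also have "\<dots> < b * ?W" using wpos[of "(y,t)"] T by simp
        finally have "upper_env (game_F p) ((\<theta> * ?W) *\<^sub>R (2 *\<^sub>R (y - z))) ?X < b * ?W"
          using upper_env_le_norm[OF assms tr] unfolding N_def by (rule le_less_trans[rotated])
        with 1 2 show ?thesis unfolding strict_supersolution_at_def by blast
      qed
      show "\<forall>\<^sub>F y in at (z0, t0) within ball z d \<times> {0<..<2 * T}. U y \<le> w y"
        if z0: "z0 \<in> closure (ball z d)" and t0: "0 \<le> t0" and bd: "z0 \<notin> ball z d \<or> t0 = 0" for z0 t0
      proof (cases "t0 = 0")
        case True
        have "z0 \<in> \<Omega>" using z0 cb d by auto
        have "(U \<longlongrightarrow> 0) (at (z0, 0) within ball z d \<times> {0<..<2 * T})"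
          by (rule tendsto_within_subset[OF U0[OF \<open>z0 \<in> \<Omega>\<close>]]) (use cb ball_subset_cball in auto)
        then have "\<forall>\<^sub>F y in at (z0, 0) within ball z d \<times> {0<..<2 * T}. 0 < w y - U y"
          by (intro order_tendstoD(1)[OF tendsto_diff[OF cw]]) (use wpos in auto)
        then show ?thesis unfolding True by eventually_elim simp
      next
        case False
        then have "norm (z0 - z) = d" using z0 bd d by (auto simp: dist_norm norm_minus_commute)
        then have "w (z0, t0) > M" using M b t0 False by (simp add: w_def)
        then have "\<forall>\<^sub>F y in at (z0, t0) within ball z d \<times> {0<..<2 * T}. M < w y"
          by (intro order_tendstoD(1)[OF cw])
        moreover have "\<forall>\<^sub>F y in at (z0, t0) within ball z d \<times> {0<..<2 * T}. y \<in> ball z d \<times> {0<..<2 * T}"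
          by (auto simp: eventually_at_filter)
        ultimately show ?thesis
        proof eventually_elim
          case (elim y)
          then have "y \<in> \<Omega> \<times> {0<..}" using cb ball_subset_cball by fastforce
          then show ?case using UM elim by fastforce
        qed
      qed
    qed (use d T cb ball_subset_cball UM in auto)
    also have "w (z, T) = M * exp (- (1 / (16 * N)) * d\<^sup>2 / T + (S / 4 + 1))"
    proof -
      have "\<theta> * (- d\<^sup>2) + b * T = - (1 / (16 * N)) * d\<^sup>2 / T + (S / 4 + 1)"
        using N T by (simp add: b_def \<theta>_def field_simps power2_eq_square)
      then show ?thesis by (simp add: w_def)
    qed
    also have "\<dots> = exp (S / 4 + 1) * M * exp (- (1 / (16 * N)) * d\<^sup>2 / T)"
      by (simp only: exp_add mult.commute mult.left_commute)
    finally show ?thesis .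
  qed
  then show ?thesis using N by (intro that[of "exp (S / 4 + 1)" "1 / (16 * N)"]) auto
qed

section \<open>The complementary error function\<close>

lemma set_integrable_gauss:
  assumes "A \<in> sets borel" shows "set_integrable lborel A (\<lambda>\<tau>::real. exp (- \<tau>\<^sup>2))"
proof -
  have pos: "set_integrable lborel {0..} (\<lambda>\<tau>::real. exp (- \<tau>\<^sup>2))"
    using gaussian_moment_0 by (simp add: set_integrable_def has_bochner_integral_iff)
  have "integrable lborel (\<lambda>x. indicator {0..} (0 + (-1) * x) *\<^sub>R exp (- (0 + (-1) * x)\<^sup>2) :: real)"
    using lborel_integrable_real_affine[OF pos[unfolded set_integrable_def], of "-1" 0] by simp
  then have neg: "set_integrable lborel {..0} (\<lambda>\<tau>::real. exp (- \<tau>\<^sup>2))"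
    unfolding set_integrable_def by (rule Bochner_Integration.integrable_cong[THEN iffD1, rotated -1]) (auto simp: indicator_def)
  have "set_integrable lborel ({..0} \<union> {0..}) (\<lambda>\<tau>::real. exp (- \<tau>\<^sup>2))"
    by (rule set_integrable_Un[OF neg pos]) auto
  moreover have "{..0} \<union> {0..} = (UNIV :: real set)" by auto
  ultimately show ?thesis using set_integrable_subset[of lborel UNIV _ A] assms by simp
qed

lemma Erfc_0: "Erfc 0 = 1"
  using gaussian_moment_0 by (simp add: Erfc_def set_lebesgue_integral_def has_bochner_integral_iff)

lemma Erfc_nonneg: "0 \<le> Erfc \<sigma>"
  unfolding Erfc_def set_lebesgue_integral_def by (intro mult_nonneg_nonneg integral_nonneg_AE) auto

lemma Erfc_diff:
  assumes "a \<le> b" shows "Erfc a = 2 / sqrt pi * integral {a..b} (\<lambda>\<tau>. exp (- \<tau>\<^sup>2)) + Erfc b"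
proof -
  have "(LBINT \<tau>:{a..}. exp (- \<tau>\<^sup>2)) = (LBINT \<tau>:{a..b} \<union> {b..}. exp (- \<tau>\<^sup>2))"
    using assms by (intro arg_cong2[where f="\<lambda>A. set_lebesgue_integral lborel A"]) auto
  also have "\<dots> = (LBINT \<tau>:{a..b}. exp (- \<tau>\<^sup>2)) + (LBINT \<tau>:{b..}. exp (- \<tau>\<^sup>2))"
  proof (rule set_integral_Un_AE)
    show "AE x in lborel. \<not> (x \<in> {a..b} \<and> x \<in> {b..})"
      using AE_lborel_singleton[of b] by eventually_elim auto
  qed (auto intro: set_integrable_gauss)
  also have "(LBINT \<tau>:{a..b}. exp (- \<tau>\<^sup>2)) = integral {a..b} (\<lambda>\<tau>. exp (- \<tau>\<^sup>2))"
    by (rule set_borel_integral_eq_integral) (rule set_integrable_gauss, simp)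
  finally show ?thesis by (simp add: Erfc_def distrib_left)
qed

lemma Erfc_has_real_derivative:
  "(Erfc has_real_derivative - (2 / sqrt pi * exp (- s\<^sup>2))) (at s)"
proof -
  have "((\<lambda>x. 2 / sqrt pi * integral {x..s+1} (\<lambda>\<tau>. exp (- \<tau>\<^sup>2)) + Erfc (s + 1))
      has_real_derivative - (2 / sqrt pi * exp (- s\<^sup>2))) (at s within {s-1..s+1})"
    by (rule derivative_eq_intros integral_has_real_derivative' continuous_intros refl | simp)+
  then have "(Erfc has_real_derivative - (2 / sqrt pi * exp (- s\<^sup>2))) (at s within {s-1..s+1})"
  proof (rule has_field_derivative_transform_within[where d=1])
    fix x assume "x \<in> {s - 1..s + 1}"
    then show "2 / sqrt pi * integral {x..s+1} (\<lambda>\<tau>. exp (- \<tau>\<^sup>2)) + Erfc (s + 1) = Erfc x"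
      using Erfc_diff[of x "s + 1"] by simp
  qed auto
  moreover have "at s within {s-1..s+1} = at s" by (rule at_within_interior) auto
  ultimately show ?thesis by simp
qed

lemma isCont_Erfc: "isCont Erfc s"
  using DERIV_isCont[OF Erfc_has_real_derivative] .

lemma Erfc_antimono: "a \<le> b \<Longrightarrow> Erfc b \<le> Erfc a"
  by (rule DERIV_nonpos_imp_nonincreasing[of a b]) (auto intro!: exI Erfc_has_real_derivative)

lemma Erfc_tendsto_0: "(Erfc \<longlongrightarrow> 0) at_top"
proof -
  have "((\<lambda>\<sigma>. LBINT \<tau>. indicator {\<sigma>..} \<tau> *\<^sub>R exp (- \<tau>\<^sup>2) :: real) \<longlongrightarrow> (LBINT \<tau>::real. 0 :: real)) at_top"
  proof (rule integral_dominated_convergence_at_top)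
    show "integrable lborel (\<lambda>\<tau>::real. exp (- \<tau>\<^sup>2))"
      using set_integrable_gauss[of UNIV] by (simp add: set_integrable_def)
    show "AE \<tau> in lborel. ((\<lambda>\<sigma>. indicator {\<sigma>..} \<tau> *\<^sub>R exp (- \<tau>\<^sup>2) :: real) \<longlongrightarrow> 0) at_top"
    proof (rule AE_I2)
      fix \<tau> :: real
      have "\<forall>\<^sub>F \<sigma> in at_top. indicator {\<sigma>..} \<tau> *\<^sub>R exp (- \<tau>\<^sup>2) = (0::real)"
        using eventually_gt_at_top[of \<tau>] by eventually_elim auto
      then show "((\<lambda>\<sigma>. indicator {\<sigma>..} \<tau> *\<^sub>R exp (- \<tau>\<^sup>2) :: real) \<longlongrightarrow> 0) at_top"
        by (rule tendsto_eventually)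
    qed
  qed (auto simp: indicator_def)
  then have "((\<lambda>\<sigma>. 2 / sqrt pi * (LBINT \<tau>. indicator {\<sigma>..} \<tau> *\<^sub>R exp (- \<tau>\<^sup>2))) \<longlongrightarrow> 2 / sqrt pi * (LBINT \<tau>::real. 0)) at_top"
    by (intro tendsto_mult tendsto_const)
  then show ?thesis by (simp add: Erfc_def[abs_def] set_lebesgue_integral_def)
qed

lemma Erfc_le_1: "0 \<le> s \<Longrightarrow> Erfc s \<le> 1"
  using Erfc_antimono[of 0 s] by (simp add: Erfc_0)

text \<open>Negative arguments occur because a barrier has to be bounded on the whole domain, whereas the
  height above the boundary graph is positive only near the touching point.\<close>

lemma Erfc_le_2: "Erfc s \<le> 2"
proof (cases "s \<ge> 0")
  case False
  define b where "b = - s"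
  have b: "b \<ge> 0" using False by (simp add: b_def)
  have "integral {-b..0} (\<lambda>\<tau>. exp (- \<tau>\<^sup>2)) = integral {0..b} (\<lambda>\<tau>. exp (- \<tau>\<^sup>2) :: real)"
    using Henstock_Kurzweil_Integration.integral_reflect_real[of b 0 "\<lambda>\<tau>. exp (- \<tau>\<^sup>2) :: real"] by simp
  then have "Erfc s + Erfc b = 2"
    using Erfc_diff[of "-b" 0] Erfc_diff[of 0 b] b by (simp add: Erfc_0 b_def)
  then show ?thesis using Erfc_nonneg[of b] by linarith
qed (use Erfc_le_1[of s] in linarith)

lemma Erfc_second_derivative:
  "((\<lambda>s. - (2 / sqrt pi * exp (- s\<^sup>2))) has_real_derivative 4 / sqrt pi * s * exp (- s\<^sup>2)) (at s)"
  by (rule derivative_eq_intros refl)+ simp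

lemma C2_on_Erfc:
  assumes "C2_on S (f :: 'a::real_normed_vector \<Rightarrow> real)"
  shows "C2_on S (\<lambda>x. Erfc (f x))"
proof (rule C2_on_compose_real[OF assms Erfc_has_real_derivative Erfc_second_derivative])
  show "continuous_on (f ` S) (\<lambda>s. 4 / sqrt pi * s * exp (- s\<^sup>2))" by (intro continuous_intros) auto
qed

section \<open>Barriers with two profiles\<close>

text \<open>For a unit vector \<open>k\<close> parallel to the gradient the value of the operator at \<open>outer k\<close> is
  \<open>1 / p + (1 - 2 / p) = 1 / p'\<close>, the diffusivity across the boundary layer. Deviations of
  relative size \<open>\<epsilon>\<close> from the direction \<open>\<nu>\<close> change it by \<open>O(\<epsilon>)\<close>. The gradient is compared with a
  multiple of \<open>\<nu>\<close>, of either sign, since the operator does not see its length or orientation.\<close>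

lemma game_F_outer_near:
  fixes \<nu> k \<xi> :: "real^'n"
  assumes "1 < p" and \<nu>: "norm \<nu> = 1" and \<epsilon>: "\<epsilon> \<le> 1/4" and k: "norm (k - \<nu>) \<le> \<epsilon>"
    and c: "c \<noteq> 0" and \<xi>: "norm (\<xi> - c *\<^sub>R \<nu>) \<le> \<epsilon> * \<bar>c\<bar>"
  shows "\<bar>game_F p \<xi> (outer k) - 1 / conj_exp p\<bar> \<le> 25 * \<epsilon>"
proof -
  note ip = inverse_exponent_bounds[OF \<open>1 < p\<close>]
  define i where "i = real_of_ereal (1 / p)"
  define \<zeta> where "\<zeta> = (1 / c) *\<^sub>R \<xi>"
  have \<epsilon>0: "\<epsilon> \<ge> 0" using k norm_ge_zero order_trans by blast
  have "\<zeta> - \<nu> = (1 / c) *\<^sub>R (\<xi> - c *\<^sub>R \<nu>)" using c by (simp add: \<zeta>_def scaleR_diff_right)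
  then have "norm (\<zeta> - \<nu>) = (1 / \<bar>c\<bar>) * norm (\<xi> - c *\<^sub>R \<nu>)" by simp
  also have "\<dots> \<le> \<epsilon>" using \<xi> c by (simp add: field_simps)
  finally have z: "norm (\<zeta> - \<nu>) \<le> \<epsilon>" .
  have \<nu>\<nu>: "\<nu> \<bullet> \<nu> = 1" using \<nu> by (simp add: dot_square_norm)
  have ineq: "\<bar>a \<bullet> b - 1\<bar> \<le> 9 / 4 * \<epsilon>" if "norm (a - \<nu>) \<le> \<epsilon>" "norm (b - \<nu>) \<le> \<epsilon>" for a b
  proof -
    have "a \<bullet> b - 1 = (a - \<nu>) \<bullet> \<nu> + \<nu> \<bullet> (b - \<nu>) + (a - \<nu>) \<bullet> (b - \<nu>)"
      using \<nu>\<nu> by (simp add: inner_diff_left inner_diff_right)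
    moreover have "\<bar>(a - \<nu>) \<bullet> \<nu>\<bar> \<le> \<epsilon>" "\<bar>\<nu> \<bullet> (b - \<nu>)\<bar> \<le> \<epsilon>"
      using Cauchy_Schwarz_ineq2[of "a - \<nu>" \<nu>] Cauchy_Schwarz_ineq2[of \<nu> "b - \<nu>"] that \<nu> by auto
    moreover have "\<bar>(a - \<nu>) \<bullet> (b - \<nu>)\<bar> \<le> 1/4 * \<epsilon>"
      using mult_mono[OF that(1)[THEN order_trans[OF _ \<epsilon>]] that(2)]
      by (intro order_trans[OF Cauchy_Schwarz_ineq2]) auto
    ultimately show ?thesis by linarith
  qed
  define a where "a = k \<bullet> \<zeta> - 1"
  define b where "b = \<zeta> \<bullet> \<zeta> - 1"
  define m where "m = k \<bullet> k - 1"
  have ab: "\<bar>a\<bar> \<le> 9/4*\<epsilon>" "\<bar>b\<bar> \<le> 9/4*\<epsilon>" "\<bar>m\<bar> \<le> 9/4*\<epsilon>"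
    unfolding a_def b_def m_def using ineq k z by auto
  have b1: "1 + b \<ge> 7/16" using ab \<epsilon> by linarith
  have "\<xi> = c *\<^sub>R \<zeta>" using c by (simp add: \<zeta>_def)
  then have "(outer k *v \<xi>) \<bullet> \<xi> = c\<^sup>2 * (1 + a)\<^sup>2" "(norm \<xi>)\<^sup>2 = c\<^sup>2 * (1 + b)"
    unfolding a_def b_def outer_mult power2_norm_eq_inner
    by (simp_all add: power2_eq_square)
  then have "((outer k *v \<xi>) \<bullet> \<xi>) / (norm \<xi>)\<^sup>2 = (c\<^sup>2 * (1 + a)\<^sup>2) / (c\<^sup>2 * (1 + b))"
    by simp
  also have "\<dots> = (1 + a)\<^sup>2 / (1 + b)" using c by simp
  finally have r: "((outer k *v \<xi>) \<bullet> \<xi>) / (norm \<xi>)\<^sup>2 = (1 + a)\<^sup>2 / (1 + b)" .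
  have aa: "\<bar>a * a\<bar> \<le> 9/16 * (9/4 * \<epsilon>)"
    unfolding abs_mult by (rule mult_mono) (use ab \<epsilon> \<epsilon>0 in auto)
  have "(1 + a)\<^sup>2 / (1 + b) - 1 = (2 * a + a * a - b) / (1 + b)"
    using b1 by (simp add: field_simps power2_eq_square)
  then have "\<bar>(1 + a)\<^sup>2 / (1 + b) - 1\<bar> = \<bar>2 * a + a * a - b\<bar> / (1 + b)" using b1 by simp
  also have "\<dots> \<le> \<bar>2 * a + a * a - b\<bar> / (7/16)" using b1 by (intro divide_left_mono) auto
  also have "\<dots> \<le> 20 * \<epsilon>"
  proof -
    have "\<bar>2 * a + a * a - b\<bar> \<le> 35 / 4 * \<epsilon>" using ab(1,2) aa \<epsilon>0 unfolding abs_le_iff by linarith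
    then show ?thesis by simp
  qed
  finally have q: "\<bar>(1 + a)\<^sup>2 / (1 + b) - 1\<bar> \<le> 20 * \<epsilon>" .
  have tr: "trace (outer k) = 1 + m" by (simp add: trace_outer m_def power2_norm_eq_inner)
  have "game_F p \<xi> (outer k) - 1 / conj_exp p = i * m + (1 - 2 * i) * ((1 + a)\<^sup>2 / (1 + b) - 1)"
    unfolding game_F_def r tr ip(3) i_def[symmetric] by (simp add: algebra_simps)
  also have "\<bar>\<dots>\<bar> \<le> 1 * (9/4*\<epsilon>) + 1 * (20*\<epsilon>)"
    by (rule order_trans[OF abs_triangle_ineq], unfold abs_mult, intro add_mono mult_mono)
      (use ip(1,2) ab q in \<open>auto simp: i_def[symmetric]\<close>)
  finally show ?thesis using \<epsilon>0 by linarith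
qed

text \<open>If the profiles \<open>P\<close> and \<open>E\<close> are monotone in the same sense and both \<open>h1\<close> and \<open>h2\<close> have
  gradients close to \<open>\<nu>\<close>, then the gradient of \<open>P \<circ> h1 + E \<circ> h2\<close> stays in a narrow cone about a
  line. There the operator is evaluated at one and the same gradient for all terms, hence
  linearly, and a strict supersolution is recognised by a scalar inequality: \<open>q1\<close> and \<open>q2\<close> stand
  for its values at the tensor squares, \<open>e1\<close> and \<open>e2\<close> for those at the Hessians of \<open>h1\<close> and
  \<open>h2\<close>.\<close>

lemma two_profile_strict_supersolution:
  fixes \<nu> :: "real^'n" and w :: "(real^'n) \<times> real \<Rightarrow> real"
  assumes "1 < p" and \<nu>: "norm \<nu> = 1" and \<epsilon>: "\<epsilon> \<le> 1/4"
    and h1: "has_jet h1 z k1 H1" "norm (k1 - \<nu>) \<le> \<epsilon>" "transpose H1 = H1"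
    and h2: "has_jet h2 z k2 H2" "norm (k2 - \<nu>) \<le> \<epsilon>" "transpose H2 = H2"
    and P: "\<And>r. (P has_real_derivative P' r) (at r)" "(P' has_real_derivative P2) (at (h1 z))"
    and E: "\<And>r. (E has_real_derivative E' r) (at r)" "(E' has_real_derivative E2) (at (h2 z))"
    and sgn: "s * P' (h1 z) \<ge> 0" "s * E' (h2 z) > 0" "\<bar>s\<bar> = 1"
    and w: "\<And>y. w (y, t) = P (h1 y) + E (h2 y)"
    and \<tau>: "((\<lambda>s. w (z, s)) has_real_derivative \<tau>) (at t)"
    and lt: "\<And>q1 e1 q2 e2. \<bar>q1 - 1 / conj_exp p\<bar> \<le> 25 * \<epsilon> \<Longrightarrow> \<bar>q2 - 1 / conj_exp p\<bar> \<le> 25 * \<epsilon> \<Longrightarrow>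
      \<bar>e1\<bar> \<le> (real CARD('n) + 1) * norm H1 \<Longrightarrow> \<bar>e2\<bar> \<le> (real CARD('n) + 1) * norm H2 \<Longrightarrow>
      P2 * q1 + P' (h1 z) * e1 + E2 * q2 + E' (h2 z) * e2 < \<tau>"
  shows "strict_supersolution_at p w z t"
proof -
  define a where "a = P' (h1 z)"
  define b where "b = E' (h2 z)"
  define \<xi> where "\<xi> = a *\<^sub>R k1 + b *\<^sub>R k2"
  define X where "X = (P2 *\<^sub>R outer k1 + a *\<^sub>R H1) + (E2 *\<^sub>R outer k2 + b *\<^sub>R H2)"
  have j: "has_jet (\<lambda>y. w (y, t)) z \<xi> X"
    unfolding w \<xi>_def X_def a_def b_def
    by (intro has_jet_add has_jet_compose h1 h2 P E)
  have tr: "transpose X = X"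
  proof -
    have "transpose (A + B) = transpose A + transpose B" "transpose (c *\<^sub>R A) = c *\<^sub>R transpose A"
      for A B :: "real^'n^'n" and c by (simp_all add: transpose_def vec_eq_iff)
    then show ?thesis by (simp add: X_def h1 h2)
  qed
  have abs: "\<bar>a + b\<bar> = \<bar>a\<bar> + \<bar>b\<bar>" "a + b \<noteq> 0"
    using sgn by (auto simp: a_def[symmetric] b_def[symmetric] abs_if split: if_splits)
  have "\<xi> - (a + b) *\<^sub>R \<nu> = a *\<^sub>R (k1 - \<nu>) + b *\<^sub>R (k2 - \<nu>)" by (simp add: \<xi>_def algebra_simps)
  then have "norm (\<xi> - (a + b) *\<^sub>R \<nu>) \<le> \<bar>a\<bar> * norm (k1 - \<nu>) + \<bar>b\<bar> * norm (k2 - \<nu>)"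
    by (metis norm_triangle_ineq norm_scaleR)
  also have "\<dots> \<le> \<bar>a\<bar> * \<epsilon> + \<bar>b\<bar> * \<epsilon>" by (intro add_mono mult_left_mono h1 h2) auto
  finally have n: "norm (\<xi> - (a + b) *\<^sub>R \<nu>) \<le> \<epsilon> * \<bar>a + b\<bar>" by (simp add: abs algebra_simps)
  have "\<xi> \<noteq> 0"
  proof
    assume "\<xi> = 0"
    then have "\<bar>a + b\<bar> \<le> \<epsilon> * \<bar>a + b\<bar>" using n \<nu> by simp
    then have "1 \<le> \<epsilon>" using abs(2) by simp
    then show False using \<epsilon> by simp
  qed
  have "game_F p \<xi> X = P2 * game_F p \<xi> (outer k1) + a * game_F p \<xi> H1 + E2 * game_F p \<xi> (outer k2) + b * game_F p \<xi> H2"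
    by (simp add: X_def game_F_linear)
  also have "\<dots> < \<tau>"
    unfolding a_def b_def
    by (intro lt game_F_outer_near[OF \<open>1 < p\<close> \<nu> \<epsilon> _ abs(2) n] h1 h2 abs_game_F_le[OF \<open>1 < p\<close>])
  finally have "upper_env (game_F p) \<xi> X < \<tau>"
    using upper_env_le_game_F[OF \<open>1 < p\<close> tr \<open>\<xi> \<noteq> 0\<close>] by simp
  with j \<tau> show ?thesis unfolding strict_supersolution_at_def by blast
qed

lemma exists_small_exp:
  assumes "c > 0" "e > 0" obtains T :: real where "T > 0" "T \<le> 1" "\<And>t. 0 < t \<Longrightarrow> t \<le> T \<Longrightarrow> C * exp (- c / t) < e"
proof -
  have "((\<lambda>t. C * exp (- c / t)) \<longlongrightarrow> 0) (at_right 0)"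
  proof -
    have "filterlim (\<lambda>t::real. c * inverse t) at_top (at_right 0)"
      by (rule filterlim_tendsto_pos_mult_at_top[OF tendsto_const \<open>c > 0\<close> filterlim_inverse_at_top_right])
    then have "filterlim (\<lambda>t::real. - (c * inverse t)) at_bot (at_right 0)"
      by (simp add: filterlim_uminus_at_top)
    then have "((\<lambda>t. exp (- (c * inverse t))) \<longlongrightarrow> 0) (at_right 0)"
      by (rule filterlim_compose[OF exp_at_bot])
    then show ?thesis using tendsto_mult[OF tendsto_const[of C]] by (fastforce simp: divide_inverse)
  qed
  then have "\<forall>\<^sub>F t in at_right 0. C * exp (- c / t) < e" using \<open>e > 0\<close> by (rule order_tendstoD)
  then obtain b where "b > 0" "\<And>t. 0 < t \<Longrightarrow> t < b \<Longrightarrow> C * exp (- c / t) < e"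
    by (auto simp: eventually_at_right_field)
  then show ?thesis by (intro that[of "min 1 (b/2)"]) auto
qed

text \<open>Powers of the time are written as real powers: those are of class \<open>C\<^sup>2\<close> for positive times by
  \<open>C2_on_powr\<close>.\<close>

lemma powr_minus_half: "t > 0 \<Longrightarrow> t powr (-1/2) = 1 / sqrt t"
  using powr_minus[of t "1/2"] by (simp add: powr_half_sqrt inverse_eq_divide)

lemma Erfc_time_derivative:
  assumes "t > 0"
  shows "((\<lambda>s. Erfc (\<alpha> * s powr (-1/2))) has_real_derivative
     (2 / sqrt pi * exp (- (\<alpha> / sqrt t)\<^sup>2)) * (\<alpha> / sqrt t) / (2 * t)) (at t)"
proof -
  have "((\<lambda>s. \<alpha> * s powr (-1/2)) has_real_derivative \<alpha> * ((-1/2) * t powr (-1/2 - 1))) (at t)"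
    by (rule DERIV_cmult, rule has_real_derivative_powr) (use assms in auto)
  from DERIV_chain2[OF Erfc_has_real_derivative this]
  have *: "((\<lambda>s. Erfc (\<alpha> * s powr (-1/2))) has_real_derivative
     - (2 / sqrt pi * exp (- (\<alpha> * t powr (-1/2))\<^sup>2)) * (\<alpha> * ((-1/2) * t powr (-1/2 - 1)))) (at t)" .
  have e: "t powr (-1/2 - 1) = 1 / (sqrt t * t)"
    unfolding powr_diff powr_minus_half[OF assms] using assms by simp
  show ?thesis
    by (rule DERIV_cong[OF *[unfolded e powr_minus_half[OF assms]]]) simp
qed

lemma gauss_time_derivative:
  assumes "t > 0"
  shows "((\<lambda>s. s powr (-1/8) * exp (- (\<beta> * s powr (-1)))) has_real_derivative
     t powr (-1/8) * exp (- (\<beta> / t)) * (- 1 / (8 * t) + \<beta> / t\<^sup>2)) (at t)"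
proof -
  have 1: "((\<lambda>s. s powr (-1/8)) has_real_derivative ((-1/8) * t powr (-1/8 - 1))) (at t)"
    by (rule has_real_derivative_powr) (use assms in auto)
  have 2: "((\<lambda>s. s powr (-1)) has_real_derivative ((-1) * t powr (-1 - 1))) (at t)"
    by (rule has_real_derivative_powr) (use assms in auto)
  have e1: "t powr (-1) = 1 / t" using powr_minus[of t 1] assms by (simp add: inverse_eq_divide)
  have e2: "t powr (-1 - 1) = 1 / t\<^sup>2" unfolding powr_diff e1 using assms by (simp add: power2_eq_square)
  have e3: "t powr (-1/8 - 1) = t powr (-1/8) / t" unfolding powr_diff using assms by simp
  define G where "G = t powr (-1/8)"
  have "((\<lambda>s. s powr (-1/8) * exp (- (\<beta> * s powr (-1)))) has_real_derivative
    ((-1/8) * t powr (-1/8 - 1)) * exp (- (\<beta> * t powr (-1))) +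
    exp (- (\<beta> * t powr (-1))) * (- (\<beta> * ((-1) * t powr (-1 - 1)))) * t powr (-1/8)) (at t)"
    by (rule DERIV_mult[OF 1 DERIV_chain2[OF DERIV_exp DERIV_minus[OF DERIV_cmult[OF 2]]]])
  then show ?thesis
    by (rule DERIV_cong) (unfold e1 e2 e3 G_def[symmetric], use assms in \<open>simp add: algebra_simps\<close>)
qed

lemma sqrt_time_derivative:
  assumes "t > 0"
  shows "((\<lambda>s. s powr (1/2)) has_real_derivative 1 / (2 * sqrt t)) (at t)"
proof -
  have "((\<lambda>s. s powr (1/2)) has_real_derivative ((1/2) * t powr (1/2 - 1))) (at t)"
    by (rule has_real_derivative_powr) (use assms in auto)
  then show ?thesis
    by (rule DERIV_cong) (use powr_minus_half[OF assms] in simp)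
qed

lemma erfc_profile_derivatives:
  "((\<lambda>r. Erfc (a * (r + \<delta>) * k)) has_real_derivative - (2 / sqrt pi * exp (- (a * (r + \<delta>) * k)\<^sup>2)) * (a * k)) (at r)"
  "((\<lambda>r. - (2 / sqrt pi * exp (- (a * (r + \<delta>) * k)\<^sup>2)) * (a * k)) has_real_derivative
      (4 / sqrt pi * (a * (r + \<delta>) * k) * exp (- (a * (r + \<delta>) * k)\<^sup>2)) * (a * k) * (a * k)) (at r)"
proof -
  have 1: "((\<lambda>r. a * (r + \<delta>) * k) has_real_derivative a * k) (at r)" for r
    by (rule derivative_eq_intros refl | simp)+
  show "((\<lambda>r. Erfc (a * (r + \<delta>) * k)) has_real_derivative - (2 / sqrt pi * exp (- (a * (r + \<delta>) * k)\<^sup>2)) * (a * k)) (at r)"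
    by (rule DERIV_chain2[OF Erfc_has_real_derivative 1])
  show "((\<lambda>r. - (2 / sqrt pi * exp (- (a * (r + \<delta>) * k)\<^sup>2)) * (a * k)) has_real_derivative
      (4 / sqrt pi * (a * (r + \<delta>) * k) * exp (- (a * (r + \<delta>) * k)\<^sup>2)) * (a * k) * (a * k)) (at r)"
    by (rule DERIV_cmult_right[OF DERIV_chain2[OF Erfc_second_derivative 1]])
qed

lemma gauss_profile_derivatives:
  fixes B :: real
  shows "((\<lambda>r. exp (- (B * r\<^sup>2))) has_real_derivative - (2 * B * r) * exp (- (B * r\<^sup>2))) (at r)"
  "((\<lambda>r. - (2 * B * r) * exp (- (B * r\<^sup>2))) has_real_derivative (4 * B\<^sup>2 * r\<^sup>2 - 2 * B) * exp (- (B * r\<^sup>2))) (at r)"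
  by (auto intro!: derivative_eq_intros simp: algebra_simps power2_eq_square)

lemma exp_profile_derivatives:
  fixes k :: real
  shows "((\<lambda>r. \<eta> * exp (k * r)) has_real_derivative \<eta> * k * exp (k * r)) (at r)"
  "((\<lambda>r. \<eta> * k * exp (k * r)) has_real_derivative \<eta> * k\<^sup>2 * exp (k * r)) (at r)"
  by (auto intro!: derivative_eq_intros simp: algebra_simps power2_eq_square)

text \<open>The estimates hold on a ball of twice the radius, which leaves room for moving away from
  points of the smaller ball.\<close>

lemma local_chart:
  fixes \<Omega> :: "(real^'n) set"
  assumes gr: "local_C2_graph \<Omega> y \<nu> g" and g0: "grad g y = 0" and "\<epsilon> > 0" "\<epsilon> \<le> 1"
  obtains r H where "r > 0" "H > 0"
    "\<And>z. z \<in> cball y (2 * r) \<Longrightarrow> z \<in> \<Omega> \<longleftrightarrow> 0 < z \<bullet> \<nu> - g z"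
    "\<And>z. z \<in> cball y (2 * r) \<Longrightarrow> norm (grad g z) \<le> \<epsilon>"
    "\<And>z. z \<in> cball y (2 * r) \<Longrightarrow> norm (hessian g z) \<le> H"
    "\<And>z z'. z \<in> cball y (2 * r) \<Longrightarrow> z' \<in> cball y (2 * r) \<Longrightarrow>
      \<bar>(z \<bullet> \<nu> - g z) - (z' \<bullet> \<nu> - g z')\<bar> \<le> 2 * norm (z - z')"
proof -
  have c2: "C2_on UNIV g" and n: "norm \<nu> = 1" using gr by (auto simp: local_C2_graph_def)
  note J = C2_on_UNIV_jet[OF c2]
  obtain r0 where r0: "r0 > 0" "\<And>z. z \<in> ball y r0 \<Longrightarrow> z \<in> \<Omega> \<longleftrightarrow> g z < z \<bullet> \<nu>"
    using gr by (auto simp: local_C2_graph_def)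
  have "isCont (grad g) y" using J(5) has_derivative_continuous by blast
  then obtain r1 where r1: "r1 > 0" "\<And>z. dist z y < r1 \<Longrightarrow> dist (grad g z) (grad g y) < \<epsilon>"
    unfolding continuous_at_eps_delta using \<open>\<epsilon> > 0\<close> by blast
  define r where "r = min r0 r1 / 4"
  have r: "r > 0" "2 * r < r0" "2 * r < r1" using r0 r1 by (auto simp: r_def)
  have "compact (hessian g ` cball y (2 * r))"
    by (rule compact_continuous_image[OF continuous_on_subset[OF J(3)]]) auto
  then obtain H where H: "H > 0" "\<And>z. z \<in> cball y (2 * r) \<Longrightarrow> norm (hessian g z) \<le> H"
    using compact_imp_bounded[of "hessian g ` cball y (2 * r)"] unfolding bounded_pos by blast
  have ge: "norm (grad g z) \<le> \<epsilon>" if "z \<in> cball y (2 * r)" for z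
    using r1(2)[of z] that r g0 by (auto simp: dist_commute)
  have L: "\<bar>(z \<bullet> \<nu> - g z) - (z' \<bullet> \<nu> - g z')\<bar> \<le> 2 * norm (z - z')"
    if z: "z \<in> cball y (2 * r)" "z' \<in> cball y (2 * r)" for z z'
  proof -
    have "norm (g z - g z') \<le> 1 * norm (z - z')"
    proof (rule differentiable_bound[OF convex_cball _ _ z])
      show "(g has_derivative (\<lambda>v. grad g x \<bullet> v)) (at x within cball y (2 * r))" for x
        using J(4) has_derivative_at_withinI by blast
      show "onorm ((\<bullet>) (grad g x)) \<le> 1" if "x \<in> cball y (2 * r)" for x
      proof (rule onorm_le)
        fix v :: "real^'n"
        have "norm (grad g x) * norm v \<le> 1 * norm v"
          by (intro mult_right_mono) (use ge[OF that] \<open>\<epsilon> \<le> 1\<close> in auto)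
        then show "norm (grad g x \<bullet> v) \<le> 1 * norm v"
          using Cauchy_Schwarz_ineq2[of "grad g x" v] by simp
      qed
    qed
    moreover have "\<bar>(z - z') \<bullet> \<nu>\<bar> \<le> norm (z - z')"
      using Cauchy_Schwarz_ineq2[of "z - z'" \<nu>] n by simp
    ultimately show ?thesis by (simp add: inner_diff_left)
  qed
  show ?thesis
    by (rule that[OF r(1) H(1) _ ge H(2) L]) (use r0(2) r in auto)
qed

text \<open>The quadratic term, with \<open>c = 1\<close> or \<open>c = -1\<close>, serves to dominate on the lateral boundary of a
  small ball.\<close>

lemma height_jets:
  fixes g :: "real^'n \<Rightarrow> real"
  assumes "C2_on UNIV g"
  shows "has_jet (\<lambda>z. z \<bullet> \<nu> - g z) z (\<nu> - grad g z) (- hessian g z)"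
    "has_jet (\<lambda>z. (z \<bullet> \<nu> - g z) + c * (norm (z - y))\<^sup>2) z
       (\<nu> - grad g z + c *\<^sub>R (2 *\<^sub>R (z - y))) (- hessian g z + c *\<^sub>R (2 *\<^sub>R mat 1))"
    "transpose (- hessian g z) = - hessian g z"
    "transpose (- hessian g z + c *\<^sub>R (2 *\<^sub>R mat 1)) = - hessian g z + c *\<^sub>R (2 *\<^sub>R mat 1)"
proof -
  note J = C2_on_UNIV_jet[OF assms]
  show 1: "has_jet (\<lambda>z. z \<bullet> \<nu> - g z) z (\<nu> - grad g z) (- hessian g z)"
    using has_jet_add[OF has_jet_inner has_jet_minus[OF J(1)], of \<nu> z] by simp
  show "has_jet (\<lambda>z. (z \<bullet> \<nu> - g z) + c * (norm (z - y))\<^sup>2) z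
       (\<nu> - grad g z + c *\<^sub>R (2 *\<^sub>R (z - y))) (- hessian g z + c *\<^sub>R (2 *\<^sub>R mat 1))"
    by (intro has_jet_add 1 has_jet_cmult has_jet_norm2)
  have t: "hessian g z $ i $ j = hessian g z $ j $ i" for i j
    using arg_cong[OF J(2)[of z], of "\<lambda>A. A $ j $ i"] by (simp add: transpose_def)
  show "transpose (- hessian g z) = - hessian g z"
    "transpose (- hessian g z + c *\<^sub>R (2 *\<^sub>R mat 1)) = - hessian g z + c *\<^sub>R (2 *\<^sub>R mat 1)"
    by (auto simp: transpose_def vec_eq_iff mat_def t)
qed

section \<open>The upper barrier\<close>

text \<open>The scalar inequality for the upper barrier, term by term. The error function satisfies a heat
  equation with diffusivity \<open>1 / (4 a\<^sup>2)\<close>, which is at least \<open>q1\<close>. The Gaussian term is a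
  supersolution by itself: relative to its size, its diffusion gains \<open>3 / (16 t)\<close> and its weight
  \<open>t powr (-1/8)\<close> costs only \<open>1 / (8 t)\<close>, so \<open>1 / (16 t)\<close> is left for the curvature. All other
  errors are at most of order \<open>1 / sqrt t\<close> and are absorbed by the time derivative of
  \<open>K sqrt t\<close>.\<close>

lemma upper_barrier_arith:
  fixes a b c0 He He2 A K E E0 t h q1 e1 q2 e2 kk \<delta> G \<phi> :: real
  assumes t: "0 < t" "t \<le> 1" and b: "0 \<le> b" and a: "a > 0"
    and phi: "0 \<le> \<phi>" "\<phi> \<le> 2" and h: "0 \<le> h" and \<delta>: "\<delta> \<ge> 0" and G: "G \<ge> 0"
    and c0: "0 < c0" "c0 \<le> 1"
    and q1: "3/4 * c0 \<le> q1" "q1 \<le> 5/4 * c0" "q1 \<le> 1 / (4 * a\<^sup>2)" and q2: "\<bar>q2\<bar> \<le> 2"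
    and e1: "\<bar>e1\<bar> \<le> He" and e2: "\<bar>e2\<bar> \<le> He2"
    and A: "A = 1 / (8 * c0)" and hA: "2 * A * h * He \<le> 1 / 16"
    and E: "0 \<le> E" "E \<le> E0" and kk: "kk \<ge> 0"
    and K: "K > 4 * b * a * He + 2 * (E0 * (2 * kk\<^sup>2 + kk * He2))"
  shows "(b * (2 * \<phi> * (a * h / sqrt t) * (a / sqrt t) * (a / sqrt t)) + \<delta> * (G * (4 * (A / t)\<^sup>2 * h\<^sup>2 - 2 * (A / t)))) * q1
     + (b * (- \<phi> * (a / sqrt t)) + \<delta> * (G * (- (2 * (A / t) * h)))) * e1 + (E * kk\<^sup>2) * q2 + (- (E * kk)) * e2
     < b * (\<phi> * (a * h / sqrt t) / (2 * t)) + K * (1 / (2 * sqrt t)) + \<delta> * (G * (- 1 / (8 * t) + A * h\<^sup>2 / t\<^sup>2))"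
proof -
  define s where "s = sqrt t"
  have s: "0 < s" "s \<le> 1" "s * s = t" using t by (auto simp: s_def)
  have He: "He \<ge> 0" using e1 by linarith
  have I1: "b * (2 * \<phi> * (a * h / s) * (a / s) * (a / s)) * q1 \<le> b * (\<phi> * (a * h / s) / (2 * t))"
  proof -
    have "2 * \<phi> * (a * h / s) * (a / s) * (a / s) * q1 \<le> 2 * \<phi> * (a * h / s) * (a / s) * (a / s) * (1 / (4 * a\<^sup>2))"
      by (intro mult_left_mono q1) (use phi a h s in auto)
    also have "\<dots> = \<phi> * (a * h / s) / (2 * t)" using a s by (simp add: field_simps power2_eq_square)
    finally have "b * (2 * \<phi> * (a * h / s) * (a / s) * (a / s) * q1) \<le> b * (\<phi> * (a * h / s) / (2 * t))"
      using b by (intro mult_left_mono)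
    then show ?thesis by (simp add: mult.assoc)
  qed
  have I2: "b * (- \<phi> * (a / s)) * e1 \<le> 2 * b * a * He / s"
  proof -
    have "b * (- \<phi> * (a / s)) * e1 \<le> \<bar>b * (- \<phi> * (a / s)) * e1\<bar>" by (rule abs_ge_self)
    also have "\<dots> = (b * (a / s)) * (\<phi> * \<bar>e1\<bar>)" using b phi a s by (simp add: abs_mult)
    also have "\<dots> \<le> (b * (a / s)) * (2 * He)"
      by (intro mult_left_mono mult_mono) (use phi e1 b a s in auto)
    finally show ?thesis by (simp add: field_simps)
  qed
  have A0: "A > 0" using c0 A by simp
  have Aq: "4 * A * q1 \<le> 1" "2 * A * q1 \<ge> 3/16"
    using q1 c0 by (simp_all add: A field_simps)
  have I3: "(4 * (A / t)\<^sup>2 * h\<^sup>2 - 2 * (A / t)) * q1 + (- (2 * (A / t) * h)) * e1 \<le> - 1 / (8 * t) + A * h\<^sup>2 / t\<^sup>2"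
  proof -
    have x: "A * h\<^sup>2 / t * (4 * A * q1) \<le> A * h\<^sup>2 / t * 1"
      by (intro mult_left_mono Aq) (use A0 t in auto)
    have "- (2 * A * h * e1) \<le> \<bar>2 * A * h * e1\<bar>" by simp
    also have "\<dots> = 2 * A * h * \<bar>e1\<bar>" using A0 h by (simp add: abs_mult)
    also have "\<dots> \<le> 2 * A * h * He" by (intro mult_left_mono e1) (use A0 h in auto)
    also have "\<dots> \<le> 1 / 16" by (rule hA)
    finally have y: "- (2 * A * h * e1) \<le> 1/16" .
    have "A * h\<^sup>2 / t * (4 * A * q1) - 2 * A * q1 - 2 * A * h * e1 \<le> A * h\<^sup>2 / t - 1/8"
      using x y Aq by linarith
    then have "(A * h\<^sup>2 / t * (4 * A * q1) - 2 * A * q1 - 2 * A * h * e1) / t \<le> (A * h\<^sup>2 / t - 1/8) / t"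
      using t by (intro divide_right_mono) auto
    moreover have "(A * h\<^sup>2 / t * (4 * A * q1) - 2 * A * q1 - 2 * A * h * e1) / t
      = (4 * (A / t)\<^sup>2 * h\<^sup>2 - 2 * (A / t)) * q1 + (- (2 * (A / t) * h)) * e1"
      using t by (simp add: field_simps power2_eq_square)
    moreover have "(A * h\<^sup>2 / t - 1/8) / t = - 1 / (8 * t) + A * h\<^sup>2 / t\<^sup>2"
      using t by (simp add: field_simps power2_eq_square)
    ultimately show ?thesis by simp
  qed
  have "\<delta> * (G * ((4 * (A / t)\<^sup>2 * h\<^sup>2 - 2 * (A / t)) * q1 + (- (2 * (A / t) * h)) * e1)) \<le> \<delta> * (G * (- 1 / (8 * t) + A * h\<^sup>2 / t\<^sup>2))"
    by (intro mult_left_mono I3 \<delta> G)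
  then have I3': "\<delta> * (G * (4 * (A / t)\<^sup>2 * h\<^sup>2 - 2 * (A / t))) * q1 + \<delta> * (G * (- (2 * (A / t) * h))) * e1
    \<le> \<delta> * (G * (- 1 / (8 * t) + A * h\<^sup>2 / t\<^sup>2))" by (simp add: algebra_simps)
  have I4: "(E * kk\<^sup>2) * q2 + (- (E * kk)) * e2 \<le> E0 * (2 * kk\<^sup>2 + kk * He2)"
  proof -
    have "kk\<^sup>2 * q2 \<le> kk\<^sup>2 * 2" by (intro mult_left_mono) (use q2 in auto)
    moreover have "kk * (- e2) \<le> kk * He2" by (intro mult_left_mono) (use e2 kk in auto)
    ultimately have "E * (kk\<^sup>2 * q2 + kk * (- e2)) \<le> E * (2 * kk\<^sup>2 + kk * He2)"
      using E by (intro mult_left_mono) auto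
    also have "\<dots> \<le> E0 * (2 * kk\<^sup>2 + kk * He2)"
      by (intro mult_right_mono) (use E kk e2 in \<open>auto intro!: add_nonneg_nonneg mult_nonneg_nonneg\<close>)
    finally show ?thesis by (simp add: algebra_simps)
  qed
  have E00: "0 \<le> E0 * (2 * kk\<^sup>2 + kk * He2)"
    using E kk e2 by (intro mult_nonneg_nonneg add_nonneg_nonneg) auto
  have I5: "2 * b * a * He / s + E0 * (2 * kk\<^sup>2 + kk * He2) < K * (1 / (2 * s))"
  proof -
    have "E0 * (2 * kk\<^sup>2 + kk * He2) \<le> E0 * (2 * kk\<^sup>2 + kk * He2) / s"
      unfolding pos_le_divide_eq[OF s(1)] using mult_left_mono[OF s(2) E00] by simp
    moreover have "(4 * b * a * He + 2 * (E0 * (2 * kk\<^sup>2 + kk * He2))) / (2 * s) < K / (2 * s)"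
      using K s by (intro divide_strict_right_mono) auto
    moreover have "(4 * b * a * He + 2 * (E0 * (2 * kk\<^sup>2 + kk * He2))) / (2 * s) = 2 * b * a * He / s + E0 * (2 * kk\<^sup>2 + kk * He2) / s"
      using s by (simp add: field_simps)
    ultimately show ?thesis by (simp only: times_divide_eq_right mult_1_right)
  qed
  show ?thesis using I1 I2 I3' I4 I5 unfolding s_def[symmetric] by (simp only: distrib_right)
qed

text \<open>The barrier is \<open>b Erfc (a h / sqrt t) + K sqrt t + \<delta> t powr (-1/8) exp (- A h\<^sup>2 / t) + (\<eta> / 4)
  exp (- kk h2)\<close>, where \<open>h\<close> is the height above the boundary graph and \<open>h2 = h - |z - y|\<^sup>2\<close>.
  Diffusivity strictly above \<open>1 / p'\<close> in the first term leaves room for errors; the second term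
  pays for the curvature of the boundary. On \<open>\<Gamma>\<close> the first term is at least \<open>b\<close>. The last one
  exceeds the bound \<open>M\<close> on the part of the sphere about \<open>y\<close> that is close to \<open>\<Gamma>\<close>; on the rest of
  the sphere \<open>U\<close> itself is small at small times by interior decay. The corner \<open>\<Gamma> \<times> {0}\<close>, where
  the solution has no limit, is the reason for the third term: it blows up there as long as
  \<open>h\<^sup>2\<close> is at most a multiple of \<open>t\<close>, and above that interior decay takes over. At the end \<open>\<delta>\<close>
  tends to 0. For \<open>U = u\<close> the constant \<open>b\<close> is 1; with \<open>b = 0\<close> the same barrier bounds \<open>- u\<close>.\<close>

lemma boundary_upper_barrier:
  fixes \<Omega> :: "(real^'n) set" and U :: "(real^'n) \<times> real \<Rightarrow> real"
  assumes p1: "1 < p" and op: "open \<Omega>" and sub: "viscosity_subsolution p \<Omega> U"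
    and gr: "local_C2_graph \<Omega> y \<nu> g" and g0: "grad g y = 0" and gy: "g y = y \<bullet> \<nu>"
    and M: "M > 0" and UM: "\<And>z. z \<in> \<Omega> \<times> {0<..} \<Longrightarrow> U z \<le> M"
    and U0: "\<And>z0. z0 \<in> \<Omega> \<Longrightarrow> (U \<longlongrightarrow> 0) (at (z0, 0) within \<Omega> \<times> {0<..})"
    and Ub: "\<And>z0 t0. z0 \<in> frontier \<Omega> \<Longrightarrow> t0 > 0 \<Longrightarrow> \<exists>b'\<le>b. (U \<longlongrightarrow> b') (at (z0, t0) within \<Omega> \<times> {0<..})"
    and b: "0 \<le> b" and a: "a > 0" "4 * a\<^sup>2 < conj_exp p" and "\<eta> > 0"
  shows "\<exists>r>0. \<exists>t0>0. \<forall>z\<in>\<Omega> \<inter> ball y r. \<forall>t. 0 < t \<and> t < t0 \<longrightarrow>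
     U (z, t) \<le> b * Erfc (a * (z \<bullet> \<nu> - g z) / sqrt t) + \<eta>"
proof -
  note ip = inverse_exponent_bounds[OF p1]
  have c2: "C2_on UNIV g" and n\<nu>: "norm \<nu> = 1" using gr by (auto simp: local_C2_graph_def)
  define c0 where "c0 = 1 / conj_exp p"
  have c0: "0 < c0" "c0 \<le> 1"
  proof -
    show "0 < c0" unfolding c0_def using ip(4) by (simp only: zero_less_divide_1_iff)
    show "c0 \<le> 1" unfolding c0_def using ip(1,3) by linarith
  qed
  have c0a: "c0 < 1 / (4 * a\<^sup>2)" using a ip(4) by (simp add: c0_def field_simps)
  define \<epsilon> where "\<epsilon> = min (1/4) (min (c0/100) ((1 / (4 * a\<^sup>2) - c0)/25))"
  have \<epsilon>: "\<epsilon> > 0" "\<epsilon> \<le> 1/4" "25 * \<epsilon> \<le> c0/4" "25 * \<epsilon> \<le> 1 / (4 * a\<^sup>2) - c0"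
  proof -
    define e3 where "e3 = (1 / (4 * a\<^sup>2) - c0) / 25"
    have "e3 > 0" using c0a by (simp add: e3_def)
    then show "\<epsilon> > 0" using c0 unfolding \<epsilon>_def e3_def[symmetric] by simp
    have "\<epsilon> \<le> 1/4" "\<epsilon> \<le> c0/100" "\<epsilon> \<le> e3" unfolding \<epsilon>_def e3_def[symmetric] by (simp_all add: min_def)
    then show "\<epsilon> \<le> 1/4" "25 * \<epsilon> \<le> c0/4" "25 * \<epsilon> \<le> 1 / (4 * a\<^sup>2) - c0" by (simp_all add: e3_def)
  qed
  obtain r1 H where r1: "r1 > 0" and H: "H > 0"
    and chart: "\<And>z. z \<in> cball y (2 * r1) \<Longrightarrow> z \<in> \<Omega> \<longleftrightarrow> 0 < z \<bullet> \<nu> - g z"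
    and gle: "\<And>z. z \<in> cball y (2 * r1) \<Longrightarrow> norm (grad g z) \<le> \<epsilon> / 2"
    and Hle: "\<And>z. z \<in> cball y (2 * r1) \<Longrightarrow> norm (hessian g z) \<le> H"
    and Lip: "\<And>z z'. z \<in> cball y (2 * r1) \<Longrightarrow> z' \<in> cball y (2 * r1) \<Longrightarrow>
      \<bar>(z \<bullet> \<nu> - g z) - (z' \<bullet> \<nu> - g z')\<bar> \<le> 2 * norm (z - z')"
    by (rule local_chart[OF gr g0, of "\<epsilon> / 2"]) (use \<epsilon> in auto)
  define h where "h z = z \<bullet> \<nu> - g z" for z
  define N1 where "N1 = real CARD('n) + 1"
  define S where "S = norm (mat 1 :: real^'n^'n)"
  define He where "He = N1 * H"
  define He2 where "He2 = N1 * (H + 2 * S)"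
  have N1: "N1 > 0" by (simp add: N1_def)
  have He: "He > 0" using N1 H by (simp add: He_def)
  define A where "A = 1 / (8 * c0)"
  have A: "A > 0" using c0 by (simp add: A_def)
  define r where "r = min r1 (min (\<epsilon> / 4) (1 / (64 * A * He)))"
  have r: "r > 0" "r \<le> r1" "r \<le> \<epsilon> / 4" "r \<le> 1 / (64 * A * He)"
    using r1 \<epsilon> A He by (auto simp: r_def)
  define h2 where "h2 z = h z + (-1) * (norm (z - y))\<^sup>2" for z
  define \<eta>2 where "\<eta>2 = \<eta> / 4"
  have \<eta>2: "\<eta>2 > 0" using \<open>\<eta> > 0\<close> by (simp add: \<eta>2_def)
  \<comment> \<open>Large enough that the last term exceeds \<open>M\<close> where \<open>|z - y| = r\<close> and \<open>h z \<le> r\<^sup>2 / 2\<close>.\<close>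
  define kk where "kk = 2 * ln ((M + 1) / \<eta>2 + 1) / r\<^sup>2"
  have "0 < ln ((M + 1) / \<eta>2 + 1)" by (rule ln_gt_zero) (use M \<eta>2 in simp)
  then have kk: "kk > 0" using r by (simp add: kk_def)
  have kkM: "\<eta>2 * exp (kk * (r\<^sup>2 / 2)) > M"
  proof -
    have "kk * (r\<^sup>2 / 2) = ln ((M + 1) / \<eta>2 + 1)" using r by (simp add: kk_def)
    then have "exp (kk * (r\<^sup>2 / 2)) = (M + 1) / \<eta>2 + 1" using M \<eta>2 by (simp add: add_pos_pos)
    then show ?thesis using \<eta>2 by (simp add: field_simps)
  qed
  obtain C c where C: "C > 0" "c > 0" and dec:
    "\<And>(\<Omega>::(real^'n) set) U M z d T. open \<Omega> \<Longrightarrow> viscosity_subsolution p \<Omega> U \<Longrightarrow> M > 0 \<Longrightarrow>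
      (\<And>z. z \<in> \<Omega> \<times> {0<..} \<Longrightarrow> U z \<le> M) \<Longrightarrow>
      (\<And>z0. z0 \<in> \<Omega> \<Longrightarrow> (U \<longlongrightarrow> 0) (at (z0, 0) within \<Omega> \<times> {0<..})) \<Longrightarrow>
      cball z d \<subseteq> \<Omega> \<Longrightarrow> d > 0 \<Longrightarrow> T > 0 \<Longrightarrow> U (z, T) \<le> C * M * exp (- c * d\<^sup>2 / T)"
    using interior_decay[OF p1] by metis
  have hb: "0 < h z" "h z \<le> 2 * r" if "z \<in> \<Omega>" "z \<in> cball y r" for z
  proof -
    have z: "z \<in> cball y (2 * r1)" "y \<in> cball y (2 * r1)" using that r by auto
    show "0 < h z" using chart[OF z(1)] that by (simp add: h_def)
    have "\<bar>h z - h y\<bar> \<le> 2 * norm (z - y)" using Lip[OF z] by (simp add: h_def)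
    moreover have "norm (z - y) \<le> r" using that by (simp add: dist_norm norm_minus_commute)
    ultimately show "h z \<le> 2 * r" by (simp add: h_def gy)
  qed
  have decay: "U (z, t) \<le> C * M * exp (- (c / 16) * (h z)\<^sup>2 / t)"
    if z: "z \<in> \<Omega>" "z \<in> cball y r" and t: "t > 0" for z t
  proof -
    have "cball z (h z / 4) \<subseteq> \<Omega>"
    proof
      fix z' assume z': "z' \<in> cball z (h z / 4)"
      have "dist y z' \<le> dist y z + dist z z'" by (rule dist_triangle)
      also have "\<dots> \<le> r + r / 2" using z z' hb[OF z] by auto
      finally have m: "z' \<in> cball y (2 * r1)" "z \<in> cball y (2 * r1)" using r z by auto
      have "\<bar>h z' - h z\<bar> \<le> 2 * norm (z' - z)" using Lip[OF m] by (simp add: h_def)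
      also have "\<dots> \<le> h z / 2" using z' by (simp add: dist_norm norm_minus_commute)
      finally have "h z' > 0" using hb[OF z] by linarith
      then show "z' \<in> \<Omega>" using chart[OF m(1)] by (simp add: h_def)
    qed
    from dec[OF op sub M UM U0 this] hb[OF z] t
    show ?thesis by (simp add: power_divide)
  qed
  \<comment> \<open>A lower bound for the last term on the whole domain of comparison.\<close>
  define e where "e = \<eta>2 * exp (- kk * (2 * r))"
  have e: "e > 0" using \<eta>2 by (simp add: e_def)
  obtain T1 where T1: "T1 > 0" "T1 \<le> 1"
    and T1d: "\<And>t. 0 < t \<Longrightarrow> t \<le> T1 \<Longrightarrow> C * M * exp (- (c / 16 * (r\<^sup>2 / 2)\<^sup>2) / t) < e"
    using exists_small_exp[of "c / 16 * (r\<^sup>2 / 2)\<^sup>2" e] C e r by auto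
  obtain T2 where T2: "T2 > 0" and T2d: "C * M * exp (- (c / 16) / T2) < e"
    using exists_small_exp[of "c / 16" e "C * M"] C e by (metis divide_pos_pos order_refl zero_less_numeral)
  define Ce where "Ce = (\<eta>2 * exp (kk * r\<^sup>2)) * (2 * kk\<^sup>2 + kk * He2)"
  define K where "K = 4 * b * a * He + 2 * Ce + 1"
  have Ce: "Ce \<ge> 0" using \<eta>2 kk N1 H by (auto simp: Ce_def He2_def S_def intro!: mult_nonneg_nonneg add_nonneg_nonneg)
  have K: "K > 0" using b a He Ce by (auto simp: K_def intro!: add_nonneg_pos)
  let ?D = "\<Omega> \<inter> ball y r"
  define W where "W \<delta> z = b * Erfc (a * h (fst z) * snd z powr (-1/2)) + K * snd z powr (1/2)
     + \<delta> * (snd z powr (-1/8) * exp (- (A * (h (fst z))\<^sup>2 * snd z powr (-1))))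
     + \<eta>2 * exp (- kk * h2 (fst z))" for \<delta> and z :: "(real^'n) \<times> real"
  have C2h: "C2_on V (\<lambda>z. h (fst z))" for V :: "((real^'n) \<times> real) set"
    using C2_on_fst[OF C2_on_diff[OF C2_on_inner c2]] unfolding h_def .
  have C2n: "C2_on V (\<lambda>z. (norm (fst z - y))\<^sup>2)" for V :: "((real^'n) \<times> real) set"
    by (rule C2_on_fst[OF C2_on_norm2])
  have C2W: "C2_on (\<Omega> \<times> {0<..}) (W \<delta>)" for \<delta>
    unfolding W_def h2_def
    by (intro C2_on_add C2_on_mult C2_on_cmult C2_on_exp C2_on_minus C2_on_Erfc C2h C2n C2_on_powr C2_on_snd C2_on_const
        C2_on_power2 C2_on_fst C2_on_norm2) auto
  have Wpos: "W \<delta> z \<ge> 0" "W \<delta> z \<ge> \<eta>2 * exp (- kk * h2 (fst z))"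
    "W \<delta> z \<ge> \<delta> * (snd z powr (-1/8) * exp (- (A * (h (fst z))\<^sup>2 * snd z powr (-1))))" if "\<delta> > 0" for \<delta> z
    using b K that \<eta>2 Erfc_nonneg
    unfolding W_def by (auto intro!: add_nonneg_nonneg mult_nonneg_nonneg)
  have Wcont: "(W \<delta> \<longlongrightarrow> W \<delta> (z0, t0)) (at (z0, t0) within V)" if "t0 > 0" for \<delta> z0 t0 V
  proof -
    have "C2_on (UNIV \<times> {0<..}) (W \<delta>)"
      unfolding W_def h2_def
      by (intro C2_on_add C2_on_mult C2_on_cmult C2_on_exp C2_on_minus C2_on_Erfc C2h C2n C2_on_powr C2_on_snd C2_on_const
        C2_on_power2 C2_on_fst C2_on_norm2) auto
    then have "isCont (W \<delta>) (z0, t0)"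
      unfolding C2_on_def using that by (auto intro: has_derivative_continuous)
    then show ?thesis by (meson continuous_at_imp_continuous_at_within continuous_within)
  qed
  have main: "U (z, t) \<le> W \<delta> (z, t)" if \<delta>: "\<delta> > 0" and z: "z \<in> ?D" and t: "0 < t" "t < T1" for \<delta> z t
  proof (rule comparison[OF sub op _ _ _ T1(1) UM C2W, where D="?D" and B=0])
    show "open ?D" "?D \<subseteq> \<Omega>" "bounded ?D" using op by auto
    show "- 0 \<le> W \<delta> z" for z using Wpos(1)[OF \<delta>] by simp
  next
    fix z t assume z: "z \<in> ?D" and t: "0 < t" "t < T1"
    have zc: "z \<in> cball y (2 * r1)" using z r by auto
    have hz: "0 < h z" "h z \<le> 2 * r" using hb z by auto
    note J = height_jets[OF c2]
    have nz: "norm (z - y) \<le> r" using z by (simp add: dist_norm norm_minus_commute)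
    let ?k = "t powr (-1/2)"
    let ?B = "A * t powr (-1)"
    define P where "P = (\<lambda>r. b * Erfc (a * (r + 0) * ?k) + K * t powr (1/2) + \<delta> * (t powr (-1/8) * exp (- (?B * r\<^sup>2))))"
    define P' where "P' = (\<lambda>r. b * (- (2 / sqrt pi * exp (- (a * (r + 0) * ?k)\<^sup>2)) * (a * ?k)) + \<delta> * (t powr (-1/8) * (- (2 * ?B * r) * exp (- (?B * r\<^sup>2)))))"
    define P2 where "P2 = (\<lambda>r. b * ((4 / sqrt pi * (a * (r + 0) * ?k) * exp (- (a * (r + 0) * ?k)\<^sup>2)) * (a * ?k) * (a * ?k)) + \<delta> * (t powr (-1/8) * ((4 * ?B\<^sup>2 * r\<^sup>2 - 2 * ?B) * exp (- (?B * r\<^sup>2)))))"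
    show "strict_supersolution_at p (W \<delta>) z t"
    proof (rule two_profile_strict_supersolution[OF p1 n\<nu> \<epsilon>(2), where s="-1"])
      show "has_jet h z (\<nu> - grad g z) (- hessian g z)" unfolding h_def by (rule J)
      show "has_jet h2 z (\<nu> - grad g z + (-1) *\<^sub>R (2 *\<^sub>R (z - y))) (- hessian g z + (-1) *\<^sub>R (2 *\<^sub>R mat 1))"
        unfolding h2_def h_def by (rule J)
      show "norm (\<nu> - grad g z - \<nu>) \<le> \<epsilon>" using gle[OF zc] \<epsilon> by simp
      have "norm (\<nu> - grad g z + (-1) *\<^sub>R (2 *\<^sub>R (z - y)) - \<nu>) = norm (grad g z + 2 *\<^sub>R (z - y))"
        by (subst norm_minus_cancel[symmetric]) (simp add: algebra_simps)
      also have "\<dots> \<le> \<epsilon> / 2 + 2 * r"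
        by (rule order_trans[OF norm_triangle_ineq]) (use gle[OF zc] nz in auto)
      finally show "norm (\<nu> - grad g z + (-1) *\<^sub>R (2 *\<^sub>R (z - y)) - \<nu>) \<le> \<epsilon>" using r by simp
      show "(P has_real_derivative P' r) (at r)" for r
      proof -
        have "(P has_real_derivative b * (- (2 / sqrt pi * exp (- (a * (r + 0) * ?k)\<^sup>2)) * (a * ?k)) + 0 + \<delta> * (t powr (-1/8) * (- (2 * ?B * r) * exp (- (?B * r\<^sup>2))))) (at r)"
          unfolding P_def by (intro DERIV_add DERIV_cmult erfc_profile_derivatives gauss_profile_derivatives DERIV_const)
        then show ?thesis by (simp add: P'_def)
      qed
      show "(P' has_real_derivative P2 (h z)) (at (h z))"
        unfolding P'_def P2_def by (intro DERIV_add DERIV_cmult erfc_profile_derivatives gauss_profile_derivatives)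
      show "((\<lambda>r. \<eta>2 * exp (- kk * r)) has_real_derivative \<eta>2 * (- kk) * exp (- kk * r)) (at r)"
        "((\<lambda>r. \<eta>2 * (- kk) * exp (- kk * r)) has_real_derivative \<eta>2 * (- kk)\<^sup>2 * exp (- kk * h2 z)) (at (h2 z))" for r
        by (rule exp_profile_derivatives)+
      show "0 \<le> - 1 * P' (h z)"
        using b a hz A \<delta> by (auto simp: P'_def intro!: add_nonneg_nonneg mult_nonneg_nonneg)
      show "0 < - 1 * (\<eta>2 * (- kk) * exp (- kk * h2 z))" using \<eta>2 kk by simp
      show "W \<delta> (x, t) = P (h x) + \<eta>2 * exp (- kk * h2 x)" for x
        by (simp add: W_def P_def mult_ac)
      show "((\<lambda>s. W \<delta> (z, s)) has_real_derivative
         b * (2 / sqrt pi * exp (- ((a * h z) / sqrt t)\<^sup>2) * ((a * h z) / sqrt t) / (2 * t)) + K * (1 / (2 * sqrt t))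
          + \<delta> * (t powr (-1/8) * exp (- (A * (h z)\<^sup>2 / t)) * (- 1 / (8 * t) + A * (h z)\<^sup>2 / t\<^sup>2)) + 0) (at t)"
        unfolding W_def fst_conv snd_conv
        by (intro DERIV_add DERIV_cmult Erfc_time_derivative gauss_time_derivative sqrt_time_derivative DERIV_const t)
      fix q1 e1 q2 e2
      assume q1: "\<bar>q1 - 1 / conj_exp p\<bar> \<le> 25 * \<epsilon>" and q2: "\<bar>q2 - 1 / conj_exp p\<bar> \<le> 25 * \<epsilon>"
        and e1: "\<bar>e1\<bar> \<le> (real CARD('n) + 1) * norm (- hessian g z)"
        and e2: "\<bar>e2\<bar> \<le> (real CARD('n) + 1) * norm (- hessian g z + (-1) *\<^sub>R (2 *\<^sub>R (mat 1 :: real^'n^'n)))"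
      define \<phi> where "\<phi> = 2 / sqrt pi * exp (- ((a * h z) / sqrt t)\<^sup>2)"
      define G where "G = t powr (-1/8) * exp (- (A * (h z)\<^sup>2 / t))"
      define E where "E = \<eta>2 * exp (- kk * h2 z)"
      have phi: "0 \<le> \<phi>" "\<phi> \<le> 2"
      proof -
        have "1 \<le> sqrt pi" using pi_ge_two by simp
        then have "2 / sqrt pi * exp (- ((a * h z) / sqrt t)\<^sup>2) \<le> 2 * 1"
          by (intro mult_mono) (auto simp: field_simps)
        then show "\<phi> \<le> 2" by (simp add: \<phi>_def)
      qed (simp add: \<phi>_def)
      have e1': "\<bar>e1\<bar> \<le> He"
      proof -
        have "N1 * norm (hessian g z) \<le> He" unfolding He_def by (intro mult_left_mono Hle[OF zc]) (use N1 in auto)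
        then show ?thesis using e1 unfolding N1_def norm_minus_cancel by linarith
      qed
      have e2': "\<bar>e2\<bar> \<le> He2"
      proof -
        have "norm (- hessian g z + (-1) *\<^sub>R (2 *\<^sub>R (mat 1 :: real^'n^'n))) \<le> H + 2 * S"
          by (rule order_trans[OF norm_triangle_ineq]) (use Hle[OF zc] in \<open>simp add: S_def\<close>)
        from mult_left_mono[OF this, of N1] e2 N1 show ?thesis unfolding He2_def N1_def by linarith
      qed
      have hA: "2 * A * h z * He \<le> 1 / 16"
      proof -
        have "2 * A * h z * He \<le> 2 * A * (2 * (1 / (64 * A * He))) * He"
          by (intro mult_right_mono mult_left_mono) (use hz r A He in auto)
        also have "\<dots> = 1/16" using A He by simp
        finally show ?thesis .
      qed
      have EE: "0 \<le> E" "E \<le> \<eta>2 * exp (kk * r\<^sup>2)"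
      proof -
        have "(norm (z - y))\<^sup>2 \<le> r\<^sup>2" using nz by (intro power_mono) auto
        then have "- h2 z \<le> r\<^sup>2" using hz(1) unfolding h2_def by linarith
        then have "kk * (- h2 z) \<le> kk * r\<^sup>2" using kk by (intro mult_left_mono) auto
        then show "E \<le> \<eta>2 * exp (kk * r\<^sup>2)" using \<eta>2 by (simp add: E_def)
      qed (use \<eta>2 in \<open>simp add: E_def\<close>)
      have k: "?k = 1 / sqrt t" "?B = A / t" using powr_minus_half[OF t(1)] powr_minus[of t 1] t by (auto simp: inverse_eq_divide)
      have arith: "(b * (2 * \<phi> * (a * h z / sqrt t) * (a / sqrt t) * (a / sqrt t)) + \<delta> * (G * (4 * (A / t)\<^sup>2 * (h z)\<^sup>2 - 2 * (A / t)))) * q1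
     + (b * (- \<phi> * (a / sqrt t)) + \<delta> * (G * (- (2 * (A / t) * h z)))) * e1 + (E * kk\<^sup>2) * q2 + (- (E * kk)) * e2
     < b * (\<phi> * (a * h z / sqrt t) / (2 * t)) + K * (1 / (2 * sqrt t)) + \<delta> * (G * (- 1 / (8 * t) + A * (h z)\<^sup>2 / t\<^sup>2))"
      proof (rule upper_barrier_arith[where ?c0.0=c0 and He=He and ?He2.0=He2 and ?E0.0="\<eta>2 * exp (kk * r\<^sup>2)"])
        show "3/4 * c0 \<le> q1" "q1 \<le> 5/4 * c0" "q1 \<le> 1 / (4 * a\<^sup>2)"
          using q1 \<epsilon> c0 unfolding c0_def[symmetric] by linarith+
        show "\<bar>q2\<bar> \<le> 2" using q2 \<epsilon> c0 unfolding c0_def[symmetric] by linarith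
        show "4 * b * a * He + 2 * (\<eta>2 * exp (kk * r\<^sup>2) * (2 * kk\<^sup>2 + kk * He2)) < K" by (simp add: K_def Ce_def)
      qed (use t T1 b a phi hz \<delta> c0 e1' e2' hA EE kk in \<open>auto simp: A_def G_def\<close>)
      have P2e: "P2 (h z) = b * (2 * \<phi> * (a * h z / sqrt t) * (a / sqrt t) * (a / sqrt t)) + \<delta> * (G * (4 * (A / t)\<^sup>2 * (h z)\<^sup>2 - 2 * (A / t)))"
        unfolding P2_def k \<phi>_def G_def by (simp add: mult_ac)
      have P1e: "P' (h z) = b * (- \<phi> * (a / sqrt t)) + \<delta> * (G * (- (2 * (A / t) * h z)))"
        unfolding P'_def k \<phi>_def G_def by (simp add: mult_ac)
      have Ee: "\<eta>2 * (- kk)\<^sup>2 * exp (- kk * h2 z) = E * kk\<^sup>2" "\<eta>2 * (- kk) * exp (- kk * h2 z) = - (E * kk)"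
        by (simp_all add: E_def)
      show "P2 (h z) * q1 + P' (h z) * e1 + \<eta>2 * (- kk)\<^sup>2 * exp (- kk * h2 z) * q2 + \<eta>2 * (- kk) * exp (- kk * h2 z) * e2
        < b * (2 / sqrt pi * exp (- ((a * h z) / sqrt t)\<^sup>2) * ((a * h z) / sqrt t) / (2 * t)) + K * (1 / (2 * sqrt t))
          + \<delta> * (t powr (-1/8) * exp (- (A * (h z)\<^sup>2 / t)) * (- 1 / (8 * t) + A * (h z)\<^sup>2 / t\<^sup>2)) + 0"
        unfolding Ee P2e P1e add_0_right \<phi>_def[symmetric] G_def[symmetric] by (rule arith)
    qed (rule J | simp)+
  next
    fix z0 t0 assume z0: "z0 \<in> closure ?D" and t0: "0 \<le> t0" "t0 \<le> T1" and bd: "z0 \<notin> ?D \<or> t0 = 0"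
    let ?F = "at (z0, t0) within ?D \<times> {0<..<T1}"
    have inQ: "\<forall>\<^sub>F z in ?F. z \<in> ?D \<times> {0<..<T1}" by (auto simp: eventually_at_filter)
    have z0c: "z0 \<in> closure \<Omega>" "z0 \<in> cball y r"
    proof -
      show "z0 \<in> closure \<Omega>" using z0 closure_mono[of ?D \<Omega>] by auto
      have "?D \<subseteq> cball y r" by auto
      from closure_mono[OF this] show "z0 \<in> cball y r" using z0 by auto
    qed
    have z0c2: "z0 \<in> cball y (2 * r1)" using z0c r by auto
    show "\<forall>\<^sub>F z in ?F. U z \<le> W \<delta> z"
    proof (cases "t0 = 0")
      case True
      define X where "X = 1 / T2"
      \<comment> \<open>Before the time \<open>t1\<close> the corner term exceeds \<open>M\<close> wherever \<open>h\<^sup>2 \<le> X s\<close>.\<close>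
      define t1 where "t1 = (\<delta> * exp (- (A * X)) / M) powr 8"
      have t1: "t1 > 0" using \<delta> M by (simp add: t1_def)
      have "((\<lambda>z. snd z) \<longlongrightarrow> t0) ?F" by (intro tendsto_eq_intros refl | simp)+
      then have "\<forall>\<^sub>F z in ?F. snd z < t1" using t1 True by (intro order_tendstoD) auto
      with inQ show ?thesis
      proof eventually_elim
        case (elim z')
        obtain x s where xs: "z' = (x, s)" by fastforce
        have x: "x \<in> \<Omega>" "x \<in> cball y r" and s: "0 < s" "s < t1" using elim xs by auto
        have sp: "s powr (-1) = 1 / s" using powr_minus[of s 1] s by (simp add: inverse_eq_divide)
        show ?case
        proof (cases "(h x)\<^sup>2 / s \<le> X")
          case True
          have "t1 powr (-1/8) = (\<delta> * exp (- (A * X)) / M) powr (-1)" by (simp add: t1_def powr_powr)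
          also have "\<dots> = M / (\<delta> * exp (- (A * X)))"
            using powr_minus[of "\<delta> * exp (- (A * X)) / M" 1] \<delta> M by (simp add: inverse_eq_divide)
          finally have t1p: "t1 powr (-1/8) = M / (\<delta> * exp (- (A * X)))" .
          have "s powr (-1/8) \<ge> t1 powr (-1/8)" using s by (intro powr_mono2') auto
          moreover have "exp (- (A * X)) \<le> exp (- (A * (h x)\<^sup>2 * (1 / s)))"
            using mult_left_mono[OF True, of A] A by simp
          ultimately have "s powr (-1/8) * exp (- (A * (h x)\<^sup>2 * s powr (-1))) \<ge> (M / (\<delta> * exp (- (A * X)))) * exp (- (A * X))"
            unfolding t1p sp by (intro mult_mono) auto
          then have "\<delta> * (s powr (-1/8) * exp (- (A * (h x)\<^sup>2 * s powr (-1)))) \<ge> \<delta> * ((M / (\<delta> * exp (- (A * X)))) * exp (- (A * X)))"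
            using \<delta> by (intro mult_left_mono) auto
          also have "\<delta> * ((M / (\<delta> * exp (- (A * X)))) * exp (- (A * X))) = M" using \<delta> by simp
          finally have "M \<le> W \<delta> (x, s)" using Wpos(3)[OF \<delta>, of "(x, s)"] by simp
          then show ?thesis using UM[of "(x, s)"] x s xs by simp
        next
          case False
          have "(c / 16) * X \<le> (c / 16) * ((h x)\<^sup>2 / s)" using False C by (intro mult_left_mono) auto
          then have ee: "exp (- (c / 16) * (h x)\<^sup>2 / s) \<le> exp (- (c / 16) / T2)" by (simp add: X_def)
          have "U (x, s) \<le> C * M * exp (- (c / 16) * (h x)\<^sup>2 / s)" by (rule decay[OF x s(1)])
          also have "\<dots> \<le> C * M * exp (- (c / 16) / T2)" using ee C M by (intro mult_left_mono) auto
          also have "\<dots> < e" by (rule T2d)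
          also have "e \<le> \<eta>2 * exp (- kk * h2 x)"
          proof -
            have "h2 x \<le> 2 * r" using hb[OF x] zero_le_power2[of "norm (x - y)"] unfolding h2_def by linarith
            then show ?thesis using kk \<eta>2 by (simp add: e_def)
          qed
          finally show ?thesis using Wpos(2)[OF \<delta>, of z'] xs by simp
        qed
      qed
    next
      case False
      then have t0p: "t0 > 0" using t0 by simp
      have z0D: "z0 \<notin> ?D" using bd False by simp
      have lim: "\<forall>\<^sub>F z in ?F. U z \<le> W \<delta> z" if "(U \<longlongrightarrow> l) ?F" "l < W \<delta> (z0, t0)" for l
      proof -
        have "((\<lambda>z. U z - W \<delta> z) \<longlongrightarrow> l - W \<delta> (z0, t0)) ?F" by (intro tendsto_diff that Wcont t0p)
        then have "\<forall>\<^sub>F z in ?F. U z - W \<delta> z < 0" by (rule order_tendstoD) (use that in simp)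
        then show ?thesis by eventually_elim simp
      qed
      have sube: "?D \<times> {0<..<T1} \<subseteq> \<Omega> \<times> {0<..}" by auto
      show ?thesis
      proof (cases "z0 \<in> \<Omega>")
        case False
        then have "z0 \<in> frontier \<Omega>" using z0c op by (simp add: frontier_def interior_open)
        from Ub[OF this t0p] obtain b' where b': "b' \<le> b" "(U \<longlongrightarrow> b') (at (z0, t0) within \<Omega> \<times> {0<..})" by blast
        have "h z0 \<le> 0" using chart[OF z0c2] False by (simp add: h_def not_less)
        then have "a * h z0 * t0 powr (-1/2) \<le> 0" using a by (simp add: mult_nonneg_nonpos mult_nonpos_nonneg)
        then have "1 \<le> Erfc (a * h z0 * t0 powr (-1/2))" using Erfc_antimono Erfc_0 by metis
        then have "b * 1 \<le> b * Erfc (a * h z0 * t0 powr (-1/2))" using b by (intro mult_left_mono) auto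
        moreover have "0 < \<eta>2 * exp (- kk * h2 z0)" "0 \<le> K * t0 powr (1/2)"
          "0 \<le> \<delta> * (t0 powr (-1/8) * exp (- (A * (h z0)\<^sup>2 * t0 powr (-1))))" using \<eta>2 K \<delta> by auto
        ultimately have "b < W \<delta> (z0, t0)" unfolding W_def fst_conv snd_conv by linarith
        then show ?thesis using b' by (intro lim[OF tendsto_within_subset[OF b'(2) sube]]) auto
      next
        case True
        then have nr: "norm (z0 - y) = r" using z0D z0c by (auto simp: dist_norm norm_minus_commute)
        show ?thesis
        proof (cases "h z0 \<le> r\<^sup>2 / 2")
          case True
          then have "r\<^sup>2 / 2 \<le> - h2 z0" using nr by (simp add: h2_def)
          then have "kk * (r\<^sup>2 / 2) \<le> kk * (- h2 z0)" using kk by (intro mult_left_mono) auto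
          then have "\<eta>2 * exp (kk * (r\<^sup>2 / 2)) \<le> \<eta>2 * exp (- kk * h2 z0)" using \<eta>2 by simp
          then have "M < W \<delta> (z0, t0)" using kkM Wpos(2)[OF \<delta>, of "(z0, t0)"] by simp
          then have "\<forall>\<^sub>F z in ?F. M < W \<delta> z" by (rule order_tendstoD[OF Wcont[OF t0p]])
          with inQ show ?thesis
          proof eventually_elim
            case (elim z)
            then have "U z \<le> M" using sube by (intro UM) blast
            then show ?case using elim(2) by linarith
          qed
        next
          case False
          have "(r\<^sup>2 / 2)\<^sup>2 \<le> (h z0)\<^sup>2" using False by (intro power_mono) auto
          then have "(c / 16 * (r\<^sup>2 / 2)\<^sup>2) / t0 \<le> (c / 16) * (h z0)\<^sup>2 / t0"
            using C t0p by (intro divide_right_mono mult_left_mono) auto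
          then have "C * M * exp (- (c / 16) * (h z0)\<^sup>2 / t0) \<le> C * M * exp (- (c / 16 * (r\<^sup>2 / 2)\<^sup>2) / t0)"
            using C M by (intro mult_left_mono) auto
          then have "U (z0, t0) < e" using decay[OF True z0c(2) t0p] T1d[OF t0p t0(2)] by linarith
          also have "e \<le> \<eta>2 * exp (- kk * h2 z0)"
          proof -
            have "h2 z0 \<le> 2 * r" using hb[OF True z0c(2)] zero_le_power2[of "norm (z0 - y)"] unfolding h2_def by linarith
            then show ?thesis using kk \<eta>2 by (simp add: e_def)
          qed
          also have "\<dots> \<le> W \<delta> (z0, t0)" using Wpos(2)[OF \<delta>, of "(z0, t0)"] by simp
          finally have lt: "U (z0, t0) < W \<delta> (z0, t0)" .
          have "continuous_on (\<Omega> \<times> {0<..}) U" using sub by (simp add: viscosity_subsolution_def)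
          then have "(U \<longlongrightarrow> U (z0, t0)) (at (z0, t0) within \<Omega> \<times> {0<..})"
            unfolding continuous_on using True t0p by auto
          then show ?thesis by (intro lim[OF tendsto_within_subset[OF _ sube] lt])
        qed
      qed
    qed
  qed (use z t in auto)
  \<comment> \<open>Close to \<open>y\<close> and at small times the term with \<open>K\<close> and the last one cost at most \<open>\<eta> / 2\<close> each.\<close>
  define r' where "r' = min r (sqrt (1 / (2 * kk)))"
  define t0 where "t0 = min T1 ((\<eta> / (2 * K))\<^sup>2)"
  have r': "r' > 0" "r' \<le> r" "r'\<^sup>2 \<le> 1 / (2 * kk)"
  proof -
    show "r' > 0" "r' \<le> r" using r kk by (auto simp: r'_def)
    have "r'\<^sup>2 \<le> (sqrt (1 / (2 * kk)))\<^sup>2" using \<open>r' > 0\<close> by (intro power_mono) (auto simp: r'_def)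
    then show "r'\<^sup>2 \<le> 1 / (2 * kk)" using kk by simp
  qed
  have "U (z, t) \<le> b * Erfc (a * (z \<bullet> \<nu> - g z) / sqrt t) + \<eta>"
    if z: "z \<in> \<Omega> \<inter> ball y r'" and t: "0 < t" "t < t0" for z t
  proof -
    have zD: "z \<in> ?D" using z r' by auto
    have tT: "t < T1" using t by (simp add: t0_def)
    have "((\<lambda>\<delta>. W \<delta> (z, t)) \<longlongrightarrow> W 0 (z, t)) (at_right 0)"
      unfolding W_def by (intro tendsto_intros)
    moreover have "\<forall>\<^sub>F \<delta> in at_right 0. U (z, t) \<le> W \<delta> (z, t)"
      using main[OF _ zD t(1) tT] eventually_at_right_less[of 0] by (auto elim: eventually_mono)
    ultimately have le: "U (z, t) \<le> W 0 (z, t)"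
      by (intro tendsto_lowerbound[of "\<lambda>\<delta>. W \<delta> (z, t)" _ "at_right (0::real)"]) auto
    have "sqrt t \<le> sqrt ((\<eta> / (2 * K))\<^sup>2)" using t by (intro real_sqrt_le_mono) (auto simp: t0_def)
    also have "\<dots> = \<eta> / (2 * K)" using \<open>\<eta> > 0\<close> K by simp
    finally have "K * sqrt t \<le> \<eta> / 2" using K by (simp add: field_simps)
    moreover have "\<eta>2 * exp (- kk * h2 z) \<le> \<eta> / 2"
    proof -
      have "norm (z - y) < r'" using z by (simp add: dist_norm norm_minus_commute)
      then have "(norm (z - y))\<^sup>2 \<le> r'\<^sup>2" by (intro power_mono) auto
      then have "(norm (z - y))\<^sup>2 \<le> 1 / (2 * kk)" using r'(3) by linarith
      moreover have "0 < h z" using hb(1)[of z] zD by auto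
      ultimately have "- h2 z \<le> 1 / (2 * kk)" unfolding h2_def by linarith
      then have "kk * (- h2 z) \<le> kk * (1 / (2 * kk))" using kk by (intro mult_left_mono) auto
      then have "- kk * h2 z \<le> 1 / 2" using kk by simp
      then have "exp (- kk * h2 z) \<le> exp (1 / 2)" by simp
      also have "\<dots> \<le> 2" using exp_half_le2 by simp
      finally show ?thesis using \<eta>2 by (simp add: \<eta>2_def)
    qed
    moreover have "W 0 (z, t) = b * Erfc (a * (z \<bullet> \<nu> - g z) / sqrt t) + K * sqrt t + \<eta>2 * exp (- kk * h2 z)"
      using t powr_minus_half[OF t(1)] by (simp add: W_def h_def powr_half_sqrt)
    ultimately show ?thesis using le by linarith
  qed
  moreover have "t0 > 0" using T1 \<open>\<eta> > 0\<close> K by (simp add: t0_def)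
  ultimately show ?thesis using r'(1) by blast
qed

section \<open>The lower barrier\<close>

text \<open>The time derivative of the Erfc term has the sign opposite to that in the upper barrier, so
  now the diffusivity \<open>1 / (4 a\<^sup>2)\<close> has to be at most \<open>q1\<close>.\<close>

lemma lower_barrier_arith:
  fixes a He He2 K t q1 e1 q2 e2 kk \<phi> \<sigma> E E0 :: real
  assumes t: "0 < t" "t \<le> 1" and a: "a > 0"
    and phi: "0 \<le> \<phi>" "\<phi> \<le> 2" and \<sigma>: "0 \<le> \<sigma>"
    and q1: "1 / (4 * a\<^sup>2) \<le> q1" and q2: "\<bar>q2\<bar> \<le> 2"
    and e1: "\<bar>e1\<bar> \<le> He" and e2: "\<bar>e2\<bar> \<le> He2"
    and E: "0 \<le> E" "E \<le> E0" and kk: "kk \<ge> 0"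
    and K: "K > 4 * a * He + 2 * (E0 * (2 * kk\<^sup>2 + kk * He2))"
  shows "(- (2 * \<phi> * \<sigma> * (a / sqrt t) * (a / sqrt t))) * q1 + (\<phi> * (a / sqrt t)) * e1 + (E * kk\<^sup>2) * q2 + (E * kk) * e2
     < - (\<phi> * \<sigma> / (2 * t)) + K * (1 / (2 * sqrt t))"
proof -
  define s where "s = sqrt t"
  have s: "0 < s" "s \<le> 1" "s * s = t" using t by (auto simp: s_def)
  have I1: "(- (2 * \<phi> * \<sigma> * (a / s) * (a / s))) * q1 \<le> - (\<phi> * \<sigma> / (2 * t))"
  proof -
    have "2 * \<phi> * \<sigma> * (a / s) * (a / s) * q1 \<ge> 2 * \<phi> * \<sigma> * (a / s) * (a / s) * (1 / (4 * a\<^sup>2))"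
      by (intro mult_left_mono q1) (use phi a \<sigma> s in auto)
    moreover have "2 * \<phi> * \<sigma> * (a / s) * (a / s) * (1 / (4 * a\<^sup>2)) = \<phi> * \<sigma> / (2 * t)"
      using a s by (simp add: field_simps power2_eq_square)
    ultimately show ?thesis by simp
  qed
  have I2: "(\<phi> * (a / s)) * e1 \<le> 2 * a * He / s"
  proof -
    have "(\<phi> * (a / s)) * e1 \<le> \<bar>(\<phi> * (a / s)) * e1\<bar>" by (rule abs_ge_self)
    also have "\<dots> = (a / s) * (\<phi> * \<bar>e1\<bar>)" using phi a s by (simp add: abs_mult)
    also have "\<dots> \<le> (a / s) * (2 * He)"
      by (intro mult_left_mono mult_mono) (use phi e1 a s in auto)
    finally show ?thesis by (simp add: field_simps)
  qed
  have I4: "(E * kk\<^sup>2) * q2 + (E * kk) * e2 \<le> E0 * (2 * kk\<^sup>2 + kk * He2)"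
  proof -
    have "kk\<^sup>2 * q2 \<le> kk\<^sup>2 * 2" by (intro mult_left_mono) (use q2 in auto)
    moreover have "kk * e2 \<le> kk * He2" by (intro mult_left_mono) (use e2 kk in auto)
    ultimately have "E * (kk\<^sup>2 * q2 + kk * e2) \<le> E * (2 * kk\<^sup>2 + kk * He2)"
      using E by (intro mult_left_mono) auto
    also have "\<dots> \<le> E0 * (2 * kk\<^sup>2 + kk * He2)"
      by (intro mult_right_mono) (use E kk e2 in \<open>auto intro!: add_nonneg_nonneg mult_nonneg_nonneg\<close>)
    finally show ?thesis by (simp add: algebra_simps)
  qed
  have E00: "0 \<le> E0 * (2 * kk\<^sup>2 + kk * He2)"
    using E kk e2 by (intro mult_nonneg_nonneg add_nonneg_nonneg) auto
  have I5: "2 * a * He / s + E0 * (2 * kk\<^sup>2 + kk * He2) < K * (1 / (2 * s))"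
  proof -
    have "E0 * (2 * kk\<^sup>2 + kk * He2) \<le> E0 * (2 * kk\<^sup>2 + kk * He2) / s"
      unfolding pos_le_divide_eq[OF s(1)] using mult_left_mono[OF s(2) E00] by simp
    moreover have "(4 * a * He + 2 * (E0 * (2 * kk\<^sup>2 + kk * He2))) / (2 * s) < K / (2 * s)"
      using K s by (intro divide_strict_right_mono) auto
    moreover have "(4 * a * He + 2 * (E0 * (2 * kk\<^sup>2 + kk * He2))) / (2 * s) = 2 * a * He / s + E0 * (2 * kk\<^sup>2 + kk * He2) / s"
      using s by (simp add: field_simps)
    ultimately show ?thesis by (simp only: times_divide_eq_right mult_1_right)
  qed
  show ?thesis using I1 I2 I4 I5 unfolding s_def[symmetric] by linarith
qed

text \<open>Here \<open>U\<close> is \<open>- u\<close> and the barrier is \<open>- Erfc (a (h + \<delta>) / sqrt t) + K sqrt t + (\<eta> / 4) exp (kk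
  h2)\<close> with \<open>h2 = h + |z - y|\<^sup>2\<close>, increasing in \<open>h\<close>. The shift by \<open>\<delta>\<close> makes the Erfc term
  negligible at small times, even at the corner; there the upper barrier with \<open>b = 0\<close> has
  already shown that \<open>U\<close> is at most a small fraction of \<open>\<eta>\<close>.\<close>

lemma boundary_lower_barrier:
  fixes \<Omega> :: "(real^'n) set" and U :: "(real^'n) \<times> real \<Rightarrow> real"
  assumes p1: "1 < p" and op: "open \<Omega>" and sub: "viscosity_subsolution p \<Omega> U"
    and gr: "local_C2_graph \<Omega> y \<nu> g" and g0: "grad g y = 0" and gy: "g y = y \<bullet> \<nu>"
    and M: "M > 0" and UM: "\<And>z. z \<in> \<Omega> \<times> {0<..} \<Longrightarrow> U z \<le> M"
    and U0: "\<And>z0. z0 \<in> \<Omega> \<Longrightarrow> (U \<longlongrightarrow> 0) (at (z0, 0) within \<Omega> \<times> {0<..})"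
    and Ub: "\<And>z0 t0. z0 \<in> frontier \<Omega> \<Longrightarrow> t0 > 0 \<Longrightarrow> (U \<longlongrightarrow> - 1) (at (z0, t0) within \<Omega> \<times> {0<..})"
    and a: "a > 0" "4 * a\<^sup>2 > conj_exp p" and "\<eta> > 0"
  shows "\<exists>r>0. \<exists>t0>0. \<forall>z\<in>\<Omega> \<inter> ball y r. \<forall>t. 0 < t \<and> t < t0 \<longrightarrow>
     U (z, t) \<le> - Erfc (a * (z \<bullet> \<nu> - g z) / sqrt t) + \<eta>"
proof -
  note ip = inverse_exponent_bounds[OF p1]
  have c2: "C2_on UNIV g" and n\<nu>: "norm \<nu> = 1" using gr by (auto simp: local_C2_graph_def)
  have "\<exists>r>0. \<exists>t0>0. \<forall>z\<in>\<Omega> \<inter> ball y r. \<forall>t. 0 < t \<and> t < t0 \<longrightarrow>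
     U (z, t) \<le> 0 * Erfc (sqrt (conj_exp p / 8) * (z \<bullet> \<nu> - g z) / sqrt t) + \<eta> / 8"
  proof (rule boundary_upper_barrier[OF p1 op sub gr g0 gy M UM U0])
    show "\<exists>b'\<le>0. (U \<longlongrightarrow> b') (at (z0, t0) within \<Omega> \<times> {0<..})" if "z0 \<in> frontier \<Omega>" "t0 > 0" for z0 t0
      using Ub[OF that] by (intro exI[of _ "-1"]) auto
  qed (use ip(4) \<open>\<eta> > 0\<close> in auto)
  then obtain rI tI where rI: "rI > 0" "tI > 0"
    and init: "\<And>z t. z \<in> \<Omega> \<Longrightarrow> z \<in> ball y rI \<Longrightarrow> 0 < t \<Longrightarrow> t < tI \<Longrightarrow> U (z, t) \<le> \<eta> / 8"
    by (fastforce simp: Bex_def)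
  define c0 where "c0 = 1 / conj_exp p"
  have c0: "0 < c0" "c0 \<le> 1"
  proof -
    show "0 < c0" unfolding c0_def using ip(4) by (simp only: zero_less_divide_1_iff)
    show "c0 \<le> 1" unfolding c0_def using ip(1,3) by linarith
  qed
  have c0a: "1 / (4 * a\<^sup>2) < c0" using a ip(4) by (simp add: c0_def field_simps)
  define \<epsilon> where "\<epsilon> = min (1/4) (min (c0/100) ((c0 - 1 / (4 * a\<^sup>2))/25))"
  have \<epsilon>: "\<epsilon> > 0" "\<epsilon> \<le> 1/4" "25 * \<epsilon> \<le> c0/4" "25 * \<epsilon> \<le> c0 - 1 / (4 * a\<^sup>2)"
  proof -
    define e3 where "e3 = (c0 - 1 / (4 * a\<^sup>2)) / 25"
    have "e3 > 0" using c0a by (simp add: e3_def)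
    then show "\<epsilon> > 0" using c0 unfolding \<epsilon>_def e3_def[symmetric] by simp
    have "\<epsilon> \<le> 1/4" "\<epsilon> \<le> c0/100" "\<epsilon> \<le> e3" unfolding \<epsilon>_def e3_def[symmetric] by (simp_all add: min_def)
    then show "\<epsilon> \<le> 1/4" "25 * \<epsilon> \<le> c0/4" "25 * \<epsilon> \<le> c0 - 1 / (4 * a\<^sup>2)" by (simp_all add: e3_def)
  qed
  obtain r1 H where r1: "r1 > 0" and H: "H > 0"
    and chart: "\<And>z. z \<in> cball y (2 * r1) \<Longrightarrow> z \<in> \<Omega> \<longleftrightarrow> 0 < z \<bullet> \<nu> - g z"
    and gle: "\<And>z. z \<in> cball y (2 * r1) \<Longrightarrow> norm (grad g z) \<le> \<epsilon> / 2"
    and Hle: "\<And>z. z \<in> cball y (2 * r1) \<Longrightarrow> norm (hessian g z) \<le> H"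
    and Lip: "\<And>z z'. z \<in> cball y (2 * r1) \<Longrightarrow> z' \<in> cball y (2 * r1) \<Longrightarrow>
      \<bar>(z \<bullet> \<nu> - g z) - (z' \<bullet> \<nu> - g z')\<bar> \<le> 2 * norm (z - z')"
    by (rule local_chart[OF gr g0, of "\<epsilon> / 2"]) (use \<epsilon> in auto)
  define h where "h z = z \<bullet> \<nu> - g z" for z
  define N1 where "N1 = real CARD('n) + 1"
  define S where "S = norm (mat 1 :: real^'n^'n)"
  define He where "He = N1 * H"
  define He2 where "He2 = N1 * (H + 2 * S)"
  have N1: "N1 > 0" by (simp add: N1_def)
  have He: "He > 0" using N1 H by (simp add: He_def)
  define r where "r = min r1 (min (\<epsilon> / 4) (rI / 2))"
  have r: "r > 0" "r \<le> r1" "r \<le> \<epsilon> / 4" "r < rI" using r1 \<epsilon> rI by (auto simp: r_def)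
  define h2 where "h2 z = h z + 1 * (norm (z - y))\<^sup>2" for z
  define \<eta>2 where "\<eta>2 = \<eta> / 4"
  have \<eta>2: "\<eta>2 > 0" using \<open>\<eta> > 0\<close> by (simp add: \<eta>2_def)
  \<comment> \<open>Large enough that the last term exceeds \<open>M + 1\<close> where \<open>|z - y| = r\<close>.\<close>
  define kk where "kk = ln ((M + 1) / \<eta>2 + 1) / r\<^sup>2"
  have "0 < ln ((M + 1) / \<eta>2 + 1)" by (rule ln_gt_zero) (use M \<eta>2 in simp)
  then have kk: "kk > 0" using r by (simp add: kk_def)
  have kkM: "\<eta>2 * exp (kk * r\<^sup>2) > M + 1"
  proof -
    have "kk * r\<^sup>2 = ln ((M + 1) / \<eta>2 + 1)" using r by (simp add: kk_def)
    then have "exp (kk * r\<^sup>2) = (M + 1) / \<eta>2 + 1" using M \<eta>2 by (simp add: add_pos_pos)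
    then show ?thesis using \<eta>2 by (simp add: field_simps)
  qed
  have hb: "0 < h z" "h z \<le> 2 * norm (z - y)" if "z \<in> \<Omega>" "z \<in> cball y r" for z
  proof -
    have z: "z \<in> cball y (2 * r1)" "y \<in> cball y (2 * r1)" using that r by auto
    show "0 < h z" using chart[OF z(1)] that by (simp add: h_def)
    have "\<bar>h z - h y\<bar> \<le> 2 * norm (z - y)" using Lip[OF z] by (simp add: h_def)
    then show "h z \<le> 2 * norm (z - y)" by (simp add: h_def gy)
  qed
  define T1 where "T1 = min 1 tI"
  have T1: "T1 > 0" "T1 \<le> 1" "T1 \<le> tI" using rI by (auto simp: T1_def)
  define E0 where "E0 = \<eta>2 * exp (kk * (2 * r + r\<^sup>2))"
  define K where "K = 4 * a * He + 2 * (E0 * (2 * kk\<^sup>2 + kk * He2)) + 1"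
  have E0: "E0 > 0" using \<eta>2 by (simp add: E0_def)
  have He2: "He2 \<ge> 0" using N1 H by (auto simp: He2_def S_def intro!: mult_nonneg_nonneg add_nonneg_nonneg)
  have K: "K > 0" using a He E0 kk He2
    unfolding K_def by (intro add_nonneg_pos add_nonneg_nonneg mult_nonneg_nonneg) auto
  let ?D = "\<Omega> \<inter> ball y r"
  define W where "W \<delta> z = (-1) * Erfc (a * (h (fst z) + \<delta>) * snd z powr (-1/2)) + K * snd z powr (1/2)
     + \<eta>2 * exp (kk * h2 (fst z))" for \<delta> and z :: "(real^'n) \<times> real"
  have C2h: "C2_on V (\<lambda>z. h (fst z))" for V :: "((real^'n) \<times> real) set"
    using C2_on_fst[OF C2_on_diff[OF C2_on_inner c2]] unfolding h_def .
  have C2n: "C2_on V (\<lambda>z. (norm (fst z - y))\<^sup>2)" for V :: "((real^'n) \<times> real) set"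
    by (rule C2_on_fst[OF C2_on_norm2])
  have C2W': "C2_on (V \<times> {0<..}) (W \<delta>)" for \<delta> V
    unfolding W_def h2_def
    by (intro C2_on_add C2_on_mult C2_on_cmult C2_on_exp C2_on_minus C2_on_Erfc C2h C2n C2_on_powr C2_on_snd C2_on_const) auto
  have Wge: "W \<delta> z \<ge> \<eta>2 * exp (kk * h2 (fst z)) - Erfc (a * (h (fst z) + \<delta>) * snd z powr (-1/2))" for \<delta> z
    using K unfolding W_def by simp
  have Wcont: "(W \<delta> \<longlongrightarrow> W \<delta> (z0, t0)) (at (z0, t0) within V)" if "t0 > 0" for \<delta> z0 t0 V
  proof -
    have "isCont (W \<delta>) (z0, t0)"
      using C2W'[of UNIV \<delta>] unfolding C2_on_def using that by (auto intro: has_derivative_continuous)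
    then show ?thesis by (meson continuous_at_imp_continuous_at_within continuous_within)
  qed
  have main: "U (z, t) \<le> W \<delta> (z, t)" if \<delta>: "\<delta> > 0" and z: "z \<in> ?D" and t: "0 < t" "t < T1" for \<delta> z t
  proof (rule comparison[OF sub op _ _ _ T1(1) UM C2W', where D="?D" and B=2])
    show "open ?D" "?D \<subseteq> \<Omega>" "bounded ?D" using op by auto
    show "- 2 \<le> W \<delta> z" for z
    proof -
      have "0 < \<eta>2 * exp (kk * h2 (fst z))" using \<eta>2 by simp
      then show ?thesis using Wge[of z \<delta>] Erfc_le_2[of "a * (h (fst z) + \<delta>) * snd z powr (-1/2)"] by linarith
    qed
  next
    fix z t assume z: "z \<in> ?D" and t: "0 < t" "t < T1"
    have zc: "z \<in> cball y (2 * r1)" using z r by auto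
    have nz: "norm (z - y) \<le> r" using z by (simp add: dist_norm norm_minus_commute)
    have hz: "0 < h z" "h z \<le> 2 * r" using hb[of z] z nz by auto
    note J = height_jets[OF c2]
    let ?k = "t powr (-1/2)"
    define P where "P = (\<lambda>r. (-1) * Erfc (a * (r + \<delta>) * ?k) + K * t powr (1/2))"
    define P' where "P' = (\<lambda>r. (-1) * (- (2 / sqrt pi * exp (- (a * (r + \<delta>) * ?k)\<^sup>2)) * (a * ?k)))"
    define P2 where "P2 = (\<lambda>r. (-1) * ((4 / sqrt pi * (a * (r + \<delta>) * ?k) * exp (- (a * (r + \<delta>) * ?k)\<^sup>2)) * (a * ?k) * (a * ?k)))"
    define \<sigma> where "\<sigma> = (a * (h z + \<delta>)) / sqrt t"
    show "strict_supersolution_at p (W \<delta>) z t"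
    proof (rule two_profile_strict_supersolution[OF p1 n\<nu> \<epsilon>(2), where s=1])
      show "has_jet h z (\<nu> - grad g z) (- hessian g z)" unfolding h_def by (rule J)
      show "has_jet h2 z (\<nu> - grad g z + 1 *\<^sub>R (2 *\<^sub>R (z - y))) (- hessian g z + 1 *\<^sub>R (2 *\<^sub>R mat 1))"
        unfolding h2_def h_def by (rule J)
      show "norm (\<nu> - grad g z - \<nu>) \<le> \<epsilon>" using gle[OF zc] \<epsilon> by simp
      have "norm (\<nu> - grad g z + 1 *\<^sub>R (2 *\<^sub>R (z - y)) - \<nu>) = norm (2 *\<^sub>R (z - y) - grad g z)"
        by (simp add: algebra_simps)
      also have "\<dots> \<le> 2 * r + \<epsilon> / 2"
        by (rule order_trans[OF norm_triangle_ineq4]) (use gle[OF zc] nz in auto)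
      finally show "norm (\<nu> - grad g z + 1 *\<^sub>R (2 *\<^sub>R (z - y)) - \<nu>) \<le> \<epsilon>" using r by simp
      show "(P has_real_derivative P' r) (at r)" for r
      proof -
        have "(P has_real_derivative (-1) * (- (2 / sqrt pi * exp (- (a * (r + \<delta>) * ?k)\<^sup>2)) * (a * ?k)) + 0) (at r)"
          unfolding P_def by (intro DERIV_add DERIV_cmult erfc_profile_derivatives DERIV_const)
        then show ?thesis by (simp add: P'_def)
      qed
      show "(P' has_real_derivative P2 (h z)) (at (h z))"
        unfolding P'_def P2_def by (intro DERIV_cmult erfc_profile_derivatives)
      show "((\<lambda>r. \<eta>2 * exp (kk * r)) has_real_derivative \<eta>2 * kk * exp (kk * r)) (at r)"
        "((\<lambda>r. \<eta>2 * kk * exp (kk * r)) has_real_derivative \<eta>2 * kk\<^sup>2 * exp (kk * h2 z)) (at (h2 z))" for r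
        by (rule exp_profile_derivatives)+
      show "0 \<le> 1 * P' (h z)" using a by (auto simp: P'_def)
      show "0 < 1 * (\<eta>2 * kk * exp (kk * h2 z))" using \<eta>2 kk by simp
      show "W \<delta> (x, t) = P (h x) + \<eta>2 * exp (kk * h2 x)" for x
        by (simp add: W_def P_def)
      show "((\<lambda>s. W \<delta> (z, s)) has_real_derivative
         (-1) * (2 / sqrt pi * exp (- \<sigma>\<^sup>2) * \<sigma> / (2 * t)) + K * (1 / (2 * sqrt t)) + 0) (at t)"
        unfolding W_def fst_conv snd_conv \<sigma>_def
        by (intro DERIV_add DERIV_cmult Erfc_time_derivative sqrt_time_derivative DERIV_const t)
      fix q1 e1 q2 e2
      assume q1: "\<bar>q1 - 1 / conj_exp p\<bar> \<le> 25 * \<epsilon>" and q2: "\<bar>q2 - 1 / conj_exp p\<bar> \<le> 25 * \<epsilon>"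
        and e1: "\<bar>e1\<bar> \<le> (real CARD('n) + 1) * norm (- hessian g z)"
        and e2: "\<bar>e2\<bar> \<le> (real CARD('n) + 1) * norm (- hessian g z + 1 *\<^sub>R (2 *\<^sub>R (mat 1 :: real^'n^'n)))"
      define \<phi> where "\<phi> = 2 / sqrt pi * exp (- \<sigma>\<^sup>2)"
      define E where "E = \<eta>2 * exp (kk * h2 z)"
      have phi: "0 \<le> \<phi>" "\<phi> \<le> 2"
      proof -
        have "1 \<le> sqrt pi" using pi_ge_two by simp
        then have "2 / sqrt pi * exp (- \<sigma>\<^sup>2) \<le> 2 * 1"
          by (intro mult_mono) (auto simp: field_simps)
        then show "\<phi> \<le> 2" by (simp add: \<phi>_def)
      qed (simp add: \<phi>_def)
      have e1': "\<bar>e1\<bar> \<le> He"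
      proof -
        have "N1 * norm (hessian g z) \<le> He" unfolding He_def by (intro mult_left_mono Hle[OF zc]) (use N1 in auto)
        then show ?thesis using e1 unfolding N1_def norm_minus_cancel by linarith
      qed
      have e2': "\<bar>e2\<bar> \<le> He2"
      proof -
        have "norm (- hessian g z + 1 *\<^sub>R (2 *\<^sub>R (mat 1 :: real^'n^'n))) \<le> H + 2 * S"
          by (rule order_trans[OF norm_triangle_ineq]) (use Hle[OF zc] in \<open>simp add: S_def\<close>)
        from mult_left_mono[OF this, of N1] e2 N1 show ?thesis unfolding He2_def N1_def by linarith
      qed
      have EE: "0 \<le> E" "E \<le> E0"
      proof -
        have "(norm (z - y))\<^sup>2 \<le> r\<^sup>2" using nz by (intro power_mono) auto
        then have "h2 z \<le> 2 * r + r\<^sup>2" using hz(2) unfolding h2_def by linarith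
        then have "kk * h2 z \<le> kk * (2 * r + r\<^sup>2)" using kk by (intro mult_left_mono) auto
        then show "E \<le> E0" using \<eta>2 by (simp add: E_def E0_def)
      qed (use \<eta>2 in \<open>simp add: E_def\<close>)
      have k: "?k = 1 / sqrt t" using powr_minus_half[OF t(1)] by simp
      have arith: "(- (2 * \<phi> * \<sigma> * (a / sqrt t) * (a / sqrt t))) * q1 + (\<phi> * (a / sqrt t)) * e1 + (E * kk\<^sup>2) * q2 + (E * kk) * e2
     < - (\<phi> * \<sigma> / (2 * t)) + K * (1 / (2 * sqrt t))"
      proof (rule lower_barrier_arith[where He=He and ?He2.0=He2 and ?E0.0=E0])
        show "1 / (4 * a\<^sup>2) \<le> q1" using q1 \<epsilon> c0 unfolding c0_def[symmetric] by linarith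
        show "\<bar>q2\<bar> \<le> 2" using q2 \<epsilon> c0 unfolding c0_def[symmetric] by linarith
        show "4 * a * He + 2 * (E0 * (2 * kk\<^sup>2 + kk * He2)) < K" by (simp add: K_def)
        show "0 \<le> \<sigma>" using a hz \<delta> t by (simp add: \<sigma>_def)
      qed (use t T1 a phi e1' e2' EE kk in auto)
      have P2e: "P2 (h z) = - (2 * \<phi> * \<sigma> * (a / sqrt t) * (a / sqrt t))"
        unfolding P2_def k \<phi>_def \<sigma>_def by (simp add: mult_ac)
      have P1e: "P' (h z) = \<phi> * (a / sqrt t)"
        unfolding P'_def k \<phi>_def \<sigma>_def by (simp add: mult_ac)
      have Ee: "\<eta>2 * kk\<^sup>2 * exp (kk * h2 z) = E * kk\<^sup>2" "\<eta>2 * kk * exp (kk * h2 z) = E * kk"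
        by (simp_all add: E_def)
      show "P2 (h z) * q1 + P' (h z) * e1 + \<eta>2 * kk\<^sup>2 * exp (kk * h2 z) * q2 + \<eta>2 * kk * exp (kk * h2 z) * e2
        < (-1) * (2 / sqrt pi * exp (- \<sigma>\<^sup>2) * \<sigma> / (2 * t)) + K * (1 / (2 * sqrt t)) + 0"
        unfolding Ee P2e P1e add_0_right \<phi>_def[symmetric] mult_minus1 by (rule arith)
    qed (rule J | simp)+
  next
    fix z0 t0 assume z0: "z0 \<in> closure ?D" and t0: "0 \<le> t0" "t0 \<le> T1" and bd: "z0 \<notin> ?D \<or> t0 = 0"
    let ?F = "at (z0, t0) within ?D \<times> {0<..<T1}"
    have inQ: "\<forall>\<^sub>F z in ?F. z \<in> ?D \<times> {0<..<T1}" by (auto simp: eventually_at_filter)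
    have z0c: "z0 \<in> closure \<Omega>" "z0 \<in> cball y r"
    proof -
      show "z0 \<in> closure \<Omega>" using z0 closure_mono[of ?D \<Omega>] by auto
      have "?D \<subseteq> cball y r" by auto
      from closure_mono[OF this] show "z0 \<in> cball y r" using z0 by auto
    qed
    have h0: "0 \<le> h z0"
    proof -
      have "continuous_on UNIV g" using C2_on_UNIV_jet(4)[OF c2]
        by (meson continuous_at_imp_continuous_on has_derivative_continuous)
      then have "closed {z. 0 \<le> h z}"
        unfolding h_def by (intro closed_Collect_le continuous_intros)
      moreover have "?D \<subseteq> {z. 0 \<le> h z}" using hb by (force simp: less_imp_le)
      ultimately show ?thesis using closure_minimal z0 by blast
    qed
    show "\<forall>\<^sub>F z in ?F. U z \<le> W \<delta> z"
    proof (cases "t0 = 0")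
      case True
      have "\<forall>\<^sub>F x in at_top. Erfc x < \<eta> / 8" using Erfc_tendsto_0 \<open>\<eta> > 0\<close> by (intro order_tendstoD) auto
      then obtain X where X: "\<And>x. x \<ge> X \<Longrightarrow> Erfc x < \<eta> / 8" by (auto simp: eventually_at_top_linorder)
      \<comment> \<open>Before the time \<open>t1\<close> the shifted argument of Erfc is at least \<open>X\<close>, uniformly in space.\<close>
      define t1 where "t1 = (a * \<delta> / (\<bar>X\<bar> + 1))\<^sup>2"
      have t1: "t1 > 0" using \<delta> a by (simp add: t1_def)
      have "((\<lambda>z. snd z) \<longlongrightarrow> t0) ?F" by (intro tendsto_eq_intros refl | simp)+
      then have "\<forall>\<^sub>F z in ?F. snd z < t1" using t1 True by (intro order_tendstoD) auto
      with inQ show ?thesis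
      proof eventually_elim
        case (elim z')
        obtain x s where xs: "z' = (x, s)" by fastforce
        have x: "x \<in> \<Omega>" "x \<in> cball y r" "x \<in> ball y rI" and s: "0 < s" "s < t1" "s < tI" using elim xs r T1 by auto
        have "sqrt s \<le> sqrt t1" using s by simp
        also have "\<dots> = a * \<delta> / (\<bar>X\<bar> + 1)" using a \<delta> by (simp add: t1_def)
        finally have "\<bar>X\<bar> + 1 \<le> a * \<delta> / sqrt s" using s by (simp add: field_simps)
        also have "\<dots> \<le> a * (h x + \<delta>) / sqrt s"
          using hb(1)[OF x(1,2)] a s by (intro divide_right_mono mult_left_mono) auto
        finally have "Erfc (a * (h x + \<delta>) / sqrt s) < \<eta> / 8" by (intro X) linarith
        moreover have "1 \<le> exp (kk * h2 x)" using kk hb(1)[OF x(1,2)] by (simp add: h2_def)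
        then have "\<eta>2 * 1 \<le> \<eta>2 * exp (kk * h2 x)" using \<eta>2 by (intro mult_left_mono) auto
        moreover have "U (x, s) \<le> \<eta> / 8" by (rule init[OF x(1,3) s(1,3)])
        ultimately show ?case using Wge[of z' \<delta>] powr_minus_half[OF s(1)] unfolding xs by (simp add: \<eta>2_def)
      qed
    next
      case False
      then have t0p: "t0 > 0" using t0 by simp
      have z0D: "z0 \<notin> ?D" using bd False by simp
      have sube: "?D \<times> {0<..<T1} \<subseteq> \<Omega> \<times> {0<..}" by auto
      have le1: "Erfc (a * (h z0 + \<delta>) * t0 powr (-1/2)) \<le> 1"
        using h0 a \<delta> by (intro Erfc_le_1 mult_nonneg_nonneg) auto
      show ?thesis
      proof (cases "z0 \<in> \<Omega>")
        case False
        then have "z0 \<in> frontier \<Omega>" using z0c op by (simp add: frontier_def interior_open)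
        from tendsto_within_subset[OF Ub[OF this t0p] sube]
        have "((\<lambda>z. U z - W \<delta> z) \<longlongrightarrow> - 1 - W \<delta> (z0, t0)) ?F" by (intro tendsto_diff Wcont t0p)
        moreover have "0 < \<eta>2 * exp (kk * h2 z0)" using \<eta>2 by simp
        then have "- 1 - W \<delta> (z0, t0) < 0" using Wge[of "(z0, t0)" \<delta>] le1 unfolding fst_conv snd_conv by linarith
        ultimately have "\<forall>\<^sub>F z in ?F. U z - W \<delta> z < 0" by (rule order_tendstoD)
        then show ?thesis by eventually_elim simp
      next
        case True
        then have nr: "norm (z0 - y) = r" using z0D z0c by (auto simp: dist_norm norm_minus_commute)
        then have "r\<^sup>2 \<le> h2 z0" using h0 by (simp add: h2_def)
        then have "kk * r\<^sup>2 \<le> kk * h2 z0" using kk by (intro mult_left_mono) auto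
        then have "\<eta>2 * exp (kk * r\<^sup>2) \<le> \<eta>2 * exp (kk * h2 z0)" using \<eta>2 by simp
        then have "M < W \<delta> (z0, t0)" using kkM Wge[of "(z0, t0)" \<delta>] le1 unfolding fst_conv snd_conv by linarith
        then have "\<forall>\<^sub>F z in ?F. M < W \<delta> z" by (rule order_tendstoD[OF Wcont[OF t0p]])
        with inQ show ?thesis
        proof eventually_elim
          case (elim z)
          then have "U z \<le> M" using sube by (intro UM) blast
          then show ?case using elim(2) by linarith
        qed
      qed
    qed
  qed (use z t in auto)
  define r' where "r' = min r (min 1 (1 / (6 * kk)))"
  define t0 where "t0 = min T1 ((\<eta> / (2 * K))\<^sup>2)"
  have r': "r' > 0" "r' \<le> r" "r' \<le> 1" "r' \<le> 1 / (6 * kk)" using r kk by (auto simp: r'_def)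
  have "U (z, t) \<le> - Erfc (a * (z \<bullet> \<nu> - g z) / sqrt t) + \<eta>"
    if z: "z \<in> \<Omega> \<inter> ball y r'" and t: "0 < t" "t < t0" for z t
  proof -
    have zD: "z \<in> ?D" using z r' by auto
    have tT: "t < T1" using t by (simp add: t0_def)
    have "((\<lambda>\<delta>. W \<delta> (z, t)) \<longlongrightarrow> W 0 (z, t)) (at_right 0)"
      unfolding W_def by (intro tendsto_intros isCont_tendsto_compose[OF isCont_Erfc])
    moreover have "\<forall>\<^sub>F \<delta> in at_right 0. U (z, t) \<le> W \<delta> (z, t)"
      using main[OF _ zD t(1) tT] eventually_at_right_less[of 0] by (auto elim: eventually_mono)
    ultimately have le: "U (z, t) \<le> W 0 (z, t)"
      by (intro tendsto_lowerbound[of "\<lambda>\<delta>. W \<delta> (z, t)" _ "at_right (0::real)"]) auto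
    have "sqrt t \<le> sqrt ((\<eta> / (2 * K))\<^sup>2)" using t by (intro real_sqrt_le_mono) (auto simp: t0_def)
    also have "\<dots> = \<eta> / (2 * K)" using \<open>\<eta> > 0\<close> K by simp
    finally have "K * sqrt t \<le> \<eta> / 2" using K by (simp add: field_simps)
    moreover have "\<eta>2 * exp (kk * h2 z) \<le> \<eta> / 2"
    proof -
      have n: "norm (z - y) < r'" using z by (simp add: dist_norm norm_minus_commute)
      then have "(norm (z - y))\<^sup>2 \<le> 1 * r'" unfolding power2_eq_square using r' by (intro mult_mono) auto
      moreover have "h z \<le> 2 * norm (z - y)" using hb(2)[of z] zD by auto
      ultimately have "h2 z \<le> 3 * r'" using n unfolding h2_def by linarith
      then have "kk * h2 z \<le> kk * (3 * (1 / (6 * kk)))" using kk r'(4) by (intro mult_left_mono) auto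
      then have "kk * h2 z \<le> 1 / 2" using kk by simp
      then have "exp (kk * h2 z) \<le> exp (1 / 2)" by simp
      also have "\<dots> \<le> 2" using exp_half_le2 by simp
      finally show ?thesis using \<eta>2 by (simp add: \<eta>2_def)
    qed
    moreover have "W 0 (z, t) = - Erfc (a * (z \<bullet> \<nu> - g z) / sqrt t) + K * sqrt t + \<eta>2 * exp (kk * h2 z)"
      using t powr_minus_half[OF t(1)] by (simp add: W_def h_def powr_half_sqrt)
    ultimately show ?thesis using le by linarith
  qed
  moreover have "t0 > 0" using T1 \<open>\<eta> > 0\<close> K by (simp add: t0_def)
  ultimately show ?thesis using r'(1) by blast
qed

section \<open>The boundary layer\<close>

lemma IBVP_solution_facts:
  fixes \<Omega> :: "(real^'n) set"
  assumes "bounded_IBVP_solution p \<Omega> u" "open \<Omega>"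
  shows "viscosity_subsolution p \<Omega> u" "viscosity_subsolution p \<Omega> (\<lambda>z. - u z)"
    "\<And>z0. z0 \<in> \<Omega> \<Longrightarrow> (u \<longlongrightarrow> 0) (at (z0, 0) within \<Omega> \<times> {0<..})"
    "\<And>z0 t0. z0 \<in> frontier \<Omega> \<Longrightarrow> t0 > 0 \<Longrightarrow> (u \<longlongrightarrow> 1) (at (z0, t0) within \<Omega> \<times> {0<..})"
    "\<exists>M>0. \<forall>z\<in>\<Omega> \<times> {0<..}. \<bar>u z\<bar> \<le> M"
proof -
  note a = assms(1)[unfolded bounded_IBVP_solution_def]
  show "viscosity_subsolution p \<Omega> u" "viscosity_subsolution p \<Omega> (\<lambda>z. - u z)"
    using viscosity_solution_subsolutions a assms(2) by blast+
  let ?S = "closure \<Omega> \<times> {0..} - frontier \<Omega> \<times> {0::real}"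
  have lim: "(u \<longlongrightarrow> u z) (at z within \<Omega> \<times> {0<..})" if "z \<in> ?S" for z
  proof -
    have "(u \<longlongrightarrow> u z) (at z within ?S)" using a that unfolding continuous_on by blast
    then show ?thesis by (rule tendsto_within_subset) (use closure_subset in auto)
  qed
  show "(u \<longlongrightarrow> 0) (at (z0, 0) within \<Omega> \<times> {0<..})" if "z0 \<in> \<Omega>" for z0
  proof -
    have "(z0, 0) \<in> ?S" using that assms(2) closure_subset by (auto simp: frontier_def interior_open)
    moreover have "u (z0, 0) = 0" using a that by blast
    ultimately show ?thesis using lim[of "(z0, 0)"] by simp
  qed
  show "(u \<longlongrightarrow> 1) (at (z0, t0) within \<Omega> \<times> {0<..})" if "z0 \<in> frontier \<Omega>" "t0 > 0" for z0 t0
  proof -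
    have "(z0, t0) \<in> ?S" using that by (auto simp: frontier_def)
    moreover have "u (z0, t0) = 1" using a that by blast
    ultimately show ?thesis using lim[of "(z0, t0)"] by simp
  qed
  obtain M where "M > 0" "\<forall>v\<in>u ` (\<Omega> \<times> {0<..}). norm v \<le> M" using a bounded_pos by metis
  then show "\<exists>M>0. \<forall>z\<in>\<Omega> \<times> {0<..}. \<bar>u z\<bar> \<le> M" by auto
qed

text \<open>The point \<open>y\<close> is a limit of points above the graph but, \<open>\<Omega>\<close> being open, it is not above the
  graph itself.\<close>

lemma graph_passes_through:
  fixes \<Omega> :: "(real^'n) set"
  assumes "open \<Omega>" "y \<in> frontier \<Omega>" "local_C2_graph \<Omega> y \<nu> g"
  shows "g y = y \<bullet> \<nu>"
proof -
  obtain r where r: "r > 0" "\<And>z. z \<in> ball y r \<Longrightarrow> z \<in> \<Omega> \<longleftrightarrow> g z < z \<bullet> \<nu>"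
    using assms(3) by (auto simp: local_C2_graph_def)
  have c2: "C2_on UNIV g" using assms(3) by (auto simp: local_C2_graph_def)
  have ny: "y \<notin> \<Omega>" and yc: "y \<in> closure \<Omega>" using assms by (auto simp: frontier_def interior_open)
  then have "y \<bullet> \<nu> \<le> g y" using r by force
  moreover have "\<not> y \<bullet> \<nu> < g y"
  proof
    assume lt: "y \<bullet> \<nu> < g y"
    have "continuous_on UNIV g" using C2_on_UNIV_jet(4)[OF c2]
      by (meson continuous_at_imp_continuous_on has_derivative_continuous)
    then have "open {z. z \<bullet> \<nu> < g z}" by (intro open_Collect_less continuous_intros)
    then have "open ({z. z \<bullet> \<nu> < g z} \<inter> ball y r)" by auto
    moreover have "y \<in> {z. z \<bullet> \<nu> < g z} \<inter> ball y r" using lt r by simp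
    ultimately have "({z. z \<bullet> \<nu> < g z} \<inter> ball y r) \<inter> \<Omega> \<noteq> {}"
      using yc open_Int_closure_eq_empty[of "{z. z \<bullet> \<nu> < g z} \<inter> ball y r" \<Omega>] by blast
    then obtain z where "z \<in> \<Omega>" "z \<in> {z. z \<bullet> \<nu> < g z} \<inter> ball y r" by blast
    then show False using r by force
  qed
  ultimately show ?thesis by simp
qed

text \<open>If the radius through \<open>y\<close> had a unit direction \<open>e\<close> other than \<open>\<nu>\<close>, then a small step from \<open>y\<close>
  in the direction \<open>e - \<nu>\<close> would stay inside the ball and leave \<open>\<Omega>\<close>, both to first order.\<close>

lemma touching_ball_normal:
  fixes \<Omega> :: "(real^'n) set"
  assumes op: "open \<Omega>" and R: "R > 0" and y: "y \<in> frontier \<Omega>" and tb: "cball x R \<inter> (- \<Omega>) = {y}"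
    and gr: "local_C2_graph \<Omega> y \<nu> g" and g0: "grad g y = 0"
  shows "x = y + R *\<^sub>R \<nu>"
proof -
  obtain r where r: "r > 0" "\<And>z. z \<in> ball y r \<Longrightarrow> z \<in> \<Omega> \<longleftrightarrow> g z < z \<bullet> \<nu>"
    using gr by (auto simp: local_C2_graph_def)
  have c2: "C2_on UNIV g" and n: "norm \<nu> = 1" and tr: "\<And>z s. g (z + s *\<^sub>R \<nu>) = g z"
    using gr by (auto simp: local_C2_graph_def)
  note gy = graph_passes_through[OF op y gr]
  have \<nu>\<nu>: "\<nu> \<bullet> \<nu> = 1" using n by (simp add: dot_square_norm)
  have yc: "dist x y \<le> R" using tb by auto
  have dR: "dist x y = R"
  proof (rule ccontr)
    assume "dist x y \<noteq> R"
    then have lt: "dist x y < R" using yc by simp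
    define s where "s = min (R - dist x y) r / 2"
    have s: "s > 0" "s < R - dist x y" "s < r" using lt r by (auto simp: s_def)
    let ?z = "y + (- s) *\<^sub>R \<nu>"
    have d: "dist y ?z = s" using s n by (simp add: dist_norm)
    have "?z \<notin> \<Omega>" using r(2)[of ?z] d s tr[of y "- s"] gy \<nu>\<nu> by (simp add: inner_diff_left)
    moreover have "?z \<in> cball x R" using dist_triangle[of x ?z y] d s by simp
    ultimately have "?z = y" using tb by blast
    then show False using s n by auto
  qed
  define e where "e = (1 / R) *\<^sub>R (x - y)"
  have ne: "norm e = 1" using dR R by (simp add: e_def dist_norm)
  have ee: "e \<bullet> e = 1" using ne by (simp add: dot_square_norm)
  have xe: "x = y + R *\<^sub>R e" using R by (simp add: e_def)
  have "\<nu> = e"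
  proof (rule ccontr)
    assume "\<nu> \<noteq> e"
    define w where "w = e - \<nu>"
    have "0 < w \<bullet> w" using \<open>\<nu> \<noteq> e\<close> by (simp add: w_def)
    also have "w \<bullet> w = 2 - 2 * (e \<bullet> \<nu>)" by (simp add: w_def inner_diff_left inner_diff_right ee \<nu>\<nu> inner_commute)
    finally have e\<nu>: "e \<bullet> \<nu> < 1" by simp
    have we: "w \<bullet> e > 0" "w \<bullet> \<nu> < 0" using e\<nu> by (auto simp: w_def inner_diff_left inner_diff_right ee \<nu>\<nu> inner_commute)
    have wn: "w \<bullet> w > 0" "norm w > 0" using \<open>\<nu> \<noteq> e\<close> by (auto simp: w_def)
    have "((\<lambda>s. (y + s *\<^sub>R w) \<bullet> \<nu> - g (y + s *\<^sub>R w)) has_real_derivative w \<bullet> \<nu>) (at 0)"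
    proof -
      have 1: "((\<lambda>s. y + s *\<^sub>R w) has_derivative (\<lambda>h. h *\<^sub>R w)) (at (0::real))"
        by (auto intro!: derivative_eq_intros)
      have 2: "(g has_derivative (\<lambda>v. 0)) (at (y + 0 *\<^sub>R w))" using C2_on_UNIV_jet(4)[OF c2, of y] g0 by simp
      have "((\<lambda>s. g (y + s *\<^sub>R w)) has_derivative (\<lambda>h. 0)) (at (0::real))"
        using has_derivative_compose[OF 1 2] by simp
      then have "((\<lambda>s. (y + s *\<^sub>R w) \<bullet> \<nu> - g (y + s *\<^sub>R w)) has_derivative (\<lambda>h. (h *\<^sub>R w) \<bullet> \<nu> - 0)) (at (0::real))"
        by (intro has_derivative_diff has_derivative_inner_left 1)
      then show ?thesis unfolding has_field_derivative_def
        by (rule has_derivative_eq_rhs) (auto simp: fun_eq_iff)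
    qed
    from DERIV_neg_dec_right[OF this we(2)] obtain d where d: "d > 0"
      "\<And>h. 0 < h \<Longrightarrow> h < d \<Longrightarrow> (y + h *\<^sub>R w) \<bullet> \<nu> - g (y + h *\<^sub>R w) < y \<bullet> \<nu> - g y" by auto
    define s where "s = min (min (d / 2) (r / (2 * norm w))) (R * (w \<bullet> e) / (w \<bullet> w))"
    have s: "s > 0" "s < d" "s * norm w < r" "s \<le> R * (w \<bullet> e) / (w \<bullet> w)"
    proof -
      show s0: "s > 0" using d r wn we R by (simp add: s_def)
      have "s \<le> d / 2" unfolding s_def by (rule min.coboundedI1, rule min.coboundedI1, rule order_refl)
      then show "s < d" using d by simp
      have "s \<le> r / (2 * norm w)" by (simp add: s_def)
      then have "s * norm w \<le> r / 2" using wn by (simp add: field_simps)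
      then show "s * norm w < r" using r by simp
      show "s \<le> R * (w \<bullet> e) / (w \<bullet> w)" by (simp add: s_def)
    qed
    let ?z = "y + s *\<^sub>R w"
    have "?z \<notin> \<Omega>" using d(2)[OF s(1,2)] r(2)[of ?z] s gy by (simp add: dist_norm)
    moreover have "?z \<in> cball x R"
    proof -
      have "s * (w \<bullet> w) \<le> R * (w \<bullet> e)" using s(4) wn by (simp add: field_simps)
      then have a: "s * (s * (w \<bullet> w)) \<le> s * (R * (w \<bullet> e))" using s by (intro mult_left_mono) auto
      have "0 < s * (R * (w \<bullet> e))" using s R we by simp
      moreover have "(norm (?z - x))\<^sup>2 = R\<^sup>2 - 2 * (s * (R * (w \<bullet> e))) + s * (s * (w \<bullet> w))"
        unfolding power2_norm_eq_inner xe
        by (simp add: inner_diff_left inner_diff_right inner_add_left inner_add_right ee inner_commute power2_eq_square algebra_simps)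
      ultimately have "(norm (?z - x))\<^sup>2 \<le> R\<^sup>2" using a by linarith
      then have "norm (?z - x) \<le> R" by (rule power2_le_imp_le) (use R in simp)
      then show ?thesis by (simp add: dist_norm norm_minus_commute)
    qed
    ultimately have "?z = y" using tb by blast
    then show False using s wn by auto
  qed
  then show ?thesis using xe by simp
qed

lemma critical_point_taylor:
  fixes g :: "real^'n \<Rightarrow> real"
  assumes "C2_on UNIV g" "grad g y = 0"
  obtains \<theta> where "0 < \<theta>" "\<theta> < 1" "g (y + v) - g y = ((hessian g (y + \<theta> *\<^sub>R v) *v v) \<bullet> v) / 2"
proof -
  note J = C2_on_UNIV_jet[OF assms(1)]
  define diff where "diff m s = (if m = 0 then g (y + s *\<^sub>R v) else if m = 1 then grad g (y + s *\<^sub>R v) \<bullet> v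
     else (hessian g (y + s *\<^sub>R v) *v v) \<bullet> v)" for m :: nat and s :: real
  have line: "((\<lambda>s. y + s *\<^sub>R v) has_derivative (\<lambda>h. h *\<^sub>R v)) (at (s::real))" for s
    by (auto intro!: derivative_eq_intros)
  have d0: "((\<lambda>s. g (y + s *\<^sub>R v)) has_real_derivative grad g (y + s *\<^sub>R v) \<bullet> v) (at s)" for s
    using has_derivative_compose[OF line J(4)] unfolding has_field_derivative_def
    by (rule has_derivative_eq_rhs) (auto simp: fun_eq_iff)
  have d1: "((\<lambda>s. grad g (y + s *\<^sub>R v) \<bullet> v) has_real_derivative (hessian g (y + s *\<^sub>R v) *v v) \<bullet> v) (at s)" for s
    using has_derivative_inner_left[OF has_derivative_compose[OF line J(5)], of v s] unfolding has_field_derivative_def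
    by (rule has_derivative_eq_rhs) (auto simp: fun_eq_iff matrix_scaleR_vector_ac scaleR_matrix_vector_assoc[symmetric])
  have "\<exists>t>0. t < 1 \<and> diff 0 1 = (\<Sum>m<2. diff m 0 / fact m * 1 ^ m) + diff 2 t / fact 2 * 1 ^ 2"
  proof (rule Maclaurin)
    show "\<forall>m t. m < 2 \<and> 0 \<le> t \<and> t \<le> 1 \<longrightarrow> (diff m has_real_derivative diff (Suc m) t) (at t)"
    proof (intro allI impI)
      fix m :: nat and t :: real assume "m < 2 \<and> 0 \<le> t \<and> t \<le> 1"
      then consider "m = 0" | "m = 1" by linarith
      then show "(diff m has_real_derivative diff (Suc m) t) (at t)"
        by cases (use d0[of t] d1[of t] in \<open>simp_all add: diff_def[abs_def]\<close>)
    qed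
  qed auto
  then obtain t where "0 < t" "t < 1" "diff 0 1 = (\<Sum>m<2. diff m 0 / fact m * 1 ^ m) + diff 2 t / fact 2 * 1 ^ 2" by blast
  then show ?thesis using assms(2)
    by (intro that[of t]) (auto simp: diff_def numeral_2_eq_2 lessThan_Suc)
qed

text \<open>The two barriers enclose the solution between Erfc profiles with parameters arbitrarily close
  to \<open>sqrt p' / 2\<close> on either side.\<close>

lemma boundary_layer_limit:
  fixes \<Omega> :: "(real^'n) set"
  assumes p1: "1 < p" and op: "open \<Omega>" and u: "bounded_IBVP_solution p \<Omega> u"
    and y: "y \<in> frontier \<Omega>" and gr: "local_C2_graph \<Omega> y \<nu> g" and g0: "grad g y = 0"
    and z: "\<forall>\<^sub>F t in at_right 0. z t \<in> \<Omega>" "(z \<longlongrightarrow> y) (at_right 0)"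
    and l: "((\<lambda>t. (z t \<bullet> \<nu> - g (z t)) / sqrt t) \<longlongrightarrow> l) (at_right 0)"
  shows "((\<lambda>t. u (z t, t)) \<longlongrightarrow> Erfc (sqrt (conj_exp p) / 2 * l)) (at_right 0)"
proof -
  note F = IBVP_solution_facts[OF u op]
  obtain M where M: "M > 0" "\<And>z. z \<in> \<Omega> \<times> {0<..} \<Longrightarrow> \<bar>u z\<bar> \<le> M" using F(5) by blast
  note gy = graph_passes_through[OF op y gr]
  have q: "conj_exp p > 0" using inverse_exponent_bounds[OF p1] by simp
  define a0 where "a0 = sqrt (conj_exp p) / 2"
  have a0: "a0 > 0" "4 * a0\<^sup>2 = conj_exp p" using q by (auto simp: a0_def power_divide)
  have ev: "\<forall>\<^sub>F t in at_right 0. z t \<in> \<Omega> \<inter> ball y r \<and> 0 < t \<and> t < t0" if "r > 0" "t0 > 0" for r t0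
  proof -
    have "\<forall>\<^sub>F t in at_right 0. z t \<in> ball y r" using tendstoD[OF z(2) \<open>r > 0\<close>] by (simp add: dist_commute)
    moreover have "\<forall>\<^sub>F t in at_right 0. t < t0"
      unfolding eventually_at_right_field using \<open>t0 > 0\<close> by (intro exI[of _ t0]) auto
    ultimately show ?thesis using z(1) eventually_at_right_less[of "0::real"] by eventually_elim auto
  qed
  have lim: "((\<lambda>t. Erfc (a * (z t \<bullet> \<nu> - g (z t)) / sqrt t)) \<longlongrightarrow> Erfc (a * l)) (at_right 0)" for a
  proof -
    have "((\<lambda>t. a * ((z t \<bullet> \<nu> - g (z t)) / sqrt t)) \<longlongrightarrow> a * l) (at_right 0)" by (intro tendsto_mult tendsto_const l)
    from isCont_tendsto_compose[OF isCont_Erfc this] show ?thesis by simp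
  qed
  have cont: "((\<lambda>a. Erfc (a * l)) \<longlongrightarrow> Erfc (a0 * l)) (at a0 within S)" for S
    by (intro isCont_tendsto_compose[OF isCont_Erfc] tendsto_intros)
  show ?thesis unfolding a0_def[symmetric]
  proof (rule order_tendstoI)
    fix b assume b: "Erfc (a0 * l) < b"
    define \<eta> where "\<eta> = (b - Erfc (a0 * l)) / 3"
    have \<eta>: "\<eta> > 0" using b by (simp add: \<eta>_def)
    have "\<forall>\<^sub>F a in at_left a0. Erfc (a * l) < Erfc (a0 * l) + \<eta>" using cont \<eta> by (intro order_tendstoD) auto
    moreover have "\<forall>\<^sub>F a in at_left a0. 0 < a \<and> a < a0"
      unfolding eventually_at_left_field using a0 by (intro exI[of _ 0]) auto
    ultimately have "\<forall>\<^sub>F a in at_left a0. Erfc (a * l) < Erfc (a0 * l) + \<eta> \<and> 0 < a \<and> a < a0" by eventually_elim auto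
    then obtain a where a: "Erfc (a * l) < Erfc (a0 * l) + \<eta>" "0 < a" "a < a0"
      using eventually_happens[of _ "at_left a0"] trivial_limit_at_left_real by blast
    have "a\<^sup>2 < a0\<^sup>2" using a by (intro power_strict_mono) auto
    then have "4 * a\<^sup>2 < conj_exp p" using a0 by simp
    then have "\<exists>r>0. \<exists>t0>0. \<forall>z\<in>\<Omega> \<inter> ball y r. \<forall>t. 0 < t \<and> t < t0 \<longrightarrow>
       u (z, t) \<le> 1 * Erfc (a * (z \<bullet> \<nu> - g z) / sqrt t) + \<eta>"
      by (intro boundary_upper_barrier[OF p1 op F(1) gr g0 gy M(1) _ F(3)])
        (use M F(4) a \<eta> in \<open>auto simp: abs_le_iff\<close>)
    then obtain r t0 where rt: "r > 0" "t0 > 0" "\<And>z t. z \<in> \<Omega> \<inter> ball y r \<Longrightarrow> 0 < t \<and> t < t0 \<Longrightarrow>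
       u (z, t) \<le> 1 * Erfc (a * (z \<bullet> \<nu> - g z) / sqrt t) + \<eta>" by blast
    have "\<forall>\<^sub>F t in at_right 0. Erfc (a * (z t \<bullet> \<nu> - g (z t)) / sqrt t) < Erfc (a * l) + \<eta>"
      using \<eta> by (intro order_tendstoD[OF lim]) auto
    with ev[OF rt(1,2)] show "\<forall>\<^sub>F t in at_right 0. u (z t, t) < b"
    proof eventually_elim
      case (elim t)
      then have "u (z t, t) \<le> 1 * Erfc (a * (z t \<bullet> \<nu> - g (z t)) / sqrt t) + \<eta>" by (intro rt) auto
      then show ?case using elim a(1) \<eta> unfolding \<eta>_def by argo
    qed
  next
    fix b assume b: "b < Erfc (a0 * l)"
    define \<eta> where "\<eta> = (Erfc (a0 * l) - b) / 3"
    have \<eta>: "\<eta> > 0" using b by (simp add: \<eta>_def)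
    have "\<forall>\<^sub>F a in at_right a0. Erfc (a * l) > Erfc (a0 * l) - \<eta>" using cont \<eta> by (intro order_tendstoD) auto
    moreover have "\<forall>\<^sub>F a in at_right a0. a > a0" by (rule eventually_at_right_less)
    ultimately have "\<forall>\<^sub>F a in at_right a0. Erfc (a * l) > Erfc (a0 * l) - \<eta> \<and> a > a0" by eventually_elim auto
    then obtain a where a: "Erfc (a * l) > Erfc (a0 * l) - \<eta>" "a > a0"
      using eventually_happens[of _ "at_right a0"] trivial_limit_at_right_real by blast
    have "a0\<^sup>2 < a\<^sup>2" using a a0 by (intro power_strict_mono) auto
    then have a4: "4 * a\<^sup>2 > conj_exp p" using a0 by simp
    have "\<exists>r>0. \<exists>t0>0. \<forall>z\<in>\<Omega> \<inter> ball y r. \<forall>t. 0 < t \<and> t < t0 \<longrightarrow>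
       - u (z, t) \<le> - Erfc (a * (z \<bullet> \<nu> - g z) / sqrt t) + \<eta>"
    proof (rule boundary_lower_barrier[OF p1 op F(2) gr g0 gy M(1)])
      show "((\<lambda>z. - u z) \<longlongrightarrow> 0) (at (z0, 0) within \<Omega> \<times> {0<..})" if "z0 \<in> \<Omega>" for z0
        using tendsto_minus[OF F(3)[OF that]] by simp
      show "((\<lambda>z. - u z) \<longlongrightarrow> - 1) (at (z0, t0) within \<Omega> \<times> {0<..})" if "z0 \<in> frontier \<Omega>" "t0 > 0" for z0 t0
        using tendsto_minus[OF F(4)[OF that]] by simp
      show "- u z \<le> M" if "z \<in> \<Omega> \<times> {0<..}" for z using M(2)[OF that] by (simp add: abs_le_iff)
    qed (use a a0 a4 \<eta> in auto)
    then obtain r t0 where rt: "r > 0" "t0 > 0" "\<And>z t. z \<in> \<Omega> \<inter> ball y r \<Longrightarrow> 0 < t \<and> t < t0 \<Longrightarrow>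
       - u (z, t) \<le> - Erfc (a * (z \<bullet> \<nu> - g z) / sqrt t) + \<eta>" by blast
    have "\<forall>\<^sub>F t in at_right 0. Erfc (a * (z t \<bullet> \<nu> - g (z t)) / sqrt t) > Erfc (a * l) - \<eta>"
      using \<eta> by (intro order_tendstoD[OF lim]) auto
    with ev[OF rt(1,2)] show "\<forall>\<^sub>F t in at_right 0. b < u (z t, t)"
    proof eventually_elim
      case (elim t)
      then have "- u (z t, t) \<le> - Erfc (a * (z t \<bullet> \<nu> - g (z t)) / sqrt t) + \<eta>" by (intro rt) auto
      then show ?case using elim a(1) \<eta> unfolding \<eta>_def by argo
    qed
  qed
qed

section \<open>Geometry at the touching point\<close>

text \<open>Frames are indexed by the coordinates of the space, so that \<open>frame_map\<close> is an isometry of the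
  space to itself.\<close>

definition orthonormal_frame :: "('n::finite \<Rightarrow> real^'n) \<Rightarrow> bool" where
  "orthonormal_frame b \<longleftrightarrow> (\<forall>i j. b i \<bullet> b j = (if i = j then 1 else 0))"

definition frame_map :: "('n::finite \<Rightarrow> real^'n) \<Rightarrow> real^'n \<Rightarrow> real^'n" where
  "frame_map b w = (\<Sum>i\<in>UNIV. (w $ i) *\<^sub>R b i)"

lemma frame_map_inner:
  assumes "orthonormal_frame b" shows "frame_map b w \<bullet> b j = w $ j"
proof -
  have "frame_map b w \<bullet> b j = (\<Sum>i\<in>UNIV. w $ i * (b i \<bullet> b j))" by (simp add: frame_map_def inner_sum_left)
  also have "\<dots> = (\<Sum>i\<in>UNIV. if i = j then w $ i else 0)"
    using assms unfolding orthonormal_frame_def by (intro sum.cong) auto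
  finally show ?thesis by simp
qed

lemma orthogonal_frame_map:
  assumes "orthonormal_frame b"
  shows "orthogonal_transformation (frame_map b)"
  unfolding orthogonal_transformation_def
proof (intro conjI allI)
  show "linear (frame_map b)"
    by (rule linearI) (simp_all add: frame_map_def sum.distrib scaleR_left_distrib scaleR_sum_right)
  show "frame_map b v \<bullet> frame_map b w = v \<bullet> w" for v w
  proof -
    have "frame_map b v \<bullet> frame_map b w = (\<Sum>j\<in>UNIV. w $ j * (frame_map b v \<bullet> b j))"
      unfolding frame_map_def[of b w] by (simp add: inner_sum_right)
    also have "\<dots> = (\<Sum>j\<in>UNIV. w $ j * v $ j)" using frame_map_inner[OF assms] by simp
    finally show ?thesis by (simp add: inner_vec_def mult.commute)
  qed
qed

lemma frame_expansion:
  assumes "orthonormal_frame b"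
  shows "(\<Sum>i\<in>UNIV. (v \<bullet> b i) *\<^sub>R b i) = v"
proof -
  obtain w where w: "v = frame_map b w"
    using orthogonal_transformation_surj[OF orthogonal_frame_map[OF assms]] by (metis surjD)
  then show ?thesis using frame_map_inner[OF assms] by (simp add: frame_map_def)
qed

lemma norm_frame:
  assumes "orthonormal_frame b"
  shows "(norm v)\<^sup>2 = (\<Sum>i\<in>UNIV. (v \<bullet> b i)\<^sup>2)"
proof -
  have "v \<bullet> v = (\<Sum>i\<in>UNIV. (v \<bullet> b i) *\<^sub>R b i) \<bullet> v" by (simp add: frame_expansion[OF assms])
  also have "\<dots> = (\<Sum>i\<in>UNIV. (v \<bullet> b i) * (b i \<bullet> v))" by (simp add: inner_sum_left)
  finally have e: "v \<bullet> v = (\<Sum>i\<in>UNIV. (v \<bullet> b i) * (b i \<bullet> v))" .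
  show ?thesis unfolding power2_norm_eq_inner e by (simp add: power2_eq_square inner_commute)
qed

text \<open>The normal takes the place of an arbitrary coordinate \<open>k\<close>, the principal directions those of
  the others, as enumerated by \<open>\<sigma>\<close>.\<close>

lemma adapted_frame:
  fixes \<Omega> :: "(real^'n) set"
  assumes "principal_curvatures \<Omega> y \<kappa>"
  obtains \<nu> g b and k :: 'n and \<sigma> where "local_C2_graph \<Omega> y \<nu> g" "grad g y = 0" "orthonormal_frame b" "b k = \<nu>"
    "\<And>i. i \<noteq> k \<Longrightarrow> hessian g y *v b i = \<kappa> (\<sigma> i) *\<^sub>R b i"
    "bij_betw \<sigma> (UNIV - {k}) {1..CARD('n) - 1}"
proof -
  obtain \<nu> g e where g: "local_C2_graph \<Omega> y \<nu> g" "grad g y = 0"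
      and e\<nu>: "\<And>j. j\<in>{1..CARD('n) - 1} \<Longrightarrow> e j \<bullet> \<nu> = 0"
      and ee: "\<And>i j. i\<in>{1..CARD('n) - 1} \<Longrightarrow> j\<in>{1..CARD('n) - 1} \<Longrightarrow> e i \<bullet> e j = (if i = j then 1 else 0)"
      and H: "\<And>j. j\<in>{1..CARD('n) - 1} \<Longrightarrow> hessian g y *v e j = \<kappa> j *\<^sub>R e j"
    using assms unfolding principal_curvatures_def by blast
  define k :: 'n where "k = undefined"
  have "card (UNIV - {k}) = card {1..CARD('n) - 1}" by (simp add: card_Diff_singleton)
  then obtain \<sigma> where \<sigma>: "bij_betw \<sigma> (UNIV - {k}) {1..CARD('n) - 1}"
    using finite_same_card_bij by (metis finite finite_atLeastAtMost)
  define b where "b i = (if i = k then \<nu> else e (\<sigma> i))" for i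
  have \<sigma>i: "\<sigma> i \<in> {1..CARD('n) - 1}" if "i \<noteq> k" for i using \<sigma> that by (auto simp: bij_betw_def)
  have \<sigma>inj: "\<sigma> i = \<sigma> j \<longleftrightarrow> i = j" if "i \<noteq> k" "j \<noteq> k" for i j
    using \<sigma> that by (auto simp: bij_betw_def inj_on_def)
  have "norm \<nu> = 1" using g by (simp add: local_C2_graph_def)
  then have \<nu>\<nu>: "\<nu> \<bullet> \<nu> = 1" by (simp add: dot_square_norm)
  have e\<nu>': "\<nu> \<bullet> e (\<sigma> j) = 0" if "j \<noteq> k" for j using e\<nu>[OF \<sigma>i[OF that]] by (simp add: inner_commute)
  have "orthonormal_frame b"
    unfolding orthonormal_frame_def b_def using \<nu>\<nu> e\<nu>[OF \<sigma>i] e\<nu>' ee[OF \<sigma>i \<sigma>i] \<sigma>inj by auto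
  then show ?thesis
    by (rule that[OF g, of b k \<sigma>]) (use H[OF \<sigma>i] \<sigma> in \<open>auto simp: b_def\<close>)
qed

lemma tangential_hessian_form:
  fixes b :: "'n::finite \<Rightarrow> real^'n"
  assumes b: "orthonormal_frame b" and H: "\<And>i. i \<noteq> k \<Longrightarrow> H *v b i = kap i *\<^sub>R b i" and v: "v \<bullet> b k = 0"
  shows "(H *v v) \<bullet> v = (\<Sum>i\<in>UNIV - {k}. kap i * (v \<bullet> b i)\<^sup>2)"
proof -
  have "H *v v = H *v (\<Sum>i\<in>UNIV. (v \<bullet> b i) *\<^sub>R b i)" by (simp add: frame_expansion[OF b])
  also have "\<dots> = (\<Sum>i\<in>UNIV. (v \<bullet> b i) *\<^sub>R (H *v b i))"
    by (simp add: linear_sum[OF matrix_vector_mul_linear] matrix_scaleR_vector_ac scaleR_matrix_vector_assoc[symmetric])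
  also have "\<dots> = (\<Sum>i\<in>UNIV - {k}. (v \<bullet> b i) *\<^sub>R (kap i *\<^sub>R b i))"
    by (subst sum.remove[of _ k]) (auto simp: v H)
  finally have "(H *v v) \<bullet> v = (\<Sum>i\<in>UNIV - {k}. (v \<bullet> b i) *\<^sub>R (kap i *\<^sub>R b i)) \<bullet> v" by simp
  also have "\<dots> = (\<Sum>i\<in>UNIV - {k}. kap i * (v \<bullet> b i)\<^sup>2)"
    unfolding inner_sum_left by (intro sum.cong) (auto simp: power2_eq_square inner_commute)
  finally show ?thesis .
qed

text \<open>In terms of the depth \<open>(z - y) \<bullet> \<nu>\<close>: the ball lies inside a paraboloid with vertex at the
  touching point.\<close>

lemma norm2_in_touching_ball:
  fixes x y \<nu> z :: "'a::real_inner"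
  assumes "norm \<nu> = 1" and x: "x = y + R *\<^sub>R \<nu>" and "z \<in> ball x R"
  shows "(norm (z - y))\<^sup>2 < 2 * R * ((z - y) \<bullet> \<nu>)"
proof -
  have \<nu>\<nu>: "\<nu> \<bullet> \<nu> = 1" using assms(1) by (simp add: dot_square_norm)
  have "norm (z - x) < R" using assms(3) by (simp add: dist_norm norm_minus_commute)
  then have "(norm (z - x))\<^sup>2 < R\<^sup>2" by (intro power_strict_mono) auto
  moreover have "(norm (z - x))\<^sup>2 = (norm (z - y))\<^sup>2 - 2 * R * ((z - y) \<bullet> \<nu>) + R\<^sup>2"
  proof -
    have "z - x = (z - y) - R *\<^sub>R \<nu>" using x by simp
    then show ?thesis
      by (simp only: power2_norm_eq_inner inner_diff_left inner_diff_right inner_scaleR_left inner_scaleR_right \<nu>\<nu>)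
        (simp add: inner_commute power2_eq_square algebra_simps)
  qed
  ultimately show ?thesis by linarith
qed

text \<open>Near \<open>y\<close>, a point of the ball at depth \<open>s\<close> has a tangential part \<open>v\<close> with \<open>|v|\<^sup>2 \<le> 2 R s\<close>, and
  the boundary graph rises by at most \<open>k' |v|\<^sup>2 / 2\<close>, where \<open>k' R < 1\<close> by the bound on the
  curvatures; thus a height of at least \<open>(1 - k' R) s\<close> is left. Away from \<open>y\<close> the closed ball is
  a compact subset of \<open>\<Omega>\<close>.\<close>

lemma depth_in_touching_ball:
  fixes \<Omega> :: "(real^'n) set"
  assumes op: "open \<Omega>" and R: "R > 0" and tb: "cball x R \<inter> (- \<Omega>) = {y}"
    and gr: "local_C2_graph \<Omega> y \<nu> g" and g0: "grad g y = 0" and gy: "g y = y \<bullet> \<nu>" and x: "x = y + R *\<^sub>R \<nu>"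
    and b: "orthonormal_frame b" "b k = \<nu>" and H: "\<And>i. i \<noteq> k \<Longrightarrow> hessian g y *v b i = kap i *\<^sub>R b i"
    and lam: "\<And>i. i \<noteq> k \<Longrightarrow> kap i < 1 / R"
  obtains c where "c > 0" "\<And>z. z \<in> ball x R \<Longrightarrow> 0 < (z - y) \<bullet> \<nu> \<and> cball z (c * ((z - y) \<bullet> \<nu>)) \<subseteq> \<Omega>"
proof -
  have c2: "C2_on UNIV g" and n: "norm \<nu> = 1" and tr: "\<And>z s. g (z + s *\<^sub>R \<nu>) = g z"
    using gr by (auto simp: local_C2_graph_def)
  have \<nu>\<nu>: "\<nu> \<bullet> \<nu> = 1" using n by (simp add: dot_square_norm)
  define K0 where "K0 = Max (insert 0 (kap ` (UNIV - {k})))"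
  have K0: "0 \<le> K0" "K0 < 1 / R" "\<And>i. i \<noteq> k \<Longrightarrow> kap i \<le> K0"
    using R lam unfolding K0_def by (auto simp: Max_less_iff)
  define \<epsilon> where "\<epsilon> = (1 / R - K0) / 2"
  \<comment> \<open>A bound for the curvatures in a whole neighbourhood, still with \<open>k' R < 1\<close>.\<close>
  define k' where "k' = K0 + \<epsilon>"
  have \<epsilon>: "\<epsilon> > 0" using K0 by (simp add: \<epsilon>_def)
  have "k' < 1 / R" unfolding k'_def \<epsilon>_def using K0(2) by argo
  then have k': "0 < k'" "k' * R < 1" using K0 \<epsilon> R by (auto simp: k'_def field_simps)
  have "isCont (hessian g) y" using C2_on_UNIV_jet(3)[OF c2] by (simp add: continuous_on_eq_continuous_at)
  then obtain r2 where r2: "r2 > 0" "\<And>z. dist z y < r2 \<Longrightarrow> dist (hessian g z) (hessian g y) < \<epsilon>"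
    unfolding continuous_at_eps_delta using \<epsilon> by blast
  obtain r1 H1 where r1: "r1 > 0"
    and chart: "\<And>z. z \<in> cball y (2 * r1) \<Longrightarrow> z \<in> \<Omega> \<longleftrightarrow> 0 < z \<bullet> \<nu> - g z"
    and Lip: "\<And>z z'. z \<in> cball y (2 * r1) \<Longrightarrow> z' \<in> cball y (2 * r1) \<Longrightarrow>
      \<bar>(z \<bullet> \<nu> - g z) - (z' \<bullet> \<nu> - g z')\<bar> \<le> 2 * norm (z - z')"
    using local_chart[OF gr g0, of 1] by (metis order_refl zero_less_one)
  define r where "r = min r1 r2"
  have r: "r > 0" "r \<le> r1" "r \<le> r2" using r1 r2 by (auto simp: r_def)
  note ballz = norm2_in_touching_ball[OF n x]
  have spos: "0 < (z - y) \<bullet> \<nu>" if "z \<in> ball x R" for z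
  proof -
    have "0 < 2 * R * ((z - y) \<bullet> \<nu>)" using ballz[OF that] zero_le_power2[of "norm (z - y)"] by linarith
    then show ?thesis using R by (simp add: zero_less_mult_iff)
  qed
  define c1 where "c1 = (1 - k' * R) / 4"
  have c1: "c1 > 0" using k' by (simp add: c1_def)
  have near: "cball z (c1 * ((z - y) \<bullet> \<nu>)) \<subseteq> \<Omega>" if z: "z \<in> ball x R" "z \<in> ball y r" for z
  proof -
    define s where "s = (z - y) \<bullet> \<nu>"
    define v where "v = z - y - s *\<^sub>R \<nu>"
    have s: "s > 0" using spos[OF z(1)] by (simp add: s_def)
    have v\<nu>: "v \<bullet> \<nu> = 0" by (simp add: v_def inner_diff_left \<nu>\<nu> s_def)
    have zv: "z = (y + v) + s *\<^sub>R \<nu>" by (simp add: v_def)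
    have "(norm (z - y))\<^sup>2 = (norm v)\<^sup>2 + s\<^sup>2"
    proof -
      have "z - y = v + s *\<^sub>R \<nu>" by (simp add: v_def)
      then show ?thesis
        by (simp only: power2_norm_eq_inner inner_add_left inner_add_right inner_scaleR_left inner_scaleR_right \<nu>\<nu> v\<nu> inner_commute[of \<nu> v])
          (simp add: power2_eq_square)
    qed
    then have vz: "(norm v)\<^sup>2 \<le> (norm (z - y))\<^sup>2" by simp
    then have vn: "norm v \<le> norm (z - y)" by (rule power2_le_imp_le) simp
    have v2: "(norm v)\<^sup>2 \<le> 2 * R * s" using vz ballz[OF z(1)] unfolding s_def by linarith
    obtain \<theta> where \<theta>: "0 < \<theta>" "\<theta> < 1" "g (y + v) - g y = ((hessian g (y + \<theta> *\<^sub>R v) *v v) \<bullet> v) / 2"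
      using critical_point_taylor[OF c2 g0] by blast
    have "(hessian g (y + \<theta> *\<^sub>R v) *v v) \<bullet> v = (hessian g y *v v) \<bullet> v + ((hessian g (y + \<theta> *\<^sub>R v) - hessian g y) *v v) \<bullet> v"
      by (simp add: matrix_vector_mult_diff_rdistrib inner_diff_left)
    also have "(hessian g y *v v) \<bullet> v = (\<Sum>i\<in>UNIV - {k}. kap i * (v \<bullet> b i)\<^sup>2)"
      by (rule tangential_hessian_form[OF b(1) H]) (simp_all add: b v\<nu>)
    also have "\<dots> \<le> (\<Sum>i\<in>UNIV - {k}. K0 * (v \<bullet> b i)\<^sup>2)" by (intro sum_mono mult_right_mono K0) auto
    also have "\<dots> \<le> K0 * (norm v)\<^sup>2"
      unfolding norm_frame[OF b(1)] sum_distrib_left using K0 by (intro sum_mono2) auto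
    also have "((hessian g (y + \<theta> *\<^sub>R v) - hessian g y) *v v) \<bullet> v \<le> \<epsilon> * (norm v)\<^sup>2"
    proof -
      have "dist (y + \<theta> *\<^sub>R v) y = \<theta> * norm v" using \<theta> by (simp add: dist_norm)
      also have "\<dots> \<le> norm v" using \<theta> by (simp add: mult_left_le_one_le)
      also have "\<dots> < r2" using vn z(2) r by (simp add: dist_norm norm_minus_commute)
      finally have m: "norm (hessian g (y + \<theta> *\<^sub>R v) - hessian g y) < \<epsilon>" using r2(2) by (simp add: dist_norm)
      have "((hessian g (y + \<theta> *\<^sub>R v) - hessian g y) *v v) \<bullet> v \<le> norm ((hessian g (y + \<theta> *\<^sub>R v) - hessian g y) *v v) * norm v"
        by (rule norm_cauchy_schwarz)
      also have "\<dots> \<le> (norm (hessian g (y + \<theta> *\<^sub>R v) - hessian g y) * norm v) * norm v"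
        by (intro mult_right_mono norm_matrix_vector_mult_le) auto
      also have "\<dots> \<le> (\<epsilon> * norm v) * norm v" using m by (intro mult_right_mono) auto
      finally show ?thesis by (simp add: power2_eq_square mult.assoc)
    qed
    finally have "(hessian g (y + \<theta> *\<^sub>R v) *v v) \<bullet> v \<le> k' * (norm v)\<^sup>2" by (simp add: k'_def algebra_simps)
    also have "\<dots> \<le> k' * (2 * R * s)" using k' by (intro mult_left_mono v2) auto
    finally have "g (y + v) - g y \<le> k' * R * s" using \<theta>(3) by simp
    moreover have "g z = g (y + v)" using tr[of "y + v" s] zv by metis
    moreover have "z \<bullet> \<nu> = y \<bullet> \<nu> + s" by (simp add: s_def inner_diff_left)
    ultimately have "z \<bullet> \<nu> - g z \<ge> s - k' * R * s" using gy by linarith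
    moreover have "4 * (c1 * s) = s - k' * R * s" by (simp add: c1_def field_simps)
    ultimately have hz: "z \<bullet> \<nu> - g z \<ge> 4 * (c1 * s)" by simp
    have cs: "c1 * s > 0" using c1 s by simp
    show ?thesis
    proof
      fix z' assume z': "z' \<in> cball z (c1 * ((z - y) \<bullet> \<nu>))"
      have "s \<le> norm (z - y)" using norm_cauchy_schwarz[of "z - y" \<nu>] n by (simp add: s_def)
      then have "s < r" using z(2) by (simp add: dist_norm norm_minus_commute)
      have "0 < k' * R" using k' R by simp
      then have "c1 \<le> 1" by (simp add: c1_def)
      then have "c1 * s \<le> s" using s by (simp add: mult_left_le_one_le)
      have "dist y z' \<le> dist y z + dist z z'" by (rule dist_triangle)
      also have "\<dots> \<le> r + r" using z z' \<open>s < r\<close> \<open>c1 * s \<le> s\<close> by (simp add: s_def[symmetric])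
      finally have m: "z' \<in> cball y (2 * r1)" "z \<in> cball y (2 * r1)" using r z by auto
      have "\<bar>(z' \<bullet> \<nu> - g z') - (z \<bullet> \<nu> - g z)\<bar> \<le> 2 * norm (z' - z)" using Lip[OF m] .
      also have "\<dots> \<le> 2 * (c1 * s)" using z' by (simp add: dist_norm norm_minus_commute s_def)
      finally have "z' \<bullet> \<nu> - g z' > 0" using hz cs by linarith
      then show "z' \<in> \<Omega>" using chart[OF m(1)] by simp
    qed
  qed
  have "compact (cball x R - ball y r)" by (intro compact_diff) auto
  moreover have "cball x R - ball y r \<subseteq> \<Omega>"
  proof
    fix z assume z: "z \<in> cball x R - ball y r"
    then have "z \<noteq> y" using r by auto
    then show "z \<in> \<Omega>" using z tb by blast
  qed
  ultimately obtain d0 where d0: "d0 > 0" "(\<Union>z\<in>cball x R - ball y r. ball z d0) \<subseteq> \<Omega>"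
    using compact_subset_open_imp_ball_epsilon_subset[OF _ op] by metis
  define c2 where "c2 = d0 / (4 * R)"
  have c2: "c2 > 0" using d0 R by (simp add: c2_def)
  have far: "cball z (c2 * ((z - y) \<bullet> \<nu>)) \<subseteq> \<Omega>" if z: "z \<in> ball x R" "z \<notin> ball y r" for z
  proof -
    have "dist y z \<le> dist y x + dist x z" by (rule dist_triangle)
    moreover have "dist y x = R" using x n R by (simp add: dist_norm)
    ultimately have "norm (z - y) \<le> 2 * R" using z by (simp add: dist_norm norm_minus_commute)
    moreover have "(z - y) \<bullet> \<nu> \<le> norm (z - y)" using norm_cauchy_schwarz[of "z - y" \<nu>] n by simp
    ultimately have "c2 * ((z - y) \<bullet> \<nu>) \<le> c2 * (2 * R)" using c2 by (intro mult_left_mono) auto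
    also have "\<dots> < d0" using d0 R by (simp add: c2_def)
    finally have "cball z (c2 * ((z - y) \<bullet> \<nu>)) \<subseteq> ball z d0" by auto
    also have "z \<in> cball x R - ball y r" using z by auto
    then have "ball z d0 \<subseteq> \<Omega>" using d0(2) by blast
    finally show ?thesis .
  qed
  show ?thesis
  proof (rule that[of "min c1 c2"])
    show "min c1 c2 > 0" using c1 c2 by simp
    fix z assume z: "z \<in> ball x R"
    have m: "cball z (min c1 c2 * ((z - y) \<bullet> \<nu>)) \<subseteq> cball z (c1 * ((z - y) \<bullet> \<nu>))"
      "cball z (min c1 c2 * ((z - y) \<bullet> \<nu>)) \<subseteq> cball z (c2 * ((z - y) \<bullet> \<nu>))"
      using spos[OF z] by (intro subset_cball mult_right_mono; simp)+
    show "0 < (z - y) \<bullet> \<nu> \<and> cball z (min c1 c2 * ((z - y) \<bullet> \<nu>)) \<subseteq> \<Omega>"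
      using spos[OF z] near[OF z] far[OF z] m by blast
  qed
qed

lemma decay_in_touching_ball:
  fixes \<Omega> :: "(real^'n) set"
  assumes p1: "1 < p" and op: "open \<Omega>" and u: "bounded_IBVP_solution p \<Omega> u"
    and c: "c > 0" "\<And>z. z \<in> B \<Longrightarrow> 0 < (z - y) \<bullet> \<nu> \<and> cball z (c * ((z - y) \<bullet> \<nu>)) \<subseteq> \<Omega>"
  obtains C c' where "C > 0" "c' > 0" "\<And>z t. z \<in> B \<Longrightarrow> t > 0 \<Longrightarrow> \<bar>u (z, t)\<bar> \<le> C * exp (- c' * ((z - y) \<bullet> \<nu>)\<^sup>2 / t)"
proof -
  note F = IBVP_solution_facts[OF u op]
  obtain M where M: "M > 0" "\<And>z. z \<in> \<Omega> \<times> {0<..} \<Longrightarrow> \<bar>u z\<bar> \<le> M" using F(5) by blast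
  obtain C c' where C: "C > 0" "c' > 0" and dec:
    "\<And>(\<Omega>::(real^'n) set) U M z d T. open \<Omega> \<Longrightarrow> viscosity_subsolution p \<Omega> U \<Longrightarrow> M > 0 \<Longrightarrow>
      (\<And>z. z \<in> \<Omega> \<times> {0<..} \<Longrightarrow> U z \<le> M) \<Longrightarrow>
      (\<And>z0. z0 \<in> \<Omega> \<Longrightarrow> (U \<longlongrightarrow> 0) (at (z0, 0) within \<Omega> \<times> {0<..})) \<Longrightarrow>
      cball z d \<subseteq> \<Omega> \<Longrightarrow> d > 0 \<Longrightarrow> T > 0 \<Longrightarrow> U (z, T) \<le> C * M * exp (- c' * d\<^sup>2 / T)"
    using interior_decay[OF p1] by metis
  show ?thesis
  proof (rule that[of "C * M" "c' * c\<^sup>2"])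
    fix z t assume z: "z \<in> B" and t: "(t::real) > 0"
    let ?s = "(z - y) \<bullet> \<nu>"
    have s: "0 < c * ?s" "cball z (c * ?s) \<subseteq> \<Omega>" using c z by auto
    have "u (z, t) \<le> C * M * exp (- c' * (c * ?s)\<^sup>2 / t)"
      by (rule dec[OF op F(1) M(1) _ F(3) s(2,1) t]) (use M in \<open>auto simp: abs_le_iff\<close>)
    moreover have "- u (z, t) \<le> C * M * exp (- c' * (c * ?s)\<^sup>2 / t)"
    proof (rule dec[OF op F(2) M(1) _ _ s(2,1) t])
      show "((\<lambda>z. - u z) \<longlongrightarrow> 0) (at (z0, 0) within \<Omega> \<times> {0<..})" if "z0 \<in> \<Omega>" for z0
        using tendsto_minus[OF F(3)[OF that]] by simp
    qed (use M in \<open>auto simp: abs_le_iff\<close>)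
    ultimately show "\<bar>u (z, t)\<bar> \<le> C * M * exp (- (c' * c\<^sup>2) * ?s\<^sup>2 / t)"
      by (simp add: abs_le_iff power_mult_distrib mult.assoc)
  qed (use C M c in auto)
qed

section \<open>The mean as a root\<close>

text \<open>The signed power \<open>sgn a |a| powr r\<close>. For \<open>r = q - 1\<close> it is, up to the factor \<open>q\<close>, the
  derivative of \<open>|a| powr q\<close>.\<close>

definition spow :: "real \<Rightarrow> real \<Rightarrow> real" where
  "spow r a = max a 0 powr r - max (- a) 0 powr r"

lemma spow_nonneg: "0 \<le> a \<Longrightarrow> spow r a = a powr r"
  by (simp add: spow_def)

lemma spow_minus: "spow r (- a) = - spow r a"
  by (simp add: spow_def)

lemma abs_spow: "\<bar>spow r a\<bar> = \<bar>a\<bar> powr r"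
  by (cases "a \<ge> 0") (auto simp: spow_def)

lemma spow_mult: "0 \<le> l \<Longrightarrow> spow r (l * a) = l powr r * spow r a"
proof (cases "a \<ge> 0")
  case False
  assume l: "0 \<le> l"
  have "spow r (l * a) = - spow r (l * (- a))" using spow_minus[of r "l * (- a)"] by simp
  also have "\<dots> = - (l powr r * (- a) powr r)"
  proof -
    have "0 \<le> l * (- a)" using False l by (intro mult_nonneg_nonneg) auto
    then have "spow r (l * (- a)) = (l * (- a)) powr r" by (rule spow_nonneg)
    then show ?thesis using powr_mult[of l "- a" r] False l by simp
  qed
  also have "- ((- a) powr r) = spow r a"
    using False spow_minus[of r "- a"] by (simp add: spow_nonneg)
  then have "- (l powr r * (- a) powr r) = l powr r * spow r a" by (metis mult_minus_right)
  finally show ?thesis .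
qed (simp add: spow_nonneg powr_mult)

lemma continuous_spow:
  assumes "r > 0" shows "continuous_on A (spow r)"
  unfolding spow_def by (intro continuous_intros continuous_on_powr') (use assms in auto)

lemma spow_strict_mono:
  assumes "r > 0" "a < b" shows "spow r a < spow r b"
proof -
  consider "0 \<le> a" | "a < 0" "0 \<le> b" | "b < 0" using \<open>a < b\<close> by linarith
  then show ?thesis
  proof cases
    case 1 then show ?thesis using assms by (simp add: spow_nonneg powr_less_mono2)
  next
    case 2
    then have "0 \<le> b powr r" "0 < (- a) powr r" by simp_all
    moreover have "spow r a = - ((- a) powr r)" "spow r b = b powr r" using 2 by (auto simp: spow_def max_def)
    ultimately show ?thesis by linarith
  next
    case 3 then show ?thesis using assms by (simp add: spow_def max_def powr_less_mono2)
  qed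
qed

lemma spow_inverse:
  assumes "r > 0" "c \<ge> 0" shows "spow r (c powr (1 / r)) = c"
  using assms by (simp add: spow_nonneg powr_powr)

lemma abs_powr_has_derivative:
  assumes "1 < q" shows "((\<lambda>x. \<bar>x\<bar> powr q) has_real_derivative q * spow (q - 1) x) (at x)"
proof -
  consider "x > 0" | "x < 0" | "x = 0" by linarith
  then show ?thesis
  proof cases
    case 1
    have "((\<lambda>x. x powr q) has_real_derivative q * x powr (q - 1)) (at x)"
      by (rule has_real_derivative_powr) (use 1 in auto)
    then have "((\<lambda>x. \<bar>x\<bar> powr q) has_real_derivative q * x powr (q - 1)) (at x)"
      by (rule has_field_derivative_transform_within_open[of _ _ _ "{0<..}"]) (use 1 in auto)
    then show ?thesis using 1 by (simp add: spow_nonneg)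
  next
    case 2
    have "((\<lambda>x. x powr q) has_real_derivative q * (- x) powr (q - 1)) (at (- x))"
      by (rule has_real_derivative_powr) (use 2 in auto)
    from DERIV_chain2[OF this DERIV_minus[OF DERIV_ident]]
    have "((\<lambda>x. (- x) powr q) has_real_derivative q * (- x) powr (q - 1) * (- 1)) (at x)" .
    then have "((\<lambda>x. \<bar>x\<bar> powr q) has_real_derivative q * (- x) powr (q - 1) * (- 1)) (at x)"
      by (rule has_field_derivative_transform_within_open[of _ _ _ "{..<0}"]) (use 2 in auto)
    then show ?thesis using 2 by (simp add: spow_def max_def)
  next
    case 3
    have "((\<lambda>h. \<bar>h\<bar> powr (q - 1)) \<longlongrightarrow> 0) (at (0::real))"
    proof -
      have "continuous_on UNIV (\<lambda>h::real. \<bar>h\<bar> powr (q - 1))"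
        by (intro continuous_on_powr' continuous_intros) (use assms in auto)
      then have "isCont (\<lambda>h::real. \<bar>h\<bar> powr (q - 1)) 0" by (simp add: continuous_on_eq_continuous_at)
      then show ?thesis using assms by (simp add: isCont_def)
    qed
    then have "((\<lambda>h. (\<bar>0 + h\<bar> powr q - \<bar>0\<bar> powr q) / h) \<longlongrightarrow> 0) (at (0::real))"
    proof (rule Lim_null_comparison[rotated])
      show "\<forall>\<^sub>F h in at 0. norm ((\<bar>0 + h\<bar> powr q - \<bar>0\<bar> powr q) / h) \<le> \<bar>h\<bar> powr (q - 1)"
        unfolding eventually_at_filter
        by (intro always_eventually) (auto simp: powr_diff)
    qed
    then show ?thesis using 3 by (simp add: DERIV_def spow_def)
  qed
qed

lemma abs_powr_strictly_convex:
  assumes "1 < q" "a \<noteq> b"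
  shows "\<bar>a\<bar> powr q + q * spow (q - 1) a * (b - a) < \<bar>b\<bar> powr q"
proof (cases "a < b")
  case True
  obtain z where z: "a < z" "z < b" "\<bar>b\<bar> powr q - \<bar>a\<bar> powr q = (b - a) * (q * spow (q - 1) z)"
    using MVT2[OF True, of "\<lambda>x. \<bar>x\<bar> powr q" "\<lambda>x. q * spow (q - 1) x"] abs_powr_has_derivative[OF assms(1)] by blast
  have "spow (q - 1) a < spow (q - 1) z" by (rule spow_strict_mono) (use assms z in auto)
  then have "(b - a) * (q * spow (q - 1) a) < (b - a) * (q * spow (q - 1) z)"
    using True assms by simp
  then show ?thesis using z(3) by (simp add: algebra_simps)
next
  case False
  then have ba: "b < a" using assms by simp
  obtain z where z: "b < z" "z < a" "\<bar>a\<bar> powr q - \<bar>b\<bar> powr q = (a - b) * (q * spow (q - 1) z)"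
    using MVT2[OF ba, of "\<lambda>x. \<bar>x\<bar> powr q" "\<lambda>x. q * spow (q - 1) x"] abs_powr_has_derivative[OF assms(1)] by blast
  have "spow (q - 1) z < spow (q - 1) a" by (rule spow_strict_mono) (use assms z in auto)
  then have "(a - b) * (q * spow (q - 1) z) < (a - b) * (q * spow (q - 1) a)"
    using ba assms by simp
  then show ?thesis using z(3) by (simp add: algebra_simps)
qed

lemma spow_measurable [measurable]: "spow r \<in> borel_measurable borel"
  unfolding spow_def[abs_def] by measurable

lemma integrable_spow_diff:
  assumes "finite_measure M" and v: "v \<in> borel_measurable M" "\<And>x. x \<in> space M \<Longrightarrow> \<bar>v x\<bar> \<le> K" and "r > 0"
  shows "integrable M (\<lambda>x. spow r (v x - c))"
proof -
  interpret finite_measure M by fact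
  show ?thesis
  proof (rule integrable_const_bound[where B="(K + \<bar>c\<bar>) powr r"])
    have "norm (spow r (v x - c)) \<le> (K + \<bar>c\<bar>) powr r" if "x \<in> space M" for x
      unfolding real_norm_def abs_spow using v(2)[OF that] \<open>r > 0\<close> by (intro powr_mono2) auto
    then show "AE x in M. norm (spow r (v x - c)) \<le> (K + \<bar>c\<bar>) powr r" by (rule AE_I2)
    show "(\<lambda>x. spow r (v x - c)) \<in> borel_measurable M" using v(1) by measurable
  qed
qed

text \<open>Integrating the tangent line inequality of a strictly convex function; the linear term
  vanishes at the root.\<close>

lemma unique_minimizer_of_root:
  assumes fin: "finite_measure M" and pos: "emeasure M (space M) \<noteq> 0"
    and v: "v \<in> borel_measurable M" "\<And>x. x \<in> space M \<Longrightarrow> \<bar>v x\<bar> \<le> K" and q: "1 < q"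
    and root: "(\<integral>x. spow (q - 1) (v x - \<mu>) \<partial>M) = 0"
  shows "(THE m. \<forall>c. (\<integral>x. \<bar>v x - m\<bar> powr q \<partial>M) powr (1 / q) \<le> (\<integral>x. \<bar>v x - c\<bar> powr q \<partial>M) powr (1 / q)) = \<mu>"
proof -
  interpret finite_measure M by fact
  define J where "J c = (\<integral>x. \<bar>v x - c\<bar> powr q \<partial>M)" for c
  have int: "integrable M (\<lambda>x. \<bar>v x - c\<bar> powr q)" for c
  proof (rule integrable_const_bound[where B="(K + \<bar>c\<bar>) powr q"])
    have "norm (\<bar>v x - c\<bar> powr q) \<le> (K + \<bar>c\<bar>) powr q" if "x \<in> space M" for x
      using v(2)[OF that] q by (auto intro!: powr_mono2)
    then show "AE x in M. norm (\<bar>v x - c\<bar> powr q) \<le> (K + \<bar>c\<bar>) powr q" by (rule AE_I2)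
    show "(\<lambda>x. \<bar>v x - c\<bar> powr q) \<in> borel_measurable M" using v(1) by measurable
  qed
  have lt: "J \<mu> < J c" if "c \<noteq> \<mu>" for c
  proof -
    have i2: "integrable M (\<lambda>x. spow (q - 1) (v x - \<mu>))"
      using integrable_spow_diff[OF fin v] q by simp
    have "(\<integral>x. \<bar>v x - \<mu>\<bar> powr q + spow (q - 1) (v x - \<mu>) * (q * (\<mu> - c)) \<partial>M) < J c"
      unfolding J_def
    proof (rule integral_less_AE_space[OF _ int _ pos])
      show "integrable M (\<lambda>x. \<bar>v x - \<mu>\<bar> powr q + spow (q - 1) (v x - \<mu>) * (q * (\<mu> - c)))"
        by (intro Bochner_Integration.integrable_add int integrable_mult_left i2)
      have "\<bar>v x - \<mu>\<bar> powr q + spow (q - 1) (v x - \<mu>) * (q * (\<mu> - c)) < \<bar>v x - c\<bar> powr q" for x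
        using abs_powr_strictly_convex[OF q, of "v x - \<mu>" "v x - c"] that by (simp add: mult_ac)
      then show "AE x in M. \<bar>v x - \<mu>\<bar> powr q + spow (q - 1) (v x - \<mu>) * (q * (\<mu> - c)) < \<bar>v x - c\<bar> powr q"
        by simp
    qed
    moreover have "(\<integral>x. \<bar>v x - \<mu>\<bar> powr q + spow (q - 1) (v x - \<mu>) * (q * (\<mu> - c)) \<partial>M) = J \<mu>"
      by (subst Bochner_Integration.integral_add) (auto simp: int i2 root J_def)
    ultimately show ?thesis by simp
  qed
  have J0: "J c \<ge> 0" for c unfolding J_def by (rule integral_nonneg_AE) auto
  show ?thesis unfolding J_def[symmetric]
  proof (rule the_equality)
    show "\<forall>c. J \<mu> powr (1 / q) \<le> J c powr (1 / q)"
      using lt q J0 by (auto intro!: powr_mono2 simp: less_imp_le) (metis less_eq_real_def)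
    fix m assume m: "\<forall>c. J m powr (1 / q) \<le> J c powr (1 / q)"
    show "m = \<mu>"
    proof (rule ccontr)
      assume "m \<noteq> \<mu>"
      then have "J \<mu> powr (1 / q) < J m powr (1 / q)" using lt q J0 by (intro powr_less_mono2) auto
      then show False using m by (meson not_less)
    qed
  qed
qed

text \<open>The integral is a continuous function of the candidate value, so that it has a root between
  values with opposite signs. This is how the mean is located without being computed.\<close>

lemma mean_between_sign_change:
  assumes fin: "finite_measure M" and pos: "emeasure M (space M) \<noteq> 0"
    and v: "v \<in> borel_measurable M" "\<And>x. x \<in> space M \<Longrightarrow> \<bar>v x\<bar> \<le> K" and q: "1 < q"
    and ab: "a < b" "0 < (\<integral>x. spow (q - 1) (v x - a) \<partial>M)" "(\<integral>x. spow (q - 1) (v x - b) \<partial>M) < 0"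
  shows "(THE m. \<forall>c. (\<integral>x. \<bar>v x - m\<bar> powr q \<partial>M) powr (1 / q) \<le> (\<integral>x. \<bar>v x - c\<bar> powr q \<partial>M) powr (1 / q)) \<in> {a..b}"
proof -
  interpret finite_measure M by fact
  define \<psi> where "\<psi> c = (\<integral>x. spow (q - 1) (v x - c) \<partial>M)" for c
  have "continuous_on {a..b} \<psi>"
    unfolding continuous_on_sequentially comp_def
  proof (intro ballI allI impI, elim conjE)
    fix l f assume l: "l \<in> {a..b}" and f: "\<forall>n::nat. f n \<in> {a..b}" "f \<longlonglongrightarrow> l"
    show "(\<lambda>n. \<psi> (f n)) \<longlonglongrightarrow> \<psi> l"
      unfolding \<psi>_def
    proof (rule integral_dominated_convergence[where w="\<lambda>_. (K + \<bar>a\<bar> + \<bar>b\<bar>) powr (q - 1)"])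
      show "(\<lambda>x. spow (q - 1) (v x - l)) \<in> borel_measurable M" "(\<lambda>x. spow (q - 1) (v x - f n)) \<in> borel_measurable M" for n
        using v(1) by measurable
      have c: "isCont (spow (q - 1)) x" for x
        using continuous_spow[of "q - 1" UNIV] q by (simp add: continuous_on_eq_continuous_at)
      show "AE x in M. (\<lambda>n. spow (q - 1) (v x - f n)) \<longlonglongrightarrow> spow (q - 1) (v x - l)"
        by (intro AE_I2 isCont_tendsto_compose[OF c] tendsto_intros f)
      have "norm (spow (q - 1) (v x - f n)) \<le> (K + \<bar>a\<bar> + \<bar>b\<bar>) powr (q - 1)" if "x \<in> space M" for x n
        unfolding real_norm_def abs_spow
      proof (rule powr_mono2)
        have "a \<le> f n" "f n \<le> b" using f(1) by auto
        then show "\<bar>v x - f n\<bar> \<le> K + \<bar>a\<bar> + \<bar>b\<bar>" using v(2)[OF that] by linarith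
      qed (use q in auto)
      then show "AE x in M. norm (spow (q - 1) (v x - f n)) \<le> (K + \<bar>a\<bar> + \<bar>b\<bar>) powr (q - 1)" for n by (rule AE_I2)
    qed auto
  qed
  then obtain \<mu> where \<mu>: "a \<le> \<mu>" "\<mu> \<le> b" "\<psi> \<mu> = 0"
    using IVT2'[of \<psi> b 0 a] ab unfolding \<psi>_def by (auto simp: less_imp_le)
  then show ?thesis using unique_minimizer_of_root[OF fin pos v q, of \<mu>] by (simp add: \<psi>_def)
qed

lemma lebesgue_on_ball:
  "finite_measure (lebesgue_on (ball (x::'a::euclidean_space) R))"
  "R > 0 \<Longrightarrow> emeasure (lebesgue_on (ball x R)) (space (lebesgue_on (ball x R))) \<noteq> 0"
proof -
  have "emeasure lebesgue (ball x R) < \<infinity>" using emeasure_bounded_finite[of "ball x R"] by auto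
  then show "finite_measure (lebesgue_on (ball x R))"
    by (intro finite_measureI) (simp add: emeasure_restrict_space less_top)
  assume "R > 0"
  moreover have "unit_ball_vol (real DIM('a)) * R ^ DIM('a) > 0" using \<open>R > 0\<close> by (intro mult_pos_pos zero_less_power) auto
  ultimately have "emeasure lborel (ball x R) \<noteq> 0"
    unfolding emeasure_ball[OF less_imp_le[OF \<open>R > 0\<close>]] ennreal_eq_0_iff by linarith
  then show "emeasure (lebesgue_on (ball x R)) (space (lebesgue_on (ball x R))) \<noteq> 0"
    by (simp add: emeasure_restrict_space)
qed

text \<open>A continuous function exceeding a bound at one point exceeds it on a ball, which has positive
  measure; hence its essential supremum bounds every value.\<close>

lemma esssup_abs_diff_bounds:
  fixes v :: "'a::euclidean_space \<Rightarrow> real"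
  assumes R: "R > 0" and v: "continuous_on (ball x R) v" and K: "\<And>z. z \<in> ball x R \<Longrightarrow> \<bar>v z - c\<bar> \<le> K"
  defines "E \<equiv> real_of_ereal (esssup (lebesgue_on (ball x R)) (\<lambda>z. ereal \<bar>v z - c\<bar>))"
  shows "E \<le> K" "\<And>z. z \<in> ball x R \<Longrightarrow> \<bar>v z - c\<bar> \<le> E"
proof -
  let ?M = "lebesgue_on (ball x R)"
  let ?e = "esssup ?M (\<lambda>z. ereal \<bar>v z - c\<bar>)"
  have "v \<in> borel_measurable ?M" by (rule continuous_imp_measurable_on_sets_lebesgue[OF v]) auto
  then have m: "(\<lambda>z. ereal \<bar>v z - c\<bar>) \<in> borel_measurable ?M" by measurable
  have up: "?e \<le> ereal K" by (rule esssup_I[OF m]) (use K in \<open>auto intro!: AE_I2\<close>)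
  have low: "ereal \<bar>v z - c\<bar> \<le> ?e" if z: "z \<in> ball x R" for z
  proof (rule ccontr)
    assume "\<not> ?thesis"
    then have "?e < ereal \<bar>v z - c\<bar>" by simp
    then obtain d where d: "?e < ereal d" "ereal d < ereal \<bar>v z - c\<bar>" using ereal_dense2 by blast
    have "open (ball x R \<inter> (\<lambda>z. \<bar>v z - c\<bar>) -` {d<..})"
      by (rule continuous_open_preimage) (auto intro!: continuous_intros v)
    moreover have "z \<in> ball x R \<inter> (\<lambda>z. \<bar>v z - c\<bar>) -` {d<..}" using z d by simp
    ultimately obtain r where r: "r > 0" "ball z r \<subseteq> ball x R \<inter> (\<lambda>z. \<bar>v z - c\<bar>) -` {d<..}"
      using open_contains_ball by blast
    have "AE w in ?M. ereal \<bar>v w - c\<bar> \<le> ?e" by (rule esssup_AE)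
    then have "AE w in ?M. \<bar>v w - c\<bar> \<le> d"
    proof eventually_elim
      case (elim w)
      then have "ereal \<bar>v w - c\<bar> \<le> ereal d" using d(1) by (meson le_less_trans less_imp_le)
      then show ?case by simp
    qed
    then have "AE w in lebesgue. w \<in> ball x R \<longrightarrow> \<bar>v w - c\<bar> \<le> d"
      by (subst (asm) AE_restrict_space_iff) auto
    then have "AE w in lebesgue. w \<notin> ball z r"
      by eventually_elim (use r(2) in fastforce)
    then have "emeasure lebesgue (ball z r) = 0"
      by (subst (asm) AE_iff_measurable[of "ball z r"]) auto
    then have "emeasure lborel (ball z r) = 0" by simp
    moreover have "unit_ball_vol (real DIM('a)) * r ^ DIM('a) > 0" using r(1) by (intro mult_pos_pos zero_less_power) auto
    ultimately show False using r(1) by (simp add: emeasure_ball ennreal_eq_0_iff)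
  qed
  have "\<bar>?e\<bar> \<noteq> \<infinity>"
    using up low[of x] R by (cases ?e) auto
  then have e: "?e = ereal E" unfolding E_def by (simp add: ereal_real)
  show "E \<le> K" using up e by simp
  show "\<bar>v z - c\<bar> \<le> E" if "z \<in> ball x R" for z using low[OF that] e by simp
qed

text \<open>The best uniform approximation by a constant is the midpoint of the range.\<close>

lemma infinity_mean:
  fixes u :: "(real^'n) \<times> real \<Rightarrow> real"
  assumes R: "R > 0" and v: "continuous_on (ball x R) (\<lambda>y. u (y, t))" and bd: "\<And>z. z \<in> ball x R \<Longrightarrow> i \<le> u (z, t) \<and> u (z, t) \<le> s"
    and sup: "\<And>e. e < s \<Longrightarrow> \<exists>z\<in>ball x R. e < u (z, t)" and inf: "\<And>e. i < e \<Longrightarrow> \<exists>z\<in>ball x R. u (z, t) < e"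
  shows "q_mean \<infinity> R u x t = (i + s) / 2"
proof -
  define E where "E c = Lq_norm \<infinity> (ball x R) (\<lambda>y. u (y, t) - c)" for c
  have bdc: "\<bar>u (z, t) - c\<bar> \<le> (s - i) / 2 + \<bar>c - (i + s) / 2\<bar>" if "z \<in> ball x R" for z c
    using bd[OF that] by (simp add: abs_if field_simps)
  have Ec: "E c \<le> (s - i) / 2 + \<bar>c - (i + s) / 2\<bar>" "\<And>z. z \<in> ball x R \<Longrightarrow> \<bar>u (z, t) - c\<bar> \<le> E c" for c
    using esssup_abs_diff_bounds[OF R v bdc] unfolding E_def Lq_norm_def by auto
  have E: "E c = (s - i) / 2 + \<bar>c - (i + s) / 2\<bar>" for c
  proof -
    have "s - c \<le> E c"
    proof (rule ccontr)
      assume "\<not> ?thesis"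
      then obtain z where "z \<in> ball x R" "E c + c < u (z, t)" using sup[of "E c + c"] by (auto simp: algebra_simps)
      then show False using Ec(2)[of z c] by linarith
    qed
    moreover have "c - i \<le> E c"
    proof (rule ccontr)
      assume "\<not> ?thesis"
      then obtain z where "z \<in> ball x R" "u (z, t) < c - E c" using inf[of "c - E c"] by (auto simp: algebra_simps)
      then show False using Ec(2)[of z c] by linarith
    qed
    ultimately show ?thesis using Ec(1)[of c] by (simp add: abs_if field_simps split: if_splits)
  qed
  show ?thesis unfolding q_mean_def E_def[symmetric] E
  proof (rule the_equality)
    fix m assume m: "\<forall>c. (s - i) / 2 + \<bar>m - (i + s) / 2\<bar> \<le> (s - i) / 2 + \<bar>c - (i + s) / 2\<bar>"
    have "\<bar>m - (i + s) / 2\<bar> \<le> 0"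
      using spec[OF m, of "(i + s) / 2"] unfolding diff_self abs_zero by linarith
    then show "m = (i + s) / 2" by linarith
  qed auto
qed

section \<open>Integration in frame coordinates and over paraboloids\<close>

text \<open>The standard argument for the uniqueness of Haar measure: the double integral of
  \<open>1\<^sub>B(y) 1\<^sub>A(Q x + y)\<close>, evaluated in both orders, shows that the image measure is proportional
  to Lebesgue measure, and on the unit ball \<open>B\<close>, which \<open>Q\<close> preserves, the two agree.\<close>

lemma lborel_distr_orthogonal:
  fixes Q :: "'a::euclidean_space \<Rightarrow> 'a"
  assumes Q: "orthogonal_transformation Q"
  shows "distr lborel borel Q = lborel"
proof (rule measure_eqI)
  fix A assume "A \<in> sets (distr lborel borel Q)"
  then have [measurable]: "A \<in> sets borel" by simp
  have lin: "linear Q" using Q by (rule orthogonal_transformation_linear)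
  have Qm [measurable]: "Q \<in> borel_measurable borel"
    using linear_continuous_on[of Q UNIV] lin by (intro borel_measurable_continuous_onI) (simp add: linear_conv_bounded_linear)
  obtain P where P: "\<And>x. Q (P x) = x" using orthogonal_transformation_surj[OF Q] by (metis surj_def)
  let ?B = "ball (0::'a) 1"
  have transl: "(\<integral>\<^sup>+x. f (x + c) \<partial>lborel) = (\<integral>\<^sup>+x. f x \<partial>lborel)"
    if [measurable]: "f \<in> borel_measurable borel" for f :: "'a \<Rightarrow> ennreal" and c
  proof -
    have "(\<integral>\<^sup>+x. f x \<partial>lborel) = (\<integral>\<^sup>+x. f x \<partial>distr lborel borel ((+) c))" by (simp add: lborel_distr_plus)
    then show ?thesis by (subst (asm) nn_integral_distr) (auto simp: add.commute)
  qed
  define IA :: "'a \<Rightarrow> ennreal" where "IA = indicator A"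
  define IB :: "'a \<Rightarrow> ennreal" where "IB = indicator ?B"
  have [measurable]: "IA \<in> borel_measurable borel" "IB \<in> borel_measurable borel"
    unfolding IA_def IB_def by (auto intro!: borel_measurable_indicator)
  have IAB: "(\<integral>\<^sup>+x. IA x \<partial>lborel) = emeasure lborel A" "(\<integral>\<^sup>+x. IB x \<partial>lborel) = emeasure lborel ?B"
    unfolding IA_def IB_def by (auto intro!: nn_integral_indicator)
  define a where "a = (\<integral>\<^sup>+x. IA (Q x) \<partial>lborel)"
  have inner: "(\<integral>\<^sup>+x. IA (Q x + y) \<partial>lborel) = a" for y
  proof -
    have "Q x + y = Q (x + P y)" for x using linear_add[OF lin] P by simp
    then have "(\<integral>\<^sup>+x. IA (Q x + y) \<partial>lborel) = (\<integral>\<^sup>+x. IA (Q (x + P y)) \<partial>lborel)" by simp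
    also have "\<dots> = a" unfolding a_def by (rule transl) measurable
    finally show ?thesis .
  qed
  have ball: "(\<integral>\<^sup>+x. IB (y - Q x) \<partial>lborel) = emeasure lborel ?B" for y
  proof -
    have "y - Q x \<in> ?B \<longleftrightarrow> x \<in> ball (P y) 1" for x
    proof -
      have "y - Q x = Q (P y - x)" using linear_diff[OF lin] P by simp
      then have "norm (y - Q x) = norm (P y - x)" using orthogonal_transformation_norm[OF Q] by simp
      then show ?thesis by (simp add: dist_norm norm_minus_commute)
    qed
    then have "(\<integral>\<^sup>+x. IB (y - Q x) \<partial>lborel) = (\<integral>\<^sup>+x. indicator (ball (P y) 1) x \<partial>lborel)"
      by (intro nn_integral_cong) (auto simp: indicator_def IB_def)
    also have "\<dots> = emeasure lborel (ball (P y) 1)" by (rule nn_integral_indicator) simp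
    finally show ?thesis by (simp add: emeasure_ball)
  qed
  have "a * emeasure lborel ?B = (\<integral>\<^sup>+y. IB y * a \<partial>lborel)"
    by (subst nn_integral_multc) (auto simp: mult.commute IAB)
  also have "\<dots> = (\<integral>\<^sup>+y. (\<integral>\<^sup>+x. IB y * IA (Q x + y) \<partial>lborel) \<partial>lborel)"
    by (intro nn_integral_cong) (simp add: nn_integral_cmult inner)
  also have "\<dots> = (\<integral>\<^sup>+x. (\<integral>\<^sup>+y. IB y * IA (Q x + y) \<partial>lborel) \<partial>lborel)"
    by (rule lborel_pair.Fubini') measurable
  also have "\<dots> = (\<integral>\<^sup>+x. (\<integral>\<^sup>+y. IB (y - Q x) * IA y \<partial>lborel) \<partial>lborel)"
  proof (rule nn_integral_cong)
    fix x
    have "(\<integral>\<^sup>+y. IB ((y + Q x) - Q x) * IA (y + Q x) \<partial>lborel) = (\<integral>\<^sup>+y. IB (y - Q x) * IA y \<partial>lborel)"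
      by (rule transl) measurable
    then show "(\<integral>\<^sup>+y. IB y * IA (Q x + y) \<partial>lborel) = (\<integral>\<^sup>+y. IB (y - Q x) * IA y \<partial>lborel)"
      by (simp add: add.commute)
  qed
  also have "\<dots> = (\<integral>\<^sup>+y. (\<integral>\<^sup>+x. IB (y - Q x) * IA y \<partial>lborel) \<partial>lborel)"
    by (rule lborel_pair.Fubini') measurable
  also have "\<dots> = (\<integral>\<^sup>+y. emeasure lborel ?B * IA y \<partial>lborel)"
  proof (rule nn_integral_cong)
    fix y
    have "(\<integral>\<^sup>+x. IB (y - Q x) * IA y \<partial>lborel) = (\<integral>\<^sup>+x. IB (y - Q x) \<partial>lborel) * IA y"
      by (rule nn_integral_multc) measurable
    then show "(\<integral>\<^sup>+x. IB (y - Q x) * IA y \<partial>lborel) = emeasure lborel ?B * IA y" by (simp only: ball)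
  qed
  also have "\<dots> = emeasure lborel ?B * emeasure lborel A"
    by (subst nn_integral_cmult) (auto simp: IAB)
  finally have eq: "emeasure lborel ?B * a = emeasure lborel ?B * emeasure lborel A" by (simp add: mult.commute)
  have "emeasure lborel ?B \<noteq> 0" "emeasure lborel ?B \<noteq> top"
    using lebesgue_on_ball(2)[of 1 "0::'a"] emeasure_lborel_ball_finite[of "0::'a" 1]
    by (auto simp: emeasure_restrict_space)
  then have "a = emeasure lborel A" using eq
    by (simp add: ennreal_mult_cancel_left)
  moreover have "emeasure (distr lborel borel Q) A = a"
  proof -
    have "a = (\<integral>\<^sup>+x. IA x \<partial>distr lborel borel Q)"
      unfolding a_def by (subst nn_integral_distr) auto
    then show ?thesis by (simp add: IA_def)
  qed
  ultimately show "emeasure (distr lborel borel Q) A = emeasure lborel A" by simp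
qed simp

lemma lborel_integral_frame_coordinates:
  fixes b :: "'n::finite \<Rightarrow> real^'n" and F :: "real^'n \<Rightarrow> real"
  assumes b: "orthonormal_frame b" and c: "\<And>i. c i > 0" and [measurable]: "F \<in> borel_measurable borel"
  shows "(\<integral>z. F z \<partial>lborel) = (\<Prod>i\<in>UNIV. c i) * (\<integral>w. F (y + frame_map b (\<chi> i. c i * w $ i)) \<partial>lborel)"
proof -
  note Q = orthogonal_frame_map[OF b]
  have lin: "linear (frame_map b)" using Q by (rule orthogonal_transformation_linear)
  have Qm [measurable]: "frame_map b \<in> borel_measurable borel"
    using linear_continuous_on[of "frame_map b" UNIV] lin by (intro borel_measurable_continuous_onI) (simp add: linear_conv_bounded_linear)
  define d where "d v = (\<Sum>i\<in>UNIV. c i * (v $ i))" for v :: "real^'n"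
  define T where "T x = 0 + (\<Sum>j\<in>Basis. (d j * (x \<bullet> j)) *\<^sub>R j)" for x :: "real^'n"
  have d_axis: "d (axis i 1) = c i" for i
  proof -
    have "d (axis i 1) = (\<Sum>j\<in>UNIV. if j = i then c i else 0)"
      unfolding d_def by (intro sum.cong) (auto simp: axis_def)
    then show ?thesis by simp
  qed
  have Basis: "(Basis :: (real^'n) set) = (\<lambda>i. axis i 1) ` UNIV" by (auto simp: Basis_vec_def)
  have inj: "inj (\<lambda>i::'n. axis i (1::real))" by (auto simp: inj_on_def axis_eq_axis)
  have T: "T w = (\<chi> i. c i * w $ i)" for w
  proof -
    have "T w = (\<Sum>i\<in>UNIV. (c i * w $ i) *\<^sub>R axis i 1)"
      unfolding T_def Basis by (subst sum.reindex[OF inj]) (simp add: d_axis inner_axis o_def)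
    then show ?thesis by (simp add: vec_eq_iff axis_def if_distrib cong: if_cong)
  qed
  have Tm [measurable]: "T \<in> borel_measurable borel"
    unfolding T_def by measurable
  have aff: "lborel = density (distr lborel borel T) (\<lambda>_. ennreal (\<Prod>j\<in>(Basis::(real^'n) set). \<bar>d j\<bar>))"
    unfolding T_def by (rule lborel_affine_euclidean) (use c in \<open>auto simp: Basis d_axis less_imp_neq[symmetric]\<close>)
  have pr: "(\<Prod>j\<in>(Basis::(real^'n) set). \<bar>d j\<bar>) = (\<Prod>i\<in>UNIV. c i)"
    unfolding Basis by (subst prod.reindex[OF inj]) (use less_imp_le[OF c] in \<open>simp add: d_axis o_def\<close>)
  have "(\<integral>z. F z \<partial>lborel) = (\<integral>z. F z \<partial>distr lborel borel ((+) y))" by (simp add: lborel_distr_plus)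
  also have "\<dots> = (\<integral>z. F (y + z) \<partial>lborel)" by (subst integral_distr) auto
  also have "\<dots> = (\<integral>z. F (y + z) \<partial>distr lborel borel (frame_map b))" by (simp add: lborel_distr_orthogonal[OF Q])
  also have "\<dots> = (\<integral>z. F (y + frame_map b z) \<partial>lborel)" by (subst integral_distr) auto
  also have "\<dots> = (\<integral>z. F (y + frame_map b z) \<partial>density (distr lborel borel T) (\<lambda>_. ennreal (\<Prod>i\<in>UNIV. c i)))"
    by (subst aff) (simp add: pr)
  also have "\<dots> = (\<integral>z. (\<Prod>i\<in>UNIV. c i) * F (y + frame_map b z) \<partial>distr lborel borel T)"
    using prod_pos[of UNIV c] c by (subst integral_real_density) (auto intro!: AE_I2 less_imp_le)
  also have "\<dots> = (\<integral>w. (\<Prod>i\<in>UNIV. c i) * F (y + frame_map b (T w)) \<partial>lborel)"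
    by (subst integral_distr) auto
  finally show ?thesis by (simp add: T)
qed

lemma borel_measurable_component:
  "i \<in> J \<Longrightarrow> (\<lambda>x. x i) \<in> borel_measurable (Pi\<^sub>M J (\<lambda>_. lborel :: real measure))"
  using measurable_component_singleton[of i J "\<lambda>_. lborel"] by simp

lemma emeasure_product_open_ball:
  assumes "finite I" "r > 0"
  shows "emeasure (Pi\<^sub>M I (\<lambda>_. lborel)) {f \<in> space (Pi\<^sub>M I (\<lambda>_. lborel)). (\<Sum>i\<in>I. (f i)\<^sup>2) < r\<^sup>2}
    = ennreal (unit_ball_vol (real (card I)) * r ^ card I)"
proof -
  let ?M = "Pi\<^sub>M I (\<lambda>_. lborel :: real measure)"
  let ?O = "{f \<in> space ?M. (\<Sum>i\<in>I. (f i)\<^sup>2) < r\<^sup>2}"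
  let ?C = "\<lambda>r. {f. sqrt (\<Sum>i\<in>I. (f i)\<^sup>2) \<le> r} \<inter> space ?M"
  define \<rho> where "\<rho> f = (\<Sum>i\<in>I. (f i)\<^sup>2)" for f :: "'a \<Rightarrow> real"
  have [measurable]: "\<rho> \<in> borel_measurable ?M"
    unfolding \<rho>_def by (intro borel_measurable_sum borel_measurable_power borel_measurable_component)
  have \<rho>0: "\<rho> f \<ge> 0" for f by (simp add: \<rho>_def sum_nonneg)
  have "{f \<in> space ?M. \<rho> f < r\<^sup>2} \<in> sets ?M" by measurable
  then have Om: "?O \<in> sets ?M" by (simp add: \<rho>_def)
  have Cm: "?C r \<in> sets ?M" for r
  proof -
    have "?C r = {f \<in> space ?M. sqrt (\<rho> f) \<le> r}" by (auto simp: \<rho>_def)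
    also have "\<dots> \<in> sets ?M" by measurable
    finally show ?thesis .
  qed
  have up: "emeasure ?M ?O \<le> ennreal (unit_ball_vol (real (card I)) * r ^ card I)"
  proof -
    have "?O \<subseteq> ?C r"
    proof
      fix f assume f: "f \<in> ?O"
      then have "sqrt (\<Sum>i\<in>I. (f i)\<^sup>2) \<le> sqrt (r\<^sup>2)" by (intro real_sqrt_le_mono) auto
      then show "f \<in> ?C r" using f assms(2) by simp
    qed
    from emeasure_mono[OF this Cm] show ?thesis by (simp only: emeasure_cball_aux[OF assms])
  qed
  have low: "ennreal (unit_ball_vol (real (card I)) * s ^ card I) \<le> emeasure ?M ?O" if "0 < s" "s < r" for s
  proof -
    have "?C s \<subseteq> ?O"
    proof
      fix f assume f: "f \<in> ?C s"
      have "(\<Sum>i\<in>I. (f i)\<^sup>2) = (sqrt (\<Sum>i\<in>I. (f i)\<^sup>2))\<^sup>2" by (simp add: sum_nonneg)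
      also have "\<dots> \<le> s\<^sup>2" using f by (intro power_mono) (auto simp: sum_nonneg)
      also have "\<dots> < r\<^sup>2" using that by (intro power_strict_mono) auto
      finally show "f \<in> ?O" using f by auto
    qed
    from emeasure_mono[OF this Om] show ?thesis by (simp only: emeasure_cball_aux[OF assms(1) that(1)])
  qed
  have "((\<lambda>s. ennreal (unit_ball_vol (real (card I)) * s ^ card I)) \<longlongrightarrow> ennreal (unit_ball_vol (real (card I)) * r ^ card I)) (at_left r)"
    by (intro tendsto_ennrealI tendsto_intros)
  moreover have "\<forall>\<^sub>F s in at_left r. ennreal (unit_ball_vol (real (card I)) * s ^ card I) \<le> emeasure ?M ?O"
    unfolding eventually_at_left_field using low assms(2) by (intro exI[of _ 0]) auto
  ultimately have "ennreal (unit_ball_vol (real (card I)) * r ^ card I) \<le> emeasure ?M ?O"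
    by (intro tendsto_upperbound[of _ _ "at_left r"]) auto
  with up show ?thesis by simp
qed

text \<open>For fixed remaining coordinates the \<open>k\<close>-th one is shifted so that it becomes \<open>l\<close>; after
  exchanging the integrations the slice at level \<open>s\<close> is a ball of dimension \<open>N - 1\<close> and radius
  \<open>sqrt (2 R s)\<close>, whatever the coefficients \<open>K\<close>.\<close>

lemma nn_integral_paraboloid:
  fixes f :: "real \<Rightarrow> ennreal" and k :: "'n::finite" and K :: "'n \<Rightarrow> real"
  assumes [measurable]: "f \<in> borel_measurable borel" and R: "R > 0"
  defines "l \<equiv> \<lambda>w::real^'n. w $ k - (\<Sum>i\<in>UNIV-{k}. K i * (w $ i)\<^sup>2)"
  shows "(\<integral>\<^sup>+w. f (l w) * indicator {w. (\<Sum>i\<in>UNIV-{k}. (w $ i)\<^sup>2) < 2 * R * l w} w \<partial>lborel)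
    = (\<integral>\<^sup>+s. f s * ennreal (unit_ball_vol (real (CARD('n) - 1)) * sqrt (2 * R * s) ^ (CARD('n) - 1)) * indicator {0<..} s \<partial>lborel)"
proof -
  let ?b = "\<lambda>i::'n. axis i (1::real) :: real^'n"
  have inj: "inj ?b" by (auto simp: inj_on_def axis_eq_axis)
  have Basis: "(Basis :: (real^'n) set) = ?b ` UNIV" by (auto simp: Basis_vec_def)
  define I where "I = ?b ` (UNIV - {k})"
  have BI: "Basis = insert (?b k) I" "?b k \<notin> I" "finite I"
    unfolding I_def Basis by (auto simp: axis_eq_axis)
  have cI: "card I = CARD('n) - 1"
    unfolding I_def by (subst card_image[OF inj_on_subset[OF inj]]) (auto simp: card_Diff_singleton)
  interpret product_sigma_finite "\<lambda>_::real^'n. lborel :: real measure" by standard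
  define S where "S x = (\<Sum>i\<in>UNIV-{k}. K i * (x (?b i))\<^sup>2)" for x :: "real^'n \<Rightarrow> real"
  define \<rho> where "\<rho> x = (\<Sum>i\<in>I. (x i)\<^sup>2)" for x :: "real^'n \<Rightarrow> real"
  define h where "h x = f (x (?b k) - S x) * (if \<rho> x < 2 * R * (x (?b k) - S x) then 1 else 0)" for x :: "real^'n \<Rightarrow> real"
  have comp: "(\<Sum>b\<in>Basis. x b *\<^sub>R b) $ i = x (?b i)" for x :: "real^'n \<Rightarrow> real" and i
  proof -
    have "(\<Sum>b\<in>Basis. x b *\<^sub>R b) $ i = (\<Sum>b\<in>Basis. x b *\<^sub>R b) \<bullet> ?b i" by (simp add: inner_axis)
    also have "\<dots> = x (?b i)" by (rule inner_sum_left_Basis) (auto simp: Basis)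
    finally show ?thesis .
  qed
  have rho: "\<rho> x = (\<Sum>i\<in>UNIV-{k}. (x (?b i))\<^sup>2)" for x
    unfolding \<rho>_def I_def by (subst sum.reindex[OF inj_on_subset[OF inj]]) auto
  have bi: "?b i \<in> Basis" for i by (simp add: Basis)
  have Sm: "S \<in> borel_measurable (Pi\<^sub>M J (\<lambda>_. lborel))" if "I \<subseteq> J" for J
    unfolding S_def
    by (intro borel_measurable_sum borel_measurable_times borel_measurable_power borel_measurable_const borel_measurable_component)
      (use that in \<open>auto simp: I_def\<close>)
  have rm: "\<rho> \<in> borel_measurable (Pi\<^sub>M J (\<lambda>_. lborel))" if "I \<subseteq> J" for J
    unfolding \<rho>_def by (intro borel_measurable_sum borel_measurable_power borel_measurable_component)
      (use that in auto)
  have km: "(\<lambda>x. x (?b k)) \<in> borel_measurable (Pi\<^sub>M Basis (\<lambda>_. lborel :: real measure))"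
    by (rule borel_measurable_component) (rule bi)
  have hm: "h \<in> borel_measurable (Pi\<^sub>M Basis (\<lambda>_. lborel))"
  proof -
    have IB: "I \<subseteq> Basis" using BI by auto
    note [measurable] = Sm[OF IB] rm[OF IB] km
    show ?thesis unfolding h_def by measurable
  qed
  have lm [measurable]: "l \<in> borel_measurable borel" unfolding l_def by measurable
  have "(\<integral>\<^sup>+w. f (l w) * indicator {w. (\<Sum>i\<in>UNIV-{k}. (w $ i)\<^sup>2) < 2 * R * l w} w \<partial>lborel) = (\<integral>\<^sup>+x. h x \<partial>Pi\<^sub>M Basis (\<lambda>_. lborel))"
  proof -
    define V where "V x = (\<Sum>b\<in>Basis. x b *\<^sub>R b)" for x :: "real^'n \<Rightarrow> real"
    have Vm: "V \<in> Pi\<^sub>M Basis (\<lambda>_. lborel) \<rightarrow>\<^sub>M borel" unfolding V_def by measurable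
    have lb: "lborel = distr (Pi\<^sub>M Basis (\<lambda>_. lborel)) borel V" unfolding V_def by (rule lborel_eq)
    have lV: "l (V x) = x (?b k) - S x" "(\<Sum>i\<in>UNIV-{k}. (V x $ i)\<^sup>2) = \<rho> x" for x
      unfolding l_def S_def rho using comp[of x] by (simp_all add: V_def)
    have "(\<integral>\<^sup>+w. f (l w) * indicator {w. (\<Sum>i\<in>UNIV-{k}. (w $ i)\<^sup>2) < 2 * R * l w} w \<partial>lborel)
       = (\<integral>\<^sup>+x. f (l (V x)) * indicator {w. (\<Sum>i\<in>UNIV-{k}. (w $ i)\<^sup>2) < 2 * R * l w} (V x) \<partial>Pi\<^sub>M Basis (\<lambda>_. lborel))"
      unfolding lb by (rule nn_integral_distr[OF Vm]) measurable
    also have "\<dots> = (\<integral>\<^sup>+x. h x \<partial>Pi\<^sub>M Basis (\<lambda>_. lborel))"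
      by (intro nn_integral_cong) (simp add: h_def lV indicator_def)
    finally show ?thesis .
  qed
  also have "\<dots> = (\<integral>\<^sup>+x. (\<integral>\<^sup>+s. h (x(?b k := s)) \<partial>lborel) \<partial>Pi\<^sub>M I (\<lambda>_. lborel))"
    unfolding BI(1) by (rule product_nn_integral_insert[OF BI(3,2)]) (use hm BI(1) in simp)
  also have "\<dots> = (\<integral>\<^sup>+x. (\<integral>\<^sup>+s. f s * (if \<rho> x < 2 * R * s then 1 else 0) \<partial>lborel) \<partial>Pi\<^sub>M I (\<lambda>_. lborel))"
  proof (rule nn_integral_cong)
    fix x :: "real^'n \<Rightarrow> real"
    have "S (x(?b k := s)) = S x" "\<rho> (x(?b k := s)) = \<rho> x" for s
      unfolding S_def rho by (auto intro!: sum.cong simp: axis_eq_axis)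
    then have "(\<integral>\<^sup>+s. h (x(?b k := s)) \<partial>lborel) = (\<integral>\<^sup>+s. f (- S x + s) * (if \<rho> x < 2 * R * (- S x + s) then 1 else 0) \<partial>lborel)"
      by (simp add: h_def)
    also have "\<dots> = (\<integral>\<^sup>+s. f s * (if \<rho> x < 2 * R * s then 1 else 0) \<partial>distr lborel borel ((+) (- S x)))"
      by (subst nn_integral_distr) auto
    finally show "(\<integral>\<^sup>+s. h (x(?b k := s)) \<partial>lborel) = (\<integral>\<^sup>+s. f s * (if \<rho> x < 2 * R * s then 1 else 0) \<partial>lborel)"
      by (simp add: lborel_distr_plus)
  qed
  also have "\<dots> = (\<integral>\<^sup>+s. (\<integral>\<^sup>+x. f s * (if \<rho> x < 2 * R * s then 1 else 0) \<partial>Pi\<^sub>M I (\<lambda>_. lborel)) \<partial>lborel)"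
  proof (rule pair_sigma_finite.Fubini')
    interpret I: finite_product_sigma_finite "\<lambda>_::real^'n. lborel :: real measure" I by standard (rule BI)
    show "pair_sigma_finite lborel (Pi\<^sub>M I (\<lambda>_. lborel :: real measure))"
      by (intro pair_sigma_finite.intro I.sigma_finite_measure_axioms lborel.sigma_finite_measure_axioms)
    note [measurable] = rm[OF order_refl]
    show "(\<lambda>(s, x). f s * (if \<rho> x < 2 * R * s then 1 else 0)) \<in> borel_measurable (lborel \<Otimes>\<^sub>M Pi\<^sub>M I (\<lambda>_. lborel))"
      by measurable
  qed
  also have "\<dots> = (\<integral>\<^sup>+s. f s * ennreal (unit_ball_vol (real (CARD('n) - 1)) * sqrt (2 * R * s) ^ (CARD('n) - 1)) * indicator {0<..} s \<partial>lborel)"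
  proof (rule nn_integral_cong)
    fix s :: real
    note [measurable] = rm[OF order_refl]
    let ?A = "{x \<in> space (Pi\<^sub>M I (\<lambda>_. lborel :: real measure)). \<rho> x < 2 * R * s}"
    have "(\<integral>\<^sup>+x. f s * (if \<rho> x < 2 * R * s then 1 else 0) \<partial>Pi\<^sub>M I (\<lambda>_. lborel)) = (\<integral>\<^sup>+x. f s * indicator ?A x \<partial>Pi\<^sub>M I (\<lambda>_. lborel))"
      by (intro nn_integral_cong) (auto simp: indicator_def)
    also have "\<dots> = f s * emeasure (Pi\<^sub>M I (\<lambda>_. lborel)) ?A" by (rule nn_integral_cmult_indicator) measurable
    also have "\<dots> = f s * ennreal (unit_ball_vol (real (CARD('n) - 1)) * sqrt (2 * R * s) ^ (CARD('n) - 1)) * indicator {0<..} s"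
    proof (cases "s > 0")
      case True
      then have "emeasure (Pi\<^sub>M I (\<lambda>_. lborel)) ?A = ennreal (unit_ball_vol (real (CARD('n) - 1)) * sqrt (2 * R * s) ^ (CARD('n) - 1))"
        using emeasure_product_open_ball[OF BI(3), of "sqrt (2 * R * s)"] R by (simp add: \<rho>_def cI)
      then show ?thesis using True by simp
    next
      case False
      then have "2 * R * s \<le> 0" using R by (simp add: mult_nonneg_nonpos)
      moreover have "0 \<le> \<rho> x" for x by (simp add: \<rho>_def sum_nonneg)
      ultimately have "\<not> \<rho> x < 2 * R * s" for x by (meson not_less order_trans)
      then have "?A = {}" by blast
      then show ?thesis using False by (simp only:) simp
    qed
    finally show "(\<integral>\<^sup>+x. f s * (if \<rho> x < 2 * R * s then 1 else 0) \<partial>Pi\<^sub>M I (\<lambda>_. lborel))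
      = f s * ennreal (unit_ball_vol (real (CARD('n) - 1)) * sqrt (2 * R * s) ^ (CARD('n) - 1)) * indicator {0<..} s" .
  qed
  finally show ?thesis .
qed

section \<open>Blow-up at the touching point\<close>

text \<open>The signed powers nearly cancel where \<open>a\<close> is small, which makes the integrals over the
  blown-up ball converge. If \<open>|m| \<le> 2 |a|\<close>, both terms are of order \<open>|a| powr r\<close>; otherwise the
  mean value theorem applies on an interval whose distance from 0 is at least \<open>|a|\<close>.\<close>

lemma spow_diff_bound:
  assumes r: "r > 0" and m: "\<bar>m\<bar> \<le> 1"
  shows "\<bar>spow r (a - m) + spow r m\<bar> \<le> (3 powr r + 2 powr r + r * 2 powr r) * (\<bar>a\<bar> powr r + \<bar>a\<bar>)"
proof -
  define C where "C = 3 powr r + 2 powr r + r * 2 powr r"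
  have C: "r * 2 powr r \<le> C" "3 powr r + 2 powr r \<le> C" "C \<ge> 0" "r \<le> C"
  proof -
    have "1 \<le> 2 powr r" using r by (simp add: ge_one_powr_ge_zero)
    then have "r * 1 \<le> r * 2 powr r" using r by (intro mult_left_mono) auto
    then show "r * 2 powr r \<le> C" "3 powr r + 2 powr r \<le> C" "C \<ge> 0" "r \<le> C"
      using r by (auto simp: C_def add_increasing)
  qed
  have pos: "\<bar>spow r (a - m) + spow r m\<bar> \<le> C * (\<bar>a\<bar> powr r + \<bar>a\<bar>)" if "m \<ge> 0" "\<bar>m\<bar> \<le> 1" for a m
  proof (cases "\<bar>m\<bar> \<le> 2 * \<bar>a\<bar>")
    case True
    have "\<bar>spow r (a - m) + spow r m\<bar> \<le> \<bar>a - m\<bar> powr r + \<bar>m\<bar> powr r"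
      using abs_triangle_ineq[of "spow r (a - m)" "spow r m"] by (simp add: abs_spow)
    also have "\<dots> \<le> (3 * \<bar>a\<bar>) powr r + (2 * \<bar>a\<bar>) powr r"
      using True r by (intro add_mono powr_mono2) auto
    also have "\<dots> = (3 powr r + 2 powr r) * \<bar>a\<bar> powr r" by (simp add: powr_mult algebra_simps)
    also have "\<dots> \<le> C * (\<bar>a\<bar> powr r + \<bar>a\<bar>)" using C by (intro mult_mono) auto
    finally show ?thesis .
  next
    case False
    then have m2: "2 * \<bar>a\<bar> < m" using that by simp
    show ?thesis
    proof (cases "a = 0")
      case True then show ?thesis by (simp add: spow_minus)
    next
      case a0: False
      have mp: "m > 0" "m - a > 0" using m2 by (auto simp: abs_if split: if_splits)
      have e: "spow r (a - m) + spow r m = m powr r - (m - a) powr r"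
        using spow_minus[of r "m - a"] mp by (simp add: spow_nonneg)
      have d: "((\<lambda>x. x powr r) has_real_derivative r * x powr (r - 1)) (at x)" if "x > 0" for x
        by (rule has_real_derivative_powr) (use that in auto)
      have "\<exists>z. m - \<bar>a\<bar> \<le> z \<and> z \<le> m + \<bar>a\<bar> \<and> \<bar>m powr r - (m - a) powr r\<bar> = \<bar>a\<bar> * (r * z powr (r - 1))"
      proof (cases "a > 0")
        case True
        obtain z where "m - a < z" "z < m" "m powr r - (m - a) powr r = (m - (m - a)) * (r * z powr (r - 1))"
          using MVT2[of "m - a" m "\<lambda>x. x powr r" "\<lambda>x. r * x powr (r - 1)"] d True mp by force
        then show ?thesis using True r by (intro exI[of _ z]) (auto simp: abs_mult)
      next
        case F: False
        then have an: "a < 0" using a0 by simp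
        obtain z where z: "m < z" "z < m - a" "(m - a) powr r - m powr r = ((m - a) - m) * (r * z powr (r - 1))"
          using MVT2[of m "m - a" "\<lambda>x. x powr r" "\<lambda>x. r * x powr (r - 1)"] d an mp by force
        have "\<bar>m powr r - (m - a) powr r\<bar> = \<bar>(m - a) powr r - m powr r\<bar>" by (rule abs_minus_commute)
        also have "\<dots> = \<bar>a\<bar> * (r * z powr (r - 1))" unfolding z(3) using r by (simp add: abs_mult)
        finally show ?thesis using z an by (intro exI[of _ z]) auto
      qed
      then obtain z where z: "m - \<bar>a\<bar> \<le> z" "z \<le> m + \<bar>a\<bar>" "\<bar>m powr r - (m - a) powr r\<bar> = \<bar>a\<bar> * (r * z powr (r - 1))" by blast
      have za: "z \<ge> \<bar>a\<bar>" "z > 0" "z \<le> 2" using z m2 that by (auto simp: abs_if split: if_splits)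
      show ?thesis
      proof (cases "r \<ge> 1")
        case True
        have "z powr (r - 1) \<le> 2 powr (r - 1)" using za True by (intro powr_mono2) auto
        also have "\<dots> \<le> 2 powr r" by simp
        finally have "r * z powr (r - 1) \<le> r * 2 powr r" using r by (intro mult_left_mono) auto
        then have "\<bar>a\<bar> * (r * z powr (r - 1)) \<le> \<bar>a\<bar> * C" using C by (intro mult_left_mono) auto
        also have "\<dots> \<le> C * (\<bar>a\<bar> powr r + \<bar>a\<bar>)" using C by (simp add: algebra_simps)
        finally show ?thesis using e z(3) by simp
      next
        case False
        have "z powr (r - 1) \<le> \<bar>a\<bar> powr (r - 1)" using za False a0 by (intro powr_mono2') auto
        then have "\<bar>a\<bar> * (r * z powr (r - 1)) \<le> \<bar>a\<bar> * (r * \<bar>a\<bar> powr (r - 1))" using r by (intro mult_left_mono) auto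
        also have "\<dots> = r * \<bar>a\<bar> powr r" using a0 by (simp add: powr_diff)
        also have "\<dots> \<le> C * (\<bar>a\<bar> powr r + \<bar>a\<bar>)" using C r by (intro mult_mono) auto
        finally show ?thesis using e z(3) by simp
      qed
    qed
  qed
  show ?thesis
  proof (cases "m \<ge> 0")
    case True then show ?thesis using pos m by (simp add: C_def)
  next
    case False
    have "spow r (a - m) + spow r m = - (spow r (- a - - m) + spow r (- m))"
      using spow_minus[of r "a - m"] spow_minus[of r m] by simp
    then show ?thesis using pos[of "- m" "- a"] False m unfolding C_def by (metis abs_minus_cancel less_imp_le neg_0_le_iff_le not_le)
  qed
qed

lemma integrable_gauss_scaled:
  assumes "c > 0" shows "integrable lborel (\<lambda>s::real. exp (- c * s\<^sup>2))"
proof -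
  have "integrable lborel (\<lambda>\<tau>::real. exp (- \<tau>\<^sup>2))"
    using set_integrable_gauss[of UNIV] by (simp add: set_integrable_def)
  from lborel_integrable_real_affine[OF this, of "sqrt c" 0]
  show ?thesis using assms by (simp add: power_mult_distrib)
qed

text \<open>The power is at most exponential, since \<open>sqrt x \<le> exp x\<close>; completing the square leaves half of
  the Gaussian.\<close>

lemma finite_gauss_moment:
  assumes "c > 0" "R > 0" "D \<ge> 0"
  shows "(\<integral>\<^sup>+s. ennreal (exp (- c * s\<^sup>2)) * ennreal (D * sqrt (2 * R * s) ^ m) * indicator {0<..} s \<partial>lborel) < \<infinity>"
proof -
  define B where "B = D * exp ((2 * R * real m)\<^sup>2 / (2 * c))"
  have B: "B \<ge> 0" using assms by (simp add: B_def)
  have le: "exp (- c * s\<^sup>2) * (D * sqrt (2 * R * s) ^ m) \<le> B * exp (- (c / 2) * s\<^sup>2)" if s: "s > 0" for s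
  proof -
    have y: "2 * R * s > 0" using s assms by simp
    have "sqrt (2 * R * s) \<le> exp (2 * R * s)"
    proof -
      have "2 * R * s \<le> (1 + 2 * R * s)\<^sup>2"
      proof -
        have "(1 + 2 * R * s)\<^sup>2 = 1 + 2 * (2 * R * s) + (2 * R * s)\<^sup>2"
          by (simp add: power2_eq_square algebra_simps)
        then show ?thesis using y zero_le_power2[of "2 * R * s"] by linarith
      qed
      then have "sqrt (2 * R * s) \<le> 1 + 2 * R * s" using y by (intro real_le_lsqrt) auto
      also have "\<dots> \<le> exp (2 * R * s)" by (rule exp_ge_add_one_self)
      finally show ?thesis .
    qed
    then have "sqrt (2 * R * s) ^ m \<le> exp (2 * R * s) ^ m" using y by (intro power_mono) auto
    also have "\<dots> = exp (real m * (2 * R * s))" by (simp add: exp_of_nat_mult)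
    also have "\<dots> \<le> exp ((c / 2) * s\<^sup>2 + (2 * R * real m)\<^sup>2 / (2 * c))"
    proof -
      have "0 \<le> (c * s - 2 * R * real m)\<^sup>2 / (2 * c)" using assms by simp
      also have "\<dots> = (c / 2) * s\<^sup>2 - real m * (2 * R * s) + (2 * R * real m)\<^sup>2 / (2 * c)"
        using assms by (simp add: field_simps power2_eq_square)
      finally show ?thesis by simp
    qed
    finally have "exp (- c * s\<^sup>2) * (D * sqrt (2 * R * s) ^ m) \<le> exp (- c * s\<^sup>2) * (D * exp ((c / 2) * s\<^sup>2 + (2 * R * real m)\<^sup>2 / (2 * c)))"
      using assms by (intro mult_left_mono) auto
    also have "\<dots> = B * (exp (- c * s\<^sup>2) * exp ((c / 2) * s\<^sup>2))" by (simp add: B_def exp_add)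
    also have "exp (- c * s\<^sup>2) * exp ((c / 2) * s\<^sup>2) = exp (- (c / 2) * s\<^sup>2)"
      by (subst exp_add[symmetric]) (simp add: field_simps)
    finally show ?thesis .
  qed
  have "(\<integral>\<^sup>+s. ennreal (exp (- c * s\<^sup>2)) * ennreal (D * sqrt (2 * R * s) ^ m) * indicator {0<..} s \<partial>lborel)
    \<le> (\<integral>\<^sup>+s. ennreal (B * exp (- (c / 2) * s\<^sup>2)) \<partial>lborel)"
  proof (rule nn_integral_mono)
    fix s :: real
    show "ennreal (exp (- c * s\<^sup>2)) * ennreal (D * sqrt (2 * R * s) ^ m) * indicator {0<..} s \<le> ennreal (B * exp (- (c / 2) * s\<^sup>2))"
    proof (cases "s > 0")
      case True
      have "ennreal (exp (- c * s\<^sup>2)) * ennreal (D * sqrt (2 * R * s) ^ m) = ennreal (exp (- c * s\<^sup>2) * (D * sqrt (2 * R * s) ^ m))"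
        using True assms by (intro ennreal_mult[symmetric]) auto
      also have "\<dots> \<le> ennreal (B * exp (- (c / 2) * s\<^sup>2))" using le[OF True] by (rule ennreal_leI)
      finally show ?thesis using True by simp
    qed simp
  qed
  also have "\<dots> < \<infinity>"
  proof -
    have "integrable lborel (\<lambda>s. B * exp (- (c / 2) * s\<^sup>2))"
      using integrable_gauss_scaled[of "c / 2"] assms by (intro integrable_mult_right) auto
    then show ?thesis using B by (subst nn_integral_eq_integral) auto
  qed
  finally show ?thesis .
qed

text \<open>The hypotheses of the theorem in an orthonormal frame \<open>b\<close> that consists of the normal
  \<open>b k = \<nu>\<close> and of principal directions.\<close>

locale touching_ball =
  fixes \<Omega> :: "(real^'n) set" and x y \<nu> :: "real^'n" and R :: real and g :: "real^'n \<Rightarrow> real"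
    and b :: "'n \<Rightarrow> real^'n" and k :: 'n and kap :: "'n \<Rightarrow> real" and p :: ereal and u :: "(real^'n) \<times> real \<Rightarrow> real"
  assumes op: "open \<Omega>" and R: "R > 0" and yfr: "y \<in> frontier \<Omega>" and tb: "cball x R \<inter> (- \<Omega>) = {y}"
    and gr: "local_C2_graph \<Omega> y \<nu> g" and g0: "grad g y = 0"
    and b: "orthonormal_frame b" and bk: "b k = \<nu>"
    and H: "\<And>i. i \<noteq> k \<Longrightarrow> hessian g y *v b i = kap i *\<^sub>R b i" and lam: "\<And>i. i \<noteq> k \<Longrightarrow> kap i < 1 / R"
    and p1: "1 < p" and u: "bounded_IBVP_solution p \<Omega> u"
begin

text \<open>The map \<open>Z t\<close> introduces blow-up coordinates \<open>w\<close> at \<open>y\<close>. The depth is measured in units of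
  \<open>sqrt t\<close>, the width of the boundary layer. At that depth the ball has a width of order
  \<open>t powr (1/4)\<close>, the unit for the tangential directions; the factors \<open>1 / sqrt (\<alpha> i)\<close> make the
  slices of the limiting region round. This region is the paraboloid \<open>\<rho> w < 2 R ell w\<close>, where
  \<open>ell w\<close> is the limit of the height above the boundary in units of \<open>sqrt t\<close>, and \<open>\<beta>\<close> is the
  parameter of the limiting profile.\<close>

definition "\<alpha> i = 1 - R * kap i"
definition "stretch t i = (if i = k then sqrt t else t powr (1/4) / sqrt (\<alpha> i))"
definition "Z t w = y + frame_map b (\<chi> i. stretch t i * w $ i)"
definition "\<rho> w = (\<Sum>i\<in>UNIV-{k}. (w $ i)\<^sup>2)" for w :: "real^'n"
definition "ell w = w $ k - (\<Sum>i\<in>UNIV-{k}. (kap i / (2 * \<alpha> i)) * (w $ i)\<^sup>2)" for w :: "real^'n"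
definition "\<beta> = sqrt (conj_exp p) / 2"

lemma gy: "g y = y \<bullet> \<nu>" by (rule graph_passes_through[OF op yfr gr])
lemma x_eq: "x = y + R *\<^sub>R \<nu>" by (rule touching_ball_normal[OF op R yfr tb gr g0])
lemma \<alpha>_pos: "i \<noteq> k \<Longrightarrow> \<alpha> i > 0" using lam[of i] R by (simp add: \<alpha>_def field_simps)
lemma beta_pos: "\<beta> > 0" using inverse_exponent_bounds[OF p1] by (simp add: \<beta>_def)

lemma ball_subset: "ball x R \<subseteq> \<Omega>"
proof
  fix z assume z: "z \<in> ball x R"
  have "norm \<nu> = 1" using gr by (simp add: local_C2_graph_def)
  then have "dist x y = R" using x_eq R by (simp add: dist_norm)
  then have "z \<noteq> y" using z by auto
  moreover have "z \<in> cball x R" using z by simp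
  ultimately show "z \<in> \<Omega>" using tb by blast
qed

lemma Z_inner: "(Z t w - y) \<bullet> b i = stretch t i * w $ i"
  by (simp add: Z_def frame_map_inner[OF b])

lemma Z_depth: "(Z t w - y) \<bullet> \<nu> = sqrt t * w $ k"
  using Z_inner[of t w k] by (simp add: bk stretch_def)

text \<open>In the blow-up the ball is \<open>\<Sum> w\<^sub>i\<^sup>2 / \<alpha>\<^sub>i < 2 R w\<^sub>k\<close>; since \<open>\<alpha>\<^sub>i + R \<kappa>\<^sub>i = 1\<close>, replacing the
  depth \<open>w\<^sub>k\<close> by the height \<open>ell w\<close> rounds off the left-hand side.\<close>

lemma region_identity: "(\<Sum>i\<in>UNIV-{k}. (w $ i)\<^sup>2 / \<alpha> i) - 2 * R * w $ k = \<rho> w - 2 * R * ell w"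
proof -
  have "\<rho> w + (\<Sum>i\<in>UNIV-{k}. 2 * R * ((kap i / (2 * \<alpha> i)) * (w $ i)\<^sup>2)) = (\<Sum>i\<in>UNIV-{k}. (w $ i)\<^sup>2 / \<alpha> i)"
    unfolding \<rho>_def sum.distrib[symmetric]
  proof (rule sum.cong)
    fix i assume "i \<in> UNIV - {k}"
    then have a: "\<alpha> i > 0" using \<alpha>_pos by auto
    have "(w $ i)\<^sup>2 + 2 * R * ((kap i / (2 * \<alpha> i)) * (w $ i)\<^sup>2) = (w $ i)\<^sup>2 * (\<alpha> i + R * kap i) / \<alpha> i"
      using a by (simp add: field_simps)
    then show "(w $ i)\<^sup>2 + 2 * R * ((kap i / (2 * \<alpha> i)) * (w $ i)\<^sup>2) = (w $ i)\<^sup>2 / \<alpha> i"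
      by (simp add: \<alpha>_def)
  qed simp
  then show ?thesis by (simp add: ell_def sum_distrib_left algebra_simps)
qed

lemma Z_in_ball:
  assumes t: "t > 0"
  shows "Z t w \<in> ball x R \<longleftrightarrow> \<rho> w + sqrt t * (w $ k)\<^sup>2 < 2 * R * ell w"
proof -
  have \<nu>b: "\<nu> \<bullet> b i = (if i = k then 1 else 0)" for i
    using b unfolding bk[symmetric] orthonormal_frame_def by auto
  have q4: "(t powr (1/4))\<^sup>2 = sqrt t"
    using t by (simp add: powr_half_sqrt[symmetric] powr_powr flip: powr_realpow)
  have "(norm (Z t w - x))\<^sup>2 = (\<Sum>i\<in>UNIV. ((Z t w - y) \<bullet> b i - R * (\<nu> \<bullet> b i))\<^sup>2)"
    unfolding norm_frame[OF b] x_eq by (simp add: inner_diff_left inner_add_left algebra_simps)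
  also have "\<dots> = (sqrt t * w $ k - R)\<^sup>2 + (\<Sum>i\<in>UNIV-{k}. ((Z t w - y) \<bullet> b i - R * (\<nu> \<bullet> b i))\<^sup>2)"
    by (subst sum.remove[of _ k]) (auto simp: Z_inner \<nu>b stretch_def)
  also have "(\<Sum>i\<in>UNIV-{k}. ((Z t w - y) \<bullet> b i - R * (\<nu> \<bullet> b i))\<^sup>2) = (\<Sum>i\<in>UNIV-{k}. sqrt t * ((w $ i)\<^sup>2 / \<alpha> i))"
  proof (rule sum.cong)
    fix i assume i: "i \<in> UNIV - {k}"
    then have a: "\<alpha> i > 0" using \<alpha>_pos by auto
    have "((Z t w - y) \<bullet> b i - R * (\<nu> \<bullet> b i))\<^sup>2 = (t powr (1/4))\<^sup>2 * (w $ i)\<^sup>2 / (sqrt (\<alpha> i))\<^sup>2"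
      using i by (simp add: Z_inner \<nu>b stretch_def power_mult_distrib power_divide)
    then show "((Z t w - y) \<bullet> b i - R * (\<nu> \<bullet> b i))\<^sup>2 = sqrt t * ((w $ i)\<^sup>2 / \<alpha> i)"
      using a by (simp add: q4)
  qed simp
  also have "\<dots> = sqrt t * (\<Sum>i\<in>UNIV-{k}. (w $ i)\<^sup>2 / \<alpha> i)" by (simp add: sum_distrib_left)
  also have "(sqrt t * w $ k - R)\<^sup>2 + sqrt t * (\<Sum>i\<in>UNIV-{k}. (w $ i)\<^sup>2 / \<alpha> i)
    = R\<^sup>2 + sqrt t * (((\<Sum>i\<in>UNIV-{k}. (w $ i)\<^sup>2 / \<alpha> i) - 2 * R * w $ k) + sqrt t * (w $ k)\<^sup>2)"
    by (simp add: power2_eq_square algebra_simps)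
  finally have e: "(norm (Z t w - x))\<^sup>2 = R\<^sup>2 + sqrt t * ((\<rho> w - 2 * R * ell w) + sqrt t * (w $ k)\<^sup>2)"
    unfolding region_identity .
  have "Z t w \<in> ball x R \<longleftrightarrow> (norm (Z t w - x))\<^sup>2 < R\<^sup>2"
    using R power_less_imp_less_base[of "norm (Z t w - x)" 2 R] power_strict_mono[of "norm (Z t w - x)" R 2]
    by (auto simp: dist_norm norm_minus_commute)
  also have "\<dots> \<longleftrightarrow> (\<rho> w - 2 * R * ell w) + sqrt t * (w $ k)\<^sup>2 < 0"
    unfolding e using t by (simp add: mult_less_0_iff)
  finally show ?thesis by linarith
qed

text \<open>The boundary graph is critical at \<open>y\<close>, and by Taylor's formula it contributes half of its
  Hessian form, at tangential arguments of size \<open>t powr (1/4)\<close> and thus to the order of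
  \<open>sqrt t\<close>.\<close>

lemma scaled_height_limit:
  "((\<lambda>t. (Z t w \<bullet> \<nu> - g (Z t w)) / sqrt t) \<longlongrightarrow> ell w) (at_right 0)"
proof -
  have c2: "C2_on UNIV g" and tr: "\<And>z s. g (z + s *\<^sub>R \<nu>) = g z"
    using gr by (auto simp: local_C2_graph_def)
  define \<zeta> where "\<zeta> = frame_map b (\<chi> i. if i = k then 0 else w $ i / sqrt (\<alpha> i))"
  have \<zeta>b: "\<zeta> \<bullet> b i = (if i = k then 0 else w $ i / sqrt (\<alpha> i))" for i
    by (simp add: \<zeta>_def frame_map_inner[OF b])
  have Zeq: "Z t w = (y + (t powr (1/4)) *\<^sub>R \<zeta>) + (sqrt t * w $ k) *\<^sub>R \<nu>" for t
  proof -
    have "Z t w - y = (\<Sum>i\<in>UNIV. (stretch t i * w $ i) *\<^sub>R b i)" by (simp add: Z_def frame_map_def)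
    also have "\<dots> = (sqrt t * w $ k) *\<^sub>R \<nu> + (\<Sum>i\<in>UNIV-{k}. (stretch t i * w $ i) *\<^sub>R b i)"
      by (subst sum.remove[of _ k]) (auto simp: stretch_def bk)
    also have "(\<Sum>i\<in>UNIV-{k}. (stretch t i * w $ i) *\<^sub>R b i) = (t powr (1/4)) *\<^sub>R \<zeta>"
    proof -
      have "\<zeta> = (\<Sum>i\<in>UNIV-{k}. (w $ i / sqrt (\<alpha> i)) *\<^sub>R b i)"
        unfolding \<zeta>_def frame_map_def by (subst sum.remove[of _ k]) auto
      then show ?thesis by (simp add: scaleR_sum_right stretch_def)
    qed
    finally show ?thesis by (simp add: algebra_simps)
  qed
  have "\<forall>t. \<exists>\<theta>. 0 < \<theta> \<and> \<theta> < 1 \<and> g (y + (t powr (1/4)) *\<^sub>R \<zeta>) - g y =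
      ((hessian g (y + \<theta> *\<^sub>R ((t powr (1/4)) *\<^sub>R \<zeta>)) *v ((t powr (1/4)) *\<^sub>R \<zeta>)) \<bullet> ((t powr (1/4)) *\<^sub>R \<zeta>)) / 2"
    using critical_point_taylor[OF c2 g0] by metis
  then obtain \<theta> where \<theta>: "\<And>t. 0 < \<theta> t" "\<And>t. \<theta> t < 1" "\<And>t. g (y + (t powr (1/4)) *\<^sub>R \<zeta>) - g y =
      ((hessian g (y + \<theta> t *\<^sub>R ((t powr (1/4)) *\<^sub>R \<zeta>)) *v ((t powr (1/4)) *\<^sub>R \<zeta>)) \<bullet> ((t powr (1/4)) *\<^sub>R \<zeta>)) / 2"
    unfolding choice_iff by blast
  have t4: "((\<lambda>t::real. t powr (1/4)) \<longlongrightarrow> 0) (at_right 0)"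
  proof -
    have "((\<lambda>t::real. t powr (1/4)) \<longlongrightarrow> 0 powr (1/4)) (at_right 0)"
      by (rule tendsto_powr2) (auto simp: eventually_at_filter intro!: tendsto_intros)
    then show ?thesis by simp
  qed
  have arg: "((\<lambda>t. y + \<theta> t *\<^sub>R ((t powr (1/4)) *\<^sub>R \<zeta>)) \<longlongrightarrow> y) (at_right 0)"
  proof -
    have "((\<lambda>t. \<theta> t * t powr (1/4)) \<longlongrightarrow> 0) (at_right 0)"
    proof (rule tendsto_sandwich[OF _ _ tendsto_const t4])
      show "\<forall>\<^sub>F t in at_right 0. 0 \<le> \<theta> t * t powr (1/4)" using \<theta>(1) by (intro always_eventually) (simp add: less_imp_le)
      show "\<forall>\<^sub>F t in at_right 0. \<theta> t * t powr (1/4) \<le> t powr (1/4)"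
        using \<theta>(1,2) by (intro always_eventually) (simp add: mult_left_le_one_le less_imp_le)
    qed
    then have "((\<lambda>t. y + (\<theta> t * t powr (1/4)) *\<^sub>R \<zeta>) \<longlongrightarrow> y + 0 *\<^sub>R \<zeta>) (at_right 0)" by (intro tendsto_intros)
    then show ?thesis by simp
  qed
  have "isCont (hessian g) y" using C2_on_UNIV_jet(3)[OF c2] by (simp add: continuous_on_eq_continuous_at)
  from isCont_tendsto_compose[OF this arg]
  have Hl: "((\<lambda>t. hessian g (y + \<theta> t *\<^sub>R ((t powr (1/4)) *\<^sub>R \<zeta>))) \<longlongrightarrow> hessian g y) (at_right 0)" .
  have bl: "bounded_linear (\<lambda>A::real^'n^'n. (A *v \<zeta>) \<bullet> \<zeta>)"
    by (rule linear_conv_bounded_linear[THEN iffD1])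
      (auto intro!: linearI simp: matrix_vector_mult_add_rdistrib inner_add_left scaleR_matrix_vector_assoc[symmetric])
  have "((\<lambda>t. w $ k - ((hessian g (y + \<theta> t *\<^sub>R ((t powr (1/4)) *\<^sub>R \<zeta>)) *v \<zeta>) \<bullet> \<zeta>) / 2) \<longlongrightarrow> w $ k - ((hessian g y *v \<zeta>) \<bullet> \<zeta>) / 2) (at_right 0)"
    by (intro tendsto_intros bounded_linear.tendsto[OF bl Hl]) simp
  also have "w $ k - ((hessian g y *v \<zeta>) \<bullet> \<zeta>) / 2 = ell w"
  proof -
    have "(hessian g y *v \<zeta>) \<bullet> \<zeta> = (\<Sum>i\<in>UNIV-{k}. kap i * (\<zeta> \<bullet> b i)\<^sup>2)"
      by (rule tangential_hessian_form[OF b H]) (auto simp: \<zeta>b)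
    also have "\<dots> = (\<Sum>i\<in>UNIV-{k}. 2 * ((kap i / (2 * \<alpha> i)) * (w $ i)\<^sup>2))"
      by (rule sum.cong) (auto simp: \<zeta>b power_divide less_imp_le[OF \<alpha>_pos])
    also have "\<dots> = 2 * (\<Sum>i\<in>UNIV-{k}. (kap i / (2 * \<alpha> i)) * (w $ i)\<^sup>2)" by (simp only: sum_distrib_left)
    finally show ?thesis by (simp add: ell_def)
  qed
  finally show ?thesis
  proof (rule Lim_transform_eventually)
    show "\<forall>\<^sub>F t in at_right 0. w $ k - ((hessian g (y + \<theta> t *\<^sub>R ((t powr (1/4)) *\<^sub>R \<zeta>)) *v \<zeta>) \<bullet> \<zeta>) / 2 = (Z t w \<bullet> \<nu> - g (Z t w)) / sqrt t"
      using eventually_at_right_less[of "0::real"]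
    proof eventually_elim
      case (elim t)
      have q4: "t powr (1/4) * t powr (1/4) = sqrt t"
        using elim by (simp add: powr_half_sqrt[symmetric] flip: powr_add)
      have "g (Z t w) = g (y + (t powr (1/4)) *\<^sub>R \<zeta>)" unfolding Zeq by (rule tr)
      also have "\<dots> = g y + (t powr (1/4) * t powr (1/4)) * ((hessian g (y + \<theta> t *\<^sub>R ((t powr (1/4)) *\<^sub>R \<zeta>)) *v \<zeta>) \<bullet> \<zeta>) / 2"
        using \<theta>(3)[of t] by (simp add: matrix_scaleR_vector_ac scaleR_matrix_vector_assoc[symmetric])
      finally have "g (Z t w) = y \<bullet> \<nu> + sqrt t * ((hessian g (y + \<theta> t *\<^sub>R ((t powr (1/4)) *\<^sub>R \<zeta>)) *v \<zeta>) \<bullet> \<zeta>) / 2"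
        by (simp only: q4 gy)
      moreover have "Z t w \<bullet> \<nu> = y \<bullet> \<nu> + sqrt t * w $ k" using Z_depth[of t w] by (simp add: inner_diff_left)
      ultimately show ?case using elim by (simp add: field_simps)
    qed
  qed
qed

lemma Z_tendsto: "((\<lambda>t. Z t w) \<longlongrightarrow> y) (at_right 0)"
proof -
  have t4: "((\<lambda>t::real. t powr (1/4)) \<longlongrightarrow> 0 powr (1/4)) (at_right 0)"
    by (rule tendsto_powr2) (auto simp: eventually_at_filter intro!: tendsto_intros)
  have "((\<lambda>t. stretch t i) \<longlongrightarrow> 0) (at_right 0)" for i
  proof (cases "i = k")
    case True
    have "((\<lambda>t. sqrt t) \<longlongrightarrow> sqrt 0) (at_right 0)" by (intro tendsto_intros)
    then show ?thesis using True by (simp add: stretch_def)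
  next
    case False
    have "((\<lambda>t. t powr (1/4) / sqrt (\<alpha> i)) \<longlongrightarrow> 0 powr (1/4) / sqrt (\<alpha> i)) (at_right 0)"
      using \<alpha>_pos[OF False] by (intro tendsto_divide t4 tendsto_const) auto
    then show ?thesis using False by (simp add: stretch_def)
  qed
  then have "((\<lambda>t. y + (\<Sum>i\<in>UNIV. (stretch t i * w $ i) *\<^sub>R b i)) \<longlongrightarrow> y + (\<Sum>i\<in>UNIV. (0 * w $ i) *\<^sub>R b i)) (at_right 0)"
    by (intro tendsto_intros)
  then show ?thesis by (simp add: Z_def frame_map_def)
qed

lemma scaled_solution_limit:
  assumes "\<rho> w < 2 * R * ell w"
  shows "\<forall>\<^sub>F t in at_right 0. Z t w \<in> ball x R" "((\<lambda>t. u (Z t w, t)) \<longlongrightarrow> Erfc (\<beta> * ell w)) (at_right 0)"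
proof -
  have "((\<lambda>t. \<rho> w + sqrt t * (w $ k)\<^sup>2) \<longlongrightarrow> \<rho> w + sqrt 0 * (w $ k)\<^sup>2) (at_right 0)" by (intro tendsto_intros)
  then have "\<forall>\<^sub>F t in at_right 0. \<rho> w + sqrt t * (w $ k)\<^sup>2 < 2 * R * ell w"
    using assms by (intro order_tendstoD) auto
  with eventually_at_right_less[of "0::real"]
  show ev: "\<forall>\<^sub>F t in at_right 0. Z t w \<in> ball x R"
    by eventually_elim (use Z_in_ball in blast)
  have "\<forall>\<^sub>F t in at_right 0. Z t w \<in> \<Omega>" using ev by eventually_elim (use ball_subset in blast)
  from boundary_layer_limit[OF p1 op u yfr gr g0 this Z_tendsto scaled_height_limit]
  show "((\<lambda>t. u (Z t w, t)) \<longlongrightarrow> Erfc (\<beta> * ell w)) (at_right 0)" by (simp add: \<beta>_def)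
qed

lemma ball_decay:
  obtains C c where "C > 0" "c > 0" "\<And>z t. z \<in> ball x R \<Longrightarrow> t > 0 \<Longrightarrow> \<bar>u (z, t)\<bar> \<le> C * exp (- c * ((z - y) \<bullet> \<nu>)\<^sup>2 / t)"
    "\<And>z. z \<in> ball x R \<Longrightarrow> 0 < (z - y) \<bullet> \<nu>"
proof -
  obtain d where d: "d > 0" "\<And>z. z \<in> ball x R \<Longrightarrow> 0 < (z - y) \<bullet> \<nu> \<and> cball z (d * ((z - y) \<bullet> \<nu>)) \<subseteq> \<Omega>"
    using depth_in_touching_ball[OF op R tb gr g0 gy x_eq b bk H lam] by metis
  from decay_in_touching_ball[OF p1 op u d] d show ?thesis using that by metis
qed

lemma continuous_slice:
  assumes "t > 0" shows "continuous_on (ball x R) (\<lambda>z. u (z, t))"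
proof -
  have "continuous_on (\<Omega> \<times> {0<..}) u" using IBVP_solution_facts(1)[OF u op] by (simp add: viscosity_subsolution_def)
  then show ?thesis
    by (rule continuous_on_compose2) (use assms ball_subset in \<open>auto intro!: continuous_intros\<close>)
qed

lemma Z_measurable [measurable]: "Z t \<in> borel_measurable borel"
  unfolding Z_def frame_map_def vec_lambda_beta by (intro borel_measurable_continuous_onI continuous_intros)

lemma ell_measurable [measurable]: "ell \<in> borel_measurable borel"
  unfolding ell_def by (intro borel_measurable_continuous_onI continuous_intros)

lemma rho_measurable [measurable]: "\<rho> \<in> borel_measurable borel"
  unfolding \<rho>_def by (intro borel_measurable_continuous_onI continuous_intros)

lemma nn_integral_region:
  assumes [measurable]: "f \<in> borel_measurable borel"
  shows "(\<integral>\<^sup>+w. f (ell w) * indicator {w. \<rho> w < 2 * R * ell w} w \<partial>lborel)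
    = (\<integral>\<^sup>+s. f s * ennreal (unit_ball_vol (real (CARD('n) - 1)) * sqrt (2 * R * s) ^ (CARD('n) - 1)) * indicator {0<..} s \<partial>lborel)"
  using nn_integral_paraboloid[OF assms R, of k "\<lambda>i. kap i / (2 * \<alpha> i)"] unfolding ell_def \<rho>_def .

text \<open>Dominated convergence. Adding \<open>spow r (m t)\<close> makes the integrand small where the solution is
  small, so that by \<open>spow_diff_bound\<close> it inherits the Gaussian decay of the solution in the
  depth \<open>w\<^sub>k\<close>. On the paraboloid \<open>ell w\<close> is at most a multiple of \<open>w\<^sub>k\<close>; therefore a Gaussian in
  \<open>ell w\<close> is a majorant too, and its integral is computed by slices.\<close>

lemma scaled_integral_limit:
  assumes r: "r > 0" and m: "(m \<longlongrightarrow> 0) (at_right 0)" "\<And>t. \<bar>m t\<bar> \<le> 1"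
  shows "((\<lambda>t. \<integral>w. indicator (ball x R) (Z t w) * (spow r (u (Z t w, t) - m t) + spow r (m t)) \<partial>lborel) \<longlongrightarrow>
     (\<integral>w. indicator {w. \<rho> w < 2 * R * ell w} w * Erfc (\<beta> * ell w) powr r \<partial>lborel)) (at_right 0)"
proof -
  obtain C c where C: "C > 0" "c > 0" and dec: "\<And>z t. z \<in> ball x R \<Longrightarrow> t > 0 \<Longrightarrow> \<bar>u (z, t)\<bar> \<le> C * exp (- c * ((z - y) \<bullet> \<nu>)\<^sup>2 / t)"
    and dpos: "\<And>z. z \<in> ball x R \<Longrightarrow> 0 < (z - y) \<bullet> \<nu>"
    using ball_decay by metis
  define A where "A = {w. \<rho> w < 2 * R * ell w}"
  define Cs where "Cs = 3 powr r + 2 powr r + r * 2 powr r"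
  have Cs: "Cs \<ge> 0" using r by (simp add: Cs_def)
  define c6 where "c6 = min r 1 * c"
  have c6: "c6 > 0" "c6 \<le> r * c" "c6 \<le> c" using r C by (auto simp: c6_def min_def)
  define S where "S = (\<Sum>i\<in>UNIV-{k}. \<bar>kap i\<bar>)"
  define c4 where "c4 = 1 + 2 * R * S"
  have c4: "c4 \<ge> 1" using R by (simp add: c4_def S_def sum_nonneg)
  define C7 where "C7 = Cs * (C powr r + C)"
  have C7: "C7 \<ge> 0" using Cs C by (simp add: C7_def)
  define c7 where "c7 = c6 / c4\<^sup>2"
  have c7: "c7 > 0" using c6 c4 by (simp add: c7_def)
  have ell_le: "0 < ell w \<and> ell w \<le> c4 * w $ k" if "w \<in> A" "0 < w $ k" for w
  proof -
    have A: "\<rho> w < 2 * R * ell w" using that by (simp add: A_def)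
    have "0 \<le> \<rho> w" by (simp add: \<rho>_def sum_nonneg)
    then have "0 < 2 * R * ell w" using A by linarith
    then have "0 < ell w" using R by (simp add: zero_less_mult_iff)
    moreover have "ell w \<le> c4 * w $ k"
    proof -
      have q: "(\<Sum>i\<in>UNIV-{k}. (w $ i)\<^sup>2 / \<alpha> i) \<le> 2 * R * w $ k" using region_identity[of w] A by linarith
      have "- (\<Sum>i\<in>UNIV-{k}. (kap i / (2 * \<alpha> i)) * (w $ i)\<^sup>2) \<le> (\<Sum>i\<in>UNIV-{k}. S * ((w $ i)\<^sup>2 / \<alpha> i))"
        unfolding sum_negf[symmetric]
      proof (rule sum_mono)
        fix i assume i: "i \<in> UNIV - {k}"
        then have a: "\<alpha> i > 0" using \<alpha>_pos by auto
        have "\<bar>kap i\<bar> \<le> S" unfolding S_def by (rule member_le_sum) (use i in auto)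
        then have "- kap i / 2 \<le> S" by (simp add: abs_le_iff)
        then have "(- kap i / 2) * ((w $ i)\<^sup>2 / \<alpha> i) \<le> S * ((w $ i)\<^sup>2 / \<alpha> i)" using a by (intro mult_right_mono) auto
        then show "- ((kap i / (2 * \<alpha> i)) * (w $ i)\<^sup>2) \<le> S * ((w $ i)\<^sup>2 / \<alpha> i)" by (simp add: mult.commute)
      qed
      also have "\<dots> = S * (\<Sum>i\<in>UNIV-{k}. (w $ i)\<^sup>2 / \<alpha> i)" by (simp add: sum_distrib_left)
      also have "\<dots> \<le> S * (2 * R * w $ k)" by (intro mult_left_mono q) (simp add: S_def sum_nonneg)
      finally show ?thesis by (simp add: ell_def c4_def algebra_simps)
    qed
    ultimately show ?thesis by simp
  qed
  define maj where "maj w = indicator A w * (C7 * exp (- c7 * (ell w)\<^sup>2))" for w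
  have Am [measurable]: "A \<in> sets borel" unfolding A_def by measurable
  have maj_int: "integrable lborel maj"
  proof (rule integrableI_bounded)
    show "maj \<in> borel_measurable lborel" unfolding maj_def by measurable
    have "(\<integral>\<^sup>+w. ennreal (norm (maj w)) \<partial>lborel) = (\<integral>\<^sup>+w. ennreal C7 * (ennreal (exp (- c7 * (ell w)\<^sup>2)) * indicator A w) \<partial>lborel)"
      by (intro nn_integral_cong) (use C7 in \<open>auto simp: maj_def indicator_def ennreal_mult'\<close>)
    also have "\<dots> = ennreal C7 * (\<integral>\<^sup>+w. ennreal (exp (- c7 * (ell w)\<^sup>2)) * indicator A w \<partial>lborel)"
      by (rule nn_integral_cmult) measurable
    also have "(\<integral>\<^sup>+w. ennreal (exp (- c7 * (ell w)\<^sup>2)) * indicator A w \<partial>lborel)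
       = (\<integral>\<^sup>+s. ennreal (exp (- c7 * s\<^sup>2)) * ennreal (unit_ball_vol (real (CARD('n) - 1)) * sqrt (2 * R * s) ^ (CARD('n) - 1)) * indicator {0<..} s \<partial>lborel)"
      unfolding A_def by (rule nn_integral_region) measurable
    also have "ennreal C7 * \<dots> < \<infinity>"
      using finite_gauss_moment[OF c7 R, of "unit_ball_vol (real (CARD('n) - 1))" "CARD('n) - 1"]
      by (simp add: ennreal_mult_less_top)
    finally show "(\<integral>\<^sup>+w. ennreal (norm (maj w)) \<partial>lborel) < \<infinity>" .
  qed
  define \<Psi> where "\<Psi> t w = indicator (ball x R) (Z t w) * (spow r (u (Z t w, t) - m t) + spow r (m t))" for t w
  have \<Psi>m: "\<Psi> t \<in> borel_measurable borel" if "t > 0" for t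
  proof -
    have "continuous_on (ball x R) (\<lambda>z. spow r (u (z, t) - m t) + spow r (m t))"
      by (intro continuous_intros continuous_on_compose2[OF continuous_spow[OF r, of UNIV]] continuous_slice that) auto
    then have "(\<lambda>z. indicator (ball x R) z *\<^sub>R (spow r (u (z, t) - m t) + spow r (m t))) \<in> borel_measurable borel"
      by (intro borel_measurable_continuous_on_indicator) auto
    from measurable_compose[OF Z_measurable this] show ?thesis unfolding \<Psi>_def by simp
  qed
  have bound: "norm (\<Psi> t w) \<le> maj w" if t: "t > 0" for t w
  proof (cases "Z t w \<in> ball x R")
    case True
    have wk: "0 < w $ k" using dpos[OF True] t by (simp add: Z_depth zero_less_mult_iff)
    have "\<rho> w + sqrt t * (w $ k)\<^sup>2 < 2 * R * ell w" using True Z_in_ball[OF t] by simp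
    moreover have "0 \<le> sqrt t * (w $ k)\<^sup>2" using t by simp
    ultimately have wA: "w \<in> A" unfolding A_def by simp
    have uz: "\<bar>u (Z t w, t)\<bar> \<le> C * exp (- c * (w $ k)\<^sup>2)"
      using dec[OF True t] t by (simp add: Z_depth power_mult_distrib)
    have "\<bar>spow r (u (Z t w, t) - m t) + spow r (m t)\<bar> \<le> Cs * (\<bar>u (Z t w, t)\<bar> powr r + \<bar>u (Z t w, t)\<bar>)"
      unfolding Cs_def by (rule spow_diff_bound[OF r m(2)])
    also have "\<dots> \<le> Cs * ((C * exp (- c * (w $ k)\<^sup>2)) powr r + C * exp (- c * (w $ k)\<^sup>2))"
      using Cs r uz by (intro mult_left_mono add_mono powr_mono2) auto
    also have "(C * exp (- c * (w $ k)\<^sup>2)) powr r = C powr r * exp (- (r * c) * (w $ k)\<^sup>2)"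
      using C by (simp add: powr_mult exp_powr_real mult_ac)
    also have "Cs * (C powr r * exp (- (r * c) * (w $ k)\<^sup>2) + C * exp (- c * (w $ k)\<^sup>2))
       \<le> Cs * (C powr r * exp (- c6 * (w $ k)\<^sup>2) + C * exp (- c6 * (w $ k)\<^sup>2))"
      using Cs C c6 by (intro mult_left_mono add_mono) (auto intro!: mult_right_mono)
    also have "\<dots> = C7 * exp (- c6 * (w $ k)\<^sup>2)" by (simp add: C7_def algebra_simps)
    also have "\<dots> \<le> C7 * exp (- c7 * (ell w)\<^sup>2)"
    proof -
      have "(ell w)\<^sup>2 \<le> (c4 * w $ k)\<^sup>2" using ell_le[OF wA wk] by (intro power_mono) auto
      then have "c7 * (ell w)\<^sup>2 \<le> c7 * (c4 * w $ k)\<^sup>2" using c7 by (intro mult_left_mono) auto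
      also have "\<dots> = c6 * (w $ k)\<^sup>2" using c4 by (simp add: c7_def power_mult_distrib)
      finally show ?thesis using C7 by (intro mult_left_mono) auto
    qed
    finally show ?thesis using wA True by (simp add: \<Psi>_def maj_def)
  next
    case False
    then show ?thesis using C7 by (simp add: \<Psi>_def maj_def)
  qed
  have lim: "((\<lambda>t. \<Psi> t w) \<longlongrightarrow> indicator A w * Erfc (\<beta> * ell w) powr r) (at_right 0)" for w
  proof (cases "w \<in> A")
    case True
    then have reg: "\<rho> w < 2 * R * ell w" by (simp add: A_def)
    note L = scaled_solution_limit[OF reg]
    have c: "isCont (spow r) v" for v
      using continuous_spow[OF r, of UNIV] by (simp add: continuous_on_eq_continuous_at)
    have "((\<lambda>t. spow r (u (Z t w, t) - m t) + spow r (m t)) \<longlongrightarrow> spow r (Erfc (\<beta> * ell w) - 0) + spow r 0) (at_right 0)"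
      by (intro tendsto_intros isCont_tendsto_compose[OF c] L m)
    moreover have "spow r (Erfc (\<beta> * ell w) - 0) + spow r 0 = indicator A w * Erfc (\<beta> * ell w) powr r"
      using True Erfc_nonneg r by (simp add: spow_nonneg)
    ultimately have "((\<lambda>t. spow r (u (Z t w, t) - m t) + spow r (m t)) \<longlongrightarrow> indicator A w * Erfc (\<beta> * ell w) powr r) (at_right 0)" by simp
    then show ?thesis
      by (rule Lim_transform_eventually) (use L(1) in eventually_elim, simp add: \<Psi>_def)
  next
    case False
    have "\<forall>\<^sub>F t in at_right 0. \<Psi> t w = 0"
      using eventually_at_right_less[of "0::real"]
    proof eventually_elim
      case (elim t)
      have "norm (\<Psi> t w) \<le> 0" using bound[OF elim, of w] False by (simp add: maj_def)
      then show ?case by simp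
    qed
    then show ?thesis using False by (simp add: tendsto_eventually)
  qed
  have "((\<lambda>t. \<integral>w. \<Psi> t w \<partial>lborel) \<longlongrightarrow> (\<integral>w. indicator A w * Erfc (\<beta> * ell w) powr r \<partial>lborel)) (at_right 0)"
    unfolding tendsto_at_iff_sequentially comp_def
  proof (intro allI impI)
    fix T :: "nat \<Rightarrow> real" assume T: "\<forall>i. T i \<in> {0<..} - {0}" "T \<longlonglongrightarrow> 0"
    have Tp: "T i > 0" for i using T(1) by simp
    have "T i \<noteq> 0" for i using Tp[of i] by simp
    then have Tf: "filterlim T (at_right 0) sequentially"
      unfolding filterlim_at using T(2) Tp by simp
    have Em [measurable]: "Erfc \<in> borel_measurable borel"
      by (intro borel_measurable_continuous_onI continuous_at_imp_continuous_on ballI isCont_Erfc)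
    show "(\<lambda>n. \<integral>w. \<Psi> (T n) w \<partial>lborel) \<longlonglongrightarrow> (\<integral>w. indicator A w * Erfc (\<beta> * ell w) powr r \<partial>lborel)"
    proof (rule integral_dominated_convergence[where w=maj])
      show "(\<lambda>w. indicator A w * Erfc (\<beta> * ell w) powr r) \<in> borel_measurable lborel" by measurable
      show "\<Psi> (T n) \<in> borel_measurable lborel" for n using \<Psi>m[of "T n"] T by simp
      show "AE w in lborel. (\<lambda>n. \<Psi> (T n) w) \<longlonglongrightarrow> indicator A w * Erfc (\<beta> * ell w) powr r"
        by (intro AE_I2 filterlim_compose[OF lim Tf])
      show "AE w in lborel. norm (\<Psi> (T n) w) \<le> maj w" for n using bound T by (intro AE_I2) auto
    qed (rule maj_int)
  qed
  then show ?thesis unfolding \<Psi>_def A_def .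
qed
end

section \<open>Asymptotics of the means\<close>

text \<open>The complex duplication formula restricted to the positive reals.\<close>

lemma Gamma_legendre_duplication_real:
  fixes a :: real
  assumes "a > 0"
  shows "Gamma a * Gamma (a + 1/2) = exp ((1 - 2 * a) * ln 2) * sqrt pi * Gamma (2 * a)"
proof -
  have "a \<notin> \<int>\<^sub>\<le>\<^sub>0" "a + 1/2 \<notin> \<int>\<^sub>\<le>\<^sub>0" using assms nonpos_Ints_nonpos[of a] nonpos_Ints_nonpos[of "a + 1/2"] by auto
  then have "complex_of_real a \<notin> \<int>\<^sub>\<le>\<^sub>0" "complex_of_real (a + 1/2) \<notin> \<int>\<^sub>\<le>\<^sub>0"
    by (simp_all only: of_real_in_nonpos_Ints_iff not_False_eq_True)
  then have "Gamma (complex_of_real a) * Gamma (complex_of_real (a + 1/2))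
    = exp (complex_of_real ((1 - 2 * a) * ln 2)) * complex_of_real (sqrt pi) * Gamma (complex_of_real (2 * a))"
    using Gamma_legendre_duplication[of "complex_of_real a"] by simp
  then have "complex_of_real (Gamma a * Gamma (a + 1/2)) = complex_of_real (exp ((1 - 2 * a) * ln 2) * sqrt pi * Gamma (2 * a))"
    by (simp only: Gamma_complex_of_real exp_of_real) (simp only: of_real_mult)
  then show ?thesis by (simp only: of_real_eq_iff)
qed

context touching_ball
begin

text \<open>The Jacobian of the blow-up. It is the source of the exponent \<open>(N + 1) / 4\<close> and of the factor
  \<open>sqrt \<Pi>\<^sub>\<Gamma>\<close>.\<close>

lemma prod_stretch:
  assumes t: "t > 0"
  shows "(\<Prod>i\<in>UNIV. stretch t i) = t powr ((real CARD('n) + 1) / 4) / sqrt (\<Prod>i\<in>UNIV-{k}. \<alpha> i)"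
proof -
  have sq: "sqrt (\<Prod>i\<in>I. \<alpha> i) = (\<Prod>i\<in>I. sqrt (\<alpha> i))" if "finite I" for I :: "'n set"
    using that by (induction I rule: finite_induct) (auto simp: real_sqrt_mult)
  have "(\<Prod>i\<in>UNIV. stretch t i) = sqrt t * (\<Prod>i\<in>UNIV-{k}. t powr (1/4) / sqrt (\<alpha> i))"
    by (subst prod.remove[of _ k]) (auto simp: stretch_def)
  also have "(\<Prod>i\<in>UNIV-{k}. t powr (1/4) / sqrt (\<alpha> i)) = (t powr (1/4)) ^ (CARD('n) - 1) / sqrt (\<Prod>i\<in>UNIV-{k}. \<alpha> i)"
    by (simp add: prod_dividef sq card_Diff_singleton)
  also have "(t powr (1/4)) ^ (CARD('n) - 1) = t powr ((1/4) * real (CARD('n) - 1))"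
    using t by (simp add: powr_powr flip: powr_realpow)
  also have "sqrt t * (t powr ((1/4) * real (CARD('n) - 1)) / sqrt (\<Prod>i\<in>UNIV-{k}. \<alpha> i))
     = t powr (1/2 + (1/4) * real (CARD('n) - 1)) / sqrt (\<Prod>i\<in>UNIV-{k}. \<alpha> i)"
    using t by (simp add: powr_add powr_half_sqrt)
  also have "1/2 + (1/4) * real (CARD('n) - 1) = (real CARD('n) + 1) / 4"
    by (simp add: of_nat_diff field_simps Suc_leI)
  finally show ?thesis .
qed

lemma ball_integral_rescaled:
  assumes t: "t > 0" and r: "r > 0"
  shows "(\<integral>z. spow r (u (z, t) - m) \<partial>lebesgue_on (ball x R))
    = (\<Prod>i\<in>UNIV. stretch t i) * (\<integral>w. indicator (ball x R) (Z t w) * (spow r (u (Z t w, t) - m) + spow r m) \<partial>lborel)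
      - measure lebesgue (ball x R) * spow r m"
proof -
  define f where "f z = spow r (u (z, t) - m)" for z
  interpret finite_measure "lebesgue_on (ball x R)" by (rule lebesgue_on_ball)
  obtain M where M: "M > 0" "\<And>z. z \<in> \<Omega> \<times> {0<..} \<Longrightarrow> \<bar>u z\<bar> \<le> M" using IBVP_solution_facts(5)[OF u op] by blast
  have "(\<lambda>z. u (z, t)) \<in> borel_measurable (lebesgue_on (ball x R))"
    by (rule continuous_imp_measurable_on_sets_lebesgue[OF continuous_slice[OF t]]) auto
  moreover have "\<bar>u (z, t)\<bar> \<le> M" if "z \<in> space (lebesgue_on (ball x R))" for z
    using M(2)[of "(z, t)"] t that ball_subset by auto
  ultimately have fi: "integrable (lebesgue_on (ball x R)) f"
    unfolding f_def by (rule integrable_spow_diff[OF finite_measure_axioms _ _ r])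
  have "continuous_on (ball x R) (\<lambda>z. f z + spow r m)"
    unfolding f_def by (intro continuous_intros continuous_on_compose2[OF continuous_spow[OF r, of UNIV]] continuous_slice t) auto
  then have Fm: "(\<lambda>z. indicator (ball x R) z *\<^sub>R (f z + spow r m)) \<in> borel_measurable borel"
    by (intro borel_measurable_continuous_on_indicator) auto
  have "(\<integral>z. f z + spow r m \<partial>lebesgue_on (ball x R)) = (\<integral>z. f z \<partial>lebesgue_on (ball x R)) + measure lebesgue (ball x R) * spow r m"
    using fi by (subst Bochner_Integration.integral_add) (auto simp: measure_restrict_space)
  moreover have "(\<integral>z. f z + spow r m \<partial>lebesgue_on (ball x R)) = (\<integral>z. indicator (ball x R) z *\<^sub>R (f z + spow r m) \<partial>lebesgue)"
    by (rule integral_restrict_space) auto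
  moreover have "\<dots> = (\<integral>z. indicator (ball x R) z *\<^sub>R (f z + spow r m) \<partial>lborel)"
    by (rule integral_completion) (use Fm in simp)
  moreover have "\<dots> = (\<Prod>i\<in>UNIV. stretch t i) * (\<integral>w. indicator (ball x R) (Z t w) *\<^sub>R (f (Z t w) + spow r m) \<partial>lborel)"
    unfolding Z_def
    by (rule lborel_integral_frame_coordinates[OF b _ Fm]) (use \<alpha>_pos t in \<open>auto simp: stretch_def\<close>)
  ultimately show ?thesis by (simp add: f_def)
qed

definition "profile_integral r = (LBINT \<sigma>:{0..}. Erfc \<sigma> powr r * \<sigma> powr ((real CARD('n) - 1) / 2))"

lemma region_integral:
  "(\<integral>w. indicator {w. \<rho> w < 2 * R * ell w} w * Erfc (\<beta> * ell w) powr r \<partial>lborel)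
    = unit_ball_vol (real (CARD('n) - 1)) * (2 * R) powr ((real CARD('n) - 1) / 2)
      * \<beta> powr (- ((real CARD('n) + 1) / 2)) * profile_integral r"
proof -
  define V where "V = unit_ball_vol (real (CARD('n) - 1))"
  define s where "s = (real CARD('n) - 1) / 2"
  have V: "V \<ge> 0" by (simp add: V_def)
  have N1: "real (CARD('n) - 1) = real CARD('n) - 1" by (simp add: of_nat_diff Suc_leI)
  have Em [measurable]: "Erfc \<in> borel_measurable borel"
    by (intro borel_measurable_continuous_onI continuous_at_imp_continuous_on ballI isCont_Erfc)
  have pw: "sqrt (2 * R * \<sigma>) ^ (CARD('n) - 1) = (2 * R) powr s * \<sigma> powr s" if "\<sigma> > 0" for \<sigma>
  proof -
    have "sqrt (2 * R * \<sigma>) ^ (CARD('n) - 1) = ((2 * R * \<sigma>) powr (1/2)) powr real (CARD('n) - 1)"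
      using that R by (subst powr_realpow) (auto simp: powr_half_sqrt)
    also have "\<dots> = (2 * R * \<sigma>) powr s" by (simp add: powr_powr N1 s_def)
    finally show ?thesis using that R by (simp add: powr_mult)
  qed
  define f where "f \<sigma> = indicator {0..} \<sigma> *\<^sub>R (Erfc \<sigma> powr r * \<sigma> powr s)" for \<sigma>
  have fm [measurable]: "f \<in> borel_measurable borel" unfolding f_def by measurable
  have beta: "\<beta> > 0" by (rule beta_pos)
  have "(\<integral>w. indicator {w. \<rho> w < 2 * R * ell w} w * Erfc (\<beta> * ell w) powr r \<partial>lborel)
     = enn2real (\<integral>\<^sup>+w. ennreal (indicator {w. \<rho> w < 2 * R * ell w} w * Erfc (\<beta> * ell w) powr r) \<partial>lborel)"
    by (rule integral_eq_nn_integral) (auto intro!: AE_I2)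
  also have "(\<integral>\<^sup>+w. ennreal (indicator {w. \<rho> w < 2 * R * ell w} w * Erfc (\<beta> * ell w) powr r) \<partial>lborel)
     = (\<integral>\<^sup>+w. ennreal (Erfc (\<beta> * ell w) powr r) * indicator {w. \<rho> w < 2 * R * ell w} w \<partial>lborel)"
    by (intro nn_integral_cong) (auto simp: indicator_def)
  also have "\<dots> = (\<integral>\<^sup>+\<sigma>. ennreal (Erfc (\<beta> * \<sigma>) powr r) * ennreal (V * sqrt (2 * R * \<sigma>) ^ (CARD('n) - 1)) * indicator {0<..} \<sigma> \<partial>lborel)"
    unfolding V_def by (rule nn_integral_region) measurable
  also have "\<dots> = (\<integral>\<^sup>+\<sigma>. ennreal (V * (2 * R) powr s * \<beta> powr (- s) * f (0 + \<beta> * \<sigma>)) \<partial>lborel)"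
  proof (rule nn_integral_cong)
    fix \<sigma> :: real
    show "ennreal (Erfc (\<beta> * \<sigma>) powr r) * ennreal (V * sqrt (2 * R * \<sigma>) ^ (CARD('n) - 1)) * indicator {0<..} \<sigma>
      = ennreal (V * (2 * R) powr s * \<beta> powr (- s) * f (0 + \<beta> * \<sigma>))"
    proof (cases "\<sigma> > 0")
      case True
      have "\<beta> powr (- s) * \<beta> powr s = 1" using beta by (simp flip: powr_add)
      then have "V * (2 * R) powr s * \<beta> powr (- s) * f (0 + \<beta> * \<sigma>) = Erfc (\<beta> * \<sigma>) powr r * (V * sqrt (2 * R * \<sigma>) ^ (CARD('n) - 1))"
        using True beta pw[OF True] by (simp add: f_def powr_mult)
      moreover have "ennreal (Erfc (\<beta> * \<sigma>) powr r) * ennreal (V * sqrt (2 * R * \<sigma>) ^ (CARD('n) - 1)) * indicator {0<..} \<sigma>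
        = ennreal (Erfc (\<beta> * \<sigma>) powr r * (V * sqrt (2 * R * \<sigma>) ^ (CARD('n) - 1)))"
        using True V R by (subst ennreal_mult) auto
      ultimately show ?thesis by (simp only:)
    next
      case False
      have "f (0 + \<beta> * \<sigma>) = 0"
      proof (cases "\<sigma> = 0")
        case F: False
        then have "\<not> 0 \<le> \<beta> * \<sigma>" using False beta by (simp add: zero_le_mult_iff)
        then show ?thesis by (simp add: f_def)
      qed (simp add: f_def)
      then show ?thesis using False by simp
    qed
  qed
  also have "enn2real \<dots> = (\<integral>\<sigma>. V * (2 * R) powr s * \<beta> powr (- s) * f (0 + \<beta> * \<sigma>) \<partial>lborel)"
    by (rule integral_eq_nn_integral[symmetric])
      (use V in \<open>auto intro!: AE_I2 mult_nonneg_nonneg simp: f_def\<close>)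
  also have "\<dots> = V * (2 * R) powr s * \<beta> powr (- s) * (\<integral>\<sigma>. f (0 + \<beta> * \<sigma>) \<partial>lborel)" by simp
  also have "(\<integral>\<sigma>. f (0 + \<beta> * \<sigma>) \<partial>lborel) = profile_integral r / \<beta>"
    using lborel_integral_real_affine[of \<beta> f 0] beta
    by (simp add: profile_integral_def set_lebesgue_integral_def f_def s_def)
  also have "V * (2 * R) powr s * \<beta> powr (- s) * (profile_integral r / \<beta>) = V * (2 * R) powr s * (\<beta> powr (- s) / \<beta> powr 1) * profile_integral r"
    using beta by simp
  also have "\<beta> powr (- s) / \<beta> powr 1 = \<beta> powr (- s - 1)" by (rule powr_diff[symmetric])
  also have "- s - 1 = - ((real CARD('n) + 1) / 2)" by (simp add: s_def field_simps)
  finally show ?thesis by (simp add: V_def s_def)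
qed

text \<open>Legendre's duplication formula turns the ratio of the volumes of the unit balls of dimensions
  \<open>N - 1\<close> and \<open>N\<close> into \<open>2 powr (- N) N! / \<Gamma>((N + 1) / 2)\<^sup>2\<close>.\<close>

lemma constant_identity:
  "R powr ((real CARD('n) + 1) / 2) / sqrt (\<Prod>i\<in>UNIV-{k}. \<alpha> i)
     * (unit_ball_vol (real (CARD('n) - 1)) * (2 * R) powr ((real CARD('n) - 1) / 2)
      * \<beta> powr (- ((real CARD('n) + 1) / 2)) * P)
   = measure lebesgue (ball x R) * ((fact CARD('n) / (Gamma ((real CARD('n) + 1) / 2))\<^sup>2 * P)
       / (conj_exp p powr ((real CARD('n) + 1) / 4) * sqrt (\<Prod>i\<in>UNIV-{k}. \<alpha> i)))"
proof -
  define N where "N = CARD('n)"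
  define n where "n = real N"
  define q where "q = conj_exp p"
  have q: "q > 0" using inverse_exponent_bounds[OF p1] by (simp add: q_def)
  have N: "N \<ge> 1" by (simp add: N_def Suc_leI)
  then have n: "n \<ge> 1" by (simp add: n_def)
  have N1: "real (N - 1) = n - 1" using N by (simp add: n_def of_nat_diff)
  have meas: "measure lebesgue (ball x R) = unit_ball_vol n * R ^ N"
    using R by (simp add: content_ball n_def N_def)
  have RR: "R powr ((n + 1) / 2) * R powr ((n - 1) / 2) = R ^ N"
    using R by (simp add: n_def field_simps flip: powr_add powr_realpow)
  have b1: "\<beta> powr (- ((n + 1) / 2)) = 2 powr ((n + 1) / 2) / q powr ((n + 1) / 4)"
  proof -
    have bq: "\<beta> = q powr (1/2) / 2" using q by (simp add: \<beta>_def q_def powr_half_sqrt)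
    have "\<beta> powr ((n + 1) / 2) = (q powr (1/2)) powr ((n + 1) / 2) / 2 powr ((n + 1) / 2)"
      unfolding bq using q by (subst powr_divide) auto
    also have "(q powr (1/2)) powr ((n + 1) / 2) = q powr ((n + 1) / 4)" by (simp add: powr_powr)
    finally show ?thesis by (simp only: powr_minus) (simp add: inverse_eq_divide)
  qed
  have twos: "2 powr ((n - 1) / 2) * 2 powr ((n + 1) / 2) = (2::real) powr n"
  proof -
    have "(n - 1) / 2 + (n + 1) / 2 = n" by (simp add: field_simps)
    then show ?thesis by (simp only: powr_add[symmetric])
  qed
  have G1: "Gamma ((n + 1) / 2) > 0" "Gamma (n / 2 + 1) > 0" using n by (auto intro!: Gamma_real_pos)
  have dup: "Gamma ((n + 1) / 2) * Gamma (n / 2 + 1) = exp ((1 - 2 * ((n + 1) / 2)) * ln 2) * sqrt pi * Gamma (2 * ((n + 1) / 2))"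
  proof -
    have "(n + 1) / 2 + 1/2 = n / 2 + 1" by (simp add: field_simps)
    then show ?thesis using Gamma_legendre_duplication_real[of "(n + 1) / 2"] n by (simp only:)
  qed
  have fct: "Gamma (2 * ((n + 1) / 2)) = fact N"
  proof -
    have "2 * ((n + 1) / 2) = 1 + real N" by (simp add: n_def)
    then show ?thesis using Gamma_fact[of N, where 'a=real] by (simp only:)
  qed
  have ex: "exp ((1 - 2 * ((n + 1) / 2)) * ln 2) = 1 / 2 powr n"
    by (simp add: powr_def exp_minus field_simps)
  have key: "unit_ball_vol (n - 1) * 2 powr n = unit_ball_vol n * (fact N / (Gamma ((n + 1) / 2))\<^sup>2)"
  proof -
    have a: "(n - 1) / 2 + 1 = (n + 1) / 2" by (simp add: field_simps)
    have "pi powr (n / 2) = pi powr ((n - 1) / 2) * sqrt pi"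
    proof -
      have "(n - 1) / 2 + 1/2 = n / 2" by (simp add: field_simps)
      then show ?thesis using powr_add[of pi "(n - 1) / 2" "1/2"] by (simp only: powr_half_sqrt pi_ge_zero)
    qed
    then have e: "unit_ball_vol n = pi powr ((n - 1) / 2) * sqrt pi / Gamma (n / 2 + 1)" "unit_ball_vol (n - 1) = pi powr ((n - 1) / 2) / Gamma ((n + 1) / 2)"
      unfolding unit_ball_vol_def a by simp_all
    have f: "fact N * sqrt pi = Gamma ((n + 1) / 2) * Gamma (n / 2 + 1) * 2 powr n"
      using dup unfolding fct ex by (simp add: field_simps)
    have "unit_ball_vol n * (fact N / (Gamma ((n + 1) / 2))\<^sup>2) = pi powr ((n - 1) / 2) * (fact N * sqrt pi) / (Gamma (n / 2 + 1) * (Gamma ((n + 1) / 2))\<^sup>2)"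
      unfolding e by simp
    also have "\<dots> = unit_ball_vol (n - 1) * 2 powr n"
      unfolding f e using G1 by (simp add: field_simps power2_eq_square)
    finally show ?thesis by simp
  qed
  have m2: "(2 * R) powr ((n - 1) / 2) = 2 powr ((n - 1) / 2) * R powr ((n - 1) / 2)" using R by (simp add: powr_mult)
  let ?Pi = "sqrt (\<Prod>i\<in>UNIV-{k}. \<alpha> i)"
  have "R powr ((n + 1) / 2) / ?Pi * (unit_ball_vol (n - 1) * (2 * R) powr ((n - 1) / 2) * \<beta> powr (- ((n + 1) / 2)) * P)
    = (R powr ((n + 1) / 2) * R powr ((n - 1) / 2)) * (unit_ball_vol (n - 1) * (2 powr ((n - 1) / 2) * 2 powr ((n + 1) / 2))) * P / (q powr ((n + 1) / 4) * ?Pi)"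
    unfolding b1 m2 by (simp add: mult_ac)
  also have "\<dots> = R ^ N * (unit_ball_vol n * (fact N / (Gamma ((n + 1) / 2))\<^sup>2)) * P / (q powr ((n + 1) / 4) * ?Pi)"
    unfolding RR twos key ..
  also have "\<dots> = measure lebesgue (ball x R) * ((fact N / (Gamma ((n + 1) / 2))\<^sup>2 * P) / (q powr ((n + 1) / 4) * ?Pi))"
    unfolding meas by (simp add: mult_ac)
  finally show ?thesis by (simp only: N1[unfolded N_def] n_def N_def q_def)
qed

text \<open>For the candidate \<open>\<mu> l t\<close>, which is \<open>l\<close> times the expected power of \<open>t\<close>, the boundary layer
  and the bulk of the ball contribute to the integral of the signed power at the same order
  \<open>t powr ((N + 1) / 4)\<close>, the latter with the opposite sign. The limit of the rescaled integral
  is positive for \<open>l < l0\<close> and negative for \<open>l > l0\<close>, so that the mean is caught between two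
  candidates on either side of \<open>l0\<close>.\<close>

lemma q_mean_asymptotics:
  assumes q: "1 < q"
  shows "((\<lambda>t. (R\<^sup>2 / t) powr ((real CARD('n) + 1) / (4 * (q - 1))) * q_mean (ereal q) R u x t) \<longlongrightarrow>
      ((fact CARD('n) / (Gamma ((real CARD('n) + 1) / 2))\<^sup>2 * profile_integral (q - 1))
       / (conj_exp p powr ((real CARD('n) + 1) / 4) * sqrt (\<Prod>i\<in>UNIV-{k}. \<alpha> i))) powr (1 / (q - 1))) (at_right 0)"
proof -
  define r where "r = q - 1"
  have r: "r > 0" using q by (simp add: r_def)
  define s where "s = (real CARD('n) + 1) / 4"
  have s: "s > 0" by (simp add: s_def)
  define \<kappa> where "\<kappa> = s / r"
  have \<kappa>: "\<kappa> > 0" using s r by (simp add: \<kappa>_def)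
  define Cst where "Cst = (fact CARD('n) / (Gamma ((real CARD('n) + 1) / 2))\<^sup>2 * profile_integral r)
       / (conj_exp p powr ((real CARD('n) + 1) / 4) * sqrt (\<Prod>i\<in>UNIV-{k}. \<alpha> i))"
  have P0: "profile_integral r \<ge> 0"
    unfolding profile_integral_def set_lebesgue_integral_def by (rule integral_nonneg_AE) (auto simp: indicator_def)
  have Cst: "Cst \<ge> 0" unfolding Cst_def using P0 \<alpha>_pos
    by (intro divide_nonneg_nonneg mult_nonneg_nonneg real_sqrt_ge_zero prod_nonneg) (auto intro: less_imp_le)
  define l0 where "l0 = Cst powr (1 / r)"
  have l0: "spow r l0 = Cst" unfolding l0_def by (rule spow_inverse[OF r Cst])
  define I0 where "I0 = (\<integral>w. indicator {w. \<rho> w < 2 * R * ell w} w * Erfc (\<beta> * ell w) powr r \<partial>lborel)"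
  define B where "B = measure lebesgue (ball x R)"
  have B: "B > 0" using R by (simp add: B_def content_ball)
  define \<mu> where "\<mu> l t = (t / R\<^sup>2) powr \<kappa> * l" for l t
  define \<psi> where "\<psi> l t = (\<integral>z. spow r (u (z, t) - \<mu> l t) \<partial>lebesgue_on (ball x R))" for l t
  have scl: "((\<lambda>t. (R\<^sup>2 / t) powr s * \<psi> l t) \<longlongrightarrow> B * (Cst - spow r l)) (at_right 0)" for l
  proof -
    have \<mu>0: "((\<lambda>t. \<mu> l t) \<longlongrightarrow> 0) (at_right 0)"
    proof -
      have "((\<lambda>t. (t / R\<^sup>2) powr \<kappa>) \<longlongrightarrow> (0 / R\<^sup>2) powr \<kappa>) (at_right 0)"
      proof (rule tendsto_powr2)
        show "((\<lambda>t. t / R\<^sup>2) \<longlongrightarrow> 0 / R\<^sup>2) (at_right 0)" using R by (intro tendsto_intros) auto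
        show "\<forall>\<^sub>F t in at_right 0. 0 \<le> t / R\<^sup>2" using eventually_at_right_less[of "0::real"] by eventually_elim simp
      qed (use \<kappa> in auto)
      from tendsto_mult[OF this tendsto_const[of l]] show ?thesis by (simp add: \<mu>_def)
    qed
    \<comment> \<open>The values \<open>m t\<close> agree with \<open>\<mu> l t\<close> for small times, and they are bounded by 1 for all.\<close>
    define m where "m t = (if \<bar>\<mu> l t\<bar> \<le> 1 then \<mu> l t else 0)" for t
    have "\<forall>\<^sub>F t in at_right 0. \<bar>\<mu> l t\<bar> < 1"
      using order_tendstoD(2)[OF tendsto_rabs_zero[OF \<mu>0]] by simp
    then have mev: "\<forall>\<^sub>F t in at_right 0. m t = \<mu> l t" by eventually_elim (simp add: m_def)
    have m0: "(m \<longlongrightarrow> 0) (at_right 0)"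
      by (rule Lim_transform_eventually[OF \<mu>0]) (use mev in \<open>auto elim: eventually_mono\<close>)
    have s2: "2 * s = (real CARD('n) + 1) / 2" by (simp add: s_def)
    have "((\<lambda>t. R powr (2 * s) / sqrt (\<Prod>i\<in>UNIV-{k}. \<alpha> i) * (\<integral>w. indicator (ball x R) (Z t w) * (spow r (u (Z t w, t) - m t) + spow r (m t)) \<partial>lborel) - B * spow r l)
       \<longlongrightarrow> R powr (2 * s) / sqrt (\<Prod>i\<in>UNIV-{k}. \<alpha> i) * I0 - B * spow r l) (at_right 0)"
      unfolding I0_def by (intro tendsto_intros scaled_integral_limit[OF r m0]) (simp add: m_def)
    also have "R powr (2 * s) / sqrt (\<Prod>i\<in>UNIV-{k}. \<alpha> i) * I0 = B * Cst"
      using constant_identity[of "profile_integral r"] unfolding I0_def region_integral B_def Cst_def s2 by simp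
    finally have "((\<lambda>t. R powr (2 * s) / sqrt (\<Prod>i\<in>UNIV-{k}. \<alpha> i) * (\<integral>w. indicator (ball x R) (Z t w) * (spow r (u (Z t w, t) - m t) + spow r (m t)) \<partial>lborel) - B * spow r l)
       \<longlongrightarrow> B * (Cst - spow r l)) (at_right 0)" by (simp add: algebra_simps)
    then show ?thesis
    proof (rule Lim_transform_eventually)
      show "\<forall>\<^sub>F t in at_right 0. R powr (2 * s) / sqrt (\<Prod>i\<in>UNIV-{k}. \<alpha> i) * (\<integral>w. indicator (ball x R) (Z t w) * (spow r (u (Z t w, t) - m t) + spow r (m t)) \<partial>lborel) - B * spow r l
        = (R\<^sup>2 / t) powr s * \<psi> l t"
        using mev eventually_at_right_less[of "0::real"]
      proof eventually_elim
        case (elim t)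
        define J where "J = (\<integral>w. indicator (ball x R) (Z t w) * (spow r (u (Z t w, t) - m t) + spow r (m t)) \<partial>lborel)"
        have R2: "(R\<^sup>2) powr s = R powr (2 * s)" using powr_powr[of R 2 s] R by simp
        have 1: "\<psi> l t = t powr s / sqrt (\<Prod>i\<in>UNIV-{k}. \<alpha> i) * J - B * spow r (\<mu> l t)"
          using ball_integral_rescaled[OF elim(2) r, of "\<mu> l t"]
          by (simp only: \<psi>_def prod_stretch[OF elim(2)] J_def elim(1) s_def B_def)
        have "(R\<^sup>2 / t) powr s = R powr (2 * s) / t powr s" using elim R by (simp add: powr_divide R2)
        then have 2: "(R\<^sup>2 / t) powr s * (t powr s / sqrt (\<Prod>i\<in>UNIV-{k}. \<alpha> i) * J) = R powr (2 * s) / sqrt (\<Prod>i\<in>UNIV-{k}. \<alpha> i) * J"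
          using elim by simp
        have "spow r (\<mu> l t) = ((t / R\<^sup>2) powr \<kappa>) powr r * spow r l" unfolding \<mu>_def by (rule spow_mult) simp
        also have "((t / R\<^sup>2) powr \<kappa>) powr r = (t / R\<^sup>2) powr s" using r by (simp add: powr_powr \<kappa>_def)
        finally have 3: "spow r (\<mu> l t) = (t / R\<^sup>2) powr s * spow r l" .
        have "(R\<^sup>2 / t) powr s * (t / R\<^sup>2) powr s = 1" using elim R by (simp add: powr_divide)
        then have "(R\<^sup>2 / t) powr s * spow r (\<mu> l t) = spow r l" unfolding 3 by (simp flip: mult.assoc)
        then have "(R\<^sup>2 / t) powr s * \<psi> l t = R powr (2 * s) / sqrt (\<Prod>i\<in>UNIV-{k}. \<alpha> i) * J - B * spow r l"
          unfolding 1 right_diff_distrib 2 by (simp add: mult.left_commute)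
        then show ?case by (simp add: J_def)
      qed
    qed
  qed
  have bracket: "\<forall>\<^sub>F t in at_right 0. l1 \<le> (R\<^sup>2 / t) powr \<kappa> * q_mean (ereal q) R u x t \<and> (R\<^sup>2 / t) powr \<kappa> * q_mean (ereal q) R u x t \<le> l2"
    if l: "l1 < l0" "l0 < l2" for l1 l2
  proof -
    have "spow r l1 < Cst" "Cst < spow r l2" using spow_strict_mono[OF r] l l0 by metis+
    then have "B * (Cst - spow r l1) > 0" "B * (Cst - spow r l2) < 0" using B by (auto simp: mult_less_0_iff)
    then have "\<forall>\<^sub>F t in at_right 0. (R\<^sup>2 / t) powr s * \<psi> l1 t > 0" "\<forall>\<^sub>F t in at_right 0. (R\<^sup>2 / t) powr s * \<psi> l2 t < 0"
      using order_tendstoD[OF scl] by auto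
    then show ?thesis using eventually_at_right_less[of "0::real"]
    proof eventually_elim
      case (elim t)
      have f: "0 < (t / R\<^sup>2) powr \<kappa>" "0 < (R\<^sup>2 / t) powr s" using elim R by auto
      have \<psi>: "\<psi> l1 t > 0" "\<psi> l2 t < 0" using elim f by (auto simp: zero_less_mult_iff mult_less_0_iff)
      obtain M where M: "M > 0" "\<And>z. z \<in> \<Omega> \<times> {0<..} \<Longrightarrow> \<bar>u z\<bar> \<le> M" using IBVP_solution_facts(5)[OF u op] by blast
      have vm: "(\<lambda>z. u (z, t)) \<in> borel_measurable (lebesgue_on (ball x R))"
        by (rule continuous_imp_measurable_on_sets_lebesgue[OF continuous_slice]) (use elim in auto)
      have vb: "\<bar>u (z, t)\<bar> \<le> M" if "z \<in> space (lebesgue_on (ball x R))" for z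
        using M(2)[of "(z, t)"] elim that ball_subset by auto
      have "q_mean (ereal q) R u x t \<in> {\<mu> l1 t..\<mu> l2 t}"
        unfolding q_mean_def Lq_norm_def
        using mean_between_sign_change[OF lebesgue_on_ball(1) lebesgue_on_ball(2)[OF R] vm vb q, of "\<mu> l1 t" "\<mu> l2 t"]
          \<psi> f l by (simp add: \<psi>_def \<mu>_def r_def)
      then have "(R\<^sup>2 / t) powr \<kappa> * \<mu> l1 t \<le> (R\<^sup>2 / t) powr \<kappa> * q_mean (ereal q) R u x t"
        "(R\<^sup>2 / t) powr \<kappa> * q_mean (ereal q) R u x t \<le> (R\<^sup>2 / t) powr \<kappa> * \<mu> l2 t"
        by (auto intro!: mult_left_mono)
      moreover have "(R\<^sup>2 / t) powr \<kappa> * \<mu> l t = l" for l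
      proof -
        have "(R\<^sup>2 / t) powr \<kappa> * (t / R\<^sup>2) powr \<kappa> = 1" using elim R by (simp add: powr_divide)
        then show ?thesis by (simp add: \<mu>_def flip: mult.assoc)
      qed
      ultimately show ?case by simp
    qed
  qed
  have "((\<lambda>t. (R\<^sup>2 / t) powr \<kappa> * q_mean (ereal q) R u x t) \<longlongrightarrow> l0) (at_right 0)"
  proof (rule order_tendstoI)
    fix a assume "a < l0"
    then obtain l1 where "a < l1" "l1 < l0" using dense by blast
    then show "\<forall>\<^sub>F t in at_right 0. a < (R\<^sup>2 / t) powr \<kappa> * q_mean (ereal q) R u x t"
      using bracket[of l1 "l0 + 1"] by (auto elim!: eventually_mono)
  next
    fix a assume "l0 < a"
    then obtain l2 where "l0 < l2" "l2 < a" using dense by blast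
    then show "\<forall>\<^sub>F t in at_right 0. (R\<^sup>2 / t) powr \<kappa> * q_mean (ereal q) R u x t < a"
      using bracket[of "l0 - 1" l2] by (auto elim!: eventually_mono)
  qed
  moreover have "\<kappa> = (real CARD('n) + 1) / (4 * (q - 1))" by (simp add: \<kappa>_def s_def r_def)
  ultimately show ?thesis by (simp add: l0_def Cst_def r_def)
qed

text \<open>The mean is the midpoint of the range of \<open>u\<close> on the ball. The supremum is at least 1 at every
  positive time, because the ball touches \<open>\<Gamma>\<close>, and the upper barrier leaves at most a small
  excess. The infimum is at most the value at the centre, which is small; the upper barrier for
  \<open>- u\<close> shows that it is not much below 0.\<close>

lemma infinity_mean_limit: "((\<lambda>t. q_mean \<infinity> R u x t) \<longlongrightarrow> 1 / 2) (at_right 0)"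
proof -
  note F = IBVP_solution_facts[OF u op]
  obtain M where M: "M > 0" "\<And>z. z \<in> \<Omega> \<times> {0<..} \<Longrightarrow> \<bar>u z\<bar> \<le> M" using F(5) by blast
  obtain C c where C: "C > 0" "c > 0" and dec: "\<And>z t. z \<in> ball x R \<Longrightarrow> t > 0 \<Longrightarrow> \<bar>u (z, t)\<bar> \<le> C * exp (- c * ((z - y) \<bullet> \<nu>)\<^sup>2 / t)"
    and dpos: "\<And>z. z \<in> ball x R \<Longrightarrow> 0 < (z - y) \<bullet> \<nu>"
    using ball_decay by metis
  have n\<nu>: "norm \<nu> = 1" using gr by (simp add: local_C2_graph_def)
  then have \<nu>\<nu>: "\<nu> \<bullet> \<nu> = 1" by (simp add: dot_square_norm)
  have q0: "conj_exp p > 0" using inverse_exponent_bounds[OF p1] by simp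
  \<comment> \<open>Any value below \<open>sqrt p' / 2\<close> will do: only the bounds 0 and 1 for Erfc are used.\<close>
  define a0 where "a0 = sqrt (conj_exp p / 8)"
  have a0: "a0 > 0" "4 * a0\<^sup>2 < conj_exp p" using q0 by (auto simp: a0_def)
  have main: "\<forall>\<^sub>F t in at_right 0. \<bar>q_mean \<infinity> R u x t - 1 / 2\<bar> \<le> \<eta>" if \<eta>: "\<eta> > 0" "\<eta> < 1/4" for \<eta>
  proof -
    have "\<exists>r>0. \<exists>t0>0. \<forall>z\<in>\<Omega> \<inter> ball y r. \<forall>t. 0 < t \<and> t < t0 \<longrightarrow>
       u (z, t) \<le> 1 * Erfc (a0 * (z \<bullet> \<nu> - g z) / sqrt t) + \<eta>"
      by (intro boundary_upper_barrier[OF p1 op F(1) gr g0 gy M(1) _ F(3)])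
        (use M F(4) a0 \<eta> in \<open>auto simp: abs_le_iff\<close>)
    then obtain r1 t1 where rt1: "r1 > 0" "t1 > 0" "\<And>z t. z \<in> \<Omega> \<inter> ball y r1 \<Longrightarrow> 0 < t \<and> t < t1 \<Longrightarrow>
       u (z, t) \<le> 1 * Erfc (a0 * (z \<bullet> \<nu> - g z) / sqrt t) + \<eta>" by blast
    have "\<exists>r>0. \<exists>t0>0. \<forall>z\<in>\<Omega> \<inter> ball y r. \<forall>t. 0 < t \<and> t < t0 \<longrightarrow>
       - u (z, t) \<le> 0 * Erfc (a0 * (z \<bullet> \<nu> - g z) / sqrt t) + \<eta>"
    proof (rule boundary_upper_barrier[OF p1 op F(2) gr g0 gy M(1)])
      show "((\<lambda>z. - u z) \<longlongrightarrow> 0) (at (z0, 0) within \<Omega> \<times> {0<..})" if "z0 \<in> \<Omega>" for z0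
        using tendsto_minus[OF F(3)[OF that]] by simp
      show "\<exists>b'\<le>0. ((\<lambda>z. - u z) \<longlongrightarrow> b') (at (z0, t0) within \<Omega> \<times> {0<..})" if "z0 \<in> frontier \<Omega>" "t0 > 0" for z0 t0
        using tendsto_minus[OF F(4)[OF that]] by (intro exI[of _ "-1"]) simp
      show "- u z \<le> M" if "z \<in> \<Omega> \<times> {0<..}" for z using M(2)[OF that] by (simp add: abs_le_iff)
    qed (use a0 \<eta> in auto)
    then obtain r2 t2 where rt2: "r2 > 0" "t2 > 0" "\<And>z t. z \<in> \<Omega> \<inter> ball y r2 \<Longrightarrow> 0 < t \<and> t < t2 \<Longrightarrow>
       - u (z, t) \<le> 0 * Erfc (a0 * (z \<bullet> \<nu> - g z) / sqrt t) + \<eta>" by blast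
    obtain r3 H3 where r3: "r3 > 0" and chart: "\<And>z. z \<in> cball y (2 * r3) \<Longrightarrow> z \<in> \<Omega> \<longleftrightarrow> 0 < z \<bullet> \<nu> - g z"
      using local_chart[OF gr g0, of 1] by (metis order_refl zero_less_one)
    define r where "r = min r1 (min r2 r3)"
    have r: "r > 0" "r \<le> r1" "r \<le> r2" "r \<le> r3" using rt1 rt2 r3 by (auto simp: r_def)
    define d where "d = r\<^sup>2 / (2 * R)"
    have d: "d > 0" using r R by (simp add: d_def)
    have cd: "c * (min d R)\<^sup>2 > 0" using C d R by simp
    obtain T where T: "T > 0" "\<And>t. 0 < t \<Longrightarrow> t \<le> T \<Longrightarrow> C * exp (- (c * (min d R)\<^sup>2) / t) < \<eta>"
      using exists_small_exp[OF cd \<eta>(1), of C] by metis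
    have far: "\<bar>u (z, t)\<bar> \<le> \<eta>" if z: "z \<in> ball x R" and sd: "min d R \<le> (z - y) \<bullet> \<nu>" and t: "0 < t" "t \<le> T" for z t
    proof -
      have "(min d R)\<^sup>2 \<le> ((z - y) \<bullet> \<nu>)\<^sup>2" using sd d R by (intro power_mono) auto
      then have "c * (min d R)\<^sup>2 / t \<le> c * ((z - y) \<bullet> \<nu>)\<^sup>2 / t" using C t by (intro divide_right_mono mult_left_mono) auto
      then have "C * exp (- c * ((z - y) \<bullet> \<nu>)\<^sup>2 / t) \<le> C * exp (- (c * (min d R)\<^sup>2) / t)" using C by (intro mult_left_mono) auto
      then show ?thesis using dec[OF z t(1)] T(2)[OF t] by linarith
    qed
    have depth: "d \<le> (z - y) \<bullet> \<nu>" if z: "z \<in> ball x R" "z \<notin> ball y r" for z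
    proof -
      have "(norm (z - y))\<^sup>2 < 2 * R * ((z - y) \<bullet> \<nu>)" by (rule norm2_in_touching_ball[OF n\<nu> x_eq z(1)])
      moreover have "r\<^sup>2 \<le> (norm (z - y))\<^sup>2" using z r by (intro power_mono) (auto simp: dist_norm norm_minus_commute)
      ultimately have "r\<^sup>2 \<le> 2 * R * ((z - y) \<bullet> \<nu>)" by linarith
      then show ?thesis using R by (simp add: d_def field_simps)
    qed
    define t0 where "t0 = min T (min t1 t2)"
    have t0: "t0 > 0" "t0 \<le> T" "t0 \<le> t1" "t0 \<le> t2" using T rt1 rt2 by (auto simp: t0_def)
    have est: "\<bar>q_mean \<infinity> R u x t - 1 / 2\<bar> \<le> \<eta>" if t: "0 < t" "t < t0" for t
    proof -
      have up: "- \<eta> \<le> u (z, t) \<and> u (z, t) \<le> 1 + \<eta>" if z: "z \<in> ball x R" for z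
      proof (cases "z \<in> ball y r")
        case True
        have z\<Omega>: "z \<in> \<Omega>" using z ball_subset by blast
        have "z \<in> cball y (2 * r3)" using True r by auto
        then have "0 < z \<bullet> \<nu> - g z" using chart z\<Omega> by blast
        then have "Erfc (a0 * (z \<bullet> \<nu> - g z) / sqrt t) \<le> 1" using a0 t by (intro Erfc_le_1) simp
        moreover have "u (z, t) \<le> 1 * Erfc (a0 * (z \<bullet> \<nu> - g z) / sqrt t) + \<eta>" using True z\<Omega> r t t0 by (intro rt1(3)) auto
        moreover have "- u (z, t) \<le> 0 * Erfc (a0 * (z \<bullet> \<nu> - g z) / sqrt t) + \<eta>" using True z\<Omega> r t t0 by (intro rt2(3)) auto
        ultimately show ?thesis by simp
      next
        case False
        then have "\<bar>u (z, t)\<bar> \<le> \<eta>" using depth[OF z] t t0 by (intro far[OF z]) auto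
        then show ?thesis by (simp add: abs_le_iff)
      qed
      define v where "v z = u (z, t)" for z
      have ne: "v ` ball x R \<noteq> {}" using R by simp
      have bda: "bdd_above (v ` ball x R)" "bdd_below (v ` ball x R)"
        using up by (auto simp: v_def intro!: bdd_aboveI2[where M="1 + \<eta>"] bdd_belowI2[where m="- \<eta>"])
      define I where "I = Inf (v ` ball x R)"
      define Sp where "Sp = Sup (v ` ball x R)"
      have qm: "q_mean \<infinity> R u x t = (I + Sp) / 2"
      proof (rule infinity_mean[OF R continuous_slice[OF t(1)]])
        show "I \<le> u (z, t) \<and> u (z, t) \<le> Sp" if "z \<in> ball x R" for z
          using cInf_lower[OF imageI[OF that, of v] bda(2)] cSup_upper[OF imageI[OF that, of v] bda(1)]
          by (simp add: I_def Sp_def v_def)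
        show "\<exists>z\<in>ball x R. e < u (z, t)" if "e < Sp" for e
          using less_cSupD[OF ne, of e] that by (auto simp: Sp_def v_def)
        show "\<exists>z\<in>ball x R. u (z, t) < e" if "I < e" for e
          using cInf_lessD[OF ne, of e] that by (auto simp: I_def v_def)
      qed
      have I1: "- \<eta> \<le> I" unfolding I_def by (rule cInf_greatest[OF ne]) (use up in \<open>auto simp: v_def\<close>)
      have I2: "I \<le> \<eta>"
      proof -
        have "x \<in> ball x R" using R by simp
        moreover have "(x - y) \<bullet> \<nu> = R" using x_eq \<nu>\<nu> by simp
        ultimately have "\<bar>u (x, t)\<bar> \<le> \<eta>" using t t0 by (intro far) auto
        moreover have "I \<le> v x" unfolding I_def using \<open>x \<in> ball x R\<close> by (intro cInf_lower[OF _ bda(2)]) auto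
        ultimately show ?thesis by (simp add: v_def abs_le_iff)
      qed
      have S1: "Sp \<le> 1 + \<eta>" unfolding Sp_def by (rule cSup_least[OF ne]) (use up in \<open>auto simp: v_def\<close>)
      have S2: "1 \<le> Sp"
      proof -
        have lim: "((\<lambda>s. v (y + s *\<^sub>R \<nu>)) \<longlongrightarrow> 1) (at_right 0)"
        proof -
          have "filterlim (\<lambda>s. (y + s *\<^sub>R \<nu>, t)) (at (y, t) within \<Omega> \<times> {0<..}) (at_right 0)"
            unfolding filterlim_at
          proof
            show "((\<lambda>s. (y + s *\<^sub>R \<nu>, t)) \<longlongrightarrow> (y, t)) (at_right 0)"
              by (rule tendsto_eq_intros refl | simp)+
            have "\<forall>\<^sub>F s in at_right 0. s < R"
              unfolding eventually_at_right_field using R by (intro exI[of _ R]) auto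
            with eventually_at_right_less[of "0::real"]
            show "\<forall>\<^sub>F s in at_right 0. (y + s *\<^sub>R \<nu>, t) \<in> \<Omega> \<times> {0<..} \<and> (y + s *\<^sub>R \<nu>, t) \<noteq> (y, t)"
            proof eventually_elim
              case (elim s)
              have "x - (y + s *\<^sub>R \<nu>) = (R - s) *\<^sub>R \<nu>" using x_eq by (simp add: algebra_simps)
              then have "y + s *\<^sub>R \<nu> \<in> ball x R" using elim n\<nu> by (simp add: dist_norm)
              moreover have "s *\<^sub>R \<nu> \<noteq> 0" using elim n\<nu> by auto
              ultimately show ?case using ball_subset t by auto
            qed
          qed
          from filterlim_compose[OF F(4)[OF yfr t(1)] this] show ?thesis by (simp add: v_def)
        qed
        have "\<forall>\<^sub>F s in at_right 0. s < R"
          unfolding eventually_at_right_field using R by (intro exI[of _ R]) auto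
        with eventually_at_right_less[of "0::real"]
        have "\<forall>\<^sub>F s in at_right 0. v (y + s *\<^sub>R \<nu>) \<le> Sp"
        proof eventually_elim
          case (elim s)
          have "x - (y + s *\<^sub>R \<nu>) = (R - s) *\<^sub>R \<nu>" using x_eq by (simp add: algebra_simps)
          then have "y + s *\<^sub>R \<nu> \<in> ball x R" using elim n\<nu> by (simp add: dist_norm)
          then show ?case unfolding Sp_def by (intro cSup_upper[OF _ bda(1)]) auto
        qed
        then show ?thesis by (intro tendsto_upperbound[OF lim]) auto
      qed
      show ?thesis unfolding qm using I1 I2 S1 S2 by (simp add: abs_le_iff field_simps)
    qed
    show ?thesis unfolding eventually_at_right_field using t0 est by (intro exI[of _ t0]) auto
  qed
  show ?thesis
  proof (rule tendstoI)
    fix e :: real assume e: "e > 0"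
    define \<eta> where "\<eta> = min (e / 2) (1 / 8)"
    have "\<eta> > 0" "\<eta> < 1/4" "\<eta> < e" using e by (auto simp: \<eta>_def)
    from main[OF this(1,2)] show "\<forall>\<^sub>F t in at_right 0. dist (q_mean \<infinity> R u x t) (1 / 2) < e"
      by eventually_elim (use \<open>\<eta> < e\<close> in \<open>simp add: dist_real_def\<close>)
  qed
qed
end

theorem theorem3p6:
  fixes \<Omega> :: "(real^'n) set" and x y :: "real^'n" and R :: real
    and \<kappa> :: "nat \<Rightarrow> real" and p :: ereal and u :: "(real^'n) \<times> real \<Rightarrow> real"
  assumes "CARD('n) \<ge> 2"
    and "C2_domain \<Omega>"
    and "x \<in> \<Omega>"
    and "R > 0"
    and "y \<in> frontier \<Omega>"
    and "cball x R \<inter> (- \<Omega>) = {y}"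
    and "principal_curvatures \<Omega> y \<kappa>"
    and "\<forall>j\<in>{1..CARD('n) - 1}. \<kappa> j < 1 / R"
    and "1 < p"
    and "bounded_IBVP_solution p \<Omega> u"
  shows "(\<forall>q::real. 1 < q \<longrightarrow>
      ((\<lambda>t. (R\<^sup>2 / t) powr ((real CARD('n) + 1) / (4 * (q - 1))) * q_mean (ereal q) R u x t)
        \<longlongrightarrow>
        ((fact CARD('n) / (Gamma ((real CARD('n) + 1) / 2))\<^sup>2
            * (LBINT \<sigma>:{0..}. Erfc \<sigma> powr (q - 1) * \<sigma> powr ((real CARD('n) - 1) / 2)))
          / (conj_exp p powr ((real CARD('n) + 1) / 4)
             * sqrt (\<Prod>j = 1..CARD('n) - 1. 1 - R * \<kappa> j)))
        powr (1 / (q - 1))) (at_right 0)) \<and>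
    ((\<lambda>t. q_mean \<infinity> R u x t) \<longlongrightarrow> 1 / 2) (at_right 0)"
proof -
  obtain \<nu> g b and k :: 'n and \<sigma> where fr: "local_C2_graph \<Omega> y \<nu> g" "grad g y = 0" "orthonormal_frame b" "b k = \<nu>"
    "\<And>i. i \<noteq> k \<Longrightarrow> hessian g y *v b i = \<kappa> (\<sigma> i) *\<^sub>R b i"
    and \<sigma>: "bij_betw \<sigma> (UNIV - {k}) {1..CARD('n) - 1}"
    by (rule adapted_frame[OF assms(7)]) blast
  have \<sigma>k: "\<sigma> i \<in> {1..CARD('n) - 1}" if "i \<noteq> k" for i using \<sigma> that by (auto simp: bij_betw_def)
  interpret touching_ball \<Omega> x y \<nu> R g b k "\<lambda>i. \<kappa> (\<sigma> i)" p u
  proof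
    show "open \<Omega>" using assms(2) by (simp add: C2_domain_def)
    show "\<kappa> (\<sigma> i) < 1 / R" if "i \<noteq> k" for i using assms(8) \<sigma>k[OF that] by blast
  qed (use assms fr in auto)
  have pr: "(\<Prod>i\<in>UNIV-{k}. \<alpha> i) = (\<Prod>j = 1..CARD('n) - 1. 1 - R * \<kappa> j)"
    unfolding \<alpha>_def by (rule prod.reindex_bij_betw[OF \<sigma>])
  show ?thesis
    using q_mean_asymptotics infinity_mean_limit unfolding profile_integral_def pr by blast
qed

end
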